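(* Let $k$ be a commutative ring with unit. For every $F\in\mathcal{F}(\mathbf{FI}^{\mathrm{op}};k)$ there is a surjection of cochain complexes of $\mathbf{\Sigma}^{\mathrm{op}}$-modules, natural in $F$, $$N\big((\mathfrak{C}^\bullet F)^{\mathrm{op}}\big)\twoheadrightarrow\mathsf{Kz}\,F$$ which is a quasi-isomorphism, where $(\mathfrak{C}^\bullet F)^{\mathrm{op}}$ is the opposite cosimplicial $\mathbf{\Sigma}^{\mathrm{op}}$-module to $\mathfrak{C}^\bullet F$.
   Context: $\mathbf{FI}$ (resp. $\mathbf{\Sigma}$) is the category of finite sets and injections (resp. bijections). $\mathcal{F}(\mathcal{C};k)$ is the category of functors from $\mathcal{C}$ to $k$-modules ($\mathcal{C}$-modules). Below, objects are evaluated on $\mathbf{b}=\{1,\dots,b\}$ (or any finite set). Comonad $\perp$ on $\mathcal{F}(\mathbf{\Sigma}^{\mathrm{op}};k)$: $\perp G(\mathbf{b})=\bigoplus_{\mathbf{b}'\subseteq\mathbf{b}}G(\mathbf{b}')$, where a bijection $f:\mathbf{l}\to\mathbf{b}$ sends the summand $G(\mathbf{b}')$ to $G(f^{-1}(\mathbf{b}'))$ via $f|_{f^{-1}(\mathbf{b}')}$. The counit $\epsilon_G:\perp G\to G$ is the projection onto the summand $\mathbf{b}'=\mathbf{b}$. The comultiplication $\Delta_G:\perp G(\mathbf{b})=\bigoplus_{\mathbf{l}'\subseteq\mathbf{b}}G(\mathbf{l}')\to\perp\perp G(\mathbf{b})=\bigoplus_{\mathbf{b}''\subseteq\mathbf{b}'\subseteq\mathbf{b}}G(\mathbf{b}'')$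 has component $G(\mathbf{l}')\to G(\mathbf{b}'')$ the identity if $\mathbf{l}'=\mathbf{b}''$ and zero otherwise. The coaugmentation $\eta_G:G\to\perp G$ is the inclusion of the summand $\mathbf{b}'=\mathbf{b}$. For an $\mathbf{FI}^{\mathrm{op}}$-module $F$ (viewed also as a $\mathbf{\Sigma}^{\mathrm{op}}$-module by restriction), $\psi_F:F(\mathbf{b})\to\perp F(\mathbf{b})$ has components $F(\mathbf{b})\to F(\mathbf{b}')$ induced by the inclusions $\mathbf{b}'\subseteq\mathbf{b}$; it makes $F$ a $\perp$-comodule. The cosimplicial $\mathbf{\Sigma}^{\mathrm{op}}$-module $\mathfrak{C}^\bullet F$ has $\mathfrak{C}^nF=\perp^nF$, cofaces $d^i:\perp^nF\to\perp^{n+1}F$ given by $d^0=\eta_{\perp^nF}$, $d^i=\perp^{i-1}\Delta_{\perp^{n-i}F}$ for $0<i<n+1$, $d^{n+1}=\perp^n\psi_F$, and codegeneracies $s^j=\perp^j\epsilon_{\perp^{n-j}F}:\perp^{n+1}F\to\perp^nF$, $0\le j\le n$. The opposite cosimplicial object has the same terms, with $\tilde d^i=d^{n+1-i}$ and $\tilde s^j=s^{n-j}$. For a cosimplicial object $C^\bullet$ in an abelian category, $N(C^\bullet)$ is the normalized subcomplex $N(C^\bullet)^n=\bigcap_{j=0}^{n-1}\ker(s^j:C^n\to C^{n-1})$ of the cochain complex $(C^*,d=\sum_i(-1)^id^i)$. Koszul complex: for a finite set $S$, $\mathrm{Or}(S)=\Lambda^{|S|}(kS)$ is the top exterior power of the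 free $k$-module on $S$. For $t\in\mathbb{N}$, $$(\mathsf{Kz}F)^t(\mathbf{b})=\bigoplus_{\mathbf{b}^{(t)}\subset\mathbf{b},\,|\mathbf{b}^{(t)}|=b-t}F(\mathbf{b}^{(t)})\otimes\mathrm{Or}(\mathbf{b}\setminus\mathbf{b}^{(t)}),$$ where $g\in\mathfrak{S}_b$ sends the summand indexed by $\mathbf{b}^{(t)}$ to that indexed by $g^{-1}(\mathbf{b}^{(t)})$ via the action of $g|_{g^{-1}(\mathbf{b}^{(t)})}$ on the first factor and of $g|_{g^{-1}(\mathbf{b}\setminus\mathbf{b}^{(t)})}$ on the second (contravariant functoriality). The differential is $d(Y\otimes\alpha)=\sum_{x\in\mathbf{b}^{(t)}}\iota_x^*Y\otimes(x\wedge\alpha)$, where $\iota_x:\mathbf{b}^{(t)}\setminus\{x\}\hookrightarrow\mathbf{b}^{(t)}$ is the inclusion. This is a cochain complex of $\mathbf{\Sigma}^{\mathrm{op}}$-modules. *)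

theory Defs
  imports "HOL-Algebra.Module" "HOL-Algebra.AbelCoset"
begin

section \<open>Modules\<close>

definition mod_hom ::
    "('r, 'q) ring_scheme \<Rightarrow> ('r, 'a) module \<Rightarrow> ('r, 'b) module \<Rightarrow> ('a \<Rightarrow> 'b) set" where
  "mod_hom R M N = {h \<in> carrier M \<rightarrow> carrier N.
     (\<forall>x\<in>carrier M. \<forall>y\<in>carrier M. h (x \<oplus>\<^bsub>M\<^esub> y) = h x \<oplus>\<^bsub>N\<^esub> h y) \<and>
     (\<forall>r\<in>carrier R. \<forall>x\<in>carrier M. h (r \<odot>\<^bsub>M\<^esub> x) = r \<odot>\<^bsub>N\<^esub> h x)}"

text \<open>As in the library, the ring multiplication and unit that the record type \<open>module\<close>
  inherits from \<open>ring\<close> play no role for a module; they are left undefined throughout.\<close>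

text \<open>Direct sum over a \<^emph>\<open>finite\<close> index set.\<close>

definition direct_sum :: "'i set \<Rightarrow> ('i \<Rightarrow> ('r, 'm) module) \<Rightarrow> ('r, 'i \<Rightarrow> 'm) module" where
  "direct_sum I M =
     \<lparr>carrier = (\<Pi>\<^sub>E i\<in>I. carrier (M i)), mult = undefined, one = undefined,
      zero = (\<lambda>i\<in>I. \<zero>\<^bsub>M i\<^esub>), add = (\<lambda>u v. \<lambda>i\<in>I. u i \<oplus>\<^bsub>M i\<^esub> v i),
      smult = (\<lambda>r u. \<lambda>i\<in>I. r \<odot>\<^bsub>M i\<^esub> u i)\<rparr>"

definition transported :: "('a \<Rightarrow> 'b) \<Rightarrow> ('b \<Rightarrow> 'a) \<Rightarrow> ('r, 'a) module \<Rightarrow> ('r, 'b) module" where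
  "transported e e' M =
     \<lparr>carrier = e ` carrier M, mult = undefined, one = undefined, zero = e \<zero>\<^bsub>M\<^esub>,
      add = (\<lambda>x y. e (e' x \<oplus>\<^bsub>M\<^esub> e' y)), smult = (\<lambda>r x. e (r \<odot>\<^bsub>M\<^esub> e' x))\<rparr>"

text \<open>The map \<open>M/H \<rightarrow> N/K\<close> induced by \<open>f : M \<rightarrow> N\<close> with \<open>f H \<subseteq> K\<close>: the cosets
  \<open>K + f a\<close> for \<open>a \<in> A\<close> then all coincide, so that their union is that coset.\<close>

definition coset_map :: "('r, 'b) module \<Rightarrow> 'b set \<Rightarrow> ('a \<Rightarrow> 'b) \<Rightarrow> 'a set \<Rightarrow> 'b set" where
  "coset_map N K f A = (\<Union>a\<in>A. K +>\<^bsub>N\<^esub> f a)"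

definition quotient_module :: "('r, 'a) module \<Rightarrow> 'a set \<Rightarrow> ('r, 'a set) module" where
  "quotient_module M H =
     \<lparr>carrier = a_rcosets\<^bsub>M\<^esub> H, mult = undefined, one = undefined, zero = H,
      add = (\<lambda>A B. A <+>\<^bsub>M\<^esub> B), smult = (\<lambda>r. coset_map M H (\<lambda>a. r \<odot>\<^bsub>M\<^esub> a))\<rparr>"

definition generated_submodule ::
    "('r, 'q) ring_scheme \<Rightarrow> ('r, 'a) module \<Rightarrow> 'a set \<Rightarrow> 'a set" where
  "generated_submodule R M X = \<Inter>{H. submodule H R M \<and> X \<subseteq> H}"

text \<open>The free module \<open>kX\<close>: finitely supported functions, extended by zero outside \<open>X\<close>,
  so that \<open>kS \<subseteq> kT\<close> for \<open>S \<subseteq> T\<close>.\<close>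

definition free_module :: "('r, 'q) ring_scheme \<Rightarrow> 'a set \<Rightarrow> ('r, 'a \<Rightarrow> 'r) module" where
  "free_module R X =
     \<lparr>carrier = {u. (\<forall>x. u x \<in> carrier R) \<and> (\<forall>x. x \<notin> X \<longrightarrow> u x = \<zero>\<^bsub>R\<^esub>) \<and> finite {x. u x \<noteq> \<zero>\<^bsub>R\<^esub>}},
      mult = undefined, one = undefined, zero = (\<lambda>x. \<zero>\<^bsub>R\<^esub>),
      add = (\<lambda>u v x. u x \<oplus>\<^bsub>R\<^esub> v x), smult = (\<lambda>r u x. r \<otimes>\<^bsub>R\<^esub> u x)\<rparr>"

definition basis_vec :: "('r, 'q) ring_scheme \<Rightarrow> 'a \<Rightarrow> 'a \<Rightarrow> 'r" where
  "basis_vec R x = (\<lambda>y. if y = x then \<one>\<^bsub>R\<^esub> else \<zero>\<^bsub>R\<^esub>)"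

text \<open>The linear map \<open>kX \<rightarrow> kY\<close> extending \<open>h : X \<rightarrow> Y\<close>.\<close>

definition free_map :: "('r, 'q) ring_scheme \<Rightarrow> ('a \<Rightarrow> 'b) \<Rightarrow> ('a \<Rightarrow> 'r) \<Rightarrow> 'b \<Rightarrow> 'r" where
  "free_map R h u = (\<lambda>y. \<Oplus>\<^bsub>R\<^esub>x\<in>{x. u x \<noteq> \<zero>\<^bsub>R\<^esub> \<and> h x = y}. u x)"

definition presented :: "('r, 'q) ring_scheme \<Rightarrow> 'a set \<Rightarrow> ('a \<Rightarrow> 'r) set \<Rightarrow> ('r, ('a \<Rightarrow> 'r) set) module"
  where "presented R X Rel =
     quotient_module (free_module R X) (generated_submodule R (free_module R X) Rel)"

text \<open>The map into the module presented by \<open>(Y, Rel)\<close> that sends the class of a generator \<open>x\<close>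
  to the class of the generator \<open>h x\<close>.\<close>

definition presented_map :: "('r, 'q) ring_scheme \<Rightarrow> 'b set \<Rightarrow> ('b \<Rightarrow> 'r) set \<Rightarrow> ('a \<Rightarrow> 'b) \<Rightarrow>
    ('a \<Rightarrow> 'r) set \<Rightarrow> ('b \<Rightarrow> 'r) set" where
  "presented_map R Y Rel h =
     coset_map (free_module R Y) (generated_submodule R (free_module R Y) Rel) (free_map R h)"


section \<open>Tensor products and exterior powers\<close>

definition bilinear_rels ::
    "('r, 'q) ring_scheme \<Rightarrow> ('r, 'm) module \<Rightarrow> ('r, 'n) module \<Rightarrow> ('m \<times> 'n \<Rightarrow> 'r) set" where
  "bilinear_rels R M N =
    (let Z = free_module R (carrier M \<times> carrier N); e = basis_vec R in
       {e (x \<oplus>\<^bsub>M\<^esub> x', y) \<ominus>\<^bsub>Z\<^esub> (e (x, y) \<oplus>\<^bsub>Z\<^esub> e (x', y)) | x x' y.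
          x \<in> carrier M \<and> x' \<in> carrier M \<and> y \<in> carrier N} \<union>
       {e (x, y \<oplus>\<^bsub>N\<^esub> y') \<ominus>\<^bsub>Z\<^esub> (e (x, y) \<oplus>\<^bsub>Z\<^esub> e (x, y')) | x y y'.
          x \<in> carrier M \<and> y \<in> carrier N \<and> y' \<in> carrier N} \<union>
       {e (r \<odot>\<^bsub>M\<^esub> x, y) \<ominus>\<^bsub>Z\<^esub> r \<odot>\<^bsub>Z\<^esub> e (x, y) | r x y.
          r \<in> carrier R \<and> x \<in> carrier M \<and> y \<in> carrier N} \<union>
       {e (x, r \<odot>\<^bsub>N\<^esub> y) \<ominus>\<^bsub>Z\<^esub> r \<odot>\<^bsub>Z\<^esub> e (x, y) | r x y.
          r \<in> carrier R \<and> x \<in> carrier M \<and> y \<in> carrier N})"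

definition tensor :: "('r, 'q) ring_scheme \<Rightarrow> ('r, 'm) module \<Rightarrow> ('r, 'n) module \<Rightarrow>
    ('r, ('m \<times> 'n \<Rightarrow> 'r) set) module" where
  "tensor R M N = presented R (carrier M \<times> carrier N) (bilinear_rels R M N)"

text \<open>\<open>f \<otimes> g\<close> as a map into \<open>M \<otimes> N\<close>.\<close>

definition tensor_map :: "('r, 'q) ring_scheme \<Rightarrow> ('r, 'm) module \<Rightarrow> ('r, 'n) module \<Rightarrow>
    ('m' \<Rightarrow> 'm) \<Rightarrow> ('n' \<Rightarrow> 'n) \<Rightarrow> ('m' \<times> 'n' \<Rightarrow> 'r) set \<Rightarrow> ('m \<times> 'n \<Rightarrow> 'r) set" where
  "tensor_map R M N f g =
     presented_map R (carrier M \<times> carrier N) (bilinear_rels R M N) (map_prod f g)"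

text \<open>The list \<open>[v\<^sub>1, \<dots>, v\<^sub>n]\<close> stands for the generator \<open>v\<^sub>1 \<and> \<dots> \<and> v\<^sub>n\<close> of the exterior power.\<close>

definition vec_lists :: "nat \<Rightarrow> ('r, 'm) module \<Rightarrow> 'm list set" where
  "vec_lists n M = {vs. length vs = n \<and> set vs \<subseteq> carrier M}"

definition alternating_rels ::
    "('r, 'q) ring_scheme \<Rightarrow> nat \<Rightarrow> ('r, 'm) module \<Rightarrow> ('m list \<Rightarrow> 'r) set" where
  "alternating_rels R n M =
    (let Z = free_module R (vec_lists n M); e = basis_vec R in
       {e (vs[i := x \<oplus>\<^bsub>M\<^esub> y]) \<ominus>\<^bsub>Z\<^esub> (e (vs[i := x]) \<oplus>\<^bsub>Z\<^esub> e (vs[i := y])) | vs i x y.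
          vs \<in> vec_lists n M \<and> i < n \<and> x \<in> carrier M \<and> y \<in> carrier M} \<union>
       {e (vs[i := r \<odot>\<^bsub>M\<^esub> x]) \<ominus>\<^bsub>Z\<^esub> r \<odot>\<^bsub>Z\<^esub> e (vs[i := x]) | vs i r x.
          vs \<in> vec_lists n M \<and> i < n \<and> r \<in> carrier R \<and> x \<in> carrier M} \<union>
       {e vs | vs. vs \<in> vec_lists n M \<and> (\<exists>i j. i < j \<and> j < n \<and> vs ! i = vs ! j)})"

definition ext_power ::
    "('r, 'q) ring_scheme \<Rightarrow> nat \<Rightarrow> ('r, 'm) module \<Rightarrow> ('r, ('m list \<Rightarrow> 'r) set) module" where
  "ext_power R n M = presented R (vec_lists n M) (alternating_rels R n M)"

text \<open>The map into \<open>\<Lambda>\<^sup>n M\<close> induced by a map \<open>h\<close> on wedges of vectors.\<close>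

definition ext_power_map :: "('r, 'q) ring_scheme \<Rightarrow> nat \<Rightarrow> ('r, 'm) module \<Rightarrow>
    ('m' list \<Rightarrow> 'm list) \<Rightarrow> ('m' list \<Rightarrow> 'r) set \<Rightarrow> ('m list \<Rightarrow> 'r) set" where
  "ext_power_map R n M h = presented_map R (vec_lists n M) (alternating_rels R n M) h"

type_synonym ('x, 'r) orientation_elt = "(('x \<Rightarrow> 'r) list \<Rightarrow> 'r) set"

definition orientation ::
    "('r, 'q) ring_scheme \<Rightarrow> 'x set \<Rightarrow> ('r, ('x, 'r) orientation_elt) module" where
  "orientation R S = ext_power R (card S) (free_module R S)"

text \<open>For a bijection \<open>f : S \<rightarrow> T\<close>, the contravariant action \<open>Or(T) \<rightarrow> Or(S)\<close>. On \<open>kT \<rightarrow> kS\<close> it is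
  the pullback of functions along \<open>f\<close>, that is, the linear extension of the inverse of \<open>f\<close>.\<close>

definition orientation_map :: "('r, 'q) ring_scheme \<Rightarrow> 'x set \<Rightarrow> ('x \<Rightarrow> 'x) \<Rightarrow>
    ('x, 'r) orientation_elt \<Rightarrow> ('x, 'r) orientation_elt" where
  "orientation_map R S f = ext_power_map R (card S) (free_module R S)
     (map (\<lambda>u s. if s \<in> S then u (f s) else \<zero>\<^bsub>R\<^esub>))"

text \<open>\<open>\<alpha> \<mapsto> x \<and> \<alpha>\<close> as a map \<open>Or(T - {x}) \<rightarrow> Or(T)\<close>, for \<open>x \<in> T\<close>.\<close>

definition wedge_point :: "('r, 'q) ring_scheme \<Rightarrow> 'x set \<Rightarrow> 'x \<Rightarrow>
    ('x, 'r) orientation_elt \<Rightarrow> ('x, 'r) orientation_elt" where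
  "wedge_point R T x = ext_power_map R (card T) (free_module R T) (\<lambda>vs. basis_vec R x # vs)"


section \<open>Modules over \<open>FI\<^sup>o\<^sup>p\<close> and \<open>\<Sigma>\<^sup>o\<^sup>p\<close>\<close>

text \<open>The objects of both categories are the finite subsets of a type \<open>'x\<close>; morphisms are
  extensional functions. When \<open>'x\<close> is infinite these are equivalent to the categories of all
  finite sets.\<close>

definition FI_maps :: "'x set \<Rightarrow> 'x set \<Rightarrow> ('x \<Rightarrow> 'x) set" where
  "FI_maps a b = {f \<in> a \<rightarrow>\<^sub>E b. inj_on f a}"

definition Sigma_maps :: "'x set \<Rightarrow> 'x set \<Rightarrow> ('x \<Rightarrow> 'x) set" where
  "Sigma_maps a b = {f \<in> a \<rightarrow>\<^sub>E b. bij_betw f a b}"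

text \<open>\<open>mor F a b f\<close> is the map \<open>F(b) \<rightarrow> F(a)\<close> induced by \<open>f : a \<rightarrow> b\<close>.\<close>

record ('x, 'r, 'm) presheaf =
  ob :: "'x set \<Rightarrow> ('r, 'm) module"
  mor :: "'x set \<Rightarrow> 'x set \<Rightarrow> ('x \<Rightarrow> 'x) \<Rightarrow> 'm \<Rightarrow> 'm"

locale op_module = cring R
  for homs :: "'x set \<Rightarrow> 'x set \<Rightarrow> ('x \<Rightarrow> 'x) set"
    and R :: "('r, 'q) ring_scheme" (structure)
    and F :: "('x, 'r, 'm) presheaf" +
  assumes ob_module: "finite a \<Longrightarrow> module R (ob F a)"
    and mor_hom: "\<lbrakk>finite a; finite b; f \<in> homs a b\<rbrakk> \<Longrightarrow> mor F a b f \<in> mod_hom R (ob F b) (ob F a)"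
    and mor_id: "\<lbrakk>finite a; v \<in> carrier (ob F a)\<rbrakk> \<Longrightarrow> mor F a a (\<lambda>x\<in>a. x) v = v"
    and mor_comp: "\<lbrakk>finite a; finite b; finite c; f \<in> homs a b; g \<in> homs b c; v \<in> carrier (ob F c)\<rbrakk>
      \<Longrightarrow> mor F a c (compose a g f) v = mor F a b f (mor F b c g v)"

locale op_module_hom = F: op_module homs R F + G: op_module homs R G
  for homs :: "'x set \<Rightarrow> 'x set \<Rightarrow> ('x \<Rightarrow> 'x) set"
    and R :: "('r, 'q) ring_scheme" (structure)
    and F :: "('x, 'r, 'm) presheaf" and G :: "('x, 'r, 'n) presheaf"
    and \<tau> :: "'x set \<Rightarrow> 'm \<Rightarrow> 'n" +
  assumes component_hom: "finite a \<Longrightarrow> \<tau> a \<in> mod_hom R (ob F a) (ob G a)"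
    and natural: "\<lbrakk>finite a; finite b; f \<in> homs a b; v \<in> carrier (ob F b)\<rbrakk>
      \<Longrightarrow> \<tau> a (mor F a b f v) = mor G a b f (\<tau> b v)"

text \<open>An \<open>FI\<^sup>o\<^sup>p\<close>-module is viewed as a \<open>\<Sigma>\<^sup>o\<^sup>p\<close>-module by keeping the same presheaf record:
  the \<open>\<Sigma>\<^sup>o\<^sup>p\<close>-structure only involves \<open>mor\<close> on bijections.\<close>

abbreviation FI_op_module where "FI_op_module \<equiv> op_module FI_maps"
abbreviation FI_op_module_hom where "FI_op_module_hom \<equiv> op_module_hom FI_maps"
abbreviation Sigma_op_module where "Sigma_op_module \<equiv> op_module Sigma_maps"
abbreviation Sigma_op_module_hom where "Sigma_op_module_hom \<equiv> op_module_hom Sigma_maps"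


section \<open>Cochain complexes of \<open>\<Sigma>\<^sup>o\<^sup>p\<close>-modules\<close>

record ('x, 'r, 'm) cochain =
  coch :: "nat \<Rightarrow> ('x, 'r, 'm) presheaf"
  diff :: "nat \<Rightarrow> 'x set \<Rightarrow> 'm \<Rightarrow> 'm"

locale cochain_complex =
  fixes R :: "('r, 'q) ring_scheme" (structure) and C :: "('x, 'r, 'm) cochain"
  assumes diff_hom: "Sigma_op_module_hom R (coch C n) (coch C (Suc n)) (diff C n)"
    and diff_diff: "\<lbrakk>finite b; v \<in> carrier (ob (coch C n) b)\<rbrakk>
      \<Longrightarrow> diff C (Suc n) b (diff C n b v) = \<zero>\<^bsub>ob (coch C (Suc (Suc n))) b\<^esub>"

locale cochain_map = C: cochain_complex R C + D: cochain_complex R D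
  for R :: "('r, 'q) ring_scheme" (structure)
    and C :: "('x, 'r, 'm) cochain" and D :: "('x, 'r, 'n) cochain"
    and \<phi> :: "nat \<Rightarrow> 'x set \<Rightarrow> 'm \<Rightarrow> 'n" +
  assumes degree_hom: "Sigma_op_module_hom R (coch C n) (coch D n) (\<phi> n)"
    and commutes: "\<lbrakk>finite b; v \<in> carrier (ob (coch C n) b)\<rbrakk>
      \<Longrightarrow> \<phi> (Suc n) b (diff C n b v) = diff D n b (\<phi> n b v)"

text \<open>Kernels, images and hence surjectivity and cohomology are computed objectwise in the
  category of \<open>\<Sigma>\<^sup>o\<^sup>p\<close>-modules.\<close>

definition surjective_map :: "('x, 'r, 'm) cochain \<Rightarrow> ('x, 'r, 'n) cochain \<Rightarrow>
    (nat \<Rightarrow> 'x set \<Rightarrow> 'm \<Rightarrow> 'n) \<Rightarrow> bool" where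
  "surjective_map C D \<phi> \<longleftrightarrow>
     (\<forall>n b. finite b \<longrightarrow> \<phi> n b ` carrier (ob (coch C n) b) = carrier (ob (coch D n) b))"

definition cocycles :: "('x, 'r, 'm) cochain \<Rightarrow> nat \<Rightarrow> 'x set \<Rightarrow> ('r, 'm) module" where
  "cocycles C n b = (ob (coch C n) b)
     \<lparr>carrier := {v \<in> carrier (ob (coch C n) b). diff C n b v = \<zero>\<^bsub>ob (coch C (Suc n)) b\<^esub>}\<rparr>"

fun coboundaries :: "('x, 'r, 'm) cochain \<Rightarrow> nat \<Rightarrow> 'x set \<Rightarrow> 'm set" where
  "coboundaries C 0 b = {\<zero>\<^bsub>ob (coch C 0) b\<^esub>}"
| "coboundaries C (Suc n) b = diff C n b ` carrier (ob (coch C n) b)"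

definition cohomology :: "('x, 'r, 'm) cochain \<Rightarrow> nat \<Rightarrow> 'x set \<Rightarrow> ('r, 'm set) module" where
  "cohomology C n b = quotient_module (cocycles C n b) (coboundaries C n b)"

definition cohomology_map :: "('x, 'r, 'n) cochain \<Rightarrow> (nat \<Rightarrow> 'x set \<Rightarrow> 'm \<Rightarrow> 'n) \<Rightarrow>
    nat \<Rightarrow> 'x set \<Rightarrow> 'm set \<Rightarrow> 'n set" where
  "cohomology_map D \<phi> n b = coset_map (cocycles D n b) (coboundaries D n b) (\<phi> n b)"

definition quasi_isomorphism :: "('r, 'q) ring_scheme \<Rightarrow> ('x, 'r, 'm) cochain \<Rightarrow>
    ('x, 'r, 'n) cochain \<Rightarrow> (nat \<Rightarrow> 'x set \<Rightarrow> 'm \<Rightarrow> 'n) \<Rightarrow> bool" where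
  "quasi_isomorphism R C D \<phi> \<longleftrightarrow> (\<forall>n b. finite b \<longrightarrow>
     cohomology_map D \<phi> n b \<in> mod_hom R (cohomology C n b) (cohomology D n b) \<and>
     bij_betw (cohomology_map D \<phi> n b) (carrier (cohomology C n b)) (carrier (cohomology D n b)))"


section \<open>Cosimplicial \<open>\<Sigma>\<^sup>o\<^sup>p\<close>-modules\<close>

text \<open>\<open>coface C n i\<close> is \<open>d\<^sup>i : C\<^sup>n \<rightarrow> C\<^sup>n\<^sup>+\<^sup>1\<close> for \<open>i \<le> n + 1\<close>;
  \<open>codeg C n j\<close> is \<open>s\<^sup>j : C\<^sup>n\<^sup>+\<^sup>1 \<rightarrow> C\<^sup>n\<close> for \<open>j \<le> n\<close>.\<close>

record ('x, 'r, 'm) cosimplicial =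
  level :: "nat \<Rightarrow> ('x, 'r, 'm) presheaf"
  coface :: "nat \<Rightarrow> nat \<Rightarrow> 'x set \<Rightarrow> 'm \<Rightarrow> 'm"
  codeg :: "nat \<Rightarrow> nat \<Rightarrow> 'x set \<Rightarrow> 'm \<Rightarrow> 'm"

definition opposite :: "('x, 'r, 'm) cosimplicial \<Rightarrow> ('x, 'r, 'm) cosimplicial" where
  "opposite C = \<lparr>level = level C, coface = (\<lambda>n i. coface C n (n + 1 - i)),
     codeg = (\<lambda>n j. codeg C n (n - j))\<rparr>"

definition normalized_term :: "('x, 'r, 'm) cosimplicial \<Rightarrow> nat \<Rightarrow> ('x, 'r, 'm) presheaf" where
  "normalized_term C n =
     \<lparr>ob = (\<lambda>b. (ob (level C n) b)
        \<lparr>carrier := {v \<in> carrier (ob (level C n) b).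
           \<forall>j<n. codeg C (n - 1) j b v = \<zero>\<^bsub>ob (level C (n - 1)) b\<^esub>}\<rparr>),
      mor = mor (level C n)\<rparr>"

definition normalized :: "('x, 'r, 'm) cosimplicial \<Rightarrow> ('x, 'r, 'm) cochain" where
  "normalized C =
     \<lparr>coch = normalized_term C,
      diff = (\<lambda>n b v. let M = ob (level C (n + 1)) b in
        \<Oplus>\<^bsub>M\<^esub>i\<in>{..n + 1}. if even i then coface C n i b v else \<ominus>\<^bsub>M\<^esub> (coface C n i b v))\<rparr>"


section \<open>The comonad \<open>\<perp>\<close> and the cosimplicial object \<open>\<CC>\<^sup>\<bullet>F\<close>\<close>

text \<open>A single element type on which \<open>\<perp>\<close> can be iterated: \<open>Base m\<close> is an element \<open>m\<close> of a value
  of \<open>F\<close>, and \<open>Family w\<close> is an element of \<open>\<perp>G(b)\<close> with component \<open>w b'\<close> in \<open>G(b')\<close>.\<close>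

datatype ('x, 'm) iter = Base (the_base: 'm) | Family (component: "'x set \<Rightarrow> ('x, 'm) iter")

definition based :: "('x, 'r, 'm) presheaf \<Rightarrow> ('x, 'r, ('x, 'm) iter) presheaf" where
  "based F = \<lparr>ob = (\<lambda>b. transported Base the_base (ob F b)),
     mor = (\<lambda>a b f w. Base (mor F a b f (the_base w)))\<rparr>"

definition based_map :: "('x set \<Rightarrow> 'm \<Rightarrow> 'n) \<Rightarrow> 'x set \<Rightarrow> ('x, 'm) iter \<Rightarrow> ('x, 'n) iter" where
  "based_map \<tau> b w = Base (\<tau> b (the_base w))"

text \<open>In \<open>perp\<close>, the subset \<open>a'\<close> of \<open>a\<close> is the preimage of \<open>f ` a'\<close> under the bijection
  \<open>f : a \<rightarrow> b\<close>.\<close>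

definition perp :: "('x, 'r, ('x, 'm) iter) presheaf \<Rightarrow> ('x, 'r, ('x, 'm) iter) presheaf" where
  "perp G =
     \<lparr>ob = (\<lambda>b. transported Family component (direct_sum (Pow b) (ob G))),
      mor = (\<lambda>a b f w. Family (\<lambda>a'\<in>Pow a. mor G a' (f ` a') (restrict f a') (component w (f ` a'))))\<rparr>"

definition perp_map :: "('x set \<Rightarrow> ('x, 'm) iter \<Rightarrow> ('x, 'n) iter) \<Rightarrow>
    'x set \<Rightarrow> ('x, 'm) iter \<Rightarrow> ('x, 'n) iter" where
  "perp_map \<tau> b w = Family (\<lambda>b'\<in>Pow b. \<tau> b' (component w b'))"

definition counit :: "'x set \<Rightarrow> ('x, 'm) iter \<Rightarrow> ('x, 'm) iter" where
  "counit b w = component w b"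

definition comult :: "'x set \<Rightarrow> ('x, 'm) iter \<Rightarrow> ('x, 'm) iter" where
  "comult b w = Family (\<lambda>b'\<in>Pow b. Family (\<lambda>b''\<in>Pow b'. component w b''))"

definition coaug :: "('x, 'r, ('x, 'm) iter) presheaf \<Rightarrow> 'x set \<Rightarrow> ('x, 'm) iter \<Rightarrow> ('x, 'm) iter"
  where "coaug G b v = Family (\<lambda>b'\<in>Pow b. if b' = b then v else \<zero>\<^bsub>ob G b'\<^esub>)"

definition coaction :: "('x, 'r, ('x, 'm) iter) presheaf \<Rightarrow> 'x set \<Rightarrow> ('x, 'm) iter \<Rightarrow> ('x, 'm) iter"
  where "coaction F b v = Family (\<lambda>b'\<in>Pow b. mor F b' b (\<lambda>x\<in>b'. x) v)"

definition cobar :: "('x, 'r, 'm) presheaf \<Rightarrow> ('x, 'r, ('x, 'm) iter) cosimplicial" where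
  "cobar F =
     \<lparr>level = (\<lambda>n. (perp ^^ n) (based F)),
      coface = (\<lambda>n i. if i = 0 then coaug ((perp ^^ n) (based F))
                       else if i < n + 1 then (perp_map ^^ (i - 1)) comult
                       else (perp_map ^^ n) (coaction (based F))),
      codeg = (\<lambda>n j. (perp_map ^^ j) counit)\<rparr>"

text \<open>Functoriality of \<open>F \<mapsto> N((\<CC>\<^sup>\<bullet>F)\<^sup>o\<^sup>p)\<close>: in degree \<open>n\<close> it is given by \<open>\<perp>\<^sup>n \<tau>\<close>.\<close>

definition cobar_map :: "('x set \<Rightarrow> 'm \<Rightarrow> 'n) \<Rightarrow> nat \<Rightarrow> 'x set \<Rightarrow> ('x, 'm) iter \<Rightarrow> ('x, 'n) iter" where
  "cobar_map \<tau> n = (perp_map ^^ n) (based_map \<tau>)"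


section \<open>The Koszul complex\<close>

type_synonym ('x, 'r, 'm) koszul_elt = "'x set \<Rightarrow> ('m \<times> ('x, 'r) orientation_elt \<Rightarrow> 'r) set"

text \<open>Writing \<open>|c| + t = |b|\<close> makes this empty for \<open>t > |b|\<close>.\<close>

definition koszul_index :: "nat \<Rightarrow> 'x set \<Rightarrow> 'x set set" where
  "koszul_index t b = {c. c \<subseteq> b \<and> card c + t = card b}"

definition koszul_term :: "('r, 'q) ring_scheme \<Rightarrow> ('x, 'r, 'm) presheaf \<Rightarrow> nat \<Rightarrow>
    ('x, 'r, ('x, 'r, 'm) koszul_elt) presheaf" where
  "koszul_term R F t =
     \<lparr>ob = (\<lambda>b. direct_sum (koszul_index t b) (\<lambda>c. tensor R (ob F c) (orientation R (b - c)))),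
      mor = (\<lambda>a b g w. \<lambda>c\<in>koszul_index t a.
        tensor_map R (ob F c) (orientation R (a - c))
          (mor F c (g ` c) (restrict g c)) (orientation_map R (a - c) (restrict g (a - c)))
          (w (g ` c)))\<rparr>"

text \<open>The component of \<open>d\<close> at \<open>c\<close> collects the contributions of the summands
  indexed by \<open>c \<union> {x}\<close>, for \<open>x \<in> b - c\<close>.\<close>

definition koszul :: "('r, 'q) ring_scheme \<Rightarrow> ('x, 'r, 'm) presheaf \<Rightarrow>
    ('x, 'r, ('x, 'r, 'm) koszul_elt) cochain" where
  "koszul R F =
     \<lparr>coch = koszul_term R F,
      diff = (\<lambda>t b w. \<lambda>c\<in>koszul_index (Suc t) b.
        \<Oplus>\<^bsub>tensor R (ob F c) (orientation R (b - c))\<^esub>x\<in>b - c.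
          tensor_map R (ob F c) (orientation R (b - c))
            (mor F c (insert x c) (\<lambda>y\<in>c. y)) (wedge_point R (b - c) x) (w (insert x c)))\<rparr>"

text \<open>Functoriality in \<open>F\<close>, for a map \<open>\<tau>\<close> into \<open>G\<close>.\<close>

definition koszul_map :: "('r, 'q) ring_scheme \<Rightarrow> ('x, 'r, 'n) presheaf \<Rightarrow> ('x set \<Rightarrow> 'm \<Rightarrow> 'n) \<Rightarrow>
    nat \<Rightarrow> 'x set \<Rightarrow> ('x, 'r, 'm) koszul_elt \<Rightarrow> ('x, 'r, 'n) koszul_elt" where
  "koszul_map R G \<tau> t b w =
     (\<lambda>c\<in>koszul_index t b. tensor_map R (ob G c) (orientation R (b - c)) (\<tau> c) id (w c))"

end

theory Submission
  imports Defs "HOL-Combinatorics.Permutations"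
begin

text \<open>An element of \<open>\<perp>\<^sup>n F (b)\<close> is a function that assigns to every chain \<open>b \<supseteq> c\<^sub>1 \<supseteq> \<dots> \<supseteq> c\<^sub>n\<close> of
subsets an element of \<open>F(c\<^sub>n)\<close>. A codegeneracy evaluates this function on chains with a repeated
entry, so the normalized elements are those supported on strict chains. The cofaces given by the
comultiplication omit an entry \<open>c\<^sub>i\<close> with \<open>i \<le> n\<close> from a chain \<open>c\<^sub>1, \<dots>, c\<^sub>n\<^sub>+\<^sub>1\<close>, the
coaction omits the last entry and restricts the value from \<open>c\<^sub>n\<close> to \<open>c\<^sub>n\<^sub>+\<^sub>1\<close>, and the
coaugmentation only contributes to chains with \<open>c\<^sub>1 = b\<close>. On a strict chain the differential of the
opposite complex is therefore the restriction term plus an alternating sum over the omitted entries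
\<open>c\<^sub>1, \<dots>, c\<^sub>n\<close>, which does not change the last entry; that sum is called the inner differential
(\<open>evaluate_diff_strict\<close>).

The comparison map sends a function \<open>w\<close> on chains to the family with component
\<open>\<Sum> w(b - {x\<^sub>1}, b - {x\<^sub>1, x\<^sub>2}, \<dots>, c) \<otimes> x\<^sub>n \<and> \<dots> \<and> x\<^sub>1\<close> at \<open>c\<close>, the sum being over all orderings of
\<open>b - c\<close>, that is, over all complete flags from \<open>b\<close> to \<open>c\<close>. A chain obtained by omitting an inner entry
of a complete flag can be refined to a complete flag in exactly two ways, and the two wedges are
opposite. Hence the inner differential is mapped to zero (\<open>alternating_sum_inner_diff\<close>), and the
restriction term becomes the differential of the Koszul complex (\<open>comparison_commutes\<close>).

Since \<open>Or(b - c)\<close> is generated by the wedge of any ordering, every element of \<open>F(c) \<otimes> Or(b - c)\<close> is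
the image of a function supported on a single flag. So the comparison map is surjective, and
functoriality and \<open>d\<^sup>2 = 0\<close> pass from the normalized complex to the Koszul complex.

It remains to see that the kernel is acyclic. For a fixed \<open>c\<close>, the functions on strict chains from
\<open>b\<close> to \<open>c\<close> with the inner differential form the augmented cochain complex of the poset of subsets
strictly between \<open>c\<close> and \<open>b\<close>, the boundary of a simplex subdivided. Its cohomology is concentrated in
top degree, where it is detected on one complete flag; this is shown by a homotopy that inserts a
point into the members of a chain (\<open>inner_diff_exact\<close>). The wedge of an ordering has a left inverse
given by a determinant, so \<open>m \<mapsto> m \<otimes> x\<^sub>n \<and> \<dots> \<and> x\<^sub>1\<close> is injective (\<open>word_tensor_inj\<close>), and the
comparison map is faithful on that top cohomology: a top degree function in its kernel is an inner
coboundary (\<open>chain_value_exact\<close>). Finally the restriction term strictly raises the codimension in \<open>b\<close>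
of the last entry of a chain. In the lowest codimension in which it does not vanish, a cocycle of the
kernel is thus an inner cocycle; it can be removed there by a coboundary of an element of the kernel
(\<open>kernel_filtration_step\<close>), and the codimension is at most the size of \<open>b\<close>.\<close>

section \<open>Homomorphisms, submodules and quotients\<close>

lemma mod_homI:
  assumes "\<And>x. x \<in> carrier M \<Longrightarrow> h x \<in> carrier N"
    and "\<And>x y. \<lbrakk>x \<in> carrier M; y \<in> carrier M\<rbrakk> \<Longrightarrow> h (x \<oplus>\<^bsub>M\<^esub> y) = h x \<oplus>\<^bsub>N\<^esub> h y"
    and "\<And>r x. \<lbrakk>r \<in> carrier R; x \<in> carrier M\<rbrakk> \<Longrightarrow> h (r \<odot>\<^bsub>M\<^esub> x) = r \<odot>\<^bsub>N\<^esub> h x"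
  shows "h \<in> mod_hom R M N"
  using assms by (auto simp: mod_hom_def)

lemma mod_homD:
  assumes "h \<in> mod_hom R M N"
  shows mod_hom_closed: "x \<in> carrier M \<Longrightarrow> h x \<in> carrier N"
    and mod_hom_add: "\<lbrakk>x \<in> carrier M; y \<in> carrier M\<rbrakk> \<Longrightarrow> h (x \<oplus>\<^bsub>M\<^esub> y) = h x \<oplus>\<^bsub>N\<^esub> h y"
    and mod_hom_smult: "\<lbrakk>r \<in> carrier R; x \<in> carrier M\<rbrakk> \<Longrightarrow> h (r \<odot>\<^bsub>M\<^esub> x) = r \<odot>\<^bsub>N\<^esub> h x"
  using assms by (auto simp: mod_hom_def)

lemma mod_hom_zero:
  assumes "h \<in> mod_hom R M N" "module R M" "module R N"
  shows "h \<zero>\<^bsub>M\<^esub> = \<zero>\<^bsub>N\<^esub>"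
proof -
  interpret M: module R M by fact
  interpret N: module R N by fact
  have "h (\<zero>\<^bsub>R\<^esub> \<odot>\<^bsub>M\<^esub> \<zero>\<^bsub>M\<^esub>) = \<zero>\<^bsub>R\<^esub> \<odot>\<^bsub>N\<^esub> h \<zero>\<^bsub>M\<^esub>"
    using assms(1) by (intro mod_hom_smult) auto
  thus ?thesis using mod_hom_closed[OF assms(1), of "\<zero>\<^bsub>M\<^esub>"] by simp
qed

lemma mod_hom_minus:
  assumes "h \<in> mod_hom R M N" "module R M" "module R N" "x \<in> carrier M"
  shows "h (\<ominus>\<^bsub>M\<^esub> x) = \<ominus>\<^bsub>N\<^esub> h x"
proof -
  interpret M: module R M by fact
  interpret N: module R N by fact
  have "h (\<ominus>\<^bsub>M\<^esub> x) \<oplus>\<^bsub>N\<^esub> h x = h (\<ominus>\<^bsub>M\<^esub> x \<oplus>\<^bsub>M\<^esub> x)"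
    using mod_hom_add[OF assms(1)] assms(4) by simp
  also have "\<dots> = \<zero>\<^bsub>N\<^esub>" using assms(4) mod_hom_zero[OF assms(1-3)] by (simp add: M.M.l_neg)
  finally show ?thesis
    using mod_hom_closed[OF assms(1)] assms(4) N.M.minus_equality by fastforce
qed

lemma mod_hom_finsum:
  assumes "h \<in> mod_hom R M N" "module R M" "module R N" "f \<in> A \<rightarrow> carrier M"
  shows "h (\<Oplus>\<^bsub>M\<^esub>i\<in>A. f i) = (\<Oplus>\<^bsub>N\<^esub>i\<in>A. h (f i))"
proof -
  interpret M: module R M by fact
  interpret N: module R N by fact
  note z = mod_hom_zero[OF assms(1-3)]
  note c = mod_hom_closed[OF assms(1)]
  show ?thesis
  proof (cases "finite A")
    case True
    thus ?thesis using assms(4)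
    proof (induction A rule: finite_induct)
      case empty thus ?case by (simp add: z)
    next
      case (insert a A)
      hence "f \<in> A \<rightarrow> carrier M" "f a \<in> carrier M" by auto
      thus ?case using insert c
        by (subst M.M.finsum_insert) (auto simp: mod_hom_add[OF assms(1)] Pi_iff intro!: M.M.finsum_closed)
    qed
  next
    case False thus ?thesis by (simp add: z)
  qed
qed

lemma mod_hom_comp:
  "\<lbrakk>f \<in> mod_hom R M N; g \<in> mod_hom R N P\<rbrakk> \<Longrightarrow> (\<lambda>x. g (f x)) \<in> mod_hom R M P"
  by (intro mod_homI) (simp_all add: mod_homD[of f] mod_homD[of g])

lemma submodule_abelian_subgroup:
  assumes "module R M" "submodule H R M"
  shows "abelian_subgroup H M"
proof -
  interpret M: module R M by fact
  show ?thesis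
    using submodule.axioms(1)[OF assms(2)] M.abelian_group_axioms
    by (intro abelian_subgroupI3) (auto intro: additive_subgroup.intro)
qed

lemma mod_hom_kernel_submodule:
  assumes "h \<in> mod_hom R M N" "module R M" "module R N"
  shows "submodule {x \<in> carrier M. h x = \<zero>\<^bsub>N\<^esub>} R M"
proof -
  interpret M: module R M by fact
  interpret N: module R N by fact
  show ?thesis
    using mod_homD[OF assms(1)] mod_hom_zero[OF assms] mod_hom_minus[OF assms]
    by (intro M.submoduleI) auto
qed

lemma mod_hom_image_submodule:
  assumes "h \<in> mod_hom R M N" "module R M" "module R N"
  shows "submodule (h ` carrier M) R N"
proof -
  interpret M: module R M by fact
  interpret N: module R N by fact
  show ?thesis
  proof (intro N.submoduleI)
    show "\<zero>\<^bsub>N\<^esub> \<in> h ` carrier M" using mod_hom_zero[OF assms] by (metis M.M.zero_closed image_eqI)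
    show "\<ominus>\<^bsub>N\<^esub> a \<in> h ` carrier M" if "a \<in> h ` carrier M" for a
      using that mod_hom_minus[OF assms] by (metis (no_types, lifting) M.M.a_inv_closed image_iff)
    show "a \<oplus>\<^bsub>N\<^esub> b \<in> h ` carrier M" if "a \<in> h ` carrier M" "b \<in> h ` carrier M" for a b
      using that mod_hom_add[OF assms(1)] by (metis (no_types, lifting) M.M.a_closed image_iff)
    show "a \<odot>\<^bsub>N\<^esub> x \<in> h ` carrier M" if "a \<in> carrier R" "x \<in> h ` carrier M" for a x
      using that mod_hom_smult[OF assms(1)] by (metis (no_types, lifting) M.smult_closed image_iff)
  qed (use mod_hom_closed[OF assms(1)] in auto)
qed

lemma coset_map_coset:
  assumes "f \<in> mod_hom R M N" "module R M" "module R N" "submodule H R M" "submodule K R N"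
    and "f ` H \<subseteq> K" "x \<in> carrier M"
  shows "coset_map N K f (H +>\<^bsub>M\<^esub> x) = K +>\<^bsub>N\<^esub> f x"
proof -
  interpret M: module R M by fact
  interpret N: module R N by fact
  interpret H: abelian_subgroup H M using assms by (auto intro: submodule_abelian_subgroup)
  interpret K: abelian_subgroup K N using assms by (auto intro: submodule_abelian_subgroup)
  have "K +>\<^bsub>N\<^esub> f a = K +>\<^bsub>N\<^esub> f x" if "a \<in> H +>\<^bsub>M\<^esub> x" for a
  proof -
    obtain h where h: "h \<in> H" "a = h \<oplus>\<^bsub>M\<^esub> x" using \<open>a \<in> H +>\<^bsub>M\<^esub> x\<close> by (auto simp: a_r_coset_def')
    have "f a = f h \<oplus>\<^bsub>N\<^esub> f x" using h assms mod_hom_add[OF assms(1)] H.a_Hcarr by auto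
    moreover have "f h \<in> K" using h assms by auto
    ultimately have "f a \<in> K +>\<^bsub>N\<^esub> f x" by (auto simp: a_r_coset_def')
    thus ?thesis using mod_hom_closed[OF assms(1,7)] K.a_repr_independence' by metis
  qed
  moreover have "x \<in> H +>\<^bsub>M\<^esub> x" using H.a_rcos_self assms(7) by auto
  ultimately show ?thesis unfolding coset_map_def by blast
qed

context
  fixes R :: "('r, 'q) ring_scheme" and M :: "('r, 'm) module" and H
  assumes M: "module R M" and H: "submodule H R M"
begin

interpretation M: module R M by (rule M)
interpretation H: abelian_subgroup H M by (rule submodule_abelian_subgroup[OF M H])

lemma quotient_carrier: "carrier (quotient_module M H) = (\<lambda>x. H +>\<^bsub>M\<^esub> x) ` carrier M"
  by (auto simp: quotient_module_def A_RCOSETS_def')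

lemma quotient_add:
  "\<lbrakk>x \<in> carrier M; y \<in> carrier M\<rbrakk> \<Longrightarrow>
    (H +>\<^bsub>M\<^esub> x) \<oplus>\<^bsub>quotient_module M H\<^esub> (H +>\<^bsub>M\<^esub> y) = H +>\<^bsub>M\<^esub> (x \<oplus>\<^bsub>M\<^esub> y)"
  by (simp add: quotient_module_def H.a_rcos_sum)

lemma quotient_zero: "\<zero>\<^bsub>quotient_module M H\<^esub> = H +>\<^bsub>M\<^esub> \<zero>\<^bsub>M\<^esub>"
  using H.a_subset by (simp add: quotient_module_def)

lemma smult_mod_hom:
  assumes "r \<in> carrier R" shows "(\<lambda>x. r \<odot>\<^bsub>M\<^esub> x) \<in> mod_hom R M M"
  using assms
  by (intro mod_homI) (auto simp: M.smult_r_distr M.smult_assoc1[symmetric] M.R.m_comm)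

lemma quotient_smult:
  assumes "r \<in> carrier R" "x \<in> carrier M"
  shows "r \<odot>\<^bsub>quotient_module M H\<^esub> (H +>\<^bsub>M\<^esub> x) = H +>\<^bsub>M\<^esub> (r \<odot>\<^bsub>M\<^esub> x)"
proof -
  have "(\<lambda>x. r \<odot>\<^bsub>M\<^esub> x) ` H \<subseteq> H" using M.submoduleE(4)[OF H] assms by auto
  from coset_map_coset[OF smult_mod_hom[OF assms(1)] M M H H this assms(2)]
  show ?thesis by (simp add: quotient_module_def)
qed

lemma quotient_module_module: "module R (quotient_module M H)"
proof (rule moduleI)
  let ?Q = "quotient_module M H"
  note simps = quotient_carrier quotient_add quotient_zero quotient_smult
  show "cring R" ..
  show "abelian_group ?Q"
  proof (rule abelian_groupI, goal_cases)
    case (6 x)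
    then obtain a where "a \<in> carrier M" "x = H +>\<^bsub>M\<^esub> a" by (auto simp: simps)
    thus ?case by (auto simp: simps M.M.l_neg intro!: bexI[of _ "\<ominus>\<^bsub>M\<^esub> a"])
  qed (auto simp: simps M.M.a_ac)
qed (auto simp: quotient_carrier quotient_add quotient_smult M.smult_l_distr M.smult_r_distr M.smult_assoc1)

lemma quotient_eq_iff:
  assumes "x \<in> carrier M" "y \<in> carrier M"
  shows "H +>\<^bsub>M\<^esub> x = H +>\<^bsub>M\<^esub> y \<longleftrightarrow> x \<ominus>\<^bsub>M\<^esub> y \<in> H"
  using assms H.a_rcos_module H.a_repr_independence' H.a_rcos_self
  unfolding a_minus_def by metis

lemma quotient_proj_hom: "(\<lambda>x. H +>\<^bsub>M\<^esub> x) \<in> mod_hom R M (quotient_module M H)"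
  by (rule mod_homI) (auto simp: quotient_carrier quotient_add quotient_smult)

end

lemma coset_map_hom:
  assumes "f \<in> mod_hom R M N" "module R M" "module R N" "submodule H R M" "submodule K R N"
    and "f ` H \<subseteq> K"
  shows "coset_map N K f \<in> mod_hom R (quotient_module M H) (quotient_module N K)"
proof -
  interpret M: module R M by fact
  show ?thesis
    using mod_homD[OF assms(1)]
    by (intro mod_homI)
       (auto simp: quotient_carrier[OF assms(2,4)] quotient_carrier[OF assms(3,5)] coset_map_coset[OF assms]
         quotient_add[OF assms(2,4)] quotient_smult[OF assms(2,4)] quotient_add[OF assms(3,5)]
         quotient_smult[OF assms(3,5)])
qed

section \<open>Free modules and presentations\<close>

lemma free_carrier:
  "u \<in> carrier (free_module R X) \<longleftrightarrow>
    (\<forall>x. u x \<in> carrier R) \<and> (\<forall>x. x \<notin> X \<longrightarrow> u x = \<zero>\<^bsub>R\<^esub>) \<and> finite {x. u x \<noteq> \<zero>\<^bsub>R\<^esub>}"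
  by (simp add: free_module_def)

lemma free_simps:
  "\<zero>\<^bsub>free_module R X\<^esub> = (\<lambda>x. \<zero>\<^bsub>R\<^esub>)"
  "u \<oplus>\<^bsub>free_module R X\<^esub> v = (\<lambda>x. u x \<oplus>\<^bsub>R\<^esub> v x)"
  "r \<odot>\<^bsub>free_module R X\<^esub> u = (\<lambda>x. r \<otimes>\<^bsub>R\<^esub> u x)"
  by (simp_all add: free_module_def)

lemma submodule_zero: "submodule H R M \<Longrightarrow> \<zero>\<^bsub>M\<^esub> \<in> H"
  using subgroup.one_closed[OF submodule.axioms(1)] by fastforce

context cring
begin

lemma free_module_module: "Module.module R (free_module R X)"
proof -
  let ?Z = "free_module R X"
  have fin_add: "finite {x. u x \<oplus> v x \<noteq> \<zero>}"
    if "finite {x. u x \<noteq> \<zero>}" "finite {x. v x \<noteq> \<zero>}" for u v :: "_ \<Rightarrow> 'a"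
    by (rule finite_subset[of _ "{x. u x \<noteq> \<zero>} \<union> {x. v x \<noteq> \<zero>}"]) (use that in auto)
  have fin_smult: "finite {x. r \<otimes> u x \<noteq> \<zero>}"
    if "finite {x. u x \<noteq> \<zero>}" "r \<in> carrier R" for r and u :: "_ \<Rightarrow> 'a"
    by (rule finite_subset[of _ "{x. u x \<noteq> \<zero>}"]) (use that in auto)
  have fin_minus: "finite {x. \<ominus> u x \<noteq> \<zero>}" if "finite {x. u x \<noteq> \<zero>}" for u :: "_ \<Rightarrow> 'a"
    by (rule finite_subset[of _ "{x. u x \<noteq> \<zero>}"]) (use that in auto)
  have ab: "abelian_group ?Z"
  proof (rule abelian_groupI, goal_cases)
    case (6 u)
    thus ?case
      by (intro bexI[of _ "\<lambda>x. \<ominus> u x"]) (auto simp: free_carrier free_simps l_neg fin_minus)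
  qed (auto simp: free_carrier free_simps fin_add a_ac)
  show ?thesis
    by (rule moduleI[OF is_cring ab])
       (auto simp: free_carrier free_simps l_distr r_distr m_assoc fin_smult)
qed

lemma basis_vec_closed [simp]: "x \<in> X \<Longrightarrow> basis_vec R x \<in> carrier (free_module R X)"
  by (auto simp: free_carrier basis_vec_def intro: finite_subset[of _ "{x}"])

lemma free_module_span:
  assumes H: "submodule H R (free_module R X)" and basis: "\<And>x. x \<in> X \<Longrightarrow> basis_vec R x \<in> H"
    and u: "u \<in> carrier (free_module R X)"
  shows "u \<in> H"
proof -
  interpret Z: Module.module R "free_module R X" by (rule free_module_module)
  note E = Z.submoduleE[OF H]
  have "u \<in> H" if "finite S" "u \<in> carrier (free_module R X)" "{x. u x \<noteq> \<zero>} \<subseteq> S" for S u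
    using that
  proof (induction S arbitrary: u rule: finite_induct)
    case empty
    hence "u = \<zero>\<^bsub>free_module R X\<^esub>" by (auto simp: free_simps)
    thus ?case using submodule_zero[OF H] by simp
  next
    case (insert s S)
    show ?case
    proof (cases "s \<in> X")
      case False
      thus ?thesis using insert by (intro insert.IH) (auto simp: free_carrier)
    next
      case True
      define u' where "u' = (\<lambda>x. if x = s then \<zero> else u x)"
      have "finite {x. u' x \<noteq> \<zero>}"
        by (rule finite_subset[of _ S]) (use insert in \<open>auto simp: u'_def\<close>)
      hence "u' \<in> carrier (free_module R X)" using insert.prems by (auto simp: free_carrier u'_def)
      hence "u' \<in> H" using insert by (intro insert.IH) (auto simp: u'_def)
      moreover have "u s \<odot>\<^bsub>free_module R X\<^esub> basis_vec R s \<in> H"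
        using insert.prems basis True E(4) by (auto simp: free_carrier)
      moreover have "u = u' \<oplus>\<^bsub>free_module R X\<^esub> (u s \<odot>\<^bsub>free_module R X\<^esub> basis_vec R s)"
        using insert.prems by (auto simp: free_simps u'_def basis_vec_def free_carrier)
      ultimately show ?thesis using E(5) by metis
    qed
  qed
  thus ?thesis using u by (auto simp: free_carrier)
qed

definition linear_ext :: "('a, 'm) module \<Rightarrow> ('x \<Rightarrow> 'm) \<Rightarrow> ('x \<Rightarrow> 'a) \<Rightarrow> 'm" where
  "linear_ext N h u = (\<Oplus>\<^bsub>N\<^esub>x\<in>{x. u x \<noteq> \<zero>}. u x \<odot>\<^bsub>N\<^esub> h x)"

lemma linear_ext_superset:
  assumes "Module.module R N" "h \<in> X \<rightarrow> carrier N" "u \<in> carrier (free_module R X)"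
    and "finite S" "{x. u x \<noteq> \<zero>} \<subseteq> S" "S \<subseteq> X"
  shows "linear_ext N h u = (\<Oplus>\<^bsub>N\<^esub>x\<in>S. u x \<odot>\<^bsub>N\<^esub> h x)"
proof -
  interpret N: Module.module R N by fact
  show ?thesis unfolding linear_ext_def
    by (rule N.M.add.finprod_mono_neutral_cong_left) (use assms in \<open>auto simp: free_carrier Pi_iff\<close>)
qed

lemma linear_ext_hom:
  assumes N: "Module.module R N" and h: "h \<in> X \<rightarrow> carrier N"
  shows "linear_ext N h \<in> mod_hom R (free_module R X) N"
proof (rule mod_homI)
  interpret N: Module.module R N by fact
  interpret Z: Module.module R "free_module R X" by (rule free_module_module)
  have supp: "{x. u x \<noteq> \<zero>} \<subseteq> X" if "u \<in> carrier (free_module R X)" for u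
    using that by (auto simp: free_carrier)
  fix u assume u: "u \<in> carrier (free_module R X)"
  have "\<And>x. x \<in> {x. u x \<noteq> \<zero>} \<Longrightarrow> u x \<odot>\<^bsub>N\<^esub> h x \<in> carrier N"
    using u h by (force simp: free_carrier)
  thus "linear_ext N h u \<in> carrier N"
    unfolding linear_ext_def by (intro N.M.finsum_closed) auto
  {
    fix v assume v: "v \<in> carrier (free_module R X)"
    define S where "S = {x. u x \<noteq> \<zero>} \<union> {x. v x \<noteq> \<zero>}"
    have S: "finite S" "S \<subseteq> X" using u v supp by (auto simp: S_def free_carrier)
    have uc: "u x \<in> carrier R" "v x \<in> carrier R" for x using u v by (auto simp: free_carrier)
    have hc: "h x \<in> carrier N" if "x \<in> S" for x using S h that by auto
    have "linear_ext N h (u \<oplus>\<^bsub>free_module R X\<^esub> v)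
        = (\<Oplus>\<^bsub>N\<^esub>x\<in>S. (u x \<oplus> v x) \<odot>\<^bsub>N\<^esub> h x)"
      using u v S Z.M.a_closed[OF u v]
      by (subst linear_ext_superset[OF N h, of _ S]) (auto simp: S_def free_simps)
    also have "\<dots> = (\<Oplus>\<^bsub>N\<^esub>x\<in>S. u x \<odot>\<^bsub>N\<^esub> h x \<oplus>\<^bsub>N\<^esub> v x \<odot>\<^bsub>N\<^esub> h x)"
      by (rule N.M.finsum_cong') (auto simp: uc hc N.smult_l_distr)
    also have "\<dots> = (\<Oplus>\<^bsub>N\<^esub>x\<in>S. u x \<odot>\<^bsub>N\<^esub> h x) \<oplus>\<^bsub>N\<^esub> (\<Oplus>\<^bsub>N\<^esub>x\<in>S. v x \<odot>\<^bsub>N\<^esub> h x)"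
      by (rule N.M.finsum_addf) (auto simp: uc hc)
    also have "\<dots> = linear_ext N h u \<oplus>\<^bsub>N\<^esub> linear_ext N h v"
      using u v S linear_ext_superset[OF N h, of _ S] by (auto simp: S_def)
    finally show "linear_ext N h (u \<oplus>\<^bsub>free_module R X\<^esub> v) = linear_ext N h u \<oplus>\<^bsub>N\<^esub> linear_ext N h v" .
  }
  fix r assume r: "r \<in> carrier R"
  define S where "S = {x. u x \<noteq> \<zero>}"
  have S: "finite S" "S \<subseteq> X" using u supp by (auto simp: S_def free_carrier)
  have uc: "u x \<in> carrier R" for x using u by (auto simp: free_carrier)
  have hc: "h x \<in> carrier N" if "x \<in> S" for x using S h that by auto
  have "linear_ext N h (r \<odot>\<^bsub>free_module R X\<^esub> u) = (\<Oplus>\<^bsub>N\<^esub>x\<in>S. (r \<otimes> u x) \<odot>\<^bsub>N\<^esub> h x)"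
    using u r S Z.smult_closed[OF r u]
    by (subst linear_ext_superset[OF N h, of _ S]) (auto simp: S_def free_simps)
  also have "\<dots> = (\<Oplus>\<^bsub>N\<^esub>x\<in>S. r \<odot>\<^bsub>N\<^esub> (u x \<odot>\<^bsub>N\<^esub> h x))"
    by (rule N.M.finsum_cong') (auto simp: uc hc r N.smult_assoc1)
  also have "\<dots> = r \<odot>\<^bsub>N\<^esub> linear_ext N h u"
    unfolding linear_ext_def S_def[symmetric]
    by (rule N.finsum_smult_ldistr[symmetric]) (auto simp: r S uc hc)
  finally show "linear_ext N h (r \<odot>\<^bsub>free_module R X\<^esub> u) = r \<odot>\<^bsub>N\<^esub> linear_ext N h u" .
qed

lemma linear_ext_basis:
  assumes N: "Module.module R N" and h: "h \<in> X \<rightarrow> carrier N" and "x \<in> X"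
  shows "linear_ext N h (basis_vec R x) = h x"
proof -
  interpret N: Module.module R N by fact
  have "h x \<in> carrier N" using h \<open>x \<in> X\<close> by auto
  have "linear_ext N h (basis_vec R x) = (\<Oplus>\<^bsub>N\<^esub>y\<in>{x}. basis_vec R x y \<odot>\<^bsub>N\<^esub> h y)"
    using assms by (intro linear_ext_superset[OF N h basis_vec_closed]) (auto simp: basis_vec_def)
  thus ?thesis using \<open>h x \<in> carrier N\<close> by (simp add: basis_vec_def Pi_iff)
qed

lemma free_map_superset:
  assumes "u \<in> carrier (free_module R X)" "finite S" "{x. u x \<noteq> \<zero>} \<subseteq> S"
  shows "free_map R h u y = (\<Oplus>x\<in>S. if h x = y then u x else \<zero>)"
  unfolding free_map_def
  by (rule add.finprod_mono_neutral_cong_left) (use assms in \<open>auto simp: free_carrier\<close>)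

lemma free_map_hom:
  assumes h: "h \<in> X \<rightarrow> Y"
  shows "free_map R h \<in> mod_hom R (free_module R X) (free_module R Y)"
proof (rule mod_homI)
  interpret Z: Module.module R "free_module R X" by (rule free_module_module)
  fix u assume u: "u \<in> carrier (free_module R X)"
  note uc = u[unfolded free_carrier]
  have nz: "\<exists>x. u x \<noteq> \<zero> \<and> h x = y" if "free_map R h u y \<noteq> \<zero>" for y
  proof (rule ccontr)
    assume "\<not> ?thesis"
    hence *: "{x. u x \<noteq> \<zero> \<and> h x = y} = {}" by blast
    show False using that unfolding free_map_def * by simp
  qed
  show "free_map R h u \<in> carrier (free_module R Y)"
    unfolding free_carrier
  proof (intro conjI allI impI)
    show "free_map R h u y \<in> carrier R" for y
      unfolding free_map_def using uc by (intro finsum_closed) auto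
    show "free_map R h u y = \<zero>" if "y \<notin> Y" for y using nz[of y] uc h that by blast
    have "finite (h ` {x. u x \<noteq> \<zero>})" using uc by auto
    thus "finite {x. free_map R h u x \<noteq> \<zero>}" by (rule rev_finite_subset) (use nz in blast)
  qed
  {
    fix v assume v: "v \<in> carrier (free_module R X)"
    note vc = v[unfolded free_carrier]
    define S where "S = {x. u x \<noteq> \<zero>} \<union> {x. v x \<noteq> \<zero>}"
    have S: "finite S" "{x. u x \<noteq> \<zero>} \<subseteq> S" "{x. v x \<noteq> \<zero>} \<subseteq> S" "{x. u x \<oplus> v x \<noteq> \<zero>} \<subseteq> S"
      using uc vc by (auto simp: S_def)
    show "free_map R h (u \<oplus>\<^bsub>free_module R X\<^esub> v) = free_map R h u \<oplus>\<^bsub>free_module R Y\<^esub> free_map R h v"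
    proof
      fix y
      have "free_map R h (u \<oplus>\<^bsub>free_module R X\<^esub> v) y
          = (\<Oplus>x\<in>S. if h x = y then u x \<oplus> v x else \<zero>)"
        unfolding free_simps using S Z.M.a_closed[OF u v, unfolded free_simps]
        by (intro free_map_superset) auto
      also have "\<dots> = (\<Oplus>x\<in>S. (if h x = y then u x else \<zero>) \<oplus> (if h x = y then v x else \<zero>))"
        using uc vc by (intro finsum_cong') auto
      also have "\<dots> = free_map R h u y \<oplus> free_map R h v y"
        using uc vc S u v by (subst finsum_addf) (auto simp: free_map_superset[of _ X S])
      finally show "free_map R h (u \<oplus>\<^bsub>free_module R X\<^esub> v) y
          = (free_map R h u \<oplus>\<^bsub>free_module R Y\<^esub> free_map R h v) y" by (simp add: free_simps)
    qed
  }
  fix r assume r: "r \<in> carrier R"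
  define S where "S = {x. u x \<noteq> \<zero>}"
  have S: "finite S" "{x. u x \<noteq> \<zero>} \<subseteq> S" "{x. r \<otimes> u x \<noteq> \<zero>} \<subseteq> S" using uc r by (auto simp: S_def)
  show "free_map R h (r \<odot>\<^bsub>free_module R X\<^esub> u) = r \<odot>\<^bsub>free_module R Y\<^esub> free_map R h u"
  proof
    fix y
    have "free_map R h (r \<odot>\<^bsub>free_module R X\<^esub> u) y = (\<Oplus>x\<in>S. if h x = y then r \<otimes> u x else \<zero>)"
      unfolding free_simps using S Z.smult_closed[OF r u, unfolded free_simps]
      by (intro free_map_superset) auto
    also have "\<dots> = (\<Oplus>x\<in>S. r \<otimes> (if h x = y then u x else \<zero>))"
      using uc r by (intro finsum_cong') auto
    also have "\<dots> = r \<otimes> free_map R h u y"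
      using uc r S u by (subst finsum_rdistr[symmetric]) (auto simp: free_map_superset[of _ X S])
    finally show "free_map R h (r \<odot>\<^bsub>free_module R X\<^esub> u) y
        = (r \<odot>\<^bsub>free_module R Y\<^esub> free_map R h u) y" by (simp add: free_simps)
  qed
qed

lemma free_map_basis: "free_map R h (basis_vec R x) = basis_vec R (h x)"
proof
  fix y
  have "free_map R h (basis_vec R x) y = (\<Oplus>z\<in>{x}. if h z = y then basis_vec R x z else \<zero>)"
    by (rule free_map_superset[OF basis_vec_closed[of _ UNIV]]) (auto simp: basis_vec_def)
  also have "\<dots> = basis_vec R (h x) y" by (auto simp: basis_vec_def)
  finally show "free_map R h (basis_vec R x) y = basis_vec R (h x) y" .
qed

end

lemma generated_submodule_submodule:
  assumes M: "Module.module R M" and X: "X \<subseteq> carrier M"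
  shows "submodule (generated_submodule R M X) R M"
proof -
  interpret M: Module.module R M by fact
  have 1: "submodule (carrier M) R M" by (rule M.carrier_is_submodule)
  show ?thesis unfolding generated_submodule_def
  proof (intro M.submoduleI)
    show "\<Inter> {H. submodule H R M \<and> X \<subseteq> H} \<subseteq> carrier M" using 1 X by blast
    show "\<zero>\<^bsub>M\<^esub> \<in> \<Inter> {H. submodule H R M \<and> X \<subseteq> H}"
      using submodule_zero by blast
  qed (simp_all add: M.submoduleE)
qed

lemma generated_submodule_incl: "X \<subseteq> generated_submodule R M X"
  by (auto simp: generated_submodule_def)

lemma generated_submodule_least: "\<lbrakk>submodule H R M; X \<subseteq> H\<rbrakk> \<Longrightarrow> generated_submodule R M X \<subseteq> H"
  by (auto simp: generated_submodule_def)

lemma submodule_preimage: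
  assumes f: "f \<in> mod_hom R M N" and M: "Module.module R M" and N: "Module.module R N"
    and K: "submodule K R N"
  shows "submodule {x \<in> carrier M. f x \<in> K} R M"
proof -
  interpret M: Module.module R M by fact
  interpret N: Module.module R N by fact
  note E = N.submoduleE[OF K]
  show ?thesis
    by (intro M.submoduleI)
       (auto simp: mod_homD[OF f] mod_hom_zero[OF f M N] mod_hom_minus[OF f M N] submodule_zero[OF K] E)
qed

text \<open>The generator named \<open>x\<close> of a presented module. Tensors and wedges are such generators, and linear
maps out of presented modules are given by their values on them.\<close>

definition pclass :: "('r, 'q) ring_scheme \<Rightarrow> 'a set \<Rightarrow> ('a \<Rightarrow> 'r) set \<Rightarrow> 'a \<Rightarrow> ('a \<Rightarrow> 'r) set" where
  "pclass R X Rel x =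
     generated_submodule R (free_module R X) Rel +>\<^bsub>free_module R X\<^esub> basis_vec R x"

locale presentation = cring R for R :: "('r, 'q) ring_scheme" (structure) +
  fixes X :: "'a set" and Rel :: "('a \<Rightarrow> 'r) set"
  assumes Rel: "Rel \<subseteq> carrier (free_module R X)"
begin

abbreviation "Free \<equiv> free_module R X"
abbreviation "Gen \<equiv> generated_submodule R Free Rel"

lemma Gen_submodule: "submodule Gen R Free"
  by (intro generated_submodule_submodule free_module_module Rel)

lemma presented_module: "Module.module R (presented R X Rel)"
  unfolding presented_def by (intro quotient_module_module free_module_module Gen_submodule)

lemma proj_hom: "(\<lambda>u. Gen +>\<^bsub>Free\<^esub> u) \<in> mod_hom R Free (presented R X Rel)"
  unfolding presented_def by (intro quotient_proj_hom free_module_module Gen_submodule)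

lemma presented_carrier: "carrier (presented R X Rel) = (\<lambda>u. Gen +>\<^bsub>Free\<^esub> u) ` carrier Free"
  unfolding presented_def by (rule quotient_carrier[OF free_module_module Gen_submodule])

lemma pclass_closed [simp]: "x \<in> X \<Longrightarrow> pclass R X Rel x \<in> carrier (presented R X Rel)"
  unfolding pclass_def by (rule mod_hom_closed[OF proj_hom basis_vec_closed])

lemma proj_rel:
  assumes "u \<in> Rel" shows "Gen +>\<^bsub>Free\<^esub> u = \<zero>\<^bsub>presented R X Rel\<^esub>"
proof -
  interpret H: abelian_subgroup Gen Free
    by (rule submodule_abelian_subgroup[OF free_module_module Gen_submodule])
  have "u \<in> Gen" using generated_submodule_incl assms by (rule subsetD)
  thus ?thesis by (simp add: presented_def quotient_module_def H.a_rcos_const[of u])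
qed

lemma presented_induct:
  assumes H: "submodule H R (presented R X Rel)" and gens: "\<And>x. x \<in> X \<Longrightarrow> pclass R X Rel x \<in> H"
    and v: "v \<in> carrier (presented R X Rel)"
  shows "v \<in> H"
proof -
  obtain u where u: "u \<in> carrier Free" "v = Gen +>\<^bsub>Free\<^esub> u" using v unfolding presented_carrier by (rule imageE)
  have "u \<in> {u \<in> carrier Free. Gen +>\<^bsub>Free\<^esub> u \<in> H}"
  proof (rule free_module_span[OF _ _ u(1)])
    show "submodule {u \<in> carrier Free. Gen +>\<^bsub>Free\<^esub> u \<in> H} R Free"
      by (rule submodule_preimage[OF proj_hom free_module_module presented_module H])
    show "basis_vec R x \<in> {u \<in> carrier Free. Gen +>\<^bsub>Free\<^esub> u \<in> H}" if "x \<in> X" for x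
      using gens[OF that] that unfolding pclass_def by simp
  qed
  thus ?thesis using u by simp
qed

text \<open>The universal property of a presentation: the kernel of the linear extension of \<open>h\<close> contains the
relations, hence the submodule they generate, so the extension is constant on cosets.\<close>

lemma presented_lift:
  assumes N: "Module.module R N" and h: "h \<in> X \<rightarrow> carrier N"
    and rel: "\<And>u. u \<in> Rel \<Longrightarrow> linear_ext N h u = \<zero>\<^bsub>N\<^esub>"
  shows "\<exists>f \<in> mod_hom R (presented R X Rel) N. \<forall>x\<in>X. f (pclass R X Rel x) = h x"
proof -
  interpret N: Module.module R N by fact
  interpret Z: Module.module R Free by (rule free_module_module)
  interpret H: abelian_subgroup Gen Free
    by (rule submodule_abelian_subgroup[OF free_module_module Gen_submodule])
  interpret P: Module.module R "presented R X Rel" by (rule presented_module)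
  note L = linear_ext_hom[OF N h]
  have "Gen \<subseteq> {u \<in> carrier Free. linear_ext N h u = \<zero>\<^bsub>N\<^esub>}"
    using Rel rel by (intro generated_submodule_least mod_hom_kernel_submodule[OF L] free_module_module N) auto
  hence ker: "linear_ext N h u = \<zero>\<^bsub>N\<^esub>" if "u \<in> Gen" for u using that by auto
  define f where "f A = the_elem (linear_ext N h ` A)" for A
  have f: "f (Gen +>\<^bsub>Free\<^esub> u) = linear_ext N h u" if u: "u \<in> carrier Free" for u
  proof -
    have "linear_ext N h a = linear_ext N h u" if a: "a \<in> Gen +>\<^bsub>Free\<^esub> u" for a
    proof -
      obtain g where g: "g \<in> Gen" "a = g \<oplus>\<^bsub>Free\<^esub> u" using a by (auto simp: a_r_coset_def')
      thus ?thesis using ker mod_hom_add[OF L] H.a_Hcarr u mod_hom_closed[OF L u] by simp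
    qed
    moreover have "u \<in> Gen +>\<^bsub>Free\<^esub> u" using H.a_rcos_self u by auto
    ultimately have "linear_ext N h ` (Gen +>\<^bsub>Free\<^esub> u) = {linear_ext N h u}" by blast
    thus ?thesis by (simp add: f_def)
  qed
  have "f \<in> mod_hom R (presented R X Rel) N"
  proof (rule mod_homI, unfold presented_carrier, goal_cases)
    case (1 x)
    thus ?case using f mod_hom_closed[OF L] by auto
  next
    case (2 x y)
    then obtain u v where u: "u \<in> carrier Free" "x = Gen +>\<^bsub>Free\<^esub> u"
      and v: "v \<in> carrier Free" "y = Gen +>\<^bsub>Free\<^esub> v" by blast
    have "x \<oplus>\<^bsub>presented R X Rel\<^esub> y = Gen +>\<^bsub>Free\<^esub> (u \<oplus>\<^bsub>Free\<^esub> v)"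
      unfolding u(2) v(2) using mod_hom_add[OF proj_hom u(1) v(1)] by (rule sym)
    thus ?case using f[OF Z.M.a_closed[OF u(1) v(1)]] f[OF u(1)] f[OF v(1)] u(2) v(2)
        mod_hom_add[OF L u(1) v(1)] by simp
  next
    case (3 r x)
    then obtain u where u: "u \<in> carrier Free" "x = Gen +>\<^bsub>Free\<^esub> u" by blast
    have "r \<odot>\<^bsub>presented R X Rel\<^esub> x = Gen +>\<^bsub>Free\<^esub> (r \<odot>\<^bsub>Free\<^esub> u)"
      unfolding u(2) using mod_hom_smult[OF proj_hom 3(1) u(1)] by (rule sym)
    thus ?case using f[OF Z.smult_closed[OF 3(1) u(1)]] f[OF u(1)] u(2)
        mod_hom_smult[OF L 3(1) u(1)] by simp
  qed
  thus ?thesis by (rule bexI[rotated]) (simp add: pclass_def f linear_ext_basis[OF N h])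
qed

end

lemma presented_map_props:
  assumes "presentation R X Rel" "presentation R Y Rel'"
    and h: "h \<in> X \<rightarrow> Y"
    and rel: "\<And>u. u \<in> Rel \<Longrightarrow> free_map R h u \<in> Rel'"
  shows presented_map_hom:
      "presented_map R Y Rel' h \<in> mod_hom R (presented R X Rel) (presented R Y Rel')"
    and presented_map_pclass:
      "x \<in> X \<Longrightarrow> presented_map R Y Rel' h (pclass R X Rel x) = pclass R Y Rel' (h x)"
proof -
  interpret P: presentation R X Rel by fact
  interpret Q: presentation R Y Rel' by fact
  note L = P.free_map_hom[OF h]
  have "P.Gen \<subseteq> {u \<in> carrier P.Free. free_map R h u \<in> Q.Gen}"
  proof (rule generated_submodule_least[OF submodule_preimage[OF L P.free_module_module
          P.free_module_module Q.Gen_submodule]], rule subsetI, rule CollectI, rule conjI)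
    fix u assume u: "u \<in> Rel"
    show "u \<in> carrier P.Free" using P.Rel u by (rule subsetD)
    show "free_map R h u \<in> Q.Gen" using generated_submodule_incl rel[OF u] by (rule subsetD)
  qed
  hence sub: "free_map R h ` P.Gen \<subseteq> Q.Gen" by blast
  show "presented_map R Y Rel' h \<in> mod_hom R (presented R X Rel) (presented R Y Rel')"
    unfolding presented_map_def presented_def
    by (intro coset_map_hom[OF L] P.free_module_module P.Gen_submodule Q.Gen_submodule sub)
  show "presented_map R Y Rel' h (pclass R X Rel x) = pclass R Y Rel' (h x)" if "x \<in> X"
    unfolding presented_map_def pclass_def
    using coset_map_coset[OF L P.free_module_module P.free_module_module P.Gen_submodule
        Q.Gen_submodule sub P.basis_vec_closed[OF that]]
    by (simp add: P.free_map_basis)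
qed

section \<open>Tensor products\<close>

lemma minus_zero_iff:
  assumes "abelian_group G" "a \<in> carrier G" "b \<in> carrier G"
  shows "a \<ominus>\<^bsub>G\<^esub> b = \<zero>\<^bsub>G\<^esub> \<longleftrightarrow> a = b"
proof -
  interpret abelian_group G by fact
  show ?thesis using assms(2,3) unfolding a_minus_def
    by (metis a_inv_closed minus_equality minus_minus r_neg)
qed

lemma mod_hom_diff:
  assumes f: "f \<in> mod_hom R M N" "Module.module R M" "Module.module R N" "a \<in> carrier M" "b \<in> carrier M"
  shows "f (a \<ominus>\<^bsub>M\<^esub> b) = f a \<ominus>\<^bsub>N\<^esub> f b"
proof -
  interpret M: Module.module R M by fact
  show ?thesis using assms mod_hom_minus[OF f(1-3)] by (simp add: a_minus_def mod_homD[OF f(1)])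
qed

context cring
begin

text \<open>The relations that define tensor products and exterior powers all express additivity or homogeneity
in one variable. The lemmas here translate both kinds of relation once and for all.\<close>

lemma hom_sum_relation:
  assumes f: "f \<in> mod_hom R (free_module R X) N" and N: "Module.module R N" and "a \<in> X" "b \<in> X" "c \<in> X"
  shows "f (basis_vec R a \<ominus>\<^bsub>free_module R X\<^esub> (basis_vec R b \<oplus>\<^bsub>free_module R X\<^esub> basis_vec R c)) = \<zero>\<^bsub>N\<^esub>
    \<longleftrightarrow> f (basis_vec R a) = f (basis_vec R b) \<oplus>\<^bsub>N\<^esub> f (basis_vec R c)"
proof -
  interpret N: Module.module R N by fact
  interpret Z: Module.module R "free_module R X" by (rule free_module_module)
  show ?thesis using assms
    by (simp add: mod_hom_diff[OF f Z.module_axioms N] mod_homD[OF f] minus_zero_iff[OF N.M.abelian_group_axioms])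
qed

lemma hom_smult_relation:
  assumes f: "f \<in> mod_hom R (free_module R X) N" and N: "Module.module R N"
    and "a \<in> X" "b \<in> X" "r \<in> carrier R"
  shows "f (basis_vec R a \<ominus>\<^bsub>free_module R X\<^esub> r \<odot>\<^bsub>free_module R X\<^esub> basis_vec R b) = \<zero>\<^bsub>N\<^esub>
    \<longleftrightarrow> f (basis_vec R a) = r \<odot>\<^bsub>N\<^esub> f (basis_vec R b)"
proof -
  interpret N: Module.module R N by fact
  interpret Z: Module.module R "free_module R X" by (rule free_module_module)
  show ?thesis using assms
    by (simp add: mod_hom_diff[OF f Z.module_axioms N] mod_homD[OF f] minus_zero_iff[OF N.M.abelian_group_axioms])
qed

lemma free_map_sum_relation:
  assumes "h \<in> X \<rightarrow> Y" "a \<in> X" "b \<in> X" "c \<in> X"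
  shows "free_map R h (basis_vec R a \<ominus>\<^bsub>free_module R X\<^esub> (basis_vec R b \<oplus>\<^bsub>free_module R X\<^esub> basis_vec R c)) =
    basis_vec R (h a) \<ominus>\<^bsub>free_module R Y\<^esub> (basis_vec R (h b) \<oplus>\<^bsub>free_module R Y\<^esub> basis_vec R (h c))"
proof -
  interpret Z: Module.module R "free_module R X" by (rule free_module_module)
  note L = free_map_hom[OF assms(1)]
  show ?thesis using assms(2-)
    by (simp add: mod_hom_diff[OF L free_module_module free_module_module] mod_homD[OF L] free_map_basis)
qed

lemma free_map_smult_relation:
  assumes "h \<in> X \<rightarrow> Y" "a \<in> X" "b \<in> X" "r \<in> carrier R"
  shows "free_map R h (basis_vec R a \<ominus>\<^bsub>free_module R X\<^esub> r \<odot>\<^bsub>free_module R X\<^esub> basis_vec R b) =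
    basis_vec R (h a) \<ominus>\<^bsub>free_module R Y\<^esub> r \<odot>\<^bsub>free_module R Y\<^esub> basis_vec R (h b)"
proof -
  interpret Z: Module.module R "free_module R X" by (rule free_module_module)
  note L = free_map_hom[OF assms(1)]
  show ?thesis using assms(2-)
    by (simp add: mod_hom_diff[OF L free_module_module free_module_module] mod_homD[OF L] free_map_basis)
qed

end

context presentation
begin

lemma pclass_sum:
  assumes "a \<in> X" "b \<in> X" "c \<in> X" "basis_vec R a \<ominus>\<^bsub>Free\<^esub> (basis_vec R b \<oplus>\<^bsub>Free\<^esub> basis_vec R c) \<in> Rel"
  shows "pclass R X Rel a = pclass R X Rel b \<oplus>\<^bsub>presented R X Rel\<^esub> pclass R X Rel c"
  using hom_sum_relation[OF proj_hom presented_module assms(1-3)] proj_rel[OF assms(4)]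
  unfolding pclass_def by blast

lemma pclass_smult:
  assumes "a \<in> X" "b \<in> X" "r \<in> carrier R" "basis_vec R a \<ominus>\<^bsub>Free\<^esub> r \<odot>\<^bsub>Free\<^esub> basis_vec R b \<in> Rel"
  shows "pclass R X Rel a = r \<odot>\<^bsub>presented R X Rel\<^esub> pclass R X Rel b"
  using hom_smult_relation[OF proj_hom presented_module assms(1-3)] proj_rel[OF assms(4)]
  unfolding pclass_def by blast

lemma pclass_zero:
  assumes "basis_vec R a \<in> Rel"
  shows "pclass R X Rel a = \<zero>\<^bsub>presented R X Rel\<^esub>"
  using proj_rel[OF assms] unfolding pclass_def .

end

definition pure_tensor ::
    "('r, 'q) ring_scheme \<Rightarrow> ('r, 'm) module \<Rightarrow> ('r, 'n) module \<Rightarrow> 'm \<Rightarrow> 'n \<Rightarrow> ('m \<times> 'n \<Rightarrow> 'r) set" where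
  "pure_tensor R M N x y = pclass R (carrier M \<times> carrier N) (bilinear_rels R M N) (x, y)"

lemma bilinear_relsI:
  fixes R (structure)
  defines "Z M N \<equiv> free_module R (carrier M \<times> carrier N)"
  shows "\<lbrakk>x \<in> carrier M; x' \<in> carrier M; y \<in> carrier N\<rbrakk> \<Longrightarrow>
     basis_vec R (x \<oplus>\<^bsub>M\<^esub> x', y) \<ominus>\<^bsub>Z M N\<^esub> (basis_vec R (x, y) \<oplus>\<^bsub>Z M N\<^esub> basis_vec R (x', y)) \<in> bilinear_rels R M N"
    "\<lbrakk>x \<in> carrier M; y \<in> carrier N; y' \<in> carrier N\<rbrakk> \<Longrightarrow>
     basis_vec R (x, y \<oplus>\<^bsub>N\<^esub> y') \<ominus>\<^bsub>Z M N\<^esub> (basis_vec R (x, y) \<oplus>\<^bsub>Z M N\<^esub> basis_vec R (x, y')) \<in> bilinear_rels R M N"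
    "\<lbrakk>r \<in> carrier R; x \<in> carrier M; y \<in> carrier N\<rbrakk> \<Longrightarrow>
     basis_vec R (r \<odot>\<^bsub>M\<^esub> x, y) \<ominus>\<^bsub>Z M N\<^esub> r \<odot>\<^bsub>Z M N\<^esub> basis_vec R (x, y) \<in> bilinear_rels R M N"
    "\<lbrakk>r \<in> carrier R; x \<in> carrier M; y \<in> carrier N\<rbrakk> \<Longrightarrow>
     basis_vec R (x, r \<odot>\<^bsub>N\<^esub> y) \<ominus>\<^bsub>Z M N\<^esub> r \<odot>\<^bsub>Z M N\<^esub> basis_vec R (x, y) \<in> bilinear_rels R M N"
  unfolding bilinear_rels_def Let_def Z_def by blast+

lemma bilinear_relsE:
  fixes R (structure)
  assumes "u \<in> bilinear_rels R M N"
  defines "Z \<equiv> free_module R (carrier M \<times> carrier N)"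
  obtains
    (add_left) x x' y where "x \<in> carrier M" "x' \<in> carrier M" "y \<in> carrier N"
      "u = basis_vec R (x \<oplus>\<^bsub>M\<^esub> x', y) \<ominus>\<^bsub>Z\<^esub> (basis_vec R (x, y) \<oplus>\<^bsub>Z\<^esub> basis_vec R (x', y))"
  | (add_right) x y y' where "x \<in> carrier M" "y \<in> carrier N" "y' \<in> carrier N"
      "u = basis_vec R (x, y \<oplus>\<^bsub>N\<^esub> y') \<ominus>\<^bsub>Z\<^esub> (basis_vec R (x, y) \<oplus>\<^bsub>Z\<^esub> basis_vec R (x, y'))"
  | (smult_left) r x y where "r \<in> carrier R" "x \<in> carrier M" "y \<in> carrier N"
      "u = basis_vec R (r \<odot>\<^bsub>M\<^esub> x, y) \<ominus>\<^bsub>Z\<^esub> r \<odot>\<^bsub>Z\<^esub> basis_vec R (x, y)"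
  | (smult_right) r x y where "r \<in> carrier R" "x \<in> carrier M" "y \<in> carrier N"
      "u = basis_vec R (x, r \<odot>\<^bsub>N\<^esub> y) \<ominus>\<^bsub>Z\<^esub> r \<odot>\<^bsub>Z\<^esub> basis_vec R (x, y)"
  using assms(1) unfolding bilinear_rels_def Let_def Z_def[symmetric] Un_iff mem_Collect_eq
  by (elim disjE exE conjE) blast+

locale module_pair = M: Module.module R M + N: Module.module R N
  for R :: "('r, 'q) ring_scheme" (structure) and M :: "('r, 'm) module" and N :: "('r, 'n) module"
begin

abbreviation "X \<equiv> carrier M \<times> carrier N"

sublocale P: presentation R X "bilinear_rels R M N"
proof
  interpret Z: Module.module R "free_module R X" by (rule M.free_module_module)
  show "bilinear_rels R M N \<subseteq> carrier (free_module R X)"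
  proof
    fix u assume "u \<in> bilinear_rels R M N"
    thus "u \<in> carrier (free_module R X)" by (cases rule: bilinear_relsE) simp_all
  qed
qed

lemma tensor_module: "Module.module R (tensor R M N)"
  unfolding tensor_def by (rule P.presented_module)

lemma pure_tensor_closed [simp]:
  "\<lbrakk>x \<in> carrier M; y \<in> carrier N\<rbrakk> \<Longrightarrow> pure_tensor R M N x y \<in> carrier (tensor R M N)"
  unfolding tensor_def pure_tensor_def by simp

lemma pure_tensor_add_left:
  "\<lbrakk>x \<in> carrier M; x' \<in> carrier M; y \<in> carrier N\<rbrakk> \<Longrightarrow> pure_tensor R M N (x \<oplus>\<^bsub>M\<^esub> x') y =
    pure_tensor R M N x y \<oplus>\<^bsub>tensor R M N\<^esub> pure_tensor R M N x' y"
  unfolding tensor_def pure_tensor_def by (rule P.pclass_sum) (auto intro: bilinear_relsI)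

lemma pure_tensor_add_right:
  "\<lbrakk>x \<in> carrier M; y \<in> carrier N; y' \<in> carrier N\<rbrakk> \<Longrightarrow> pure_tensor R M N x (y \<oplus>\<^bsub>N\<^esub> y') =
    pure_tensor R M N x y \<oplus>\<^bsub>tensor R M N\<^esub> pure_tensor R M N x y'"
  unfolding tensor_def pure_tensor_def by (rule P.pclass_sum) (auto intro: bilinear_relsI)

lemma pure_tensor_smult_left:
  "\<lbrakk>r \<in> carrier R; x \<in> carrier M; y \<in> carrier N\<rbrakk> \<Longrightarrow> pure_tensor R M N (r \<odot>\<^bsub>M\<^esub> x) y =
    r \<odot>\<^bsub>tensor R M N\<^esub> pure_tensor R M N x y"
  unfolding tensor_def pure_tensor_def by (rule P.pclass_smult) (auto intro: bilinear_relsI)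

lemma pure_tensor_smult_right:
  "\<lbrakk>r \<in> carrier R; x \<in> carrier M; y \<in> carrier N\<rbrakk> \<Longrightarrow> pure_tensor R M N x (r \<odot>\<^bsub>N\<^esub> y) =
    r \<odot>\<^bsub>tensor R M N\<^esub> pure_tensor R M N x y"
  unfolding tensor_def pure_tensor_def by (rule P.pclass_smult) (auto intro: bilinear_relsI)

lemma pure_tensor_hom_left:
  "y \<in> carrier N \<Longrightarrow> (\<lambda>x. pure_tensor R M N x y) \<in> mod_hom R M (tensor R M N)"
  by (rule mod_homI) (simp_all add: pure_tensor_add_left pure_tensor_smult_left)

lemma pure_tensor_hom_right:
  "x \<in> carrier M \<Longrightarrow> pure_tensor R M N x \<in> mod_hom R N (tensor R M N)"
  by (rule mod_homI) (simp_all add: pure_tensor_add_right pure_tensor_smult_right)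

lemma tensor_induct:
  assumes "submodule H R (tensor R M N)" "v \<in> carrier (tensor R M N)"
    and "\<And>x y. \<lbrakk>x \<in> carrier M; y \<in> carrier N\<rbrakk> \<Longrightarrow> pure_tensor R M N x y \<in> H"
  shows "v \<in> H"
  by (rule P.presented_induct[OF assms(1)[unfolded tensor_def] _ assms(2)[unfolded tensor_def]])
     (use assms(3) in \<open>auto simp: pure_tensor_def\<close>)

text \<open>A bilinear map kills each of the four kinds of relations, so it factors through the presentation.\<close>

lemma tensor_lift:
  assumes Q: "Module.module R Q"
    and left: "\<And>y. y \<in> carrier N \<Longrightarrow> (\<lambda>x. h x y) \<in> mod_hom R M Q"
    and right: "\<And>x. x \<in> carrier M \<Longrightarrow> h x \<in> mod_hom R N Q"
  shows "\<exists>f \<in> mod_hom R (tensor R M N) Q. \<forall>x\<in>carrier M. \<forall>y\<in>carrier N. f (pure_tensor R M N x y) = h x y"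
proof -
  have h: "case_prod h \<in> X \<rightarrow> carrier Q" using mod_hom_closed[OF right] by auto
  note L = M.linear_ext_hom[OF Q h]
  have b: "M.linear_ext Q (case_prod h) (basis_vec R (x, y)) = h x y" if "x \<in> carrier M" "y \<in> carrier N" for x y
    using M.linear_ext_basis[OF Q h, of "(x, y)"] that by simp
  have "M.linear_ext Q (case_prod h) u = \<zero>\<^bsub>Q\<^esub>" if "u \<in> bilinear_rels R M N" for u
    using that
  proof (cases rule: bilinear_relsE)
    case add_left
    thus ?thesis by (simp add: M.hom_sum_relation[OF L Q] b mod_hom_add[OF left])
  next
    case add_right
    thus ?thesis by (simp add: M.hom_sum_relation[OF L Q] b mod_hom_add[OF right])
  next
    case smult_left
    thus ?thesis by (simp add: M.hom_smult_relation[OF L Q] b mod_hom_smult[OF left])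
  next
    case smult_right
    thus ?thesis by (simp add: M.hom_smult_relation[OF L Q] b mod_hom_smult[OF right])
  qed
  from P.presented_lift[OF Q h this] show ?thesis unfolding tensor_def pure_tensor_def by fastforce
qed

end

lemma tensor_map_props:
  assumes "Module.module R M" "Module.module R N" "Module.module R M'" "Module.module R N'"
    and f: "f \<in> mod_hom R M M'" and g: "g \<in> mod_hom R N N'"
  shows tensor_map_hom: "tensor_map R M' N' f g \<in> mod_hom R (tensor R M N) (tensor R M' N')"
    and tensor_map_pure: "\<lbrakk>x \<in> carrier M; y \<in> carrier N\<rbrakk> \<Longrightarrow>
      tensor_map R M' N' f g (pure_tensor R M N x y) = pure_tensor R M' N' (f x) (g y)"
proof -
  interpret P: module_pair R M N using assms by (simp add: module_pair_def)
  interpret Q: module_pair R M' N' using assms by (simp add: module_pair_def)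
  have h: "map_prod f g \<in> P.X \<rightarrow> Q.X" using mod_hom_closed[OF f] mod_hom_closed[OF g] by auto
  note fg = mod_homD[OF f] mod_homD[OF g]
  have rel: "free_map R (map_prod f g) u \<in> bilinear_rels R M' N'" if "u \<in> bilinear_rels R M N" for u
    using that
  proof (cases rule: bilinear_relsE)
    case add_left
    thus ?thesis by (simp add: P.M.free_map_sum_relation[OF h] fg bilinear_relsI)
  next
    case add_right
    thus ?thesis by (simp add: P.M.free_map_sum_relation[OF h] fg bilinear_relsI)
  next
    case smult_left
    thus ?thesis by (simp add: P.M.free_map_smult_relation[OF h] fg bilinear_relsI)
  next
    case smult_right
    thus ?thesis by (simp add: P.M.free_map_smult_relation[OF h] fg bilinear_relsI)
  qed
  note props = presented_map_props[OF P.P.presentation_axioms Q.P.presentation_axioms h rel]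
  show "tensor_map R M' N' f g \<in> mod_hom R (tensor R M N) (tensor R M' N')"
    unfolding tensor_map_def tensor_def by (rule props(1))
  show "tensor_map R M' N' f g (pure_tensor R M N x y) = pure_tensor R M' N' (f x) (g y)"
    if "x \<in> carrier M" "y \<in> carrier N"
    unfolding tensor_map_def pure_tensor_def using props(2)[of "(x, y)"] that by simp
qed

section \<open>Exterior powers\<close>

definition wedge :: "('r, 'q) ring_scheme \<Rightarrow> nat \<Rightarrow> ('r, 'm) module \<Rightarrow> 'm list \<Rightarrow> ('m list \<Rightarrow> 'r) set" where
  "wedge R n M vs = pclass R (vec_lists n M) (alternating_rels R n M) vs"

lemma vec_lists_update:
  "\<lbrakk>vs \<in> vec_lists n M; x \<in> carrier M\<rbrakk> \<Longrightarrow> vs[i := x] \<in> vec_lists n M"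
  unfolding vec_lists_def using set_update_subset_insert[of vs i x] by auto

lemma alternating_relsI:
  fixes R (structure)
  defines "Z n M \<equiv> free_module R (vec_lists n M)"
  shows "\<lbrakk>vs \<in> vec_lists n M; i < n; x \<in> carrier M; y \<in> carrier M\<rbrakk> \<Longrightarrow>
     basis_vec R (vs[i := x \<oplus>\<^bsub>M\<^esub> y]) \<ominus>\<^bsub>Z n M\<^esub> (basis_vec R (vs[i := x]) \<oplus>\<^bsub>Z n M\<^esub> basis_vec R (vs[i := y]))
       \<in> alternating_rels R n M"
    "\<lbrakk>vs \<in> vec_lists n M; i < n; r \<in> carrier R; x \<in> carrier M\<rbrakk> \<Longrightarrow>
     basis_vec R (vs[i := r \<odot>\<^bsub>M\<^esub> x]) \<ominus>\<^bsub>Z n M\<^esub> r \<odot>\<^bsub>Z n M\<^esub> basis_vec R (vs[i := x]) \<in> alternating_rels R n M"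
    "\<lbrakk>vs \<in> vec_lists n M; i < j; j < n; vs ! i = vs ! j\<rbrakk> \<Longrightarrow> basis_vec R vs \<in> alternating_rels R n M"
  unfolding alternating_rels_def Let_def Z_def by blast+

lemma alternating_relsE:
  fixes R (structure)
  assumes "u \<in> alternating_rels R n M"
  defines "Z \<equiv> free_module R (vec_lists n M)"
  obtains
    (add) vs i x y where "vs \<in> vec_lists n M" "i < n" "x \<in> carrier M" "y \<in> carrier M"
      "u = basis_vec R (vs[i := x \<oplus>\<^bsub>M\<^esub> y]) \<ominus>\<^bsub>Z\<^esub> (basis_vec R (vs[i := x]) \<oplus>\<^bsub>Z\<^esub> basis_vec R (vs[i := y]))"
  | (smult) vs i r x where "vs \<in> vec_lists n M" "i < n" "r \<in> carrier R" "x \<in> carrier M"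
      "u = basis_vec R (vs[i := r \<odot>\<^bsub>M\<^esub> x]) \<ominus>\<^bsub>Z\<^esub> r \<odot>\<^bsub>Z\<^esub> basis_vec R (vs[i := x])"
  | (repeated) vs i j where "vs \<in> vec_lists n M" "i < j" "j < n" "vs ! i = vs ! j" "u = basis_vec R vs"
  using assms(1) unfolding alternating_rels_def Let_def Z_def[symmetric] Un_iff mem_Collect_eq
  by (elim disjE exE conjE) blast+

locale plain_module = Module.module R M
  for R :: "('r, 'q) ring_scheme" (structure) and M :: "('r, 'm) module" (structure)
begin

lemma ext_presentation: "presentation R (vec_lists n M) (alternating_rels R n M)"
proof
  interpret Z: Module.module R "free_module R (vec_lists n M)" by (rule free_module_module)
  show "alternating_rels R n M \<subseteq> carrier (free_module R (vec_lists n M))"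
  proof
    fix u assume "u \<in> alternating_rels R n M"
    thus "u \<in> carrier (free_module R (vec_lists n M))"
      by (cases rule: alternating_relsE) (simp_all add: vec_lists_update)
  qed
qed

lemma ext_power_module: "Module.module R (ext_power R n M)"
  unfolding ext_power_def by (rule presentation.presented_module[OF ext_presentation])

lemma wedge_closed [simp]: "vs \<in> vec_lists n M \<Longrightarrow> wedge R n M vs \<in> carrier (ext_power R n M)"
  unfolding ext_power_def wedge_def by (rule presentation.pclass_closed[OF ext_presentation])

lemma wedge_update_hom:
  assumes "vs \<in> vec_lists n M" "i < n"
  shows "(\<lambda>x. wedge R n M (vs[i := x])) \<in> mod_hom R M (ext_power R n M)"
proof (rule mod_homI)
  show "wedge R n M (vs[i := x \<oplus>\<^bsub>M\<^esub> y]) =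
      wedge R n M (vs[i := x]) \<oplus>\<^bsub>ext_power R n M\<^esub> wedge R n M (vs[i := y])"
    if "x \<in> carrier M" "y \<in> carrier M" for x y
    unfolding ext_power_def wedge_def using assms that
    by (intro presentation.pclass_sum[OF ext_presentation] vec_lists_update alternating_relsI) auto
  show "wedge R n M (vs[i := r \<odot>\<^bsub>M\<^esub> x]) = r \<odot>\<^bsub>ext_power R n M\<^esub> wedge R n M (vs[i := x])"
    if "r \<in> carrier R" "x \<in> carrier M" for r x
    unfolding ext_power_def wedge_def using assms that
    by (intro presentation.pclass_smult[OF ext_presentation] vec_lists_update alternating_relsI) auto
qed (use assms in \<open>simp add: vec_lists_update\<close>)

lemma wedge_slot_hom:
  assumes "zs @ ws \<in> vec_lists n' M" "n = Suc n'"
  shows "(\<lambda>x. wedge R n M (zs @ x # ws)) \<in> mod_hom R M (ext_power R n M)"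
proof -
  have "zs @ \<zero>\<^bsub>M\<^esub> # ws \<in> vec_lists n M" "length zs < n" using assms by (auto simp: vec_lists_def)
  from wedge_update_hom[OF this] show ?thesis by simp
qed

lemma wedge_repeated:
  "\<lbrakk>vs \<in> vec_lists n M; i < j; j < n; vs ! i = vs ! j\<rbrakk> \<Longrightarrow> wedge R n M vs = \<zero>\<^bsub>ext_power R n M\<^esub>"
  unfolding ext_power_def wedge_def
  by (intro presentation.pclass_zero[OF ext_presentation] alternating_relsI)

text \<open>As usual, the wedge with \<open>x + y\<close> in both slots vanishes and is expanded by bilinearity.\<close>

lemma wedge_swap:
  assumes "zs @ x # y # ws \<in> vec_lists n M"
  shows "wedge R n M (zs @ y # x # ws) = \<ominus>\<^bsub>ext_power R n M\<^esub> wedge R n M (zs @ x # y # ws)"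
proof -
  let ?E = "ext_power R n M"
  interpret E: Module.module R ?E by (rule ext_power_module)
  define w where "w a b = wedge R n M (zs @ a # b # ws)" for a b
  have n: "n = Suc (Suc (length zs + length ws))" and xy: "x \<in> carrier M" "y \<in> carrier M"
    using assms by (auto simp: vec_lists_def)
  have l: "zs @ a # b # ws \<in> vec_lists n M" if "a \<in> carrier M" "b \<in> carrier M" for a b
    using assms that by (auto simp: vec_lists_def)
  have c: "w a b \<in> carrier ?E" if "a \<in> carrier M" "b \<in> carrier M" for a b
    unfolding w_def using l[OF that] by simp
  have alt: "w a a = \<zero>\<^bsub>?E\<^esub>" if "a \<in> carrier M" for a
    unfolding w_def using l[OF that that]
    by (rule wedge_repeated[of _ _ "length zs" "Suc (length zs)"]) (auto simp: n nth_append)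
  have h1: "(\<lambda>a. w a b) \<in> mod_hom R M ?E" if "b \<in> carrier M" for b
    unfolding w_def by (rule wedge_slot_hom) (use assms that in \<open>auto simp: vec_lists_def\<close>)
  have h2: "w a \<in> mod_hom R M ?E" if "a \<in> carrier M" for a
    using wedge_slot_hom[of "zs @ [a]" ws _ n] assms that unfolding w_def
    by (auto simp: vec_lists_def)
  have "\<zero>\<^bsub>?E\<^esub> = w (x \<oplus>\<^bsub>M\<^esub> y) (x \<oplus>\<^bsub>M\<^esub> y)" using alt xy by simp
  also have "\<dots> = (w x x \<oplus>\<^bsub>?E\<^esub> w y x) \<oplus>\<^bsub>?E\<^esub> (w x y \<oplus>\<^bsub>?E\<^esub> w y y)"
    using xy by (simp add: mod_hom_add[OF h1] mod_hom_add[OF h2])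
  also have "\<dots> = w y x \<oplus>\<^bsub>?E\<^esub> w x y" using xy by (simp add: alt c E.M.a_comm)
  finally show ?thesis using xy c unfolding w_def[symmetric] by (metis E.M.minus_equality)
qed

lemma ext_induct:
  assumes "submodule H R (ext_power R n M)" "v \<in> carrier (ext_power R n M)"
    and "\<And>vs. vs \<in> vec_lists n M \<Longrightarrow> wedge R n M vs \<in> H"
  shows "v \<in> H"
  by (rule presentation.presented_induct[OF ext_presentation assms(1)[unfolded ext_power_def] _
        assms(2)[unfolded ext_power_def]]) (use assms(3) in \<open>simp add: wedge_def\<close>)

text \<open>An alternating multilinear map kills each of the three kinds of relations, so it factors through the
presentation.\<close>

lemma ext_lift:
  assumes Q: "Module.module R Q"
    and h: "\<And>vs i. \<lbrakk>vs \<in> vec_lists n M; i < n\<rbrakk> \<Longrightarrow> (\<lambda>x. h (vs[i := x])) \<in> mod_hom R M Q"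
    and closed: "\<And>vs. vs \<in> vec_lists n M \<Longrightarrow> h vs \<in> carrier Q"
    and alt: "\<And>vs i j. \<lbrakk>vs \<in> vec_lists n M; i < j; j < n; vs ! i = vs ! j\<rbrakk> \<Longrightarrow> h vs = \<zero>\<^bsub>Q\<^esub>"
  shows "\<exists>f \<in> mod_hom R (ext_power R n M) Q. \<forall>vs\<in>vec_lists n M. f (wedge R n M vs) = h vs"
proof -
  have hc: "h \<in> vec_lists n M \<rightarrow> carrier Q" using closed by auto
  note L = linear_ext_hom[OF Q hc]
  note b = linear_ext_basis[OF Q hc]
  have "linear_ext Q h u = \<zero>\<^bsub>Q\<^esub>" if "u \<in> alternating_rels R n M" for u
    using that
  proof (cases rule: alternating_relsE)
    case (add vs i x y)
    thus ?thesis using mod_hom_add[OF h[OF add(1,2)], of x y]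
      by (simp add: hom_sum_relation[OF L Q] b vec_lists_update)
  next
    case (smult vs i r x)
    thus ?thesis using mod_hom_smult[OF h[OF smult(1,2)], of r x]
      by (simp add: hom_smult_relation[OF L Q] b vec_lists_update)
  next
    case (repeated vs i j)
    thus ?thesis using alt[OF repeated(1-4)] by (simp add: b)
  qed
  from presentation.presented_lift[OF ext_presentation Q hc this] show ?thesis
    by (simp only: ext_power_def wedge_def)
qed

end

text \<open>The prefix \<open>p\<close> allows for two uses: it is empty for the map induced by \<open>L\<close> on exterior powers of equal
degree, and it is the single basis vector of \<open>x\<close> for \<open>\<alpha> \<mapsto> x \<and> \<alpha>\<close>.\<close>

lemma ext_power_map_props:
  assumes "Module.module R M" "Module.module R N"
    and L: "L \<in> mod_hom R M N" and p: "set p \<subseteq> carrier N" and n': "n' = length p + n"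
    and h: "\<And>vs. h vs = p @ map L vs"
  shows ext_power_map_hom: "ext_power_map R n' N h \<in> mod_hom R (ext_power R n M) (ext_power R n' N)"
    and ext_power_map_wedge:
      "vs \<in> vec_lists n M \<Longrightarrow> ext_power_map R n' N h (wedge R n M vs) = wedge R n' N (p @ map L vs)"
proof -
  interpret M: plain_module R M using assms(1) by (simp add: plain_module_def)
  interpret N: plain_module R N using assms(2) by (simp add: plain_module_def)
  have hv: "h vs \<in> vec_lists n' N" if "vs \<in> vec_lists n M" for vs
  proof -
    have "set (map L vs) \<subseteq> carrier N" using that mod_hom_closed[OF L] by (auto simp: vec_lists_def)
    thus ?thesis using that p by (simp add: vec_lists_def h n')
  qed
  hence hc: "h \<in> vec_lists n M \<rightarrow> vec_lists n' N" by (rule Pi_I)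
  have upd: "h (vs[i := x]) = (h vs)[length p + i := L x]" for vs i x
    by (simp add: h list_update_append map_update)
  have rel: "free_map R h u \<in> alternating_rels R n' N" if "u \<in> alternating_rels R n M" for u
    using that
  proof (cases rule: alternating_relsE)
    case (add vs i x y)
    show ?thesis
      using alternating_relsI(1)[OF hv[OF add(1)], of "length p + i" "L x" "L y" R] add
      by (simp add: M.free_map_sum_relation[OF hc] vec_lists_update upd mod_homD[OF L] n')
  next
    case (smult vs i r x)
    show ?thesis
      using alternating_relsI(2)[OF hv[OF smult(1)], of "length p + i" r R "L x"] smult
      by (simp add: M.free_map_smult_relation[OF hc] vec_lists_update upd mod_homD[OF L] n')
  next
    case (repeated vs i j)
    have "h vs ! (length p + i) = h vs ! (length p + j)"
      using repeated by (simp add: h nth_append vec_lists_def)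
    thus ?thesis
      using alternating_relsI(3)[OF hv[OF repeated(1)], of "length p + i" "length p + j" R] repeated
      by (simp add: M.free_map_basis n')
  qed
  note props = presented_map_props[OF M.ext_presentation N.ext_presentation hc rel]
  show "ext_power_map R n' N h \<in> mod_hom R (ext_power R n M) (ext_power R n' N)"
    unfolding ext_power_map_def ext_power_def by (rule props(1))
  show "ext_power_map R n' N h (wedge R n M vs) = wedge R n' N (p @ map L vs)" if "vs \<in> vec_lists n M"
    unfolding ext_power_map_def wedge_def using props(2)[OF _ that] by (simp add: h)
qed

section \<open>Orientations\<close>

text \<open>The ring as a module over itself; linear functionals such as the determinant take values in it.\<close>

definition ring_module :: "('r, 'q) ring_scheme \<Rightarrow> ('r, 'r) module" where
  "ring_module R = \<lparr>carrier = carrier R, monoid.mult = undefined, one = undefined, zero = \<zero>\<^bsub>R\<^esub>,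
     add = (\<lambda>x y. x \<oplus>\<^bsub>R\<^esub> y), smult = (\<lambda>x y. x \<otimes>\<^bsub>R\<^esub> y)\<rparr>"

lemma ring_module_simps [simp]:
  "carrier (ring_module R) = carrier R" "\<zero>\<^bsub>ring_module R\<^esub> = \<zero>\<^bsub>R\<^esub>"
  "x \<oplus>\<^bsub>ring_module R\<^esub> y = x \<oplus>\<^bsub>R\<^esub> y" "x \<odot>\<^bsub>ring_module R\<^esub> y = x \<otimes>\<^bsub>R\<^esub> y"
  by (simp_all add: ring_module_def)

lemma (in cring) ring_module_module: "Module.module R (ring_module R)"
proof (rule moduleI[OF is_cring])
  show "abelian_group (ring_module R)"
    by (rule abelian_groupI) (auto simp: a_ac intro: bexI[of _ "\<ominus> _"] l_neg)
qed (auto simp: l_distr r_distr m_assoc)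

definition perms :: "'a set \<Rightarrow> 'a list set" where
  "perms S = {xs. distinct xs \<and> set xs = S}"

lemma perms_swap: "zs @ x # y # ws \<in> perms S \<Longrightarrow> zs @ y # x # ws \<in> perms S"
  by (auto simp: perms_def)

lemma perms_length: "xs \<in> perms S \<Longrightarrow> length xs = card S"
  by (auto simp: perms_def distinct_card)

lemma finite_perms: "finite S \<Longrightarrow> finite (perms S)"
  using finite_lists_length_eq[of S "card S"]
  by (rule finite_subset[rotated]) (auto simp: perms_def distinct_card)

lemma perms_nonempty: "finite S \<Longrightarrow> \<exists>xs. xs \<in> perms S"
  using finite_distinct_list by (fastforce simp: perms_def)

lemma perms_rev: "rev xs \<in> perms S \<longleftrightarrow> xs \<in> perms S"
  by (auto simp: perms_def)

lemma swap_closed_move: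
  assumes "\<And>zs x y ws. P (zs @ x # y # ws) \<Longrightarrow> P (zs @ y # x # ws)" and "P (zs @ x # as @ bs)"
  shows "P (zs @ as @ x # bs)"
  using assms(2)
proof (induction as arbitrary: zs)
  case (Cons a as)
  from Cons.prems have "P (zs @ x # a # (as @ bs))" by simp
  from assms(1)[OF this] have "P ((zs @ [a]) @ x # as @ bs)" by simp
  from Cons.IH[OF this] show ?case by simp
qed simp

text \<open>Any two orderings of a set are connected by adjacent transpositions: the first letter of \<open>xs\<close> is moved
to its place in \<open>ys\<close> past one letter at a time, and the remaining letters are sorted by induction.\<close>

lemma swap_closed_perms:
  assumes swap: "\<And>zs x y ws. P (zs @ x # y # ws) \<Longrightarrow> P (zs @ y # x # ws)"
    and "distinct xs" "distinct ys" "set xs = set ys" "P xs"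
  shows "P ys"
  using assms
proof (induction xs arbitrary: ys P)
  case Nil thus ?case by simp
next
  case (Cons x xs)
  have "x \<in> set ys" using Cons.prems(4) by auto
  then obtain as bs where ys: "ys = as @ x # bs" by (metis split_list)
  have "P (x # as @ bs)"
  proof (rule Cons.IH[of "\<lambda>l. P (x # l)"])
    show "P (x # zs @ b # a # ws)" if "P (x # zs @ a # b # ws)" for zs a b ws
      using Cons.prems(1)[of "x # zs" a b ws] that by simp
    show "set xs = set (as @ bs)" using Cons.prems(2-4) by (auto simp: ys)
  qed (use Cons.prems(2,3,5) in \<open>auto simp: ys\<close>)
  from swap_closed_move[of P "[]", OF Cons.prems(1)] this show ?case by (simp add: ys)
qed

subsection \<open>The determinant\<close>

definition permutation_sign :: "('r, 'q) ring_scheme \<Rightarrow> (nat \<Rightarrow> nat) \<Rightarrow> 'r" where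
  "permutation_sign R p = (if evenperm p then \<one>\<^bsub>R\<^esub> else \<ominus>\<^bsub>R\<^esub> \<one>\<^bsub>R\<^esub>)"

text \<open>The Leibniz formula for the matrix of the vectors \<open>vs\<close> with columns ordered by \<open>xs\<close>. It provides a
linear functional on the top exterior power with value one on the wedge of the letters of \<open>xs\<close>, which
shows that this generator satisfies no linear relation.\<close>

definition determinant :: "('r, 'q) ring_scheme \<Rightarrow> 'x list \<Rightarrow> ('x \<Rightarrow> 'r) list \<Rightarrow> 'r" where
  "determinant R xs vs = (\<Oplus>\<^bsub>R\<^esub>p\<in>{p. p permutes {..<length xs}}.
     permutation_sign R p \<otimes>\<^bsub>R\<^esub> (\<Otimes>\<^bsub>R\<^esub>i\<in>{..<length xs}. (vs ! i) (xs ! p i)))"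

context cring
begin

lemma permutation_sign_closed [simp]: "permutation_sign R p \<in> carrier R"
  by (simp add: permutation_sign_def)

lemma vec_entry_closed:
  "\<lbrakk>vs \<in> vec_lists n (free_module R S); i < n\<rbrakk> \<Longrightarrow> (vs ! i) x \<in> carrier R"
  unfolding vec_lists_def using nth_mem by (fastforce simp: free_carrier)

lemma determinant_closed:
  "vs \<in> vec_lists (length xs) (free_module R S) \<Longrightarrow> determinant R xs vs \<in> carrier R"
  unfolding determinant_def by (intro finsum_closed) (auto intro!: finprod_closed simp: vec_entry_closed)

lemma determinant_update_hom:
  assumes vs: "vs \<in> vec_lists (length xs) (free_module R S)" and i: "i < length xs"
  shows "(\<lambda>v. determinant R xs (vs[i := v])) \<in> mod_hom R (free_module R S) (ring_module R)"
proof -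
  let ?n = "length xs"
  let ?Z = "free_module R S"
  interpret Z: Module.module R ?Z by (rule free_module_module)
  define K where "K p = permutation_sign R p \<otimes> (\<Otimes>j\<in>{..<?n} - {i}. (vs ! j) (xs ! p j))" for p
  have K: "K p \<in> carrier R" for p
    unfolding K_def by (auto intro!: finprod_closed simp: vec_entry_closed[OF vs])
  have vc: "v x \<in> carrier R" if "v \<in> carrier ?Z" for v x using that by (auto simp: free_carrier)
  have D: "determinant R xs (vs[i := v]) = (\<Oplus>p\<in>{p. p permutes {..<?n}}. v (xs ! p i) \<otimes> K p)"
    if v: "v \<in> carrier ?Z" for v
    unfolding determinant_def
  proof (rule finsum_cong')
    fix p
    have l: "length vs = ?n" using vs by (simp add: vec_lists_def)
    have "(\<Otimes>j\<in>{..<?n}. (vs[i := v] ! j) (xs ! p j))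
        = (\<Otimes>j\<in>insert i ({..<?n} - {i}). (vs[i := v] ! j) (xs ! p j))"
      using i by (simp add: insert_absorb)
    also have "\<dots> = (vs[i := v] ! i) (xs ! p i) \<otimes> (\<Otimes>j\<in>{..<?n} - {i}. (vs[i := v] ! j) (xs ! p j))"
      using vec_entry_closed[OF vec_lists_update[OF vs v]] i by (intro finprod_insert) auto
    also have "(\<Otimes>j\<in>{..<?n} - {i}. (vs[i := v] ! j) (xs ! p j)) = (\<Otimes>j\<in>{..<?n} - {i}. (vs ! j) (xs ! p j))"
      using vec_entry_closed[OF vs] by (intro finprod_cong') auto
    also have "(vs[i := v] ! i) (xs ! p i) = v (xs ! p i)" using i l by simp
    finally show "permutation_sign R p \<otimes> (\<Otimes>j\<in>{..<?n}. (vs[i := v] ! j) (xs ! p j)) = v (xs ! p i) \<otimes> K p"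
      using vc[OF v] vec_entry_closed[OF vs] unfolding K_def by (simp add: m_lcomm Pi_iff)
  qed (use K vc[OF v] in auto)
  show ?thesis
  proof (rule mod_homI)
    show "determinant R xs (vs[i := v]) \<in> carrier (ring_module R)" if "v \<in> carrier ?Z" for v
      using determinant_closed[OF vec_lists_update[OF vs that]] by simp
    show "determinant R xs (vs[i := u \<oplus>\<^bsub>?Z\<^esub> v]) = determinant R xs (vs[i := u])
        \<oplus>\<^bsub>ring_module R\<^esub> determinant R xs (vs[i := v])" if u: "u \<in> carrier ?Z" and v: "v \<in> carrier ?Z" for u v
    proof -
      have "(\<Oplus>p\<in>{p. p permutes {..<?n}}. (u \<oplus>\<^bsub>?Z\<^esub> v) (xs ! p i) \<otimes> K p)
        = (\<Oplus>p\<in>{p. p permutes {..<?n}}. u (xs ! p i) \<otimes> K p \<oplus> v (xs ! p i) \<otimes> K p)"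
        by (rule finsum_cong') (use u v vc K in \<open>auto simp: free_simps l_distr\<close>)
      also have "\<dots> = (\<Oplus>p\<in>{p. p permutes {..<?n}}. u (xs ! p i) \<otimes> K p)
          \<oplus> (\<Oplus>p\<in>{p. p permutes {..<?n}}. v (xs ! p i) \<otimes> K p)"
        by (rule finsum_addf) (use u v vc K in auto)
      finally show ?thesis using u v by (simp add: D)
    qed
    show "determinant R xs (vs[i := r \<odot>\<^bsub>?Z\<^esub> u]) = r \<odot>\<^bsub>ring_module R\<^esub> determinant R xs (vs[i := u])"
      if r: "r \<in> carrier R" and u: "u \<in> carrier ?Z" for r u
    proof -
      have "(\<Oplus>p\<in>{p. p permutes {..<?n}}. (r \<odot>\<^bsub>?Z\<^esub> u) (xs ! p i) \<otimes> K p)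
        = (\<Oplus>p\<in>{p. p permutes {..<?n}}. r \<otimes> (u (xs ! p i) \<otimes> K p))"
        by (rule finsum_cong') (use u r vc K in \<open>auto simp: free_simps m_assoc\<close>)
      also have "\<dots> = r \<otimes> (\<Oplus>p\<in>{p. p permutes {..<?n}}. u (xs ! p i) \<otimes> K p)"
        by (rule finsum_rdistr[symmetric]) (use u r vc K in \<open>auto simp: finite_permutations\<close>)
      finally show ?thesis using u r by (simp add: D)
    qed
  qed
qed

text \<open>Composition with the transposition of \<open>i\<close> and \<open>j\<close> is a bijection from the even to the odd
permutations, and it matches equal products with opposite signs. Summing over the even permutations
only avoids a division by two.\<close>

lemma determinant_repeated:
  assumes vs: "vs \<in> vec_lists (length xs) (free_module R S)" and ij: "i < j" "j < length xs"
    and eq: "vs ! i = vs ! j"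
  shows "determinant R xs vs = \<zero>"
proof -
  let ?n = "length xs"
  define Q where "Q p = (\<Otimes>k\<in>{..<?n}. (vs ! k) (xs ! p k))" for p
  define t where "t = Transposition.transpose i j"
  define E where "E = {p. p permutes {..<?n} \<and> evenperm p}"
  define O' where "O' = {p. p permutes {..<?n} \<and> \<not> evenperm p}"
  have Qc: "Q p \<in> carrier R" for p
    unfolding Q_def by (auto intro!: finprod_closed simp: vec_entry_closed[OF vs])
  have t: "t permutes {..<?n}" unfolding t_def using ij by (intro permutes_swap_id) auto
  have tt: "t (t k) = k" "t \<circ> t = id" for k by (simp_all add: t_def fun_eq_iff)
  have fin: "finite E" "finite O'" unfolding E_def O'_def
    by (rule finite_subset[OF _ finite_permutations[of "{..<?n}"]]; auto)+
  have perm: "permutation p" if "p permutes {..<?n}" for p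
    using that by (auto simp: permutation_permutes)
  have even_t: "evenperm (p \<circ> t) \<longleftrightarrow> \<not> evenperm p" if "p permutes {..<?n}" for p
    using evenperm_comp[OF perm[OF that] perm[OF t]] ij by (simp add: t_def evenperm_swap)
  have Qt: "Q (p \<circ> t) = Q p" if "p permutes {..<?n}" for p
  proof -
    have "Q (p \<circ> t) = (\<Otimes>k\<in>{..<?n}. (vs ! t k) (xs ! p (t k)))"
      unfolding Q_def using vec_entry_closed[OF vs] eq ij
      by (intro finprod_cong') (auto simp: t_def Transposition.transpose_def)
    also have "\<dots> = (\<Otimes>k\<in>t ` {..<?n}. (vs ! k) (xs ! p k))"
      by (rule finprod_reindex[symmetric])
         (use vec_entry_closed[OF vs] permutes_image[OF t] in \<open>auto simp: permutes_inj_on[OF t]\<close>)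
    also have "\<dots> = Q p" by (simp add: permutes_image[OF t] Q_def)
    finally show ?thesis .
  qed
  have O': "O' = (\<lambda>p. p \<circ> t) ` E"
  proof
    show "(\<lambda>p. p \<circ> t) ` E \<subseteq> O'" using even_t permutes_compose[OF t] by (auto simp: E_def O'_def)
    show "O' \<subseteq> (\<lambda>p. p \<circ> t) ` E"
    proof
      fix p assume p: "p \<in> O'"
      have "p \<circ> t \<in> E" using p even_t permutes_compose[OF t] by (auto simp: E_def O'_def)
      moreover have "p = (p \<circ> t) \<circ> t" by (simp add: comp_assoc tt(2))
      ultimately show "p \<in> (\<lambda>p. p \<circ> t) ` E" by blast
    qed
  qed
  have inj: "inj_on (\<lambda>p. p \<circ> t) E"
    by (rule inj_onI) (metis comp_assoc comp_id tt(2))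
  have "determinant R xs vs = (\<Oplus>p\<in>E \<union> O'. permutation_sign R p \<otimes> Q p)"
    unfolding determinant_def Q_def E_def O'_def by (rule arg_cong[of _ _ "finsum R _"]) auto
  also have "\<dots> = (\<Oplus>p\<in>E. permutation_sign R p \<otimes> Q p) \<oplus> (\<Oplus>p\<in>O'. permutation_sign R p \<otimes> Q p)"
    using fin Qc by (intro finsum_Un_disjoint) (auto simp: E_def O'_def)
  also have "(\<Oplus>p\<in>O'. permutation_sign R p \<otimes> Q p) = (\<Oplus>p\<in>E. permutation_sign R (p \<circ> t) \<otimes> Q (p \<circ> t))"
    unfolding O' by (rule finsum_reindex) (use Qc inj in auto)
  also have "(\<Oplus>p\<in>E. permutation_sign R p \<otimes> Q p) \<oplus> (\<Oplus>p\<in>E. permutation_sign R (p \<circ> t) \<otimes> Q (p \<circ> t))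
      = (\<Oplus>p\<in>E. permutation_sign R p \<otimes> Q p \<oplus> permutation_sign R (p \<circ> t) \<otimes> Q (p \<circ> t))"
    by (rule finsum_addf[symmetric]) (use Qc in auto)
  also have "\<dots> = (\<Oplus>p\<in>E. \<zero>)"
    by (rule finsum_cong')
       (use Qc even_t Qt in \<open>auto simp: E_def permutation_sign_def l_minus r_neg\<close>)
  finally show ?thesis by simp
qed

lemma determinant_basis:
  assumes "distinct xs"
  shows "determinant R xs (map (basis_vec R) xs) = \<one>"
proof -
  let ?n = "length xs"
  define g where "g p = permutation_sign R p \<otimes> (\<Otimes>k\<in>{..<?n}. (map (basis_vec R) xs ! k) (xs ! p k))" for p
  have gc: "g p \<in> carrier R" for p
    by (auto simp: g_def basis_vec_def intro!: m_closed finprod_closed)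
  have "determinant R xs (map (basis_vec R) xs) = (\<Oplus>p\<in>{id}. g p)"
    unfolding determinant_def g_def[symmetric]
  proof (rule add.finprod_mono_neutral_cong_right)
    show "g p = \<zero>" if p: "p \<in> {p. p permutes {..<?n}} - {id}" for p
    proof -
      obtain k where k: "p k \<noteq> k" using p by (auto simp: fun_eq_iff)
      have pp: "p permutes {..<?n}" using p by simp
      have kn: "k < ?n" using k permutes_not_in[OF pp, of k] by auto
      have "p k < ?n" using permutes_in_image[OF pp, of k] kn by simp
      hence "xs ! p k \<noteq> xs ! k" using assms k kn by (simp add: nth_eq_iff_index_eq)
      hence z: "(map (basis_vec R) xs ! k) (xs ! p k) = \<zero>" using kn by (simp add: basis_vec_def)
      have "(\<Otimes>k\<in>{..<?n}. (map (basis_vec R) xs ! k) (xs ! p k))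
          = (\<Otimes>k\<in>insert k ({..<?n} - {k}). (map (basis_vec R) xs ! k) (xs ! p k))"
        using kn by (simp add: insert_absorb)
      also have "\<dots> = \<zero> \<otimes> (\<Otimes>k\<in>{..<?n} - {k}. (map (basis_vec R) xs ! k) (xs ! p k))"
        using kn z by (subst finprod_insert) (auto simp: basis_vec_def)
      also have "\<dots> = \<zero>" by (intro l_null finprod_closed) (auto simp: basis_vec_def)
      finally show "g p = \<zero>" by (simp add: g_def)
    qed
  qed (auto simp: finite_permutations permutes_id gc)
  also have "\<dots> = g id" using gc by simp
  also have "g id = permutation_sign R id \<otimes> (\<Otimes>k\<in>{..<?n}. \<one>)"
    unfolding g_def by (rule arg_cong[of _ _ "\<lambda>z. _ \<otimes> z"], rule finprod_cong') (auto simp: basis_vec_def)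
  also have "\<dots> = \<one>" by (simp add: permutation_sign_def)
  finally show ?thesis .
qed

end

subsection \<open>Tensor products with an orientation module\<close>

text \<open>The elements \<open>m \<otimes> x\<^sub>1 \<and> \<dots> \<and> x\<^sub>k\<close>, for an ordering \<open>x\<^sub>1, \<dots>, x\<^sub>k\<close> of \<open>S\<close>. All computations in
the Koszul complex are made with them.\<close>

definition word_tensor ::
    "('r, 'q) ring_scheme \<Rightarrow> ('r, 'm) module \<Rightarrow> 'x set \<Rightarrow> 'm \<Rightarrow> 'x list \<Rightarrow> ('m \<times> ('x, 'r) orientation_elt \<Rightarrow> 'r) set"
  where "word_tensor R M S m xs =
    pure_tensor R M (orientation R S) m (wedge R (card S) (free_module R S) (map (basis_vec R) xs))"

context cring
begin

lemma free_plain_module: "plain_module R (free_module R S)"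
  unfolding plain_module_def by (rule free_module_module)

lemma orientation_module: "Module.module R (orientation R S)"
  unfolding orientation_def by (rule plain_module.ext_power_module[OF free_plain_module])

lemma perms_vec_lists: "xs \<in> perms S \<Longrightarrow> map (basis_vec R) xs \<in> vec_lists (card S) (free_module R S)"
  by (auto simp: vec_lists_def perms_def distinct_card)

lemma perms_wedge_closed:
  "xs \<in> perms S \<Longrightarrow> wedge R (card S) (free_module R S) (map (basis_vec R) xs) \<in> carrier (orientation R S)"
  unfolding orientation_def
  by (intro plain_module.wedge_closed[OF free_plain_module] perms_vec_lists)

text \<open>A word in \<open>S\<close> of full length either repeats a letter, so that its wedge vanishes, or is an ordering of
\<open>S\<close>, so that its wedge is the one of \<open>xs\<close> up to sign. General vectors are reduced to letters one slot
at a time, since each slot is linear and the letters span.\<close>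

lemma orientation_cyclic:
  assumes S: "finite S" and xs: "xs \<in> perms S" and v: "v \<in> carrier (orientation R S)"
  shows "\<exists>r\<in>carrier R. v = r \<odot>\<^bsub>orientation R S\<^esub> wedge R (card S) (free_module R S) (map (basis_vec R) xs)"
proof -
  let ?Z = "free_module R S" and ?n = "card S"
  let ?O = "ext_power R ?n ?Z"
  interpret Z: plain_module R ?Z by (rule free_plain_module)
  interpret O: Module.module R ?O by (rule Z.ext_power_module)
  define w where "w = wedge R ?n ?Z (map (basis_vec R) xs)"
  have w: "w \<in> carrier ?O" using perms_wedge_closed[OF xs] by (simp add: w_def orientation_def)
  have "(\<lambda>r. r \<odot>\<^bsub>?O\<^esub> w) \<in> mod_hom R (ring_module R) ?O"
    using w by (intro mod_homI) (simp_all add: O.smult_l_distr O.smult_assoc1)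
  from mod_hom_image_submodule[OF this ring_module_module O.module_axioms]
  have H: "submodule ((\<lambda>r. r \<odot>\<^bsub>?O\<^esub> w) ` carrier R) R ?O" by simp
  define H' where "H' = (\<lambda>r. r \<odot>\<^bsub>?O\<^esub> w) ` carrier R"
  note H = H[folded H'_def]
  have perm: "wedge R ?n ?Z (map (basis_vec R) ys) \<in> H'" if "ys \<in> perms S" for ys
  proof -
    have "ys \<in> perms S \<and> wedge R ?n ?Z (map (basis_vec R) ys) \<in> H'"
    proof (rule swap_closed_perms[where xs = xs])
      have "w = \<one> \<odot>\<^bsub>?O\<^esub> w" using w by simp
      thus "xs \<in> perms S \<and> wedge R ?n ?Z (map (basis_vec R) xs) \<in> H'"
        using xs by (auto simp: H'_def w_def)
      fix zs x y ws assume *: "zs @ x # y # ws \<in> perms S \<and> wedge R ?n ?Z (map (basis_vec R) (zs @ x # y # ws)) \<in> H'"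
      show "zs @ y # x # ws \<in> perms S \<and> wedge R ?n ?Z (map (basis_vec R) (zs @ y # x # ws)) \<in> H'"
        using Z.wedge_swap[of "map (basis_vec R) zs" "basis_vec R x" "basis_vec R y" "map (basis_vec R) ws" ?n]
          perms_vec_lists[of "zs @ x # y # ws"] * perms_swap[of zs x y ws S] O.submoduleE(3)[OF H]
        by simp
    qed (use that xs in \<open>auto simp: perms_def\<close>)
    thus ?thesis ..
  qed
  have words: "wedge R ?n ?Z (map (basis_vec R) ys) \<in> H'" if ys: "set ys \<subseteq> S" "length ys = ?n" for ys
  proof (cases "distinct ys")
    case True
    hence "card (set ys) = card S" using ys by (simp add: distinct_card)
    hence "set ys = S" using card_subset_eq[OF S ys(1)] by simp
    thus ?thesis using True perm by (simp add: perms_def)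
  next
    case False
    then obtain i j where "i < j" "j < ?n" "ys ! i = ys ! j"
      using ys(2) by (metis distinct_conv_nth linorder_neqE_nat)
    hence "wedge R ?n ?Z (map (basis_vec R) ys) = \<zero>\<^bsub>?O\<^esub>"
      using ys by (intro Z.wedge_repeated[of _ _ i j]) (auto simp: vec_lists_def)
    thus ?thesis using submodule_zero[OF H] by simp
  qed
  have mixed: "wedge R ?n ?Z (map (basis_vec R) ys @ ws) \<in> H'"
    if "set ys \<subseteq> S" "set ws \<subseteq> carrier ?Z" "length ys + length ws = ?n" for ys ws
    using that
  proof (induction ws arbitrary: ys)
    case Nil thus ?case using words by simp
  next
    case (Cons u ws)
    have hom: "(\<lambda>u. wedge R ?n ?Z (map (basis_vec R) ys @ u # ws)) \<in> mod_hom R ?Z ?O"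
      using Cons.prems by (intro Z.wedge_slot_hom[of _ _ "?n - 1"]) (auto simp: vec_lists_def)
    have "u \<in> {u \<in> carrier ?Z. wedge R ?n ?Z (map (basis_vec R) ys @ u # ws) \<in> H'}"
    proof (rule free_module_span[OF submodule_preimage[OF hom Z.module_axioms O.module_axioms H]])
      fix x assume x: "x \<in> S"
      show "basis_vec R x \<in> {u \<in> carrier ?Z. wedge R ?n ?Z (map (basis_vec R) ys @ u # ws) \<in> H'}"
        using Cons.IH[of "ys @ [x]"] Cons.prems x by simp
    qed (use Cons.prems in auto)
    thus ?case by simp
  qed
  have "v \<in> H'"
    by (rule Z.ext_induct[OF H]) (use v mixed[of "[]"] in \<open>auto simp: orientation_def vec_lists_def\<close>)
  thus ?thesis by (auto simp: H'_def w_def orientation_def)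
qed

lemma word_tensor_hom:
  assumes "Module.module R M" "xs \<in> perms S"
  shows "(\<lambda>m. word_tensor R M S m xs) \<in> mod_hom R M (tensor R M (orientation R S))"
proof -
  interpret P: module_pair R M "orientation R S"
    using assms orientation_module by (simp add: module_pair_def)
  show ?thesis unfolding word_tensor_def by (intro P.pure_tensor_hom_left perms_wedge_closed assms)
qed

lemma word_tensor_swap:
  assumes M: "Module.module R M" and xs: "zs @ x # y # ws \<in> perms S" and m: "m \<in> carrier M"
  shows "word_tensor R M S m (zs @ y # x # ws)
    = \<ominus>\<^bsub>tensor R M (orientation R S)\<^esub> word_tensor R M S m (zs @ x # y # ws)"
proof -
  interpret P: module_pair R M "orientation R S"
    using M orientation_module by (simp add: module_pair_def)
  interpret Z: plain_module R "free_module R S" by (rule free_plain_module)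
  have "wedge R (card S) (free_module R S) (map (basis_vec R) (zs @ y # x # ws))
      = \<ominus>\<^bsub>orientation R S\<^esub> wedge R (card S) (free_module R S) (map (basis_vec R) (zs @ x # y # ws))"
    using Z.wedge_swap perms_vec_lists[OF xs] by (simp add: orientation_def)
  thus ?thesis
    unfolding word_tensor_def
    using mod_hom_minus[OF P.pure_tensor_hom_right[OF m] orientation_module P.tensor_module
        perms_wedge_closed[OF xs]] by simp
qed

lemma word_tensor_surj:
  assumes S: "finite S" and M: "Module.module R M" and xs: "xs \<in> perms S"
    and v: "v \<in> carrier (tensor R M (orientation R S))"
  shows "\<exists>m\<in>carrier M. v = word_tensor R M S m xs"
proof -
  interpret P: module_pair R M "orientation R S"
    using M orientation_module by (simp add: module_pair_def)
  note hom = word_tensor_hom[OF M xs]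
  have "v \<in> (\<lambda>m. word_tensor R M S m xs) ` carrier M"
  proof (rule P.tensor_induct[OF mod_hom_image_submodule[OF hom M P.tensor_module] v])
    fix m u assume m: "m \<in> carrier M" and u: "u \<in> carrier (orientation R S)"
    obtain r where r: "r \<in> carrier R"
      "u = r \<odot>\<^bsub>orientation R S\<^esub> wedge R (card S) (free_module R S) (map (basis_vec R) xs)"
      using orientation_cyclic[OF S xs u] by blast
    have "pure_tensor R M (orientation R S) m u = word_tensor R M S (r \<odot>\<^bsub>M\<^esub> m) xs"
      using r(1) m perms_wedge_closed[OF xs]
      by (simp add: r(2) word_tensor_def P.pure_tensor_smult_left P.pure_tensor_smult_right)
    thus "pure_tensor R M (orientation R S) m u \<in> (\<lambda>m. word_tensor R M S m xs) ` carrier M"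
      using r(1) m by auto
  qed
  thus ?thesis by blast
qed

text \<open>The determinant with respect to \<open>xs\<close> induces a functional \<open>D\<close> on the orientation module with value one on
the wedge of \<open>xs\<close>, and \<open>m \<otimes> \<alpha> \<mapsto> D(\<alpha>) m\<close> is then a left inverse of \<open>m \<mapsto> m \<otimes> x\<^sub>1 \<and> \<dots> \<and> x\<^sub>k\<close>.\<close>

lemma word_tensor_inj:
  assumes M: "Module.module R M" and xs: "xs \<in> perms S" and m: "m \<in> carrier M"
    and zero: "word_tensor R M S m xs = \<zero>\<^bsub>tensor R M (orientation R S)\<^esub>"
  shows "m = \<zero>\<^bsub>M\<^esub>"
proof -
  interpret P: module_pair R M "orientation R S"
    using M orientation_module by (simp add: module_pair_def)
  interpret Z: plain_module R "free_module R S" by (rule free_plain_module)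
  have len: "length xs = card S" using perms_length[OF xs] .
  have "\<exists>D\<in>mod_hom R (orientation R S) (ring_module R). \<forall>vs\<in>vec_lists (card S) (free_module R S).
      D (wedge R (card S) (free_module R S) vs) = determinant R xs vs"
    unfolding orientation_def len[symmetric]
    by (rule Z.ext_lift[OF ring_module_module])
       (simp_all add: determinant_update_hom determinant_closed determinant_repeated)
  then obtain D where D: "D \<in> mod_hom R (orientation R S) (ring_module R)"
    "\<And>vs. vs \<in> vec_lists (card S) (free_module R S) \<Longrightarrow>
      D (wedge R (card S) (free_module R S) vs) = determinant R xs vs"
    by blast
  obtain f where f: "f \<in> mod_hom R (tensor R M (orientation R S)) M"
    "\<And>x u. \<lbrakk>x \<in> carrier M; u \<in> carrier (orientation R S)\<rbrakk> \<Longrightarrow>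
       f (pure_tensor R M (orientation R S) x u) = D u \<odot>\<^bsub>M\<^esub> x"
  proof -
    have Dc: "D u \<in> carrier R" if "u \<in> carrier (orientation R S)" for u
      using mod_hom_closed[OF D(1) that] by simp
    have "\<exists>f\<in>mod_hom R (tensor R M (orientation R S)) M. \<forall>x\<in>carrier M. \<forall>u\<in>carrier (orientation R S).
        f (pure_tensor R M (orientation R S) x u) = D u \<odot>\<^bsub>M\<^esub> x"
    proof (rule P.tensor_lift[OF M])
      show "(\<lambda>x. D u \<odot>\<^bsub>M\<^esub> x) \<in> mod_hom R M M" if "u \<in> carrier (orientation R S)" for u
        by (rule smult_mod_hom[OF M P.M.carrier_is_submodule Dc[OF that]])
      show "(\<lambda>u. D u \<odot>\<^bsub>M\<^esub> x) \<in> mod_hom R (orientation R S) M" if "x \<in> carrier M" for x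
        by (rule mod_homI)
           (use that Dc mod_homD[OF D(1)] in \<open>simp_all add: P.M.smult_l_distr P.M.smult_assoc1\<close>)
    qed
    thus thesis using that by blast
  qed
  have "f (word_tensor R M S m xs) = \<one> \<odot>\<^bsub>M\<^esub> m"
    using xs m perms_wedge_closed[OF xs] D(2)[OF perms_vec_lists[OF xs]]
    by (simp add: word_tensor_def f(2) determinant_basis perms_def)
  moreover have "f (word_tensor R M S m xs) = \<zero>\<^bsub>M\<^esub>"
    unfolding zero by (rule mod_hom_zero[OF f(1) P.tensor_module M])
  ultimately show ?thesis using m by simp
qed

lemma pullback_hom:
  assumes g: "bij_betw g S T"
  shows "(\<lambda>u s. if s \<in> S then u (g s) else \<zero>) \<in> mod_hom R (free_module R T) (free_module R S)"
proof (rule mod_homI)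
  fix u assume u: "u \<in> carrier (free_module R T)"
  have "g ` {s. (if s \<in> S then u (g s) else \<zero>) \<noteq> \<zero>} \<subseteq> {t. u t \<noteq> \<zero>}" by auto
  moreover have "inj_on g {s. (if s \<in> S then u (g s) else \<zero>) \<noteq> \<zero>}"
    using g by (auto simp: bij_betw_def intro: inj_on_subset)
  moreover have "finite {t. u t \<noteq> \<zero>}" using u by (simp add: free_carrier)
  ultimately have "finite {s. (if s \<in> S then u (g s) else \<zero>) \<noteq> \<zero>}"
    using inj_on_finite by blast
  thus "(\<lambda>s. if s \<in> S then u (g s) else \<zero>) \<in> carrier (free_module R S)"
    using u by (auto simp: free_carrier)
qed (auto simp: free_simps)

lemma orientation_map_props:
  assumes g: "bij_betw g S T"
  shows orientation_map_hom: "orientation_map R S g \<in> mod_hom R (orientation R T) (orientation R S)"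
    and orientation_map_word: "xs \<in> perms S \<Longrightarrow>
      orientation_map R S g (wedge R (card T) (free_module R T) (map (basis_vec R) (map g xs)))
        = wedge R (card S) (free_module R S) (map (basis_vec R) xs)"
proof -
  let ?L = "\<lambda>u s. if s \<in> S then u (g s) else \<zero>"
  have c: "card S = card T" using g by (rule bij_betw_same_card)
  note props = ext_power_map_props[OF free_module_module free_module_module pullback_hom[OF g],
      of "[]" "card S" "card S" "map ?L"]
  show "orientation_map R S g \<in> mod_hom R (orientation R T) (orientation R S)"
    unfolding orientation_map_def orientation_def c[symmetric] by (rule props(1)) auto
  show "orientation_map R S g (wedge R (card T) (free_module R T) (map (basis_vec R) (map g xs)))
        = wedge R (card S) (free_module R S) (map (basis_vec R) xs)" if xs: "xs \<in> perms S"
  proof -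
    have "map g xs \<in> perms T" using xs g by (auto simp: perms_def bij_betw_def distinct_map)
    from perms_vec_lists[OF this]
    have "map (basis_vec R) (map g xs) \<in> vec_lists (card S) (free_module R T)" by (simp add: c)
    moreover have "map ?L (map (basis_vec R) (map g xs)) = map (basis_vec R) xs"
      using xs g by (auto simp: perms_def basis_vec_def fun_eq_iff bij_betw_def inj_on_def)
    ultimately show ?thesis
      unfolding orientation_map_def c[symmetric]
      using props(2)[of "map (basis_vec R) (map g xs)"] by (simp del: map_map)
  qed
qed

lemma wedge_point_props:
  assumes x: "x \<in> S" and S: "finite S"
  shows wedge_point_hom: "wedge_point R S x \<in> mod_hom R (orientation R (S - {x})) (orientation R S)"
    and wedge_point_word: "xs \<in> perms (S - {x}) \<Longrightarrow>
      wedge_point R S x (wedge R (card (S - {x})) (free_module R (S - {x})) (map (basis_vec R) xs))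
        = wedge R (card S) (free_module R S) (map (basis_vec R) (x # xs))"
proof -
  have c: "card S = length [basis_vec R x] + card (S - {x})" using card_Suc_Diff1[OF S x] by simp
  have hom: "id \<in> mod_hom R (free_module R (S - {x})) (free_module R S)"
    by (rule mod_homI) (simp_all add: free_carrier free_simps)
  have p: "set [basis_vec R x] \<subseteq> carrier (free_module R S)" using x by simp
  have h: "basis_vec R x # vs = [basis_vec R x] @ map id vs" for vs by simp
  note props = ext_power_map_props[OF free_module_module free_module_module hom p c h]
  show "wedge_point R S x \<in> mod_hom R (orientation R (S - {x})) (orientation R S)"
    unfolding wedge_point_def orientation_def by (rule props(1))
  show "wedge_point R S x (wedge R (card (S - {x})) (free_module R (S - {x})) (map (basis_vec R) xs))
        = wedge R (card S) (free_module R S) (map (basis_vec R) (x # xs))" if "xs \<in> perms (S - {x})"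
    unfolding wedge_point_def props(2)[OF perms_vec_lists[OF that]] by simp
qed

lemma word_tensor_orientation_map:
  assumes M: "Module.module R M" and N: "Module.module R N" and f: "f \<in> mod_hom R N M"
    and g: "bij_betw g S T"
  shows tensor_orientation_map_hom: "tensor_map R M (orientation R S) f (orientation_map R S g)
      \<in> mod_hom R (tensor R N (orientation R T)) (tensor R M (orientation R S))"
    and tensor_orientation_map_word: "\<lbrakk>m \<in> carrier N; xs \<in> perms S\<rbrakk> \<Longrightarrow>
      tensor_map R M (orientation R S) f (orientation_map R S g) (word_tensor R N T m (map g xs))
        = word_tensor R M S (f m) xs"
proof -
  note props = tensor_map_props[OF N orientation_module M orientation_module f orientation_map_hom[OF g]]
  show "tensor_map R M (orientation R S) f (orientation_map R S g)
      \<in> mod_hom R (tensor R N (orientation R T)) (tensor R M (orientation R S))" by (rule props(1))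
  show "tensor_map R M (orientation R S) f (orientation_map R S g) (word_tensor R N T m (map g xs))
        = word_tensor R M S (f m) xs" if m: "m \<in> carrier N" and xs: "xs \<in> perms S"
  proof -
    have gx: "map g xs \<in> perms T" using xs g by (auto simp: perms_def bij_betw_def distinct_map)
    show ?thesis
      unfolding word_tensor_def props(2)[OF m perms_wedge_closed[OF gx]]
      by (simp only: orientation_map_word[OF g xs])
  qed
qed

lemma word_tensor_wedge_point:
  assumes M: "Module.module R M" and N: "Module.module R N" and f: "f \<in> mod_hom R N M"
    and S: "finite S" and x: "x \<in> S"
  shows tensor_wedge_point_hom: "tensor_map R M (orientation R S) f (wedge_point R S x)
      \<in> mod_hom R (tensor R N (orientation R (S - {x}))) (tensor R M (orientation R S))"
    and tensor_wedge_point_word: "\<lbrakk>m \<in> carrier N; xs \<in> perms (S - {x})\<rbrakk> \<Longrightarrow>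
      tensor_map R M (orientation R S) f (wedge_point R S x) (word_tensor R N (S - {x}) m xs)
        = word_tensor R M S (f m) (x # xs)"
proof -
  note props = tensor_map_props[OF N orientation_module M orientation_module f wedge_point_hom[OF x S]]
  show "tensor_map R M (orientation R S) f (wedge_point R S x)
      \<in> mod_hom R (tensor R N (orientation R (S - {x}))) (tensor R M (orientation R S))" by (rule props(1))
  show "tensor_map R M (orientation R S) f (wedge_point R S x) (word_tensor R N (S - {x}) m xs)
        = word_tensor R M S (f m) (x # xs)" if m: "m \<in> carrier N" and xs: "xs \<in> perms (S - {x})"
    unfolding word_tensor_def props(2)[OF m perms_wedge_closed[OF xs]]
    by (simp only: wedge_point_word[OF x S xs])
qed

lemma word_tensor_map_id:
  assumes M: "Module.module R M" and N: "Module.module R N" and f: "f \<in> mod_hom R N M"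
  shows tensor_id_hom: "tensor_map R M (orientation R S) f id
      \<in> mod_hom R (tensor R N (orientation R S)) (tensor R M (orientation R S))"
    and tensor_id_word: "\<lbrakk>m \<in> carrier N; xs \<in> perms S\<rbrakk> \<Longrightarrow>
      tensor_map R M (orientation R S) f id (word_tensor R N S m xs) = word_tensor R M S (f m) xs"
proof -
  have "id \<in> mod_hom R (orientation R S) (orientation R S)" by (rule mod_homI) auto
  note props = tensor_map_props[OF N orientation_module M orientation_module f this]
  show "tensor_map R M (orientation R S) f id
      \<in> mod_hom R (tensor R N (orientation R S)) (tensor R M (orientation R S))" by (rule props(1))
  show "tensor_map R M (orientation R S) f id (word_tensor R N S m xs) = word_tensor R M S (f m) xs"
    if "m \<in> carrier N" "xs \<in> perms S"
    unfolding word_tensor_def using props(2)[OF that(1) perms_wedge_closed[OF that(2)]] by simp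
qed

end

section \<open>Cochains on chains of subsets\<close>

definition signed :: "('g, 'z) ring_scheme \<Rightarrow> nat \<Rightarrow> 'g \<Rightarrow> 'g" where
  "signed G n x = (if even n then x else \<ominus>\<^bsub>G\<^esub> x)"

text \<open>The alternating sum of the values of \<open>f\<close> on the chains obtained from \<open>c\<^sub>1, \<dots>, c\<^sub>n\<close> by omitting \<open>c\<^sub>i\<close>,
for \<open>i < n\<close>, with sign \<open>(-1)\<^sup>n\<^sup>-\<^sup>i\<close>. The last entry stays because it determines the module in which the
value of a cochain lies. Counting from the right gives the signs of the opposite cosimplicial object.\<close>

fun inner_diff :: "('g, 'z) ring_scheme \<Rightarrow> ('b list \<Rightarrow> 'g) \<Rightarrow> 'b list \<Rightarrow> 'g" where
  "inner_diff G f [] = \<zero>\<^bsub>G\<^esub>"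
| "inner_diff G f [c] = \<zero>\<^bsub>G\<^esub>"
| "inner_diff G f (c # d # cs) =
    inner_diff G (\<lambda>l. f (c # l)) (d # cs) \<oplus>\<^bsub>G\<^esub> signed G (Suc (length cs)) (f (d # cs))"

text \<open>The alternating sum of the values of \<open>f\<close> on the chains
\<open>c\<^sub>1 \<union> {x}, \<dots>, c\<^sub>i \<union> {x}, c\<^sub>i, \<dots>, c\<^sub>n\<close>, with sign \<open>(-1)\<^sup>n\<^sup>-\<^sup>i\<close>: the prism operator for
the comparison of a chain with the chain in which \<open>x\<close> is inserted everywhere.\<close>

fun contract :: "('g, 'z) ring_scheme \<Rightarrow> 'x \<Rightarrow> ('x set list \<Rightarrow> 'g) \<Rightarrow> 'x set list \<Rightarrow> 'g" where
  "contract G x f [] = \<zero>\<^bsub>G\<^esub>"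
| "contract G x f (c # cs) =
    signed G (length cs) (f (insert x c # c # cs)) \<oplus>\<^bsub>G\<^esub> contract G x (\<lambda>l. f (insert x c # l)) cs"

fun chain :: "'x set \<Rightarrow> 'x set list \<Rightarrow> bool" where
  "chain b [] \<longleftrightarrow> True"
| "chain b (c # cs) \<longleftrightarrow> c \<subseteq> b \<and> chain c cs"

fun strict_chain :: "'x set \<Rightarrow> 'x set list \<Rightarrow> bool" where
  "strict_chain b [] \<longleftrightarrow> True"
| "strict_chain b (c # cs) \<longleftrightarrow> c \<subset> b \<and> strict_chain c cs"

text \<open>The flag obtained by removing the letters of a word one after the other. For a repetition-free word
it is a complete flag, and every complete flag arises in this way.\<close>

fun removal_chain :: "'x set \<Rightarrow> 'x list \<Rightarrow> 'x set list" where
  "removal_chain b [] = []"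
| "removal_chain b (x # xs) = (b - {x}) # removal_chain (b - {x}) xs"

lemma strict_chain_chain: "strict_chain b l \<Longrightarrow> chain b l"
  by (induction l arbitrary: b) auto

lemma chain_mono: "\<lbrakk>chain b l; b \<subseteq> b'\<rbrakk> \<Longrightarrow> chain b' l"
  by (cases l) auto

lemma chain_appendD: "chain b (s @ t) \<Longrightarrow> chain b s"
  by (induction s arbitrary: b) auto

lemma strict_chain_mono: "\<lbrakk>strict_chain b l; b \<subseteq> b'\<rbrakk> \<Longrightarrow> strict_chain b' l"
  by (cases l) auto

lemma chain_last_subset: "chain b l \<Longrightarrow> last (b # l) \<subseteq> b"
proof (induction l arbitrary: b)
  case (Cons c cs)
  hence "last (c # cs) \<subseteq> c" "c \<subseteq> b" by auto
  thus ?case by simp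
qed simp

lemma strict_chain_last: "\<lbrakk>strict_chain b l; l \<noteq> []\<rbrakk> \<Longrightarrow> last l \<subset> b"
proof (induction l arbitrary: b)
  case (Cons c cs)
  thus ?case using Cons.IH[of c] by (cases "cs = []") auto
qed simp

lemma length_removal_chain [simp]: "length (removal_chain b xs) = length xs"
  by (induction xs arbitrary: b) auto

lemma removal_chain_eq_Nil [simp]: "removal_chain b xs = [] \<longleftrightarrow> xs = []"
  by (cases xs) auto

lemma last_removal_chain: "last (b # removal_chain b xs) = b - set xs"
  by (induction xs arbitrary: b) auto

lemma removal_chain_strict: "\<lbrakk>distinct xs; set xs \<subseteq> b\<rbrakk> \<Longrightarrow> strict_chain b (removal_chain b xs)"
proof (induction xs arbitrary: b)
  case (Cons x xs)
  have "strict_chain (b - {x}) (removal_chain (b - {x}) xs)" using Cons.prems by (intro Cons.IH) auto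
  thus ?case using Cons.prems by auto
qed simp

lemma removal_chain_append:
  "removal_chain b (xs @ ys) = removal_chain b xs @ removal_chain (b - set xs) ys"
proof (induction xs arbitrary: b)
  case (Cons x xs)
  have "b - {x} - set xs = b - set (x # xs)" by auto
  thus ?case using Cons by simp
qed simp

context abelian_group
begin

lemma signed_closed [simp]: "x \<in> carrier G \<Longrightarrow> signed G n x \<in> carrier G"
  by (simp add: signed_def)

lemma signed_zero [simp]: "signed G n \<zero> = \<zero>"
  by (simp add: signed_def)

lemma signed_add: "\<lbrakk>x \<in> carrier G; y \<in> carrier G\<rbrakk> \<Longrightarrow> signed G n (x \<oplus> y) = signed G n x \<oplus> signed G n y"
  by (simp add: signed_def minus_add)

lemma signed_signed: "x \<in> carrier G \<Longrightarrow> signed G m (signed G n x) = signed G (m + n) x"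
  by (simp add: signed_def)

lemma signed_Suc: "x \<in> carrier G \<Longrightarrow> signed G (Suc n) x = \<ominus> signed G n x"
  by (simp add: signed_def)

lemma inner_diff_closed [simp]:
  "(\<And>l. f l \<in> carrier G) \<Longrightarrow> inner_diff G f l \<in> carrier G"
proof (induction l arbitrary: f rule: induct_list012)
  case (3 c d cs)
  from "3.IH"(2)[of "\<lambda>l. f (c # l)"] "3.prems" show ?case by simp
qed auto

lemma inner_diff_cong_length:
  assumes "\<And>l'. \<lbrakk>l' \<noteq> []; Suc (length l') = length l\<rbrakk> \<Longrightarrow> f l' = g l'"
  shows "inner_diff G f l = inner_diff G g l"
  using assms
proof (induction l arbitrary: f g rule: induct_list012)
  case (3 c d cs)
  have "inner_diff G (\<lambda>l. f (c # l)) (d # cs) = inner_diff G (\<lambda>l. g (c # l)) (d # cs)"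
    using "3.prems" by (intro "3.IH"(2)) auto
  thus ?case using "3.prems"[of "d # cs"] by simp
qed auto

lemma inner_diff_cong_strict:
  assumes "strict_chain b l"
    and "\<And>l'. \<lbrakk>strict_chain b l'; l' \<noteq> []; Suc (length l') = length l; last l' = last l\<rbrakk> \<Longrightarrow> f l' = g l'"
  shows "inner_diff G f l = inner_diff G g l"
  using assms
proof (induction l arbitrary: b f g rule: induct_list012)
  case (3 c d cs)
  have "inner_diff G (\<lambda>l. f (c # l)) (d # cs) = inner_diff G (\<lambda>l. g (c # l)) (d # cs)"
    using "3.prems" by (intro "3.IH"(2)[of c]) auto
  moreover have "strict_chain b (d # cs)" using "3.prems"(1) by auto
  ultimately show ?case using "3.prems"(2)[of "d # cs"] by simp
qed auto

lemma inner_diff_cong_chain: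
  assumes "chain b l"
    and "\<And>l'. \<lbrakk>chain b l'; l' \<noteq> []; Suc (length l') = length l; last l' = last l\<rbrakk> \<Longrightarrow> f l' = g l'"
  shows "inner_diff G f l = inner_diff G g l"
  using assms
proof (induction l arbitrary: b f g rule: induct_list012)
  case (3 c d cs)
  have "inner_diff G (\<lambda>l. f (c # l)) (d # cs) = inner_diff G (\<lambda>l. g (c # l)) (d # cs)"
    using "3.prems" by (intro "3.IH"(2)[of c]) auto
  moreover have "chain b (d # cs)" using "3.prems"(1) by auto
  ultimately show ?case using "3.prems"(2)[of "d # cs"] by simp
qed auto

lemma inner_diff_add:
  assumes "\<And>l. f l \<in> carrier G" "\<And>l. g l \<in> carrier G"
  shows "inner_diff G (\<lambda>l. f l \<oplus> g l) l = inner_diff G f l \<oplus> inner_diff G g l"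
  using assms
proof (induction l arbitrary: f g rule: induct_list012)
  case (3 c d cs)
  have "inner_diff G (\<lambda>l. f (c # l) \<oplus> g (c # l)) (d # cs) =
      inner_diff G (\<lambda>l. f (c # l)) (d # cs) \<oplus> inner_diff G (\<lambda>l. g (c # l)) (d # cs)"
    using "3.prems" by (intro "3.IH"(2)) auto
  thus ?case using "3.prems" by (simp add: signed_add a_ac)
qed auto

lemma inner_diff_zero [simp]: "inner_diff G (\<lambda>l. \<zero>) l = \<zero>"
  by (induction l rule: induct_list012) auto

lemma inner_diff_signed:
  assumes "\<And>l. f l \<in> carrier G"
  shows "inner_diff G (\<lambda>l. signed G n (f l)) l = signed G n (inner_diff G f l)"
  using assms
proof (induction l arbitrary: f rule: induct_list012)
  case (3 c d cs)
  have "inner_diff G (\<lambda>l. signed G n (f (c # l))) (d # cs) = signed G n (inner_diff G (\<lambda>l. f (c # l)) (d # cs))"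
    using "3.prems" by (intro "3.IH"(2)) auto
  thus ?case using "3.prems" by (simp add: signed_add signed_signed add.commute)
qed auto

lemma inner_diff_minus:
  "(\<And>l. f l \<in> carrier G) \<Longrightarrow> inner_diff G (\<lambda>l. \<ominus> f l) l = \<ominus> inner_diff G f l"
  using inner_diff_signed[of f 1 l] by (simp add: signed_def)

lemma inner_diff_signed_length:
  assumes "\<And>l. f l \<in> carrier G" "l \<noteq> []"
  shows "inner_diff G (\<lambda>l. signed G (length l) (f l)) l = signed G (length l - 1) (inner_diff G f l)"
proof -
  have "inner_diff G (\<lambda>l. signed G (length l) (f l)) l = inner_diff G (\<lambda>t. signed G (length l - 1) (f t)) l"
    by (rule inner_diff_cong_length) (metis diff_Suc_1)
  thus ?thesis using assms(1) by (simp add: inner_diff_signed)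
qed

lemma inner_diff_Cons:
  "cs \<noteq> [] \<Longrightarrow> inner_diff G f (c # cs) =
    inner_diff G (\<lambda>l. f (c # l)) cs \<oplus> signed G (length cs) (f cs)"
  by (cases cs) auto

lemma inner_diff_inner_diff:
  assumes "\<And>l. f l \<in> carrier G"
  shows "inner_diff G (inner_diff G f) l = \<zero>"
  using assms
proof (induction l arbitrary: f rule: induct_list012)
  case (3 c d cs)
  note f = "3.prems"
  have "inner_diff G (\<lambda>l. inner_diff G f (c # l)) (d # cs)
      = inner_diff G (\<lambda>l. inner_diff G (\<lambda>l. f (c # l)) l \<oplus> signed G (length l) (f l)) (d # cs)"
    by (rule inner_diff_cong_length) (simp add: inner_diff_Cons)
  also have "\<dots> = inner_diff G (inner_diff G (\<lambda>l. f (c # l))) (d # cs)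
      \<oplus> inner_diff G (\<lambda>l. signed G (length l) (f l)) (d # cs)"
    using f by (intro inner_diff_add) auto
  also have "\<dots> = \<zero> \<oplus> signed G (length cs) (inner_diff G f (d # cs))"
    using f "3.IH"(2)[of "\<lambda>l. f (c # l)"] by (simp add: inner_diff_signed_length)
  finally show ?case using f by (simp add: signed_Suc r_neg)
qed auto

text \<open>Splits off the term in which the last but one entry is omitted. The other terms form an inner
differential of chains that end in \<open>d\<close>, and their signs are reversed since one entry fewer follows.\<close>

lemma inner_diff_snoc:
  assumes "\<And>l. f l \<in> carrier G"
  shows "inner_diff G f (l @ [d, c]) = \<ominus> inner_diff G (\<lambda>t. f (t @ [c])) (l @ [d]) \<oplus> \<ominus> f (l @ [c])"
  using assms
proof (induction l arbitrary: f)
  case Nil thus ?case by (simp add: signed_def)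
next
  case (Cons e l)
  note f = Cons.prems
  have 1: "inner_diff G (\<lambda>t. f (e # t)) (l @ [d, c]) =
      \<ominus> inner_diff G (\<lambda>t. f (e # t @ [c])) (l @ [d]) \<oplus> \<ominus> f (e # l @ [c])"
    using Cons.IH[of "\<lambda>t. f (e # t)"] f by simp
  have "inner_diff G f ((e # l) @ [d, c]) = inner_diff G (\<lambda>t. f (e # t)) (l @ [d, c])
      \<oplus> signed G (Suc (Suc (length l))) (f (l @ [d, c]))"
    by (simp add: inner_diff_Cons)
  moreover have "inner_diff G (\<lambda>t. f (t @ [c])) ((e # l) @ [d])
      = inner_diff G (\<lambda>t. f (e # t @ [c])) (l @ [d]) \<oplus> signed G (Suc (length l)) (f (l @ [d, c]))"
    by (simp add: inner_diff_Cons)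
  ultimately show ?case using f
    by (simp add: 1 signed_Suc minus_add a_ac)
qed

lemma contract_closed [simp]: "(\<And>l. f l \<in> carrier G) \<Longrightarrow> contract G x f l \<in> carrier G"
proof (induction l arbitrary: f)
  case (Cons c cs)
  from Cons.IH[of "\<lambda>l. f (insert x c # l)"] Cons.prems show ?case by simp
qed simp

lemma contract_cong_length:
  assumes "\<And>l'. length l' = Suc (length l) \<Longrightarrow> f l' = g l'"
  shows "contract G x f l = contract G x g l"
  using assms
proof (induction l arbitrary: f g)
  case (Cons c cs)
  have "contract G x (\<lambda>l. f (insert x c # l)) cs = contract G x (\<lambda>l. g (insert x c # l)) cs"
    using Cons.prems by (intro Cons.IH) simp
  thus ?case using Cons.prems by simp
qed simp

lemma contract_add:
  assumes "\<And>l. f l \<in> carrier G" "\<And>l. g l \<in> carrier G"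
  shows "contract G x (\<lambda>l. f l \<oplus> g l) l = contract G x f l \<oplus> contract G x g l"
  using assms
proof (induction l arbitrary: f g)
  case (Cons c cs)
  have "contract G x (\<lambda>l. f (insert x c # l) \<oplus> g (insert x c # l)) cs =
      contract G x (\<lambda>l. f (insert x c # l)) cs \<oplus> contract G x (\<lambda>l. g (insert x c # l)) cs"
    using Cons.prems by (intro Cons.IH) auto
  thus ?case using Cons.prems by (simp add: signed_add a_ac)
qed auto

lemma contract_signed:
  assumes "\<And>l. f l \<in> carrier G"
  shows "contract G x (\<lambda>l. signed G n (f l)) l = signed G n (contract G x f l)"
  using assms
proof (induction l arbitrary: f)
  case (Cons c cs)
  have "contract G x (\<lambda>l. signed G n (f (insert x c # l))) cs =
      signed G n (contract G x (\<lambda>l. f (insert x c # l)) cs)"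
    using Cons.prems by (intro Cons.IH) auto
  thus ?case using Cons.prems by (simp add: signed_add signed_signed add.commute)
qed auto

text \<open>The prism identity. Each of the chains in \<open>contract\<close> retains \<open>c\<^sub>n\<close>, so the prism has only one of its
two ends, namely the chain itself.\<close>

lemma contracting_homotopy:
  assumes "\<And>l. f l \<in> carrier G" "l \<noteq> []"
  shows "inner_diff G (contract G x f) l \<oplus> contract G x (inner_diff G f) l = \<ominus> f l"
  using assms
proof (induction l arbitrary: f)
  case (Cons c cs)
  note f = Cons.prems(1)
  define cx where "cx = insert x c"
  show ?case
  proof (cases "cs = []")
    case True
    thus ?thesis using f by (simp add: signed_def)
  next
    case False
    define m where "m = length cs"
    define A where "A = inner_diff G (\<lambda>l. f (cx # c # l)) cs"
    define B where "B = inner_diff G (contract G x (\<lambda>l. f (cx # l))) cs"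
    define C where "C = contract G x f cs"
    define D where "D = f (cx # cs)"
    define E where "E = f (c # cs)"
    define H where "H = contract G x (inner_diff G (\<lambda>l. f (cx # l))) cs"
    have carr: "A \<in> carrier G" "B \<in> carrier G" "C \<in> carrier G" "D \<in> carrier G" "E \<in> carrier G" "H \<in> carrier G"
      using f by (simp_all add: A_def B_def C_def D_def E_def H_def)
    have BH: "B \<oplus> H = \<ominus> D" unfolding B_def H_def D_def using f False by (intro Cons.IH) auto
    have "inner_diff G (contract G x f) (c # cs)
        = inner_diff G (\<lambda>l. contract G x f (c # l)) cs \<oplus> signed G m C"
      using False by (simp add: inner_diff_Cons m_def C_def)
    also have "inner_diff G (\<lambda>l. contract G x f (c # l)) cs
        = inner_diff G (\<lambda>l. signed G (length l) (f (cx # c # l))) cs \<oplus> B"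
      using f unfolding B_def contract.simps cx_def[symmetric] by (intro inner_diff_add) auto
    also have "inner_diff G (\<lambda>l. signed G (length l) (f (cx # c # l))) cs = signed G (m - 1) A"
      using f False by (simp add: inner_diff_signed_length A_def m_def)
    finally have 1: "inner_diff G (contract G x f) (c # cs) = signed G (m - 1) A \<oplus> B \<oplus> signed G m C" .
    have "contract G x (inner_diff G f) (c # cs)
        = signed G m (A \<oplus> signed G m D \<oplus> signed G (Suc m) E) \<oplus> contract G x (\<lambda>l. inner_diff G f (cx # l)) cs"
      using False f by (simp add: inner_diff_Cons m_def A_def D_def E_def cx_def)
    also have "contract G x (\<lambda>l. inner_diff G f (cx # l)) cs
        = contract G x (\<lambda>l. inner_diff G (\<lambda>l. f (cx # l)) l \<oplus> signed G (Suc m) (f l)) cs"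
      by (rule contract_cong_length) (subst inner_diff_Cons, auto simp: m_def)
    also have "\<dots> = H \<oplus> signed G (Suc m) C"
      using f by (simp add: contract_add contract_signed H_def C_def)
    finally have 2: "contract G x (inner_diff G f) (c # cs)
        = signed G m (A \<oplus> signed G m D \<oplus> signed G (Suc m) E) \<oplus> (H \<oplus> signed G (Suc m) C)" .
    have m: "signed G (m - 1) A = \<ominus> signed G m A"
      using False carr by (cases cs) (auto simp: m_def signed_def)
    have s: "signed G m (A \<oplus> signed G m D \<oplus> signed G (Suc m) E) = signed G m A \<oplus> D \<oplus> \<ominus> E"
      using carr by (simp add: signed_add signed_signed) (simp add: signed_def)
    have "inner_diff G (contract G x f) (c # cs) \<oplus> contract G x (inner_diff G f) (c # cs)
        = (\<ominus> signed G m A \<oplus> signed G m A) \<oplus> (signed G m C \<oplus> \<ominus> signed G m C) \<oplus> (B \<oplus> H) \<oplus> D \<oplus> \<ominus> E"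
      unfolding 1 2 m s signed_Suc[OF carr(3)] using carr by (simp add: a_ac)
    also have "\<dots> = \<ominus> E" unfolding BH using carr by (simp add: l_neg r_neg)
    finally show ?thesis by (simp add: E_def)
  qed
qed simp

text \<open>If a chain has a repeated entry, then omitting either copy gives the same chain with opposite signs,
and omitting any other entry leaves a chain with a repetition. The two exceptions are a repetition of
the last entry, which is never omitted, and a first entry equal to \<open>b\<close>, where the other copy is not part
of the list. The two correction terms account for them.\<close>

lemma inner_diff_nonstrict:
  assumes f: "\<And>l. f l \<in> carrier G" and nonstrict: "\<And>l. \<lbrakk>chain b l; \<not> strict_chain b l\<rbrakk> \<Longrightarrow> f l = \<zero>"
    and "chain b (t @ [d, c])" "\<not> strict_chain b (t @ [d, c])"
  shows "inner_diff G f (t @ [d, c]) \<oplus> (if d = c then f (t @ [d]) else \<zero>) =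
    (if hd (t @ [d]) = b then signed G (Suc (length t)) (f (tl (t @ [d, c]))) else \<zero>)"
  using assms
proof (induction t arbitrary: b f)
  case Nil
  have 0: "f [d] = \<zero>" if "d = b" using that by (intro Nil.prems(2)) simp_all
  have eq: "c = d" if "d \<noteq> b" using that Nil.prems(3,4) by auto
  have c: "f l \<in> carrier G" for l by (rule Nil.prems(1))
  show ?case
  proof (cases "d = b")
    case True thus ?thesis using 0 c by (auto simp: signed_def)
  next
    case False thus ?thesis using eq c by (simp add: signed_def l_neg)
  qed
next
  case (Cons c1 t)
  note f = Cons.prems(1) and z = Cons.prems(2)
  let ?s = "signed G (Suc (Suc (length t)))"
  define E where "E = (if d = c then f (c1 # t @ [d]) else \<zero>)"
  have E: "E \<in> carrier G" using f by (simp add: E_def)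
  have Q: "inner_diff G f (c1 # t @ [d, c]) = inner_diff G (\<lambda>l. f (c1 # l)) (t @ [d, c])
      \<oplus> ?s (f (t @ [d, c]))"
    by (simp add: inner_diff_Cons)
  have goal: ?case if "inner_diff G f (c1 # t @ [d, c]) \<oplus> E =
      (if c1 = b then ?s (f (t @ [d, c])) else \<zero>)"
    using that by (cases "d = c"; cases "c1 = b") (simp_all add: E_def)
  have sub: "c1 \<subseteq> b" "chain c1 (t @ [d, c])" using Cons.prems(3) by auto
  show ?case
  proof (cases "c1 = b")
    case True
    have 0: "f (b # l) = \<zero>" if "chain b l" for l using z[of "b # l"] that by auto
    have "inner_diff G (\<lambda>l. f (c1 # l)) (t @ [d, c]) = inner_diff G (\<lambda>l. \<zero>) (t @ [d, c])"
      by (rule inner_diff_cong_chain[OF sub(2)]) (simp add: 0 True)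
    moreover have "f (b # t @ [d]) = \<zero>"
    proof (rule 0)
      have "chain b ((t @ [d]) @ [c])" using sub True by simp
      thus "chain b (t @ [d])" by (rule chain_appendD)
    qed
    ultimately show ?thesis using f by (intro goal) (unfold Q E_def, auto simp: True)
  next
    case False
    have strict: "c1 \<subset> b" using False sub by blast
    have ns: "\<not> strict_chain c1 (t @ [d, c])" using Cons.prems(4) strict by auto
    have IH: "inner_diff G (\<lambda>l. f (c1 # l)) (t @ [d, c]) \<oplus> E =
      (if hd (t @ [d]) = c1 then signed G (Suc (length t)) (f (c1 # tl (t @ [d, c]))) else \<zero>)"
      unfolding E_def using f sub ns by (intro Cons.IH z) (auto simp: strict)
    have rearrange: "inner_diff G f (c1 # t @ [d, c]) \<oplus> E
      = (inner_diff G (\<lambda>l. f (c1 # l)) (t @ [d, c]) \<oplus> E) \<oplus> ?s (f (t @ [d, c]))"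
      using f E by (simp add: Q a_ac)
    show ?thesis
    proof (cases "hd (t @ [d]) = c1")
      case True
      have "f (t @ [d, c]) = f (c1 # tl (t @ [d, c]))" using True by (cases t) auto
      thus ?thesis using False f True
        by (intro goal) (simp add: rearrange IH signed_Suc[of _ "Suc (length t)"] r_neg)
    next
      case hd: False
      have "\<not> strict_chain b (t @ [d, c])"
        using hd ns sub(2) by (cases t) auto
      hence "f (t @ [d, c]) = \<zero>" using chain_mono[OF sub(2,1)] by (intro z)
      thus ?thesis using False hd by (intro goal) (simp add: rearrange IH)
    qed
  qed
qed

text \<open>All chains that occur in \<open>contract\<close> start with the first entry of \<open>l\<close> enlarged by \<open>x\<close>, and their last
two entries differ because \<open>x\<close> does not belong to the last one.\<close>

lemma contract_eq_zero:
  assumes f: "\<And>l. f l \<in> carrier G"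
    and "strict_chain d l" "d \<subseteq> b" "x \<in> b" "x \<notin> last l"
    and zero: "\<And>t. \<lbrakk>chain b t; hd t = insert x (hd l); length t = Suc (length l); last t = last l;
        last (butlast t) \<noteq> last t\<rbrakk> \<Longrightarrow> f t = \<zero>"
  shows "contract G x f l = \<zero>"
  using assms
proof (induction l arbitrary: f b d)
  case (Cons c cs)
  define cx where "cx = insert x c"
  have cxb: "cx \<subseteq> b" using Cons.prems by (auto simp: cx_def)
  have "f (cx # c # cs) = \<zero>"
  proof (rule Cons.prems(6))
    show "chain b (cx # c # cs)"
      using cxb Cons.prems(2) strict_chain_chain[of c cs] by (auto simp: cx_def)
    show "last (butlast (cx # c # cs)) \<noteq> last (cx # c # cs)"
    proof (cases "cs = []")
      case True thus ?thesis using Cons.prems(5) by (auto simp: cx_def)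
    next
      case False
      have "strict_chain c cs" using Cons.prems(2) by simp
      hence "last (butlast (c # cs)) \<noteq> last cs" using False
      proof (induction cs arbitrary: c)
        case (Cons e es)
        thus ?case by (cases "es = []") auto
      qed simp
      thus ?thesis using False by simp
    qed
  qed (auto simp: cx_def)
  moreover have "contract G x (\<lambda>l. f (cx # l)) cs = \<zero>"
  proof (cases "cs = []")
    case False
    show ?thesis
    proof (rule Cons.IH[of _ c cx])
      show "f (cx # t) = \<zero>" if t: "chain cx t" "hd t = insert x (hd cs)" "length t = Suc (length cs)"
        "last t = last cs" "last (butlast t) \<noteq> last t" for t
      proof (rule Cons.prems(6))
        have tn: "t \<noteq> []" "butlast t \<noteq> []" using t(3) False by (cases t; auto)+
        show "chain b (cx # t)" using t(1) cxb by simp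
        show "last (cx # t) = last (c # cs)" using t(4) tn False by simp
        show "last (butlast (cx # t)) \<noteq> last (cx # t)" using t(5) tn by simp
      qed (use t in \<open>auto simp: cx_def\<close>)
    qed (use Cons.prems False in \<open>auto simp: cx_def\<close>)
  qed simp
  ultimately show ?case by (simp add: cx_def)
qed simp

end

subsection \<open>Exactness below the top degree\<close>

context abelian_group
begin

text \<open>The cohomology of the boundary of a simplex, in the form of its barycentric subdivision: the
cochains live on the chains from \<open>b\<close> to \<open>c\<close>, and a cocycle is a coboundary up to its value on a single
complete flag. The proof is by induction on the number of points of \<open>b - c\<close>. Insertion of the point \<open>x\<close>
contracts all chains except those that start with \<open>b - {x}\<close>, where the insertion would produce \<open>b\<close>
itself; these form the same complex for the smaller set \<open>b - {x}\<close>.\<close>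

lemma inner_diff_exact:
  assumes "distinct xs" "b = c \<union> set xs" "c \<inter> set xs = {}" and v: "\<And>l. v l \<in> carrier G"
    and cocycle: "\<And>l. \<lbrakk>strict_chain b l; length l = Suc n; last (b # l) = c\<rbrakk> \<Longrightarrow> inner_diff G v l = \<zero>"
  shows "\<exists>w. (\<forall>l. w l \<in> carrier G) \<and> (\<forall>l. strict_chain b l \<and> length l = n \<and> last (b # l) = c \<and>
    l \<noteq> removal_chain b xs \<longrightarrow> v l = inner_diff G w l)"
  using assms
proof (induction xs arbitrary: b n v)
  case Nil
  have empty: "l = []" if "strict_chain b l" "last (b # l) = c" for l
  proof (rule ccontr)
    assume "l \<noteq> []"
    with strict_chain_last[OF that(1)] that(2) Nil.prems(2) show False by simp
  qed
  show ?case
  proof (intro exI[of _ "\<lambda>_. \<zero>"] conjI allI impI zero_closed)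
    fix l assume l: "strict_chain b l \<and> length l = n \<and> last (b # l) = c \<and> l \<noteq> removal_chain b []"
    from empty[of l] l have False unfolding removal_chain.simps by blast
    thus "v l = inner_diff G (\<lambda>_. \<zero>) l" ..
  qed
next
  case (Cons x xs)
  define a where "a = b - {x}"
  have x: "x \<in> b" "x \<notin> c" and a: "a = c \<union> set xs" and bc: "b \<noteq> c"
    using Cons.prems by (auto simp: a_def)
  note v = Cons.prems(4)
  define good where "good l \<longleftrightarrow> strict_chain b l \<and> length l = n \<and> last (b # l) = c" for l
  show ?case
  proof (cases n)
    case 0
    thus ?thesis using bc by (intro exI[of _ "\<lambda>_. \<zero>"]) auto
  next
    case (Suc n')
    \<comment> \<open>Cutting off makes \<open>v\<close> vanish on the chains that are not strict, as \<open>inner_diff_nonstrict\<close> requires.\<close>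
    define v1 where "v1 l = (if good l then v l else \<zero>)" for l
    have v1: "v1 l \<in> carrier G" for l using v by (simp add: v1_def)
    have cocycle1: "inner_diff G v1 l = \<zero>" if l: "strict_chain b l" "length l = Suc n" "last l = c" for l
    proof -
      have "inner_diff G v1 l = inner_diff G v l"
        by (rule inner_diff_cong_strict[OF l(1)]) (use l in \<open>auto simp: v1_def good_def\<close>)
      also have "\<dots> = \<zero>"
        by (rule Cons.prems(5)) (use l in auto)
      finally show ?thesis .
    qed
    define w1 where "w1 l = \<ominus> contract G x v1 l" for l
    have w1: "w1 l \<in> carrier G" for l using v1 by (simp add: w1_def)
    \<comment> \<open>The homotopy formula applies as long as inserting \<open>x\<close> into the first entry does not produce \<open>b\<close>.\<close>
    have v1_w1: "v1 l = inner_diff G w1 l" if l: "good l" "hd l \<noteq> a" for l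
    proof -
      have ln: "l \<noteq> []" using l Suc by (auto simp: good_def)
      have lc: "last l = c" using l ln by (simp add: good_def)
      have "contract G x (inner_diff G v1) l = \<zero>"
      proof (rule contract_eq_zero[of _ b l b])
        fix t assume t: "chain b t" "hd t = insert x (hd l)" "length t = Suc (length l)" "last t = last l"
          "last (butlast t) \<noteq> last t"
        show "inner_diff G v1 t = \<zero>"
        proof (cases "strict_chain b t")
          case True
          thus ?thesis using t l lc by (intro cocycle1) (auto simp: good_def)
        next
          case False
          have "butlast t \<noteq> []" using t(3) ln by (cases t; cases l) auto
          then obtain u d where "butlast t = u @ [d]" by (metis append_butlast_last_id)
          moreover have "t = butlast t @ [last t]" using t(3) by (metis append_butlast_last_id list.size(3) nat.distinct(1))
          ultimately have u: "t = u @ [d, last t]" by simp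
          hence ut: "hd (u @ [d]) = hd t" by (metis append.assoc append_Cons append_Nil hd_append2 snoc_eq_iff_butlast)
          have "d \<noteq> last t" using t(5) u by (metis \<open>butlast t = u @ [d]\<close> last_snoc)
          moreover have "insert x (hd l) \<noteq> b"
          proof
            assume "insert x (hd l) = b"
            moreover have "hd l \<subset> b" using l ln by (cases l) (auto simp: good_def)
            ultimately have "hd l = a" by (auto simp: a_def)
            thus False using l by simp
          qed
          ultimately show ?thesis
            using inner_diff_nonstrict[of v1 b u d "last t"] v1 u ut t(1,2) False
            by (simp add: v1_def good_def flip: u)
        qed
      qed (use l ln lc v1 x in \<open>auto simp: good_def\<close>)
      hence "inner_diff G (contract G x v1) l = \<ominus> v1 l"
        using contracting_homotopy[of v1 l x, OF v1 ln] v1 by simp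
      thus ?thesis unfolding w1_def using v1 by (simp add: inner_diff_minus)
    qed
    define v2 where "v2 l = v1 l \<ominus> inner_diff G w1 l" for l
    have v2: "v2 l \<in> carrier G" for l using v1 w1 by (simp add: v2_def)
    have v2_zero: "v2 l = \<zero>" if "good l" "hd l \<noteq> a" for l
      using v1_w1[OF that] w1 by (simp add: v2_def a_minus_def r_neg)
    have cocycle2: "inner_diff G v2 l = \<zero>" if l: "strict_chain b l" "length l = Suc n" "last l = c" for l
      unfolding v2_def a_minus_def using v1 w1 cocycle1[OF l]
      by (simp add: inner_diff_add inner_diff_minus inner_diff_inner_diff)
    have as: "a \<subset> b" using x by (auto simp: a_def)
    \<comment> \<open>The remainder lives on chains with first entry \<open>a\<close>; without that entry they are the chains below \<open>a\<close>.\<close>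
    have "\<exists>w. (\<forall>l. w l \<in> carrier G) \<and> (\<forall>l. strict_chain a l \<and> length l = n' \<and> last (a # l) = c \<and>
        l \<noteq> removal_chain a xs \<longrightarrow> v2 (a # l) = inner_diff G w l)"
    proof (rule Cons.IH)
      fix l assume l: "strict_chain a l" "length l = Suc n'" "last (a # l) = c"
      have ln: "l \<noteq> []" using l by auto
      have "good l" "hd l \<noteq> a"
        using l ln Suc as strict_chain_mono[OF l(1), of b] by (cases l; auto simp: good_def)+
      hence "v2 l = \<zero>" by (rule v2_zero)
      moreover have "inner_diff G v2 (a # l) = \<zero>"
        using l ln as Suc by (intro cocycle2) auto
      ultimately show "inner_diff G (\<lambda>l. v2 (a # l)) l = \<zero>"
        using v2 by (simp add: inner_diff_Cons[OF ln])
    qed (use Cons.prems a v2 in auto)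
    then obtain w' where w': "\<And>l. w' l \<in> carrier G"
      "\<And>l. \<lbrakk>strict_chain a l; length l = n'; last (a # l) = c; l \<noteq> removal_chain a xs\<rbrakk> \<Longrightarrow>
        v2 (a # l) = inner_diff G w' l" by blast
    define w2 where "w2 l = (if l \<noteq> [] \<and> hd l = a then w' (tl l) else \<zero>)" for l
    have w2: "w2 l \<in> carrier G" for l using w' by (simp add: w2_def)
    have v2_w2: "v2 l = inner_diff G w2 l" if l: "good l" "l \<noteq> removal_chain b (x # xs)" for l
    proof -
      obtain h t where lt: "l = h # t" using l Suc by (cases l) (auto simp: good_def)
      have ht: "h \<subset> b" "strict_chain h t" "length t = n'" "last (h # t) = c"
        using l Suc by (auto simp: lt good_def)
      have tz: "w2 t = \<zero>" if "t \<noteq> []"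
      proof -
        have "hd t \<subset> h" using ht that by (cases t) auto
        hence "hd t \<noteq> a" using ht by (auto simp: a_def)
        thus ?thesis by (simp add: w2_def)
      qed
      have Q: "inner_diff G w2 l = inner_diff G (\<lambda>l. w2 (h # l)) t"
        using tz w2 by (cases "t = []") (simp_all add: lt inner_diff_Cons)
      show ?thesis
      proof (cases "h = a")
        case True
        have "t \<noteq> removal_chain a xs" using l True by (auto simp: lt a_def)
        hence "v2 l = inner_diff G w' t" using w'(2)[of t] ht by (simp add: lt True)
        thus ?thesis by (simp add: Q True w2_def)
      next
        case False
        have "v2 l = \<zero>" using l False by (intro v2_zero) (auto simp: lt)
        thus ?thesis using False by (simp add: Q w2_def)
      qed
    qed
    have "v l = inner_diff G (\<lambda>l. w1 l \<oplus> w2 l) l" if l: "good l" "l \<noteq> removal_chain b (x # xs)" for l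
    proof -
      have "v l = inner_diff G w1 l \<oplus> v2 l"
        using l v1[of l] v w1 by (simp add: v2_def v1_def a_minus_def) (simp add: a_lcomm r_neg)
      also have "v2 l = inner_diff G w2 l" by (rule v2_w2[OF l])
      finally show ?thesis using w1 w2 by (simp add: inner_diff_add)
    qed
    thus ?thesis using w1 w2
      by (intro exI[of _ "\<lambda>l. w1 l \<oplus> w2 l"]) (auto simp: good_def)
  qed
qed

end

subsection \<open>Signed sums over complete flags\<close>

context abelian_group
begin

lemma finsum_closedI:
  assumes "\<And>x. x \<in> A \<Longrightarrow> f x \<in> carrier G"
  shows "finsum G f A \<in> carrier G"
  by (rule finsum_closed, rule Pi_I, rule assms)

lemma finsum_congI:
  assumes "\<And>x. x \<in> A \<Longrightarrow> f x = g x" "\<And>x. x \<in> A \<Longrightarrow> g x \<in> carrier G"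
  shows "finsum G f A = finsum G g A"
  by (rule finsum_cong'[OF refl], rule Pi_I, rule assms(2), assumption, rule assms(1))

lemma finsum_addI:
  assumes "\<And>x. x \<in> A \<Longrightarrow> f x \<in> carrier G" "\<And>x. x \<in> A \<Longrightarrow> g x \<in> carrier G"
  shows "finsum G (\<lambda>x. f x \<oplus> g x) A = finsum G f A \<oplus> finsum G g A"
  by (rule finsum_addf, rule Pi_I, rule assms(1), assumption, rule Pi_I, rule assms(2))

lemma finsum_insertI:
  assumes "finite A" "a \<notin> A" "f a \<in> carrier G" "\<And>x. x \<in> A \<Longrightarrow> f x \<in> carrier G"
  shows "finsum G f (insert a A) = f a \<oplus> finsum G f A"
  by (rule finsum_insert[where f = f, OF assms(1,2) _ assms(3)], rule Pi_I, rule assms(4))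

text \<open>The terms for \<open>(x, y)\<close> and \<open>(y, x)\<close> cancel. Removing one index with its row and column at a time avoids
a division by two.\<close>

lemma antisymmetric_sum_zero:
  assumes "finite A" and closed: "\<And>x y. \<lbrakk>x \<in> A; y \<in> A; x \<noteq> y\<rbrakk> \<Longrightarrow> h x y \<in> carrier G"
    and anti: "\<And>x y. \<lbrakk>x \<in> A; y \<in> A; x \<noteq> y\<rbrakk> \<Longrightarrow> h y x = \<ominus> h x y"
  shows "(\<Oplus>x\<in>A. \<Oplus>y\<in>A - {x}. h x y) = \<zero>"
  using assms
proof (induction A rule: finite_induct)
  case empty
  show ?case by (rule finsum_empty)
next
  case (insert z A)
  note c = insert.prems(1)
  have neq: "x \<noteq> z" if "x \<in> A" for x using insert.hyps(2) that by metis
  have c1: "h x z \<in> carrier G" "h z x \<in> carrier G" if "x \<in> A" for x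
    using c[of x z] c[of z x] neq[OF that] that by simp_all
  have c0: "h x y \<in> carrier G" if "x \<in> insert z A" "y \<in> insert z A - {x}" for x y
  proof (rule c)
    show "x \<noteq> y" using that(2) by blast
  qed (use that in simp_all)
  have c2: "(\<Oplus>y\<in>A - {x}. h x y) \<in> carrier G" if "x \<in> A" for x
    by (rule finsum_closedI, rule c0) (use that in simp_all)
  have c3: "(\<Oplus>y\<in>insert z A - {x}. h x y) \<in> carrier G" if "x \<in> insert z A" for x
    by (rule finsum_closedI, rule c0) (use that in simp_all)
  have inner: "(\<Oplus>y\<in>insert z A - {x}. h x y) = h x z \<oplus> (\<Oplus>y\<in>A - {x}. h x y)" if x: "x \<in> A" for x
  proof -
    have eq: "insert z A - {x} = insert z (A - {x})" using neq[OF x] by blast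
    show ?thesis unfolding eq
    proof (rule finsum_insertI)
      show "h x y \<in> carrier G" if "y \<in> A - {x}" for y by (rule c0) (use x that in simp_all)
    qed (use insert.hyps c1 x in simp_all)
  qed
  have z: "insert z A - {z} = A" using insert.hyps by auto
  have "(\<Oplus>x\<in>insert z A. \<Oplus>y\<in>insert z A - {x}. h x y)
      = (\<Oplus>y\<in>insert z A - {z}. h z y) \<oplus> (\<Oplus>x\<in>A. \<Oplus>y\<in>insert z A - {x}. h x y)"
    by (rule finsum_insertI[OF insert.hyps(1,2)]) (rule c3, simp)+
  also have "(\<Oplus>x\<in>A. \<Oplus>y\<in>insert z A - {x}. h x y) = (\<Oplus>x\<in>A. h x z \<oplus> (\<Oplus>y\<in>A - {x}. h x y))"
    by (rule finsum_congI) (simp_all only: inner c1 c2 a_closed)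
  also have "\<dots> = (\<Oplus>x\<in>A. h x z) \<oplus> (\<Oplus>x\<in>A. \<Oplus>y\<in>A - {x}. h x y)"
    by (rule finsum_addI) (simp_all only: c1 c2)
  also have "(\<Oplus>x\<in>A. \<Oplus>y\<in>A - {x}. h x y) = \<zero>"
  proof (rule insert.IH)
    show "h x y \<in> carrier G" if "x \<in> A" "y \<in> A" "x \<noteq> y" for x y
      by (rule insert.prems(1)) (use that in simp_all)
    show "h y x = \<ominus> h x y" if "x \<in> A" "y \<in> A" "x \<noteq> y" for x y
      by (rule insert.prems(2)) (use that in simp_all)
  qed
  also have "(\<Oplus>y\<in>insert z A - {z}. h z y) \<oplus> ((\<Oplus>x\<in>A. h x z) \<oplus> \<zero>) = (\<Oplus>x\<in>A. h z x) \<oplus> (\<Oplus>x\<in>A. h x z)"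
    unfolding z by (subst r_zero) (simp_all add: finsum_closedI c1)
  also have "\<dots> = (\<Oplus>x\<in>A. h z x \<oplus> h x z)"
    by (rule finsum_addI[symmetric]) (simp_all only: c1)
  also have "\<dots> = (\<Oplus>x\<in>A. \<zero>)"
  proof (rule finsum_congI)
    fix x assume x: "x \<in> A"
    have "h x z = \<ominus> h z x" by (rule insert.prems(2)) (use x neq[OF x] in simp_all)
    thus "h z x \<oplus> h x z = \<zero>" using c1(2)[OF x] by (simp add: r_neg)
  qed simp
  finally show ?case by simp
qed

lemma finsum_perms_Cons:
  assumes "finite S" "S \<noteq> {}" "\<And>xs. xs \<in> perms S \<Longrightarrow> g xs \<in> carrier G"
  shows "(\<Oplus>xs\<in>perms S. g xs) = (\<Oplus>x\<in>S. \<Oplus>xs\<in>perms (S - {x}). g (x # xs))"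
proof -
  have U: "perms S = (\<Union>x\<in>S. (#) x ` perms (S - {x}))"
  proof (intro equalityI subsetI)
    fix xs assume xs: "xs \<in> perms S"
    moreover have "xs \<noteq> []" using xs assms(2) unfolding perms_def by force
    then obtain y ys where "xs = y # ys" by (cases xs) simp_all
    moreover from this xs have "y \<in> S" "ys \<in> perms (S - {y})" by (simp_all add: perms_def) auto
    ultimately show "xs \<in> (\<Union>x\<in>S. (#) x ` perms (S - {x}))" by blast
  next
    fix xs assume "xs \<in> (\<Union>x\<in>S. (#) x ` perms (S - {x}))"
    then obtain x ys where "x \<in> S" "ys \<in> perms (S - {x})" "xs = x # ys" by blast
    thus "xs \<in> perms S" by (simp add: perms_def insert_absorb)
  qed
  have sub: "x # xs \<in> perms S" if "x \<in> S" "xs \<in> perms (S - {x})" for x xs using that by (auto simp: perms_def)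
  have "(\<Oplus>xs\<in>perms S. g xs) = (\<Oplus>x\<in>S. \<Oplus>xs\<in>(#) x ` perms (S - {x}). g xs)"
  proof (subst U, rule add.finprod_UN_disjoint[OF assms(1)])
    show "finite ((#) x ` perms (S - {x}))" for x using assms(1) by (simp add: finite_perms)
    show "pairwise (\<lambda>x y. disjnt ((#) x ` perms (S - {x})) ((#) y ` perms (S - {y}))) S"
      by (auto simp: pairwise_def disjnt_def)
    show "g xs \<in> carrier G" if x: "x \<in> S" and xs: "xs \<in> (#) x ` perms (S - {x})" for x xs
      by (rule imageE[OF xs]) (simp add: assms(3) sub[OF x])
  qed
  also have "\<dots> = (\<Oplus>x\<in>S. \<Oplus>xs\<in>perms (S - {x}). g (x # xs))"
  proof (rule finsum_congI)
    fix x assume x: "x \<in> S"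
    show "(\<Oplus>xs\<in>(#) x ` perms (S - {x}). g xs) = (\<Oplus>xs\<in>perms (S - {x}). g (x # xs))"
    proof (rule finsum_reindex)
      show "g \<in> (#) x ` perms (S - {x}) \<rightarrow> carrier G"
        by (rule Pi_I, erule imageE) (simp add: assms(3) sub[OF x])
      show "inj_on ((#) x) (perms (S - {x}))" by (rule inj_onI) simp
    qed
    show "(\<Oplus>xs\<in>perms (S - {x}). g (x # xs)) \<in> carrier G"
      by (rule finsum_closedI) (rule assms(3)[OF sub[OF x]])
  qed
  finally show ?thesis .
qed

lemma finsum_perms_rev:
  assumes "\<And>xs. xs \<in> perms S \<Longrightarrow> g xs \<in> carrier G"
  shows "(\<Oplus>xs\<in>perms S. g (rev xs)) = (\<Oplus>xs\<in>perms S. g xs)"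
proof -
  have im: "rev ` perms S = perms S"
  proof (intro equalityI subsetI)
    fix xs assume "xs \<in> perms S"
    hence "rev (rev xs) \<in> rev ` perms S" using perms_rev[of xs S] by (intro imageI) simp
    thus "xs \<in> rev ` perms S" by simp
  next
    fix xs assume "xs \<in> rev ` perms S"
    then obtain ys where "ys \<in> perms S" "xs = rev ys" by (rule imageE)
    thus "xs \<in> perms S" by (simp only: perms_rev)
  qed
  have "(\<Oplus>xs\<in>rev ` perms S. g xs) = (\<Oplus>xs\<in>perms S. g (rev xs))"
  proof (rule finsum_reindex)
    show "g \<in> rev ` perms S \<rightarrow> carrier G" unfolding im by (rule Pi_I) (rule assms)
    show "inj_on rev (perms S)" by simp
  qed
  thus ?thesis by (simp add: im)
qed

lemma finsum_perms_snoc: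
  assumes "finite S" "S \<noteq> {}" "\<And>xs. xs \<in> perms S \<Longrightarrow> g xs \<in> carrier G"
  shows "(\<Oplus>xs\<in>perms S. g xs) = (\<Oplus>x\<in>S. \<Oplus>xs\<in>perms (S - {x}). g (xs @ [x]))"
proof -
  have sub: "xs @ [x] \<in> perms S" if "x \<in> S" "xs \<in> perms (S - {x})" for x xs using that by (auto simp: perms_def)
  have "(\<Oplus>xs\<in>perms S. g xs) = (\<Oplus>xs\<in>perms S. g (rev xs))"
    by (rule finsum_perms_rev[symmetric]) (rule assms(3))
  also have "\<dots> = (\<Oplus>x\<in>S. \<Oplus>xs\<in>perms (S - {x}). g (rev (x # xs)))"
    by (rule finsum_perms_Cons[OF assms(1,2)]) (simp add: assms(3) perms_rev)
  also have "\<dots> = (\<Oplus>x\<in>S. \<Oplus>xs\<in>perms (S - {x}). g (xs @ [x]))"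
  proof (rule finsum_congI)
    fix x assume x: "x \<in> S"
    show "(\<Oplus>xs\<in>perms (S - {x}). g (rev (x # xs))) = (\<Oplus>xs\<in>perms (S - {x}). g (xs @ [x]))"
      unfolding rev.simps by (rule finsum_perms_rev) (rule assms(3)[OF sub[OF x]])
    show "(\<Oplus>xs\<in>perms (S - {x}). g (xs @ [x])) \<in> carrier G"
      by (rule finsum_closedI) (rule assms(3)[OF sub[OF x]])
  qed
  finally show ?thesis .
qed

end

text \<open>Omitting the \<open>i\<close>-th entry of the flag of \<open>x\<^sub>1, \<dots>, x\<^sub>n\<close> gives the same chain as for the word in which
\<open>x\<^sub>i\<close> and \<open>x\<^sub>i\<^sub>+\<^sub>1\<close> are exchanged, and \<open>T\<close> changes sign under this exchange. The induction on \<open>S\<close> splits off the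
first letter: omissions of later entries vanish by the induction hypothesis, and omissions of the first
entry cancel in pairs.\<close>

lemma alternating_sum_inner_diff:
  assumes M: "abelian_group M" and K: "abelian_group K" and S: "finite S"
    and f: "\<And>l. f l \<in> carrier M"
    and closed: "\<And>xs m. \<lbrakk>xs \<in> perms S; m \<in> carrier M\<rbrakk> \<Longrightarrow> T xs m \<in> carrier K"
    and add: "\<And>xs m m'. \<lbrakk>xs \<in> perms S; m \<in> carrier M; m' \<in> carrier M\<rbrakk> \<Longrightarrow>
      T xs (m \<oplus>\<^bsub>M\<^esub> m') = T xs m \<oplus>\<^bsub>K\<^esub> T xs m'"
    and zero: "\<And>xs. xs \<in> perms S \<Longrightarrow> T xs \<zero>\<^bsub>M\<^esub> = \<zero>\<^bsub>K\<^esub>"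
    and swap: "\<And>zs x y ws m. \<lbrakk>zs @ x # y # ws \<in> perms S; m \<in> carrier M\<rbrakk> \<Longrightarrow>
      T (zs @ y # x # ws) m = \<ominus>\<^bsub>K\<^esub> T (zs @ x # y # ws) m"
  shows "(\<Oplus>\<^bsub>K\<^esub>xs\<in>perms S. T xs (inner_diff M f (removal_chain b xs))) = \<zero>\<^bsub>K\<^esub>"
proof -
  interpret M: abelian_group M by fact
  interpret K: abelian_group K by fact
  show ?thesis
    using S f closed add zero swap
  proof (induction "card S" arbitrary: S f b T rule: less_induct)
    case less
    note f = less.prems(2) and closed = less.prems(3) and zero = less.prems(5) and swap = less.prems(6)
    show ?case
    proof (cases "S = {}")
      case True
      hence "perms S = {[]}" by (auto simp: perms_def)
      thus ?thesis using zero[of "[]"] by simp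
    next
      case False
      have sub: "x # xs \<in> perms S" if "x \<in> S" "xs \<in> perms (S - {x})" for x xs using that by (auto simp: perms_def)
      \<comment> \<open>The term in which the first entry is omitted; there is none if it is also the last entry.\<close>
      define e where "e x xs = (if xs = [] then \<zero>\<^bsub>M\<^esub> else signed M (length xs) (f (removal_chain (b - {x}) xs)))" for x xs
      have e: "e x xs \<in> carrier M" for x xs using f by (simp add: e_def)
      let ?Q = "\<lambda>x xs. inner_diff M (\<lambda>l. f ((b - {x}) # l)) (removal_chain (b - {x}) xs)"
      have Q: "?Q x xs \<in> carrier M" for x xs using f by (rule M.inner_diff_closed)
      have Tc: "T (x # xs) m \<in> carrier K" if "x \<in> S" "xs \<in> perms (S - {x})" "m \<in> carrier M" for x xs m
        using closed[OF sub[OF that(1,2)] that(3)] .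
      have split: "T (x # xs) (inner_diff M f (removal_chain b (x # xs)))
          = T (x # xs) (?Q x xs) \<oplus>\<^bsub>K\<^esub> T (x # xs) (e x xs)" if "x \<in> S" "xs \<in> perms (S - {x})" for x xs
      proof -
        have "inner_diff M f (removal_chain b (x # xs)) = ?Q x xs \<oplus>\<^bsub>M\<^esub> e x xs"
          using f by (cases "xs = []") (simp_all add: M.inner_diff_Cons e_def)
        thus ?thesis using less.prems(4)[OF sub[OF that] Q e] by simp
      qed
      have "(\<Oplus>\<^bsub>K\<^esub>xs\<in>perms S. T xs (inner_diff M f (removal_chain b xs)))
          = (\<Oplus>\<^bsub>K\<^esub>x\<in>S. \<Oplus>\<^bsub>K\<^esub>xs\<in>perms (S - {x}). T (x # xs) (inner_diff M f (removal_chain b (x # xs))))"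
        by (rule K.finsum_perms_Cons[OF less.prems(1) False]) (simp add: closed f)
      also have "\<dots> = (\<Oplus>\<^bsub>K\<^esub>x\<in>S. \<Oplus>\<^bsub>K\<^esub>xs\<in>perms (S - {x}). T (x # xs) (e x xs))"
      proof (rule K.finsum_congI)
        fix x assume x: "x \<in> S"
        have ec: "(\<Oplus>\<^bsub>K\<^esub>xs\<in>perms (S - {x}). T (x # xs) (e x xs)) \<in> carrier K"
          by (rule K.finsum_closedI) (rule Tc[OF x _ e])
        have "(\<Oplus>\<^bsub>K\<^esub>xs\<in>perms (S - {x}). T (x # xs) (inner_diff M f (removal_chain b (x # xs))))
            = (\<Oplus>\<^bsub>K\<^esub>xs\<in>perms (S - {x}). T (x # xs) (?Q x xs) \<oplus>\<^bsub>K\<^esub> T (x # xs) (e x xs))"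
          by (rule K.finsum_congI) (simp_all only: split[OF x] Tc[OF x] Q e K.a_closed)
        also have "\<dots> = (\<Oplus>\<^bsub>K\<^esub>xs\<in>perms (S - {x}). T (x # xs) (?Q x xs)) \<oplus>\<^bsub>K\<^esub> (\<Oplus>\<^bsub>K\<^esub>xs\<in>perms (S - {x}). T (x # xs) (e x xs))"
          by (rule K.finsum_addI) (simp_all only: Tc[OF x] Q e)
        also have "(\<Oplus>\<^bsub>K\<^esub>xs\<in>perms (S - {x}). T (x # xs) (?Q x xs)) = \<zero>\<^bsub>K\<^esub>"
        proof (rule less.hyps[of "S - {x}" _ "\<lambda>xs. T (x # xs)"])
          show "card (S - {x}) < card S" using x less.prems(1) by (rule card_Diff1_less[rotated])
          show "finite (S - {x})" using less.prems(1) by simp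
          show "f ((b - {x}) # l) \<in> carrier M" for l by (rule f)
          show "T (x # xs) m \<in> carrier K" if "xs \<in> perms (S - {x})" "m \<in> carrier M" for xs m
            by (rule Tc[OF x that])
          show "T (x # xs) (m \<oplus>\<^bsub>M\<^esub> m') = T (x # xs) m \<oplus>\<^bsub>K\<^esub> T (x # xs) m'"
            if "xs \<in> perms (S - {x})" "m \<in> carrier M" "m' \<in> carrier M" for xs m m'
            by (rule less.prems(4)[OF sub[OF x that(1)] that(2,3)])
          show "T (x # xs) \<zero>\<^bsub>M\<^esub> = \<zero>\<^bsub>K\<^esub>" if "xs \<in> perms (S - {x})" for xs
            by (rule zero[OF sub[OF x that]])
          show "T (x # zs @ z # y # ws) m = \<ominus>\<^bsub>K\<^esub> T (x # zs @ y # z # ws) m"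
            if "zs @ y # z # ws \<in> perms (S - {x})" "m \<in> carrier M" for zs y z ws m
            using swap[of "x # zs" y z ws m] sub[OF x that(1)] that(2) by simp
        qed
        also have "\<zero>\<^bsub>K\<^esub> \<oplus>\<^bsub>K\<^esub> (\<Oplus>\<^bsub>K\<^esub>xs\<in>perms (S - {x}). T (x # xs) (e x xs)) = (\<Oplus>\<^bsub>K\<^esub>xs\<in>perms (S - {x}). T (x # xs) (e x xs))"
          by (rule K.l_zero[OF ec])
        finally show "(\<Oplus>\<^bsub>K\<^esub>xs\<in>perms (S - {x}). T (x # xs) (inner_diff M f (removal_chain b (x # xs))))
            = (\<Oplus>\<^bsub>K\<^esub>xs\<in>perms (S - {x}). T (x # xs) (e x xs))" .
        show "(\<Oplus>\<^bsub>K\<^esub>xs\<in>perms (S - {x}). T (x # xs) (e x xs)) \<in> carrier K" by (rule ec)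
      qed
      also have "\<dots> = \<zero>\<^bsub>K\<^esub>"
      proof (cases "\<exists>x. S = {x}")
        case True
        then obtain x where "S = {x}" by blast
        hence S: "S - {y} = {}" "[y] \<in> perms S" if "y \<in> S" for y using that by (auto simp: perms_def)
        have p: "perms {} = {[]}" by (auto simp: perms_def)
        have "(\<Oplus>\<^bsub>K\<^esub>x\<in>S. \<Oplus>\<^bsub>K\<^esub>xs\<in>perms (S - {x}). T (x # xs) (e x xs)) = (\<Oplus>\<^bsub>K\<^esub>x\<in>S. \<zero>\<^bsub>K\<^esub>)"
          by (rule K.finsum_congI) (simp_all add: S p e_def zero)
        thus ?thesis by simp
      next
        case two: False
        define h where "h x y = (\<Oplus>\<^bsub>K\<^esub>zs\<in>perms (S - {x} - {y}). T (x # y # zs)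
            (signed M (Suc (length zs)) (f ((b - {x} - {y}) # removal_chain (b - {x} - {y}) zs))))" for x y
        have sub2: "x # y # zs \<in> perms S" if "x \<in> S" "y \<in> S - {x}" "zs \<in> perms (S - {x} - {y})" for x y zs
          using that by (auto simp: perms_def)
        have hc: "h x y \<in> carrier K" if "x \<in> S" "y \<in> S - {x}" for x y
          unfolding h_def
          by (rule K.finsum_closedI, rule closed[OF sub2[OF that]]) (simp_all add: f)
        have "(\<Oplus>\<^bsub>K\<^esub>x\<in>S. \<Oplus>\<^bsub>K\<^esub>xs\<in>perms (S - {x}). T (x # xs) (e x xs)) = (\<Oplus>\<^bsub>K\<^esub>x\<in>S. \<Oplus>\<^bsub>K\<^esub>y\<in>S - {x}. h x y)"
        proof (rule K.finsum_congI)
          fix x assume x: "x \<in> S"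
          have ne: "finite (S - {x})" "S - {x} \<noteq> {}" using two x less.prems(1) by auto
          have "(\<Oplus>\<^bsub>K\<^esub>xs\<in>perms (S - {x}). T (x # xs) (e x xs))
              = (\<Oplus>\<^bsub>K\<^esub>y\<in>S - {x}. \<Oplus>\<^bsub>K\<^esub>zs\<in>perms (S - {x} - {y}). T (x # y # zs) (e x (y # zs)))"
            by (rule K.finsum_perms_Cons[OF ne]) (simp only: Tc[OF x] e)
          thus "(\<Oplus>\<^bsub>K\<^esub>xs\<in>perms (S - {x}). T (x # xs) (e x xs)) = (\<Oplus>\<^bsub>K\<^esub>y\<in>S - {x}. h x y)"
            by (simp add: h_def e_def)
          show "(\<Oplus>\<^bsub>K\<^esub>y\<in>S - {x}. h x y) \<in> carrier K" by (rule K.finsum_closedI) (rule hc[OF x])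
        qed
        also have "\<dots> = \<zero>\<^bsub>K\<^esub>"
        proof (rule K.antisymmetric_sum_zero[OF less.prems(1)])
          fix x y assume xy: "x \<in> S" "y \<in> S" "x \<noteq> y"
          have yx: "y \<in> S - {x}" "x \<in> S - {y}" using xy by auto
          show "h x y \<in> carrier K" using hc xy(1) yx(1) .
          have comm: "S - {y} - {x} = S - {x} - {y}" "b - {y} - {x} = b - {x} - {y}" by auto
          define k where "k zs = signed M (Suc (length zs)) (f ((b - {x} - {y}) # removal_chain (b - {x} - {y}) zs))" for zs
          have k: "k zs \<in> carrier M" for zs using f by (simp add: k_def)
          have T1: "T (x # y # zs) (k zs) \<in> carrier K" if "zs \<in> perms (S - {x} - {y})" for zs
            by (rule closed[OF sub2[OF xy(1) yx(1) that] k])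
          have T2: "T (y # x # zs) (k zs) = \<ominus>\<^bsub>K\<^esub> T (x # y # zs) (k zs)" if "zs \<in> perms (S - {x} - {y})" for zs
            using swap[of "[]" x y zs, OF _ k[of zs]] sub2[OF xy(1) yx(1) that] by simp
          have "h y x \<oplus>\<^bsub>K\<^esub> h x y = (\<Oplus>\<^bsub>K\<^esub>zs\<in>perms (S - {x} - {y}). T (y # x # zs) (k zs) \<oplus>\<^bsub>K\<^esub> T (x # y # zs) (k zs))"
            unfolding h_def comm k_def[symmetric]
            by (rule K.finsum_addI[symmetric]) (simp_all only: T1 T2 K.a_inv_closed)
          also have "\<dots> = (\<Oplus>\<^bsub>K\<^esub>zs\<in>perms (S - {x} - {y}). \<zero>\<^bsub>K\<^esub>)"
            by (rule K.finsum_congI) (simp_all add: T1 T2 K.l_neg)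
          finally have "h y x \<oplus>\<^bsub>K\<^esub> h x y = \<zero>\<^bsub>K\<^esub>" by simp
          thus "h y x = \<ominus>\<^bsub>K\<^esub> h x y"
            using K.minus_equality[of "h y x" "h x y"] hc[OF xy(1) yx(1)] hc[OF xy(2) yx(2)] by simp
        qed
        finally show ?thesis .
      qed
      finally show ?thesis .
    qed
  qed
qed

section \<open>Iterates of the comonad as functions on chains\<close>

lemma direct_sum_simps [simp]:
  "carrier (direct_sum I M) = (\<Pi>\<^sub>E i\<in>I. carrier (M i))"
  "\<zero>\<^bsub>direct_sum I M\<^esub> = (\<lambda>i\<in>I. \<zero>\<^bsub>M i\<^esub>)"
  "u \<oplus>\<^bsub>direct_sum I M\<^esub> v = (\<lambda>i\<in>I. u i \<oplus>\<^bsub>M i\<^esub> v i)"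
  "r \<odot>\<^bsub>direct_sum I M\<^esub> u = (\<lambda>i\<in>I. r \<odot>\<^bsub>M i\<^esub> u i)"
  by (simp_all add: direct_sum_def)

lemma direct_sum_module:
  assumes "cring R" "\<And>i. i \<in> I \<Longrightarrow> Module.module R (M i)"
  shows "Module.module R (direct_sum I M)"
proof -
  have ab: "abelian_group (M i)" if "i \<in> I" for i using assms(2)[OF that] by (simp add: module_def)
  note m = module.smult_closed[OF assms(2)] module.smult_l_distr[OF assms(2)] module.smult_r_distr[OF assms(2)]
    module.smult_assoc1[OF assms(2)] module.smult_one[OF assms(2)]
  note g = abelian_groupE[OF ab]
  have sum: "abelian_group (direct_sum I M)"
  proof (rule abelian_groupI)
    fix x assume x: "x \<in> carrier (direct_sum I M)"
    have xi: "x i \<in> carrier (M i)" if "i \<in> I" for i using x that by (auto simp: PiE_iff)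
    show "\<exists>y\<in>carrier (direct_sum I M). y \<oplus>\<^bsub>direct_sum I M\<^esub> x = \<zero>\<^bsub>direct_sum I M\<^esub>"
    proof (rule bexI[of _ "\<lambda>i\<in>I. \<ominus>\<^bsub>M i\<^esub> x i"])
      show "(\<lambda>i\<in>I. \<ominus>\<^bsub>M i\<^esub> x i) \<oplus>\<^bsub>direct_sum I M\<^esub> x = \<zero>\<^bsub>direct_sum I M\<^esub>"
        by (auto simp: fun_eq_iff abelian_group.l_neg[OF ab] xi)
      show "(\<lambda>i\<in>I. \<ominus>\<^bsub>M i\<^esub> x i) \<in> carrier (direct_sum I M)"
        by (auto simp: abelian_group.a_inv_closed[OF ab] xi)
    qed
    show "\<zero>\<^bsub>direct_sum I M\<^esub> \<oplus>\<^bsub>direct_sum I M\<^esub> x = x"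
      using x by (auto simp: fun_eq_iff PiE_iff extensional_def g(5))
    fix y assume y: "y \<in> carrier (direct_sum I M)"
    show "x \<oplus>\<^bsub>direct_sum I M\<^esub> y \<in> carrier (direct_sum I M)" using x y by (auto simp: PiE_iff g(1))
    show "x \<oplus>\<^bsub>direct_sum I M\<^esub> y = y \<oplus>\<^bsub>direct_sum I M\<^esub> x"
      using x y by (auto simp: fun_eq_iff PiE_iff g(4))
    fix z assume z: "z \<in> carrier (direct_sum I M)"
    show "x \<oplus>\<^bsub>direct_sum I M\<^esub> y \<oplus>\<^bsub>direct_sum I M\<^esub> z = x \<oplus>\<^bsub>direct_sum I M\<^esub> (y \<oplus>\<^bsub>direct_sum I M\<^esub> z)"
      using x y z by (auto simp: fun_eq_iff PiE_iff g(3))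
  qed (auto simp: g(2))
  show ?thesis
    by (rule moduleI[OF assms(1) sum]) (auto simp: fun_eq_iff PiE_iff extensional_def m)
qed

lemma direct_sum_proj_hom: "i \<in> I \<Longrightarrow> (\<lambda>u. u i) \<in> mod_hom R (direct_sum I M) (M i)"
  by (rule mod_homI) auto

lemma transported_module:
  assumes M: "Module.module R M" and inv: "\<And>x. e' (e x) = x"
  shows "Module.module R (transported e e' M)"
proof -
  interpret M: Module.module R M by fact
  have ab: "abelian_group (transported e e' M)"
  proof (rule abelian_groupI)
    fix x assume "x \<in> carrier (transported e e' M)"
    then obtain y where "y \<in> carrier M" "x = e y" by (auto simp: transported_def)
    thus "\<exists>y\<in>carrier (transported e e' M). y \<oplus>\<^bsub>transported e e' M\<^esub> x = \<zero>\<^bsub>transported e e' M\<^esub>"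
      by (intro bexI[of _ "e (\<ominus>\<^bsub>M\<^esub> y)"]) (simp_all add: transported_def inv M.M.l_neg)
  qed (auto simp: transported_def inv M.M.a_ac)
  show ?thesis
    by (rule moduleI[OF M.R.is_cring ab])
       (auto simp: transported_def inv M.smult_l_distr M.smult_r_distr M.smult_assoc1)
qed

fun evaluate :: "('x, 'm) iter \<Rightarrow> 'x set list \<Rightarrow> 'm" where
  "evaluate w [] = the_base w"
| "evaluate w (c # cs) = evaluate (component w c) cs"

fun assemble :: "nat \<Rightarrow> 'x set \<Rightarrow> ('x set list \<Rightarrow> 'm) \<Rightarrow> ('x, 'm) iter" where
  "assemble 0 b f = Base (f [])"
| "assemble (Suc n) b f = Family (\<lambda>c\<in>Pow b. assemble n c (\<lambda>l. f (c # l)))"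

lemma evaluate_assemble: "\<lbrakk>chain b l; length l = n\<rbrakk> \<Longrightarrow> evaluate (assemble n b f) l = f l"
  by (induction n b f arbitrary: l rule: assemble.induct) (auto simp: length_Suc_conv)

lemma assemble_cong:
  assumes "\<And>l. \<lbrakk>chain b l; length l = n\<rbrakk> \<Longrightarrow> f l = g l"
  shows "assemble n b f = assemble n b g"
  using assms
proof (induction n arbitrary: b f g)
  case (Suc n)
  have "assemble n c (\<lambda>l. f (c # l)) = assemble n c (\<lambda>l. g (c # l))" if "c \<in> Pow b" for c
    using that by (intro Suc.IH Suc.prems) auto
  thus ?case by (simp add: restrict_def fun_eq_iff)
qed simp

abbreviation level_at :: "('x, 'r, 'm) presheaf \<Rightarrow> nat \<Rightarrow> 'x set \<Rightarrow> ('r, ('x, 'm) iter) module" where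
  "level_at F n b \<equiv> ob ((perp ^^ n) (based F)) b"

lemma ob_based: "ob (based F) b = transported Base the_base (ob F b)"
  by (simp add: based_def)

lemma level_at_Suc: "level_at F (Suc n) b =
    transported Family component (direct_sum (Pow b) (level_at F n))"
  by (simp add: perp_def)

text \<open>The description of \<open>\<perp>\<^sup>n F (b)\<close> by functions on chains, on which all further computations rest: an
element is determined by its values, and the value on a chain lies in \<open>F\<close> of the last subset of the chain,
which is \<open>b\<close> for the empty chain.\<close>

lemma level_carrier_iff:
  "w \<in> carrier (level_at F n b) \<longleftrightarrow> w = assemble n b (evaluate w) \<and>
    (\<forall>l. chain b l \<and> length l = n \<longrightarrow> evaluate w l \<in> carrier (ob F (last (b # l))))"
proof (induction n arbitrary: b w)
  case 0
  show ?case by (cases w) (auto simp: ob_based transported_def)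
next
  case (Suc n)
  let ?R = "w = assemble (Suc n) b (evaluate w) \<and>
    (\<forall>l. chain b l \<and> length l = Suc n \<longrightarrow> evaluate w l \<in> carrier (ob F (last (b # l))))"
  have "w \<in> carrier (level_at F (Suc n) b) \<longleftrightarrow>
      (\<exists>u. w = Family u \<and> u \<in> extensional (Pow b) \<and> (\<forall>c\<in>Pow b. u c \<in> carrier (level_at F n c)))"
    unfolding level_at_Suc transported_def by (auto simp: PiE_iff)
  also have "\<dots> \<longleftrightarrow> ?R"
  proof
    assume "\<exists>u. w = Family u \<and> u \<in> extensional (Pow b) \<and> (\<forall>c\<in>Pow b. u c \<in> carrier (level_at F n c))"
    then obtain u where u: "w = Family u" "u \<in> extensional (Pow b)" "\<And>c. c \<in> Pow b \<Longrightarrow> u c \<in> carrier (level_at F n c)"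
      by blast
    note c = Suc.IH[THEN iffD1, OF u(3)]
    have u_eq: "u = (\<lambda>c\<in>Pow b. assemble n c (\<lambda>l. evaluate w (c # l)))"
    proof
      fix c show "u c = (\<lambda>c\<in>Pow b. assemble n c (\<lambda>l. evaluate w (c # l))) c"
      proof (cases "c \<in> Pow b")
        case True
        have "(\<lambda>c\<in>Pow b. assemble n c (\<lambda>l. evaluate w (c # l))) c = assemble n c (evaluate (u c))"
          using True by (simp add: u(1))
        thus ?thesis using c[OF True] by metis
      next
        case False
        thus ?thesis using u(2) by (simp add: extensional_def)
      qed
    qed
    have closed: "evaluate w l \<in> carrier (ob F (last (b # l)))" if h: "chain b l" "length l = Suc n" for l
    proof -
      obtain d cs where l: "l = d # cs" using h(2) by (cases l) auto
      have "d \<in> Pow b" "chain d cs" "length cs = n" using h l by auto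
      thus ?thesis using c[of d, THEN conjunct2, rule_format, of cs] by (simp add: l u(1))
    qed
    have "w = assemble (Suc n) b (evaluate w)"
      unfolding assemble.simps(2) u_eq[symmetric] by (rule u(1))
    thus ?R using closed by blast
  next
    assume R: ?R
    define u where "u = (\<lambda>c\<in>Pow b. assemble n c (\<lambda>l. evaluate w (c # l)))"
    have w: "w = Family u"
      unfolding u_def by (rule R[THEN conjunct1, unfolded assemble.simps(2)])
    have "u c \<in> carrier (level_at F n c)" if "c \<in> Pow b" for c
    proof (rule Suc.IH[THEN iffD2], intro conjI allI impI)
      have ev: "evaluate (u c) l = evaluate w (c # l)" if "chain c l \<and> length l = n" for l
        using that \<open>c \<in> Pow b\<close> by (simp add: u_def evaluate_assemble)
      show "u c = assemble n c (evaluate (u c))"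
      proof -
        have "u c = assemble n c (\<lambda>l. evaluate w (c # l))" using \<open>c \<in> Pow b\<close> by (simp add: u_def)
        also have "\<dots> = assemble n c (evaluate (u c))" by (rule assemble_cong) (simp add: ev)
        finally show ?thesis .
      qed
      show "evaluate (u c) l \<in> carrier (ob F (last (c # l)))" if "chain c l \<and> length l = n" for l
        using R[THEN conjunct2, rule_format, of "c # l"] that \<open>c \<in> Pow b\<close> ev[OF that] by simp
    qed
    moreover have "u \<in> extensional (Pow b)" by (simp add: u_def)
    ultimately show "\<exists>u. w = Family u \<and> u \<in> extensional (Pow b) \<and> (\<forall>c\<in>Pow b. u c \<in> carrier (level_at F n c))"
      using w by (intro exI[of _ u] conjI ballI)
  qed
  finally show ?case .
qed

lemma level_evaluate_closed:
  "\<lbrakk>w \<in> carrier (level_at F n b); chain b l; length l = n\<rbrakk> \<Longrightarrow> evaluate w l \<in> carrier (ob F (last (b # l)))"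
  using level_carrier_iff by blast

lemma level_eqI:
  assumes "w \<in> carrier (level_at F n b)" "w' \<in> carrier (level_at F n b)"
    and "\<And>l. \<lbrakk>chain b l; length l = n\<rbrakk> \<Longrightarrow> evaluate w l = evaluate w' l"
  shows "w = w'"
proof -
  have "w = assemble n b (evaluate w)" "w' = assemble n b (evaluate w')"
    using assms(1,2) level_carrier_iff by blast+
  thus ?thesis using assemble_cong[of b n "evaluate w" "evaluate w'"] assms(3) by metis
qed

lemma assemble_carrier:
  assumes "\<And>l. \<lbrakk>chain b l; length l = n\<rbrakk> \<Longrightarrow> f l \<in> carrier (ob F (last (b # l)))"
  shows "assemble n b f \<in> carrier (level_at F n b)"
proof -
  have "assemble n b f = assemble n b (evaluate (assemble n b f))"
    by (rule assemble_cong) (simp add: evaluate_assemble)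
  thus ?thesis using assms by (intro level_carrier_iff[THEN iffD2]) (simp add: evaluate_assemble)
qed

lemma evaluate_add:
  "\<lbrakk>chain b l; length l = n\<rbrakk> \<Longrightarrow> evaluate (w \<oplus>\<^bsub>level_at F n b\<^esub> w') l =
    evaluate w l \<oplus>\<^bsub>ob F (last (b # l))\<^esub> evaluate w' l"
proof (induction n arbitrary: b l w w')
  case 0 thus ?case by (simp add: ob_based transported_def)
next
  case (Suc n)
  then obtain d cs where "l = d # cs" by (cases l) auto
  thus ?case using Suc by (simp add: level_at_Suc transported_def del: funpow.simps)
qed

lemma evaluate_smult:
  "\<lbrakk>chain b l; length l = n\<rbrakk> \<Longrightarrow> evaluate (r \<odot>\<^bsub>level_at F n b\<^esub> w) l =
    r \<odot>\<^bsub>ob F (last (b # l))\<^esub> evaluate w l"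
proof (induction n arbitrary: b l w)
  case 0 thus ?case by (simp add: ob_based transported_def)
next
  case (Suc n)
  then obtain d cs where "l = d # cs" by (cases l) auto
  thus ?case using Suc by (simp add: level_at_Suc transported_def del: funpow.simps)
qed

lemma level_zero: "\<zero>\<^bsub>level_at F n b\<^esub> = assemble n b (\<lambda>l. \<zero>\<^bsub>ob F (last (b # l))\<^esub>)"
proof (induction n arbitrary: b)
  case 0 thus ?case by (simp add: ob_based transported_def)
next
  case (Suc n)
  thus ?case by (simp add: level_at_Suc transported_def del: funpow.simps)
qed

lemma evaluate_zero:
  "\<lbrakk>chain b l; length l = n\<rbrakk> \<Longrightarrow> evaluate \<zero>\<^bsub>level_at F n b\<^esub> l = \<zero>\<^bsub>ob F (last (b # l))\<^esub>"
  by (simp add: level_zero evaluate_assemble)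

lemma evaluate_hom:
  "\<lbrakk>chain b l; length l = n\<rbrakk> \<Longrightarrow>
    (\<lambda>w. evaluate w l) \<in> mod_hom R (level_at F n b) (ob F (last (b # l)))"
  by (rule mod_homI) (simp_all only: level_evaluate_closed evaluate_add evaluate_smult)

lemma chain_member_subset: "\<lbrakk>chain c cs; d \<in> set cs\<rbrakk> \<Longrightarrow> d \<subseteq> c"
proof (induction cs arbitrary: c)
  case (Cons e es)
  thus ?case using Cons.IH[of e] by auto
qed simp

lemma evaluate_mor:
  assumes "f \<in> Sigma_maps a b" "chain a l" "length l = n"
  shows "evaluate (mor ((perp ^^ n) (based F)) a b f w) l =
    mor F (last (a # l)) (f ` last (a # l)) (restrict f (last (a # l))) (evaluate w (map (image f) l))"
  using assms
proof (induction n arbitrary: a b f l w)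
  case 0
  have "f ` a = b" "restrict f a = f"
    using 0(1) by (auto simp: Sigma_maps_def bij_betw_def PiE_iff extensional_restrict)
  thus ?case using 0 by (simp add: based_def)
next
  case (Suc n)
  then obtain c cs where l: "l = c # cs" "length cs = n" by (cases l) auto
  have c: "c \<subseteq> a" "chain c cs" using Suc.prems l by auto
  have f: "restrict f c \<in> Sigma_maps c (f ` c)"
    using Suc.prems(1) c(1) by (auto simp: Sigma_maps_def bij_betw_def inj_on_def PiE_iff image_def)
  have sub: "d \<subseteq> c" if "d \<in> set cs" for d by (rule chain_member_subset[OF c(2) that])
  have im: "restrict f c ` d = f ` d" if "d \<subseteq> c" for d using that by auto
  define e where "e = last (c # cs)"
  have e: "e \<subseteq> c" unfolding e_def using chain_last_subset[OF c(2)] .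
  have map: "map (image (restrict f c)) cs = map (image f) cs"
    by (rule map_cong[OF refl], rule im, rule sub)
  have res: "restrict (restrict f c) e = restrict f e"
    using e by (simp add: restrict_restrict Int_absorb1)
  have last: "last (a # l) = e" by (simp add: l(1) e_def)
  have "evaluate (mor ((perp ^^ Suc n) (based F)) a b f w) l
      = evaluate (mor ((perp ^^ n) (based F)) c (f ` c) (restrict f c) (component w (f ` c))) cs"
    using c by (simp add: l perp_def)
  also have "\<dots> = mor F e (restrict f c ` e) (restrict (restrict f c) e)
      (evaluate (component w (f ` c)) (map (image (restrict f c)) cs))"
    unfolding e_def by (rule Suc.IH[OF f c(2) l(2)])
  also have "\<dots> = mor F e (f ` e) (restrict f e) (evaluate w (map (image f) l))"
    by (simp only: map res im[OF e] l(1) list.map evaluate.simps)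
  finally show ?case by (simp only: last)
qed

lemma level_module:
  assumes "cring R" "\<And>c. c \<subseteq> b \<Longrightarrow> Module.module R (ob F c)"
  shows "Module.module R (level_at F n b)"
  using assms(2)
proof (induction n arbitrary: b)
  case 0
  thus ?case unfolding funpow.simps id_apply ob_based by (intro transported_module) auto
next
  case (Suc n)
  thus ?case unfolding level_at_Suc by (intro transported_module direct_sum_module assms(1) Suc.IH) auto
qed

subsection \<open>Cofaces and codegeneracies\<close>

text \<open>The chain with its entry number \<open>j\<close> repeated, where \<open>b\<close> counts as entry number \<open>0\<close>.\<close>

fun repeat_at :: "'x set \<Rightarrow> nat \<Rightarrow> 'x set list \<Rightarrow> 'x set list" where
  "repeat_at b 0 l = b # l"
| "repeat_at b (Suc j) [] = []"
| "repeat_at b (Suc j) (c # cs) = c # repeat_at c j cs"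

fun remove_at :: "nat \<Rightarrow> 'x set list \<Rightarrow> 'x set list" where
  "remove_at j [] = []"
| "remove_at 0 (c # cs) = cs"
| "remove_at (Suc j) (c # cs) = c # remove_at j cs"

lemma perp_map_Suc: "(perp_map ^^ Suc j) \<tau> = perp_map ((perp_map ^^ j) \<tau>)"
  by simp

lemma perp_map_assemble:
  "perp_map \<tau> b (assemble (Suc n) b f) = Family (\<lambda>c\<in>Pow b. \<tau> c (assemble n c (\<lambda>l. f (c # l))))"
  by (auto simp: perp_map_def restrict_def)

lemma restrict_cong': "(\<And>x. x \<in> A \<Longrightarrow> f x = g x) \<Longrightarrow> restrict f A = restrict g A"
  by (auto simp: restrict_def)

lemma codeg_assemble:
  "j \<le> n \<Longrightarrow> (perp_map ^^ j) counit b (assemble (Suc n) b f) = assemble n b (\<lambda>l. f (repeat_at b j l))"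
proof (induction j arbitrary: n b f)
  case 0 thus ?case by (simp add: counit_def)
next
  case (Suc j)
  then obtain n' where n: "n = Suc n'" by (cases n) auto
  hence j: "j \<le> n'" using Suc.prems by simp
  have "(perp_map ^^ Suc j) counit b (assemble (Suc n) b f)
      = Family (\<lambda>c\<in>Pow b. (perp_map ^^ j) counit c (assemble (Suc n') c (\<lambda>l. f (c # l))))"
    by (simp only: perp_map_Suc n perp_map_assemble)
  also have "\<dots> = Family (\<lambda>c\<in>Pow b. assemble (n') c (\<lambda>l. f (c # repeat_at c j l)))"
    by (simp only: Suc.IH[OF j])
  finally show ?case by (simp add: n)
qed

lemma comult_assemble:
  "j \<le> n \<Longrightarrow> (perp_map ^^ j) comult b (assemble (Suc n) b f) = assemble (Suc (Suc n)) b (\<lambda>l. f (remove_at j l))"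
proof (induction j arbitrary: n b f)
  case 0 thus ?case by (auto simp: comult_def restrict_def fun_eq_iff)
next
  case (Suc j)
  then obtain n' where n: "n = Suc n'" by (cases n) auto
  hence j: "j \<le> n'" using Suc.prems by simp
  have "(perp_map ^^ Suc j) comult b (assemble (Suc n) b f)
      = Family (\<lambda>c\<in>Pow b. (perp_map ^^ j) comult c (assemble (Suc n') c (\<lambda>l. f (c # l))))"
    by (simp only: perp_map_Suc n perp_map_assemble)
  also have "\<dots> = Family (\<lambda>c\<in>Pow b. assemble (Suc (Suc n')) c (\<lambda>l. f (c # remove_at j l)))"
    by (simp only: Suc.IH[OF j])
  finally show ?case by (simp add: n)
qed

abbreviation restriction :: "('x, 'r, 'm) presheaf \<Rightarrow> 'x set \<Rightarrow> 'x set \<Rightarrow> 'm \<Rightarrow> 'm" where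
  "restriction F c b \<equiv> mor F c b (\<lambda>x\<in>c. x)"

lemma coaction_assemble:
  "(perp_map ^^ n) (coaction (based F)) b (assemble n b f) =
    assemble (Suc n) b (\<lambda>l. restriction F (last l) (last (b # butlast l)) (f (butlast l)))"
proof (induction n arbitrary: b f)
  case 0 thus ?case by (simp add: coaction_def based_def restrict_def fun_eq_iff)
next
  case (Suc n)
  have "assemble (Suc n) c (\<lambda>l. restriction F (last l) (last (c # butlast l)) (f (c # butlast l)))
      = assemble (Suc n) c (\<lambda>l. restriction F (last (c # l)) (last (b # butlast (c # l))) (f (butlast (c # l))))" for c
    by (rule assemble_cong) auto
  thus ?case unfolding perp_map_Suc perp_map_assemble Suc.IH assemble.simps(2)[of "Suc n"]
    by (simp only:)
qed

lemma coaug_assemble: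
  "coaug ((perp ^^ n) (based F)) b (assemble n b f) =
    assemble (Suc n) b (\<lambda>l. if hd l = b then f (tl l) else \<zero>\<^bsub>ob F (last l)\<^esub>)"
  unfolding coaug_def assemble.simps(2) level_zero
  by (auto intro!: restrict_cong' assemble_cong)

section \<open>The normalized cochain complex\<close>

lemma signed_hom:
  assumes "h \<in> mod_hom R M N" "Module.module R M" "Module.module R N" "x \<in> carrier M"
  shows "h (signed M n x) = signed N n (h x)"
  using mod_hom_minus[OF assms] by (simp add: signed_def)

lemma inner_diff_hom:
  assumes h: "h \<in> mod_hom R M N" and M: "Module.module R M" and N: "Module.module R N"
    and "\<And>l. f l \<in> carrier M"
  shows "h (inner_diff M f l) = inner_diff N (\<lambda>l. h (f l)) l"
  using assms(4)
proof (induction l arbitrary: f rule: induct_list012)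
  case (3 c d cs)
  interpret M: Module.module R M by fact
  have "h (inner_diff M (\<lambda>l. f (c # l)) (d # cs)) = inner_diff N (\<lambda>l. h (f (c # l))) (d # cs)"
    by (rule "3.IH"(2)) (rule "3.prems")
  thus ?case using "3.prems"
    by (simp add: mod_hom_add[OF h] signed_hom[OF h M N])
qed (simp_all add: mod_hom_zero[OF h M N])

lemma inner_diff_map: "inner_diff G f (map g l) = inner_diff G (\<lambda>l. f (map g l)) l"
  by (induction l arbitrary: f rule: induct_list012) auto

lemma repeat_at_props:
  assumes "chain b l" "j \<le> length l"
  shows "chain b (repeat_at b j l)" "length (repeat_at b j l) = Suc (length l)"
    "\<not> strict_chain b (repeat_at b j l)" "last (b # repeat_at b j l) = last (b # l)"
  using assms by (induction b j l rule: repeat_at.induct) auto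

text \<open>Together with \<open>repeat_at_props\<close> this identifies the chains seen by the codegeneracies: they are the
chains that are not strict.\<close>

lemma nonstrict_repeat_at:
  assumes "chain b l" "\<not> strict_chain b l"
  shows "\<exists>j l'. l = repeat_at b j l' \<and> chain b l' \<and> j \<le> length l'"
  using assms
proof (induction l arbitrary: b)
  case (Cons c cs)
  show ?case
  proof (cases "c = b")
    case True
    show ?thesis by (rule exI[of _ 0], rule exI[of _ cs]) (use Cons.prems True in simp)
  next
    case False
    hence "\<not> strict_chain c cs" using Cons.prems by auto
    then obtain j l' where "cs = repeat_at c j l'" "chain c l'" "j \<le> length l'"
      using Cons.IH Cons.prems by fastforce
    thus ?thesis by (intro exI[of _ "Suc j"] exI[of _ "c # l'"]) (use Cons.prems in simp)
  qed
qed simp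

lemma assemble_eq_iff:
  "assemble n b f = assemble n b g \<longleftrightarrow> (\<forall>l. chain b l \<and> length l = n \<longrightarrow> f l = g l)"
  using assemble_cong[of b n f g] evaluate_assemble[of b _ n f] evaluate_assemble[of b _ n g] by metis

lemma chain_image:
  assumes f: "f \<in> Sigma_maps a b" and l: "chain a l"
  shows chain_map_image: "chain b (map (image f) l)"
    and last_map_image: "last (b # map (image f) l) = f ` last (a # l)"
    and strict_chain_map_image: "strict_chain b (map (image f) l) \<longleftrightarrow> strict_chain a l"
proof -
  have fa: "f ` a = b" and inj: "inj_on f a" using f by (auto simp: Sigma_maps_def bij_betw_def)
  have "chain (f ` d) (map (image f) l) \<and> last (f ` d # map (image f) l) = f ` last (d # l) \<and>
      (strict_chain (f ` d) (map (image f) l) \<longleftrightarrow> strict_chain d l)" if "d \<subseteq> a" "chain d l" for d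
    using that
  proof (induction l arbitrary: d)
    case (Cons e es)
    have e: "e \<subseteq> d" "e \<subseteq> a" "chain e es" using Cons.prems by auto
    have "f ` e \<subset> f ` d \<longleftrightarrow> e \<subset> d"
      using e Cons.prems(1) inj inj_on_image_eq_iff[of f a e d] by (simp add: psubset_eq image_mono)
    thus ?case using Cons.IH[OF e(2,3)] e(1) by (simp add: image_mono)
  qed simp
  from this[of a] l show "chain b (map (image f) l)" "last (b # map (image f) l) = f ` last (a # l)"
    "strict_chain b (map (image f) l) \<longleftrightarrow> strict_chain a l" by (simp_all only: fa subset_refl)
qed

lemma Sigma_maps_restrict: "\<lbrakk>f \<in> Sigma_maps a b; c \<subseteq> a\<rbrakk> \<Longrightarrow> restrict f c \<in> Sigma_maps c (f ` c)"
  by (auto simp: Sigma_maps_def bij_betw_def inj_on_def PiE_iff image_def)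

lemma Sigma_maps_FI_maps: "f \<in> Sigma_maps a b \<Longrightarrow> f \<in> FI_maps a b"
  by (auto simp: Sigma_maps_def FI_maps_def bij_betw_def)

lemma inclusion_FI_maps: "c \<subseteq> b \<Longrightarrow> (\<lambda>x\<in>c. x) \<in> FI_maps c b"
  by (auto simp: FI_maps_def inj_on_def)

text \<open>The common kernel of the codegeneracies, in terms of values on chains.\<close>

definition normal :: "('x, 'r, 'm) presheaf \<Rightarrow> nat \<Rightarrow> 'x set \<Rightarrow> ('x, 'm) iter \<Rightarrow> bool" where
  "normal F n b w \<longleftrightarrow> w \<in> carrier (level_at F n b) \<and>
     (\<forall>l. chain b l \<and> length l = n \<and> \<not> strict_chain b l \<longrightarrow> evaluate w l = \<zero>\<^bsub>ob F (last (b # l))\<^esub>)"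

abbreviation normalized_cobar :: "('x, 'r, 'm) presheaf \<Rightarrow> ('x, 'r, ('x, 'm) iter) cochain" where
  "normalized_cobar F \<equiv> normalized (opposite (cobar F))"

lemma normalized_cobar_carrier:
  "w \<in> carrier (ob (coch (normalized_cobar F) n) b) \<longleftrightarrow> normal F n b w"
proof (cases n)
  case 0
  thus ?thesis by (auto simp: normalized_def normalized_term_def opposite_def cobar_def normal_def)
next
  case (Suc m)
  have "w \<in> carrier (ob (coch (normalized_cobar F) n) b) \<longleftrightarrow> w \<in> carrier (level_at F n b) \<and>
      (\<forall>j<n. (perp_map ^^ (m - j)) counit b w = \<zero>\<^bsub>level_at F m b\<^esub>)"
    by (simp add: normalized_def normalized_term_def opposite_def cobar_def Suc del: funpow.simps)
  also have "\<dots> \<longleftrightarrow> w \<in> carrier (level_at F n b) \<and>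
      (\<forall>j\<le>m. (perp_map ^^ j) counit b w = \<zero>\<^bsub>level_at F m b\<^esub>)"
  proof -
    have reindex: "(\<forall>j<n. P (m - j)) \<longleftrightarrow> (\<forall>j\<le>m. P j)" for P :: "nat \<Rightarrow> bool"
    proof (intro iffI allI impI)
      fix j assume *: "\<forall>j<n. P (m - j)" and j: "j \<le> m"
      have "m - j < n" "m - (m - j) = j" using j Suc by simp_all
      thus "P j" using *[rule_format, of "m - j"] by simp
    qed simp
    show ?thesis
      by (simp only: reindex[of "\<lambda>j. (perp_map ^^ j) counit b w = \<zero>\<^bsub>level_at F m b\<^esub>"])
  qed
  also have "\<dots> \<longleftrightarrow> w \<in> carrier (level_at F n b) \<and>
      (\<forall>j\<le>m. \<forall>l. chain b l \<and> length l = m \<longrightarrow> evaluate w (repeat_at b j l) = \<zero>\<^bsub>ob F (last (b # l))\<^esub>)"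
  proof (rule conj_cong[OF refl])
    assume "w \<in> carrier (level_at F n b)"
    hence w: "w = assemble (Suc m) b (evaluate w)" using level_carrier_iff Suc by blast
    have eq: "(perp_map ^^ j) counit b w = assemble m b (\<lambda>l. evaluate w (repeat_at b j l))" if "j \<le> m" for j
      using codeg_assemble[OF that, of b "evaluate w"] by (simp only: w[symmetric])
    show "(\<forall>j\<le>m. (perp_map ^^ j) counit b w = \<zero>\<^bsub>level_at F m b\<^esub>) \<longleftrightarrow>
        (\<forall>j\<le>m. \<forall>l. chain b l \<and> length l = m \<longrightarrow> evaluate w (repeat_at b j l) = \<zero>\<^bsub>ob F (last (b # l))\<^esub>)"
      by (rule all_cong1, rule imp_cong[OF refl]) (simp only: eq level_zero assemble_eq_iff)
  qed
  also have "\<dots> \<longleftrightarrow> normal F n b w"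
    unfolding normal_def
  proof (rule conj_cong[OF refl], intro iffI allI impI)
    fix l assume *: "\<forall>j\<le>m. \<forall>l. chain b l \<and> length l = m \<longrightarrow> evaluate w (repeat_at b j l) = \<zero>\<^bsub>ob F (last (b # l))\<^esub>"
      and l: "chain b l \<and> length l = n \<and> \<not> strict_chain b l"
    obtain j l' where l': "l = repeat_at b j l'" "chain b l'" "j \<le> length l'"
      using nonstrict_repeat_at l by blast
    have "length l' = m" using repeat_at_props(2)[OF l'(2,3)] l Suc l'(1) by simp
    hence "evaluate w (repeat_at b j l') = \<zero>\<^bsub>ob F (last (b # l'))\<^esub>"
      using *[rule_format, of j l'] l'(2,3) by blast
    thus "evaluate w l = \<zero>\<^bsub>ob F (last (b # l))\<^esub>"
      unfolding l'(1) repeat_at_props(4)[OF l'(2,3)] .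
  next
    fix j l assume *: "\<forall>l. chain b l \<and> length l = n \<and> \<not> strict_chain b l \<longrightarrow> evaluate w l = \<zero>\<^bsub>ob F (last (b # l))\<^esub>"
      and j: "j \<le> m" and l: "chain b l \<and> length l = m"
    have jl: "j \<le> length l" and cl: "chain b l" using j l by auto
    show "evaluate w (repeat_at b j l) = \<zero>\<^bsub>ob F (last (b # l))\<^esub>"
      using *[rule_format, of "repeat_at b j l"] repeat_at_props[OF cl jl] l Suc by simp
  qed
  finally show ?thesis .
qed

lemma normalized_cobar_simps:
  "\<zero>\<^bsub>ob (coch (normalized_cobar F) n) b\<^esub> = \<zero>\<^bsub>level_at F n b\<^esub>"
  "v \<oplus>\<^bsub>ob (coch (normalized_cobar F) n) b\<^esub> w = v \<oplus>\<^bsub>level_at F n b\<^esub> w"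
  "r \<odot>\<^bsub>ob (coch (normalized_cobar F) n) b\<^esub> w = r \<odot>\<^bsub>level_at F n b\<^esub> w"
  "mor (coch (normalized_cobar F) n) = mor ((perp ^^ n) (based F))"
  by (simp_all add: normalized_def normalized_term_def opposite_def cobar_def del: funpow.simps)

lemma mor_assemble: "mor ((perp ^^ n) (based F)) a b f w = assemble n a (evaluate (mor ((perp ^^ n) (based F)) a b f w))"
proof (induction n arbitrary: a b f w)
  case 0 thus ?case by (simp add: based_def)
next
  case (Suc n)
  let ?G = "(perp ^^ n) (based F)"
  have mor_eq: "mor ((perp ^^ Suc n) (based F)) a b f w
      = Family (\<lambda>c\<in>Pow a. mor ?G c (f ` c) (restrict f c) (component w (f ` c)))"
    by (simp add: perp_def)
  have "Family (\<lambda>c\<in>Pow a. mor ?G c (f ` c) (restrict f c) (component w (f ` c)))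
      = assemble (Suc n) a (evaluate (Family (\<lambda>c\<in>Pow a. mor ?G c (f ` c) (restrict f c) (component w (f ` c)))))"
    unfolding assemble.simps(2)
  proof (rule arg_cong[of _ _ Family], rule restrict_cong')
    fix c assume c: "c \<in> Pow a"
    show "mor ?G c (f ` c) (restrict f c) (component w (f ` c)) = assemble n c
        (\<lambda>l. evaluate (Family (\<lambda>c\<in>Pow a. mor ?G c (f ` c) (restrict f c) (component w (f ` c)))) (c # l))"
      using c by (subst Suc.IH) simp
  qed
  thus ?case unfolding mor_eq .
qed

locale FI_functor = op_module FI_maps R F
  for R :: "('r, 'q) ring_scheme" (structure) and F :: "('x, 'r, 'm) presheaf"
begin

lemma ob_abelian_group: "finite a \<Longrightarrow> abelian_group (ob F a)"
  using ob_module by (simp add: module_def)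

lemma restriction_hom:
  "\<lbrakk>finite b; c \<subseteq> b\<rbrakk> \<Longrightarrow> restriction F c b \<in> mod_hom R (ob F b) (ob F c)"
  by (rule mor_hom[OF finite_subset _ inclusion_FI_maps])

lemma restriction_comp:
  assumes "finite b" "d \<subseteq> b" "c \<subseteq> d" "v \<in> carrier (ob F b)"
  shows "restriction F c d (restriction F d b v) = restriction F c b v"
proof -
  have fin: "finite d" "finite c"
    using finite_subset[OF assms(2,1)] finite_subset[OF assms(3)] by simp_all
  have "compose c (\<lambda>x\<in>d. x) (\<lambda>x\<in>c. x) = (\<lambda>x\<in>c. x)"
    using assms(3) by (auto simp: compose_def fun_eq_iff)
  thus ?thesis
    using mor_comp[OF fin(2,1) assms(1) inclusion_FI_maps[OF assms(3)] inclusion_FI_maps[OF assms(2)] assms(4)]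
    by simp
qed

lemma Sigma_mor_hom:
  "\<lbrakk>finite a; finite b; f \<in> Sigma_maps a b\<rbrakk> \<Longrightarrow> mor F a b f \<in> mod_hom R (ob F b) (ob F a)"
  by (rule mor_hom[OF _ _ Sigma_maps_FI_maps])

lemma restriction_natural:
  assumes a: "finite a" and f: "f \<in> Sigma_maps a b" and c: "c \<subseteq> a" and v: "v \<in> carrier (ob F b)"
  shows "restriction F c a (mor F a b f v) = mor F c (f ` c) (restrict f c) (restriction F (f ` c) b v)"
proof -
  have b: "f ` a = b" using f by (auto simp: Sigma_maps_def bij_betw_def)
  have fin: "finite c" "finite b" "finite (f ` c)"
    using finite_subset[OF c a] finite_imageI[OF a, of f] b by simp_all
  have sub: "f ` c \<subseteq> b" using b c by blast
  have "restriction F c a (mor F a b f v) = mor F c b (compose c f (\<lambda>x\<in>c. x)) v"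
    using mor_comp[OF fin(1) a fin(2) inclusion_FI_maps[OF c] Sigma_maps_FI_maps[OF f] v] by simp
  also have "compose c f (\<lambda>x\<in>c. x) = compose c (\<lambda>x\<in>f ` c. x) (restrict f c)"
    by (auto simp: compose_def fun_eq_iff)
  also have "mor F c b \<dots> v = mor F c (f ` c) (restrict f c) (restriction F (f ` c) b v)"
    by (rule mor_comp[OF fin(1,3,2) Sigma_maps_FI_maps[OF Sigma_maps_restrict[OF f c]] inclusion_FI_maps[OF sub] v])
  finally show ?thesis .
qed

lemma level_at_module: "finite b \<Longrightarrow> Module.module R (level_at F n b)"
  by (rule level_module[OF is_cring], rule ob_module, rule finite_subset)

lemma last_chain_finite: "\<lbrakk>finite b; chain b l\<rbrakk> \<Longrightarrow> finite (last (b # l))"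
  by (rule finite_subset[OF chain_last_subset])

lemma evaluate_minus:
  assumes "finite b" "chain b l" "length l = n" "w \<in> carrier (level_at F n b)"
  shows "evaluate (\<ominus>\<^bsub>level_at F n b\<^esub> w) l = \<ominus>\<^bsub>ob F (last (b # l))\<^esub> evaluate w l"
  by (rule mod_hom_minus[OF evaluate_hom[OF assms(2,3)] level_at_module[OF assms(1)]
        ob_module[OF last_chain_finite[OF assms(1,2)]] assms(4)])

lemma normal_submodule:
  assumes b: "finite b"
  shows "submodule {w. normal F n b w} R (level_at F n b)"
proof -
  interpret L: Module.module R "level_at F n b" by (rule level_at_module[OF b])
  have g: "abelian_group (ob F (last (b # l)))" "Module.module R (ob F (last (b # l)))" if "chain b l" for l
    using ob_abelian_group[OF last_chain_finite[OF b that]] ob_module[OF last_chain_finite[OF b that]] .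
  have minus_zero: "\<ominus>\<^bsub>G\<^esub> \<zero>\<^bsub>G\<^esub> = \<zero>\<^bsub>G\<^esub>" if "abelian_group G" for G :: "('r, 'm) module"
  proof -
    interpret abelian_group G by fact
    show ?thesis by simp
  qed
  show ?thesis
  proof (rule L.submoduleI)
    show "{w. normal F n b w} \<subseteq> carrier (level_at F n b)" by (auto simp: normal_def)
    show "\<zero>\<^bsub>level_at F n b\<^esub> \<in> {w. normal F n b w}" by (simp add: normal_def evaluate_zero)
    show "\<ominus>\<^bsub>level_at F n b\<^esub> w \<in> {w. normal F n b w}" if "w \<in> {w. normal F n b w}" for w
      using that evaluate_minus[OF b] minus_zero[OF g(1)] by (simp add: normal_def)
    show "v \<oplus>\<^bsub>level_at F n b\<^esub> w \<in> {w. normal F n b w}"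
      if "v \<in> {w. normal F n b w}" "w \<in> {w. normal F n b w}" for v w
      using that abelian_groupE(5)[OF g(1) abelian_groupE(2)[OF g(1)]]
      by (simp add: normal_def evaluate_add)
    show "r \<odot>\<^bsub>level_at F n b\<^esub> w \<in> {w. normal F n b w}" if "r \<in> carrier R" "w \<in> {w. normal F n b w}" for r w
      using that module.smult_r_null[OF g(2)] by (simp add: normal_def evaluate_smult)
  qed
qed

lemma normalized_cobar_module:
  assumes b: "finite b"
  shows "Module.module R (ob (coch (normalized_cobar F) n) b)"
proof -
  have "Module.module R ((level_at F n b)\<lparr>carrier := {w. normal F n b w}\<rparr>)"
    by (rule submodule.submodule_is_module[OF normal_submodule[OF b] level_at_module[OF b]])
  moreover have "ob (coch (normalized_cobar F) n) b =
      (level_at F n b)\<lparr>carrier := carrier (ob (coch (normalized_cobar F) n) b)\<rparr>"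
    by (simp add: normalized_def normalized_term_def opposite_def cobar_def del: funpow.simps)
  moreover have "carrier (ob (coch (normalized_cobar F) n) b) = {w. normal F n b w}"
    using normalized_cobar_carrier by blast
  ultimately show ?thesis by simp
qed

lemma normal_mor:
  assumes a: "finite a" and f: "f \<in> Sigma_maps a b" and w: "normal F n b w"
  shows "normal F n a (mor ((perp ^^ n) (based F)) a b f w)"
proof -
  let ?w = "mor ((perp ^^ n) (based F)) a b f w"
  have hom: "mor F (last (a # l)) (f ` last (a # l)) (restrict f (last (a # l)))
      \<in> mod_hom R (ob F (f ` last (a # l))) (ob F (last (a # l)))" if "chain a l" for l
    by (intro Sigma_mor_hom Sigma_maps_restrict[OF f] finite_imageI last_chain_finite[OF a that]
        chain_last_subset[OF that])
  have wc: "w \<in> carrier (level_at F n b)" using w by (simp add: normal_def)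
  have ev: "evaluate w (map (image f) l) \<in> carrier (ob F (f ` last (a # l)))" if "chain a l" "length l = n" for l
    using level_evaluate_closed[OF wc chain_map_image[OF f that(1)]] that(2) last_map_image[OF f that(1)] by simp
  have "?w \<in> carrier (level_at F n a)"
  proof (rule level_carrier_iff[THEN iffD2], intro conjI allI impI)
    show "?w = assemble n a (evaluate ?w)" by (rule mor_assemble)
    fix l assume l: "chain a l \<and> length l = n"
    show "evaluate ?w l \<in> carrier (ob F (last (a # l)))"
      unfolding evaluate_mor[OF f l[THEN conjunct1] l[THEN conjunct2]]
      by (rule mod_hom_closed[OF hom ev]) (use l in simp_all)
  qed
  moreover have "evaluate ?w l = \<zero>\<^bsub>ob F (last (a # l))\<^esub>"
    if l: "chain a l" "length l = n" "\<not> strict_chain a l" for l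
  proof -
    have "evaluate w (map (image f) l) = \<zero>\<^bsub>ob F (f ` last (a # l))\<^esub>"
      using w chain_map_image[OF f l(1)] strict_chain_map_image[OF f l(1)] last_map_image[OF f l(1)] l
      by (simp add: normal_def)
    thus ?thesis unfolding evaluate_mor[OF f l(1,2)]
      using mod_hom_zero[OF hom[OF l(1)] ob_module ob_module] last_chain_finite[OF a l(1)] by simp
  qed
  ultimately show ?thesis by (simp add: normal_def)
qed

lemma normalized_cobar_eqI:
  assumes "normal F n b v" "normal F n b w"
    and "\<And>l. \<lbrakk>strict_chain b l; length l = n\<rbrakk> \<Longrightarrow> evaluate v l = evaluate w l"
  shows "v = w"
proof (rule level_eqI)
  show "v \<in> carrier (level_at F n b)" "w \<in> carrier (level_at F n b)" using assms by (auto simp: normal_def)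
  fix l assume l: "chain b l" "length l = n"
  show "evaluate v l = evaluate w l"
    using assms l by (cases "strict_chain b l") (simp_all add: normal_def)
qed

lemma normalized_cobar_op_module: "Sigma_op_module R (coch (normalized_cobar F) n)"
proof (intro op_module.intro op_module_axioms.intro is_cring normalized_cobar_module)
  let ?G = "(perp ^^ n) (based F)"
  fix a b :: "'x set" and f
  assume a: "finite a" and b: "finite b" and f: "f \<in> Sigma_maps a b"
  have hom: "mor F (last (a # l)) (f ` last (a # l)) (restrict f (last (a # l)))
      \<in> mod_hom R (ob F (f ` last (a # l))) (ob F (last (a # l)))" if "chain a l" for l
    by (intro Sigma_mor_hom Sigma_maps_restrict[OF f] finite_imageI last_chain_finite[OF a that]
        chain_last_subset[OF that])
  show "mor (coch (normalized_cobar F) n) a b f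
      \<in> mod_hom R (ob (coch (normalized_cobar F) n) b) (ob (coch (normalized_cobar F) n) a)"
    unfolding normalized_cobar_simps
  proof (rule mod_homI, unfold normalized_cobar_carrier normalized_cobar_simps)
    interpret A: Module.module R "ob (coch (normalized_cobar F) n) a" by (rule normalized_cobar_module[OF a])
    interpret B: Module.module R "ob (coch (normalized_cobar F) n) b" by (rule normalized_cobar_module[OF b])
    note Aclosed = A.M.a_closed A.smult_closed
    note Ac = Aclosed[unfolded normalized_cobar_carrier normalized_cobar_simps]
    note Bclosed = B.M.a_closed B.smult_closed
    note Bc = Bclosed[unfolded normalized_cobar_carrier normalized_cobar_simps]
    note nm = normal_mor[OF a f]
    have ev: "evaluate w (map (image f) l) \<in> carrier (ob F (f ` last (a # l)))"
      if "normal F n b w" "strict_chain a l" "length l = n" for l w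
      using level_evaluate_closed[of w n F b, OF _ chain_map_image[OF f strict_chain_chain[OF that(2)]]]
        that last_map_image[OF f strict_chain_chain[OF that(2)]] by (simp add: normal_def)
    fix v assume v: "normal F n b v"
    show "normal F n a (mor ?G a b f v)" by (rule nm[OF v])
    {
      fix w assume w: "normal F n b w"
      show "mor ?G a b f (v \<oplus>\<^bsub>level_at F n b\<^esub> w) = mor ?G a b f v \<oplus>\<^bsub>level_at F n a\<^esub> mor ?G a b f w"
      proof (rule normalized_cobar_eqI[OF nm[OF Bc(1)[OF v w]] Ac(1)[OF nm[OF v] nm[OF w]]])
        fix l assume l: "strict_chain a l" "length l = n"
        note c = strict_chain_chain[OF l(1)]
        show "evaluate (mor ?G a b f (v \<oplus>\<^bsub>level_at F n b\<^esub> w)) l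
            = evaluate (mor ?G a b f v \<oplus>\<^bsub>level_at F n a\<^esub> mor ?G a b f w) l"
          using chain_map_image[OF f c] last_map_image[OF f c] l(2) ev[OF v l] ev[OF w l]
          by (simp add: evaluate_mor[OF f c] evaluate_add c mod_hom_add[OF hom[OF c]] del: last.simps)
      qed
    }
    fix r assume r: "r \<in> carrier R"
    show "mor ?G a b f (r \<odot>\<^bsub>level_at F n b\<^esub> v) = r \<odot>\<^bsub>level_at F n a\<^esub> mor ?G a b f v"
    proof (rule normalized_cobar_eqI[OF nm[OF Bc(2)[OF r v]] Ac(2)[OF r nm[OF v]]])
      fix l assume l: "strict_chain a l" "length l = n"
      note c = strict_chain_chain[OF l(1)]
      show "evaluate (mor ?G a b f (r \<odot>\<^bsub>level_at F n b\<^esub> v)) l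
          = evaluate (r \<odot>\<^bsub>level_at F n a\<^esub> mor ?G a b f v) l"
        using chain_map_image[OF f c] last_map_image[OF f c] l(2) ev[OF v l] r
        by (simp add: evaluate_mor[OF f c] evaluate_smult c mod_hom_smult[OF hom[OF c]] del: last.simps)
    qed
  qed
next
  let ?G = "(perp ^^ n) (based F)"
  fix a :: "'x set" and v
  assume a: "finite a" and "v \<in> carrier (ob (coch (normalized_cobar F) n) a)"
  hence v: "normal F n a v" by (simp only: normalized_cobar_carrier)
  have f: "(\<lambda>x\<in>a. x) \<in> Sigma_maps a a" by (auto simp: Sigma_maps_def bij_betw_def inj_on_def)
  show "mor (coch (normalized_cobar F) n) a a (\<lambda>x\<in>a. x) v = v"
    unfolding normalized_cobar_simps
  proof (rule normalized_cobar_eqI[OF normal_mor[OF a f v] v])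
    fix l assume l: "strict_chain a l" "length l = n"
    note c = strict_chain_chain[OF l(1)]
    define e where "e = last (a # l)"
    have e: "e \<subseteq> a" unfolding e_def by (rule chain_last_subset[OF c])
    have "map (image (\<lambda>x\<in>a. x)) l = map id l"
    proof (rule map_cong[OF refl])
      fix d assume "d \<in> set l"
      hence "d \<subseteq> a" using chain_member_subset[OF c] by blast
      thus "(\<lambda>x\<in>a. x) ` d = id d" by auto
    qed
    moreover have "(\<lambda>x\<in>a. x) ` e = e" "restrict (\<lambda>x\<in>a. x) e = (\<lambda>x\<in>e. x)"
      using e by (auto simp: Int_absorb1)
    moreover have "evaluate v l \<in> carrier (ob F e)" unfolding e_def
      using v l(2) c by (intro level_evaluate_closed) (auto simp: normal_def)
    moreover have "finite e" by (rule finite_subset[OF e a])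
    ultimately show "evaluate (mor ?G a a (\<lambda>x\<in>a. x) v) l = evaluate v l"
      unfolding evaluate_mor[OF f c l(2)] e_def[symmetric] by (simp add: mor_id)
  qed
next
  let ?G = "(perp ^^ n) (based F)"
  fix a b c :: "'x set" and f g v
  assume a: "finite a" and b: "finite b" and c: "finite c" and f: "f \<in> Sigma_maps a b" and g: "g \<in> Sigma_maps b c"
    and "v \<in> carrier (ob (coch (normalized_cobar F) n) c)"
  hence v: "normal F n c v" by (simp only: normalized_cobar_carrier)
  have fa: "f ` a = b" using f by (auto simp: Sigma_maps_def bij_betw_def)
  have "compose a g f \<in> a \<rightarrow>\<^sub>E c"
    using f g by (auto simp: Sigma_maps_def PiE_iff compose_def)
  moreover have "bij_betw (compose a g f) a c"
    using f g unfolding Sigma_maps_def by (blast intro: bij_betw_compose)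
  ultimately have gf: "compose a g f \<in> Sigma_maps a c" by (simp add: Sigma_maps_def)
  show "mor (coch (normalized_cobar F) n) a c (compose a g f) v
      = mor (coch (normalized_cobar F) n) a b f (mor (coch (normalized_cobar F) n) b c g v)"
    unfolding normalized_cobar_simps
  proof (rule normalized_cobar_eqI[OF normal_mor[OF a gf v] normal_mor[OF a f normal_mor[OF b g v]]])
    fix l assume l: "strict_chain a l" "length l = n"
    note ch = strict_chain_chain[OF l(1)]
    define e where "e = last (a # l)"
    have e: "e \<subseteq> a" unfolding e_def by (rule chain_last_subset[OF ch])
    have fe: "f ` e \<subseteq> b" using e fa by blast
    have im: "compose a g f ` d = g ` f ` d" if "d \<subseteq> a" for d using that by (auto simp: compose_def)
    have map: "map (image (compose a g f)) l = map (image g) (map (image f) l)"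
      unfolding map_map
      by (rule map_cong[OF refl]) (use chain_member_subset[OF ch] im in simp)
    note chf = chain_map_image[OF f ch]
    have lf: "last (b # map (image f) l) = f ` e" unfolding e_def by (rule last_map_image[OF f ch])
    have vc: "evaluate v (map (image g) (map (image f) l)) \<in> carrier (ob F (g ` f ` e))"
      using level_evaluate_closed[of v n F c, OF _ chain_map_image[OF g chf]] v l(2) last_map_image[OF g chf] lf
      by (simp add: normal_def)
    have fin: "finite e" "finite (f ` e)" "finite (g ` f ` e)"
      using finite_subset[OF e a] by simp_all
    have "evaluate (mor ?G a b f (mor ?G b c g v)) l = mor F e (f ` e) (restrict f e)
        (mor F (f ` e) (g ` f ` e) (restrict g (f ` e)) (evaluate v (map (image g) (map (image f) l))))"
      using evaluate_mor[OF f ch l(2), of F "mor ?G b c g v"] evaluate_mor[OF g chf, of n F v] l(2)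
      by (simp only: e_def[symmetric] lf length_map)
    also have "\<dots> = mor F e (g ` f ` e) (compose e (restrict g (f ` e)) (restrict f e))
        (evaluate v (map (image g) (map (image f) l)))"
      by (rule mor_comp[OF fin Sigma_maps_FI_maps[OF Sigma_maps_restrict[OF f e]]
            Sigma_maps_FI_maps[OF Sigma_maps_restrict[OF g fe]] vc, symmetric])
    also have "compose e (restrict g (f ` e)) (restrict f e) = restrict (compose a g f) e"
      using e by (auto simp: compose_def fun_eq_iff)
    finally have eq: "evaluate (mor ?G a b f (mor ?G b c g v)) l = mor F e (g ` f ` e) (restrict (compose a g f) e)
        (evaluate v (map (image g) (map (image f) l)))" .
    show "evaluate (mor ?G a c (compose a g f) v) l = evaluate (mor ?G a b f (mor ?G b c g v)) l"
      unfolding evaluate_mor[OF gf ch l(2)] e_def[symmetric] map im[OF e] by (rule eq[symmetric])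
  qed
qed

end

subsection \<open>The differential\<close>

lemma remove_at_props:
  assumes "chain b l" "Suc j < length l"
  shows "chain b (remove_at j l)" "Suc (length (remove_at j l)) = length l"
    "last (remove_at j l) = last l" "remove_at j l \<noteq> []"
proof -
  have "chain b (remove_at j l) \<and> Suc (length (remove_at j l)) = length l \<and>
    last (remove_at j l) = last l \<and> remove_at j l \<noteq> []"
    using assms
  proof (induction j l arbitrary: b rule: remove_at.induct)
    case (2 c cs)
    thus ?case using chain_mono[of c cs b] by auto
  next
    case (3 j c cs)
    thus ?case by auto
  qed simp
  thus "chain b (remove_at j l)" "Suc (length (remove_at j l)) = length l"
    "last (remove_at j l) = last l" "remove_at j l \<noteq> []" by blast+
qed

lemma (in abelian_group) inner_diff_finsum:
  assumes "length l = Suc n" "\<And>l'. f l' \<in> carrier G"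
  shows "(\<Oplus>i\<in>{1..n}. signed G i (f (remove_at (n - i) l))) = inner_diff G f l"
  using assms
proof (induction n arbitrary: l f)
  case 0
  then obtain c where "l = [c]" by (cases l) auto
  thus ?case by simp
next
  case (Suc n)
  obtain c cs where l: "l = c # cs" "length cs = Suc n" using Suc.prems(1) by (cases l) auto
  have set: "{1..Suc n} = insert (Suc n) {1..n}" by auto
  have "(\<Oplus>i\<in>{1..Suc n}. signed G i (f (remove_at (Suc n - i) l)))
      = signed G (Suc n) (f (remove_at (Suc n - Suc n) l)) \<oplus> (\<Oplus>i\<in>{1..n}. signed G i (f (remove_at (Suc n - i) l)))"
    unfolding set by (rule finsum_insertI) (simp_all add: Suc.prems(2))
  also have "(\<Oplus>i\<in>{1..n}. signed G i (f (remove_at (Suc n - i) l)))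
      = (\<Oplus>i\<in>{1..n}. signed G i (f (c # remove_at (n - i) cs)))"
    by (rule finsum_congI) (simp_all add: l Suc_diff_le Suc.prems(2))
  also have "\<dots> = inner_diff G (\<lambda>l. f (c # l)) cs"
    by (rule Suc.IH[of cs "\<lambda>l. f (c # l)"]) (simp_all add: l Suc.prems(2))
  finally show ?case
    using l Suc.prems(2) inner_diff_Cons[of cs f c] by (cases cs) (simp_all add: a_comm)
qed

context FI_functor
begin

abbreviation Cobar where "Cobar \<equiv> normalized_cobar F"

text \<open>The part of a cochain on the chains with last subset \<open>c\<close>, extended by zero. All its values lie in the
single module \<open>F(c)\<close>, so that the inner differential applies to it.\<close>

definition chain_value :: "nat \<Rightarrow> 'x set \<Rightarrow> 'x set \<Rightarrow> ('x, 'm) iter \<Rightarrow> 'x set list \<Rightarrow> 'm" where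
  "chain_value n b c w l =
    (if chain b l \<and> length l = n \<and> last (b # l) = c then evaluate w l else \<zero>\<^bsub>ob F c\<^esub>)"

lemma chain_value_closed:
  assumes "w \<in> carrier (level_at F n b)" "finite c"
  shows "chain_value n b c w l \<in> carrier (ob F c)"
  using level_evaluate_closed[OF assms(1), of l] abelian_groupE(2)[OF ob_abelian_group[OF assms(2)]]
  by (auto simp: chain_value_def)

lemma chain_value_eq: "\<lbrakk>chain b l; length l = n; last (b # l) = c\<rbrakk> \<Longrightarrow> chain_value n b c w l = evaluate w l"
  by (simp add: chain_value_def)

text \<open>The differential on strict chains: the inner differential plus the term in which the last entry is
omitted and the value is restricted.\<close>

definition diff_value :: "nat \<Rightarrow> 'x set \<Rightarrow> ('x, 'm) iter \<Rightarrow> 'x set list \<Rightarrow> 'm" where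
  "diff_value n b w l = inner_diff (ob F (last l)) (chain_value n b (last l) w) l \<oplus>\<^bsub>ob F (last l)\<^esub>
     restriction F (last l) (last (b # butlast l)) (evaluate w (butlast l))"

lemma chain_butlast: "chain b l \<Longrightarrow> chain b (butlast l)"
  by (cases "l = []") (auto intro: chain_appendD[of b "butlast l" "[last l]"])

lemma chain_last_butlast:
  assumes "chain b l" "l \<noteq> []" shows "last l \<subseteq> last (b # butlast l)"
  using assms
proof (induction l arbitrary: b)
  case (Cons c cs)
  thus ?case by (cases "cs = []") auto
qed simp

text \<open>In the opposite numbering, the coface \<open>0\<close> is the coaction and the coface \<open>n + 1\<close> is the coaugmentation;
the coface \<open>i\<close> in between omits the entry with index \<open>n - i\<close>.\<close>

lemma coface_terms:
  assumes b: "finite b" and w: "w \<in> carrier (level_at F n b)" and i: "i \<le> Suc n"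
  shows coface_closed: "coface (opposite (cobar F)) n i b w \<in> carrier (level_at F (Suc n) b)"
    and evaluate_coface: "\<lbrakk>chain b l; length l = Suc n\<rbrakk> \<Longrightarrow>
      evaluate (coface (opposite (cobar F)) n i b w) l =
        (if i = 0 then restriction F (last l) (last (b # butlast l)) (evaluate w (butlast l))
         else if i = Suc n then (if hd l = b then evaluate w (tl l) else \<zero>\<^bsub>ob F (last l)\<^esub>)
         else chain_value n b (last l) w (remove_at (n - i) l))"
proof -
  let ?v = "\<lambda>l. if i = 0 then restriction F (last l) (last (b # butlast l)) (evaluate w (butlast l))
         else if i = Suc n then (if hd l = b then evaluate w (tl l) else \<zero>\<^bsub>ob F (last l)\<^esub>)
         else chain_value n b (last l) w (remove_at (n - i) l)"
  have w_eq: "w = assemble n b (evaluate w)" using w level_carrier_iff[of w n F b] by blast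
  consider "i = 0" | "i = Suc n" | "0 < i" "i \<le> n" using i by linarith
  hence eq: "coface (opposite (cobar F)) n i b w = assemble (Suc n) b ?v"
  proof cases
    case 1
    have "coface (opposite (cobar F)) n i b w = (perp_map ^^ n) (coaction (based F)) b w"
      by (simp add: 1 opposite_def cobar_def del: funpow.simps)
    also have "\<dots> = assemble (Suc n) b (\<lambda>l. restriction F (last l) (last (b # butlast l)) (evaluate w (butlast l)))"
      using coaction_assemble[of n F b "evaluate w"] by (simp only: w_eq[symmetric])
    finally show ?thesis using 1 by simp
  next
    case 2
    have "coface (opposite (cobar F)) n i b w = coaug ((perp ^^ n) (based F)) b w"
      by (simp add: 2 opposite_def cobar_def del: funpow.simps)
    also have "\<dots> = assemble (Suc n) b (\<lambda>l. if hd l = b then evaluate w (tl l) else \<zero>\<^bsub>ob F (last l)\<^esub>)"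
      using coaug_assemble[of n F b "evaluate w"] by (simp only: w_eq[symmetric])
    finally show ?thesis using 2 by simp
  next
    case 3
    then obtain m where n: "n = Suc m" by (cases n) auto
    have j: "n - i \<le> m" using 3 n by simp
    have "coface (opposite (cobar F)) n i b w = (perp_map ^^ (n - i)) comult b w"
      using 3 by (simp add: opposite_def cobar_def del: funpow.simps)
    also have "\<dots> = assemble (Suc n) b (\<lambda>l. evaluate w (remove_at (n - i) l))"
      using comult_assemble[OF j, of b "evaluate w"] by (simp only: w_eq[symmetric] n[symmetric])
    also have "\<dots> = assemble (Suc n) b ?v"
    proof (rule assemble_cong)
      fix l assume l: "chain b l" "length l = Suc n"
      have "Suc (n - i) < length l" using 3 l(2) by simp
      note r = remove_at_props[OF l(1) this]
      show "evaluate w (remove_at (n - i) l) = ?v l"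
        using 3 r l(2) by (simp add: chain_value_def)
    qed
    finally show ?thesis .
  qed
  have closed: "?v l \<in> carrier (ob F (last l))" if l: "chain b l" "length l = Suc n" for l
  proof -
    have ln: "l \<noteq> []" using l(2) by auto
    have fin: "finite (last l)" using last_chain_finite[OF b l(1)] ln by simp
    have "restriction F (last l) (last (b # butlast l)) (evaluate w (butlast l)) \<in> carrier (ob F (last l))"
      using last_chain_finite[OF b chain_butlast[OF l(1)]] chain_last_butlast[OF l(1) ln] l(2)
      by (intro mod_hom_closed[OF restriction_hom] level_evaluate_closed[OF w] chain_butlast[OF l(1)]) simp_all
    moreover have "evaluate w (tl l) \<in> carrier (ob F (last l))" if h: "hd l = b"
    proof -
      obtain cs where cs: "l = b # cs" using ln h by (cases l) auto
      show ?thesis using level_evaluate_closed[OF w, of cs] l by (simp add: cs)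
    qed
    moreover have "\<zero>\<^bsub>ob F (last l)\<^esub> \<in> carrier (ob F (last l))"
      by (rule abelian_groupE(2)[OF ob_abelian_group[OF fin]])
    moreover have "chain_value n b (last l) w (remove_at (n - i) l) \<in> carrier (ob F (last l))"
      by (rule chain_value_closed[OF w fin])
    ultimately show ?thesis by simp
  qed
  show "coface (opposite (cobar F)) n i b w \<in> carrier (level_at F (Suc n) b)"
    unfolding eq
  proof (rule assemble_carrier)
    fix l assume l: "chain b l" "length l = Suc n"
    hence "last (b # l) = last l" by auto
    thus "?v l \<in> carrier (ob F (last (b # l)))" using closed[OF l] by (simp only:)
  qed
  show "evaluate (coface (opposite (cobar F)) n i b w) l = ?v l" if "chain b l" "length l = Suc n"
    unfolding eq by (rule evaluate_assemble[OF that])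
qed

lemma evaluate_signed:
  assumes "finite b" "chain b l" "length l = n" "w \<in> carrier (level_at F n b)"
  shows "evaluate (if even i then w else \<ominus>\<^bsub>level_at F n b\<^esub> w) l = signed (ob F (last (b # l))) i (evaluate w l)"
  using evaluate_minus[OF assms] by (simp add: signed_def)

lemma diff_closed_evaluate:
  assumes b: "finite b" and w: "w \<in> carrier (level_at F n b)"
  shows diff_level_closed: "diff Cobar n b w \<in> carrier (level_at F (Suc n) b)"
    and evaluate_diff: "\<lbrakk>chain b l; length l = Suc n\<rbrakk> \<Longrightarrow> evaluate (diff Cobar n b w) l =
      diff_value n b w l \<oplus>\<^bsub>ob F (last l)\<^esub> (if hd l = b then signed (ob F (last l)) (Suc n) (evaluate w (tl l)) else \<zero>\<^bsub>ob F (last l)\<^esub>)"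
proof -
  let ?L = "level_at F (Suc n) b"
  interpret L: Module.module R ?L by (rule level_at_module[OF b])
  let ?d = "\<lambda>i. coface (opposite (cobar F)) n i b w"
  let ?t = "\<lambda>i. if even i then ?d i else \<ominus>\<^bsub>?L\<^esub> ?d i"
  have diff: "diff Cobar n b w = (\<Oplus>\<^bsub>?L\<^esub>i\<in>{..Suc n}. ?t i)"
  proof -
    have lev: "level (opposite (cobar F)) (Suc n) = (perp ^^ Suc n) (based F)"
      by (simp only: opposite_def cobar_def cosimplicial.simps)
    show ?thesis
      by (simp only: normalized_def Let_def cochain.simps Suc_eq_plus1[symmetric] lev)
  qed
  have t: "?t i \<in> carrier ?L" if "i \<in> {..Suc n}" for i
    using coface_closed[OF b w, of i] that by (cases "even i") (simp_all del: funpow.simps)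
  show "diff Cobar n b w \<in> carrier ?L" unfolding diff by (rule L.M.finsum_closedI[OF t])
  show "evaluate (diff Cobar n b w) l =
      diff_value n b w l \<oplus>\<^bsub>ob F (last l)\<^esub> (if hd l = b then signed (ob F (last l)) (Suc n) (evaluate w (tl l)) else \<zero>\<^bsub>ob F (last l)\<^esub>)"
    if l: "chain b l" "length l = Suc n"
  proof -
    have ln: "l \<noteq> []" using l(2) by auto
    define c where "c = last l"
    have c: "last (b # l) = c" using ln by (simp add: c_def)
    have fin: "finite c" using last_chain_finite[OF b l(1)] c by simp
    interpret A: abelian_group "ob F c" by (rule ob_abelian_group[OF fin])
    have hom: "(\<lambda>w. evaluate w l) \<in> mod_hom R ?L (ob F c)" using evaluate_hom[OF l] c by metis
    define u where "u i = signed (ob F c) i (evaluate (?d i) l)" for i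
    have dc: "evaluate (?d i) l \<in> carrier (ob F c)" if "i \<le> Suc n" for i
      by (rule mod_hom_closed[OF hom coface_closed[OF b w that]])
    have u: "u i \<in> carrier (ob F c)" if "i \<in> {..Suc n}" for i
      unfolding u_def using dc that by simp
    have "evaluate (diff Cobar n b w) l = (\<Oplus>\<^bsub>ob F c\<^esub>i\<in>{..Suc n}. evaluate (?t i) l)"
      unfolding diff by (rule mod_hom_finsum[OF hom L.module_axioms ob_module[OF fin]]) (rule Pi_I, rule t)
    also have "\<dots> = (\<Oplus>\<^bsub>ob F c\<^esub>i\<in>{..Suc n}. u i)"
    proof (rule A.finsum_congI)
      fix i assume i: "i \<in> {..Suc n}"
      show "evaluate (?t i) l = u i"
        unfolding u_def using evaluate_signed[OF b l coface_closed[OF b w], of i i] i c by simp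
    qed (rule u)
    also have "{..Suc n} = insert 0 (insert (Suc n) {1..n})" by auto
    also have "(\<Oplus>\<^bsub>ob F c\<^esub>i\<in>insert 0 (insert (Suc n) {1..n}). u i)
        = u 0 \<oplus>\<^bsub>ob F c\<^esub> (\<Oplus>\<^bsub>ob F c\<^esub>i\<in>insert (Suc n) {1..n}. u i)"
      by (rule A.finsum_insertI) (auto intro: u)
    also have "(\<Oplus>\<^bsub>ob F c\<^esub>i\<in>insert (Suc n) {1..n}. u i) = u (Suc n) \<oplus>\<^bsub>ob F c\<^esub> (\<Oplus>\<^bsub>ob F c\<^esub>i\<in>{1..n}. u i)"
      by (rule A.finsum_insertI) (auto intro: u)
    also have "(\<Oplus>\<^bsub>ob F c\<^esub>i\<in>{1..n}. u i)
        = (\<Oplus>\<^bsub>ob F c\<^esub>i\<in>{1..n}. signed (ob F c) i (chain_value n b c w (remove_at (n - i) l)))"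
    proof (rule A.finsum_congI)
      fix i assume i: "i \<in> {1..n}"
      have "evaluate (?d i) l = chain_value n b c w (remove_at (n - i) l)"
        using evaluate_coface[OF b w _ l, of i] i by (simp add: c_def)
      thus "u i = signed (ob F c) i (chain_value n b c w (remove_at (n - i) l))" by (simp only: u_def)
      show "signed (ob F c) i (chain_value n b c w (remove_at (n - i) l)) \<in> carrier (ob F c)"
        by (rule A.signed_closed[OF chain_value_closed[OF w fin]])
    qed
    also have "\<dots> = inner_diff (ob F c) (chain_value n b c w) l"
      by (rule A.inner_diff_finsum[OF l(2) chain_value_closed[OF w fin]])
    finally have sum: "evaluate (diff Cobar n b w) l =
      u 0 \<oplus>\<^bsub>ob F c\<^esub> (u (Suc n) \<oplus>\<^bsub>ob F c\<^esub> inner_diff (ob F c) (chain_value n b c w) l)" .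
    have Q: "inner_diff (ob F c) (chain_value n b c w) l \<in> carrier (ob F c)"
      by (rule A.inner_diff_closed[OF chain_value_closed[OF w fin]])
    have u0: "u 0 = restriction F c (last (b # butlast l)) (evaluate w (butlast l))"
      using evaluate_coface[OF b w _ l, of 0] by (simp add: u_def signed_def c_def)
    have un: "u (Suc n) = (if hd l = b then signed (ob F c) (Suc n) (evaluate w (tl l)) else \<zero>\<^bsub>ob F c\<^esub>)"
    proof -
      have "evaluate (?d (Suc n)) l = (if hd l = b then evaluate w (tl l) else \<zero>\<^bsub>ob F c\<^esub>)"
        using evaluate_coface[OF b w _ l, of "Suc n"] by (simp add: c_def)
      thus ?thesis by (simp add: u_def)
    qed
    show ?thesis
      unfolding sum diff_value_def c_def[symmetric] u0[symmetric] un[symmetric]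
      using u[of 0] u[of "Suc n"] Q by (simp add: A.a_ac)
  qed
qed

lemma normal_chain_value_zero:
  assumes "normal F n b w" "finite c" "\<not> strict_chain b l"
  shows "chain_value n b c w l = \<zero>\<^bsub>ob F c\<^esub>"
  using assms by (auto simp: chain_value_def normal_def)

lemma evaluate_diff_strict:
  assumes "finite b" "normal F n b w" "strict_chain b l" "length l = Suc n"
  shows "evaluate (diff Cobar n b w) l = diff_value n b w l"
proof -
  have w: "w \<in> carrier (level_at F n b)" using assms(2) by (simp add: normal_def)
  have c: "chain b l" by (rule strict_chain_chain[OF assms(3)])
  have hd: "hd l \<noteq> b" using assms(3,4) by (cases l) auto
  have ln: "l \<noteq> []" using assms(4) by auto
  have fin: "finite (last l)" using last_chain_finite[OF assms(1) c] ln by simp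
  interpret A: abelian_group "ob F (last l)" by (rule ob_abelian_group[OF fin])
  have "restriction F (last l) (last (b # butlast l)) (evaluate w (butlast l)) \<in> carrier (ob F (last l))"
    using last_chain_finite[OF assms(1) chain_butlast[OF c]] chain_last_butlast[OF c ln] assms(4)
    by (intro mod_hom_closed[OF restriction_hom] level_evaluate_closed[OF w] chain_butlast[OF c]) simp_all
  hence "diff_value n b w l \<in> carrier (ob F (last l))"
    unfolding diff_value_def by (intro A.a_closed A.inner_diff_closed chain_value_closed[OF w fin])
  thus ?thesis using evaluate_diff[OF assms(1) w c assms(4)] hd by simp
qed

lemma strict_chain_append:
  "strict_chain b (s @ t) \<longleftrightarrow> strict_chain b s \<and> strict_chain (last (b # s)) t"
  by (induction s arbitrary: b) auto

lemma chain_append: "chain b (s @ t) \<longleftrightarrow> chain b s \<and> chain (last (b # s)) t"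
  by (induction s arbitrary: b) auto

text \<open>On a chain that is not strict, the inner differential of a normalized element is given by the two
correction terms of \<open>inner_diff_nonstrict\<close>. The one for a repeated last entry is cancelled by the
coaction, which restricts along an identity there, and the one for a first entry \<open>b\<close> is cancelled by the
coaugmentation.\<close>

lemma diff_normal:
  assumes b: "finite b" and w: "normal F n b w"
  shows "normal F (Suc n) b (diff Cobar n b w)"
proof -
  have wc: "w \<in> carrier (level_at F n b)" using w by (simp add: normal_def)
  have "evaluate (diff Cobar n b w) l = \<zero>\<^bsub>ob F (last (b # l))\<^esub>"
    if l: "chain b l" "length l = Suc n" "\<not> strict_chain b l" for l
  proof -
    have ln: "l \<noteq> []" using l(2) by auto
    define c where "c = last l"
    have c: "last (b # l) = c" using ln by (simp add: c_def)
    have fin: "finite c" using last_chain_finite[OF b l(1)] c by simp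
    interpret A: abelian_group "ob F c" by (rule ob_abelian_group[OF fin])
    let ?Q = "inner_diff (ob F c) (chain_value n b c w) l"
    let ?r = "restriction F c (last (b # butlast l)) (evaluate w (butlast l))"
    let ?a = "if hd l = b then signed (ob F c) (Suc n) (evaluate w (tl l)) else \<zero>\<^bsub>ob F c\<^esub>"
    note ev = evaluate_diff[OF b wc l(1,2), unfolded diff_value_def c_def[symmetric]]
    have "?Q \<oplus>\<^bsub>ob F c\<^esub> ?r \<oplus>\<^bsub>ob F c\<^esub> ?a = \<zero>\<^bsub>ob F c\<^esub>"
    proof (cases "n = 0")
      case True
      then obtain d where d: "l = [d]" using l(2) by (cases l) auto
      hence db: "d = b" "c = b" using l by (auto simp: c_def)
      have "the_base w \<in> carrier (ob F b)" using level_evaluate_closed[OF wc, of "[]"] True by simp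
      thus ?thesis using b
        by (simp add: d db True signed_def mor_id abelian_group.r_neg[OF ob_abelian_group[OF b]]
            abelian_groupE(5)[OF ob_abelian_group[OF b]])
    next
      case False
      obtain t d where t: "l = t @ [d, c]"
      proof -
        have "l = butlast l @ [c]" using ln by (simp add: c_def)
        moreover have "butlast l \<noteq> []" using l(2) False by (cases l) auto
        hence "butlast l = butlast (butlast l) @ [last (butlast l)]" by simp
        ultimately have "l = butlast (butlast l) @ [last (butlast l), c]"
          by (metis append.assoc append_Cons append_Nil)
        thus thesis using that by blast
      qed
      have but: "butlast l = t @ [d]" by (simp add: t butlast_append)
      have ctd: "chain b (t @ [d])" using chain_butlast[OF l(1)] but by simp
      have len: "length (t @ [d]) = n" using l(2) t by simp
      have dfin: "finite d" using last_chain_finite[OF b ctd] by simp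
      have "c \<subseteq> d" using chain_last_butlast[OF l(1) ln] unfolding but c_def by simp
      note NS = A.inner_diff_nonstrict[of "chain_value n b c w" b t d c, OF chain_value_closed[OF wc fin]
          normal_chain_value_zero[OF w fin] l(1)[unfolded t] l(3)[unfolded t]]
      have r: "?r = (if d = c then chain_value n b c w (t @ [d]) else \<zero>\<^bsub>ob F c\<^esub>)"
      proof (cases "d = c")
        case True
        have "evaluate w (t @ [d]) \<in> carrier (ob F d)" using level_evaluate_closed[OF wc ctd len] by simp
        thus ?thesis using True dfin ctd len unfolding but by (simp add: chain_value_def mor_id)
      next
        case False
        hence "c \<subset> d" using \<open>c \<subseteq> d\<close> by blast
        hence "\<not> strict_chain b (t @ [d])" using l(3) unfolding t strict_chain_append by auto
        hence "evaluate w (t @ [d]) = \<zero>\<^bsub>ob F d\<^esub>" using w ctd len by (simp add: normal_def)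
        thus ?thesis using False unfolding but
          using mod_hom_zero[OF restriction_hom[OF dfin \<open>c \<subseteq> d\<close>] ob_module[OF dfin] ob_module[OF fin]] by simp
      qed
      have a: "?a = (if hd (t @ [d]) = b then signed (ob F c) (Suc n) (evaluate w (tl l)) else \<zero>\<^bsub>ob F c\<^esub>)"
        unfolding t by (cases t) auto
      have tl: "evaluate w (tl l) = chain_value n b c w (tl l)" if h: "hd (t @ [d]) = b"
      proof -
        obtain cs where cs: "l = b # cs" using h t by (cases t) auto
        have "cs \<noteq> []" using cs l(2) False by auto
        thus ?thesis using l(1,2) cs by (simp add: chain_value_def c_def)
      qed
      have cv: "chain_value n b c w s \<in> carrier (ob F c)" for s by (rule chain_value_closed[OF wc fin])
      have n: "n = Suc (length t)" using len by simp
      show ?thesis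
      proof (cases "hd (t @ [d]) = b")
        case True
        have "?Q \<oplus>\<^bsub>ob F c\<^esub> ?r = signed (ob F c) n (chain_value n b c w (tl l))"
          using NS True unfolding r unfolding t n by simp
        thus ?thesis unfolding a unfolding tl[OF True] using True cv by (simp add: A.signed_Suc A.r_neg)
      next
        case False
        have "?Q \<oplus>\<^bsub>ob F c\<^esub> ?r = \<zero>\<^bsub>ob F c\<^esub>" using NS False unfolding r unfolding t by simp
        thus ?thesis unfolding a using False by simp
      qed
    qed
    thus ?thesis unfolding ev c .
  qed
  thus ?thesis using diff_level_closed[OF b wc] by (simp add: normal_def)
qed

end

lemma mod_hom_sum:
  assumes "f \<in> mod_hom R M N" "g \<in> mod_hom R M N" "Module.module R N"
  shows "(\<lambda>x. f x \<oplus>\<^bsub>N\<^esub> g x) \<in> mod_hom R M N"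
proof -
  interpret N: Module.module R N by fact
  show ?thesis
    by (rule mod_homI)
       (simp_all add: mod_homD[OF assms(1)] mod_homD[OF assms(2)] N.M.a_ac N.smult_r_distr)
qed

context FI_functor
begin

lemma smult_hom: "\<lbrakk>finite a; r \<in> carrier R\<rbrakk> \<Longrightarrow> (\<lambda>x. r \<odot>\<^bsub>ob F a\<^esub> x) \<in> mod_hom R (ob F a) (ob F a)"
  by (rule smult_mod_hom[OF ob_module module.carrier_is_submodule[OF ob_module]])

lemma chain_value_hom:
  assumes b: "finite b" and c: "finite c"
  shows "(\<lambda>w. chain_value n b c w l) \<in> mod_hom R (level_at F n b) (ob F c)"
proof (cases "chain b l \<and> length l = n \<and> last (b # l) = c")
  case True
  hence "(\<lambda>w. evaluate w l) \<in> mod_hom R (level_at F n b) (ob F c)"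
    using evaluate_hom[of b l n R F] by metis
  moreover have "(\<lambda>w. chain_value n b c w l) = (\<lambda>w. evaluate w l)"
    unfolding chain_value_def if_P[OF True] ..
  ultimately show ?thesis by simp
next
  case False
  interpret M: Module.module R "ob F c" by (rule ob_module[OF c])
  have "(\<lambda>w. chain_value n b c w l) = (\<lambda>w. \<zero>\<^bsub>ob F c\<^esub>)"
    unfolding chain_value_def if_not_P[OF False] ..
  moreover have "(\<lambda>w. \<zero>\<^bsub>ob F c\<^esub>) \<in> mod_hom R (level_at F n b) (ob F c)"
    by (rule mod_homI) simp_all
  ultimately show ?thesis by simp
qed

lemma inner_diff_chain_value_hom:
  assumes b: "finite b" and c: "finite c"
  shows "(\<lambda>w. inner_diff (ob F c) (chain_value n b c w) l) \<in> mod_hom R (level_at F n b) (ob F c)"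
proof (rule mod_homI)
  interpret A: abelian_group "ob F c" by (rule ob_abelian_group[OF c])
  note hom = chain_value_hom[OF b c]
  fix v assume v: "v \<in> carrier (level_at F n b)"
  note vc = chain_value_closed[OF v c]
  show "inner_diff (ob F c) (chain_value n b c v) l \<in> carrier (ob F c)" by (rule A.inner_diff_closed[OF vc])
  {
    fix w assume w: "w \<in> carrier (level_at F n b)"
    have "chain_value n b c (v \<oplus>\<^bsub>level_at F n b\<^esub> w) = (\<lambda>l. chain_value n b c v l \<oplus>\<^bsub>ob F c\<^esub> chain_value n b c w l)"
      by (rule ext) (rule mod_hom_add[OF hom v w])
    thus "inner_diff (ob F c) (chain_value n b c (v \<oplus>\<^bsub>level_at F n b\<^esub> w)) l =
        inner_diff (ob F c) (chain_value n b c v) l \<oplus>\<^bsub>ob F c\<^esub> inner_diff (ob F c) (chain_value n b c w) l"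
      using A.inner_diff_add[OF vc chain_value_closed[OF w c]] by simp
  }
  fix r assume r: "r \<in> carrier R"
  have "chain_value n b c (r \<odot>\<^bsub>level_at F n b\<^esub> v) = (\<lambda>l. r \<odot>\<^bsub>ob F c\<^esub> chain_value n b c v l)"
    by (rule ext) (rule mod_hom_smult[OF hom r v])
  thus "inner_diff (ob F c) (chain_value n b c (r \<odot>\<^bsub>level_at F n b\<^esub> v)) l =
      r \<odot>\<^bsub>ob F c\<^esub> inner_diff (ob F c) (chain_value n b c v) l"
    using inner_diff_hom[where f = "chain_value n b c v" and l = l, OF smult_hom[OF c r] ob_module[OF c] ob_module[OF c] vc]
    by simp
qed

lemma restriction_evaluate_hom:
  assumes b: "finite b" and l: "chain b l" "length l = Suc n"
  shows "(\<lambda>w. restriction F (last l) (last (b # butlast l)) (evaluate w (butlast l)))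
    \<in> mod_hom R (level_at F n b) (ob F (last l))"
proof -
  have ln: "l \<noteq> []" using l(2) by auto
  have ev: "(\<lambda>w. evaluate w (butlast l)) \<in> mod_hom R (level_at F n b) (ob F (last (b # butlast l)))"
    by (rule evaluate_hom[OF chain_butlast[OF l(1)]]) (simp add: l(2))
  show ?thesis
    by (rule mod_hom_comp[OF ev restriction_hom[OF last_chain_finite[OF b chain_butlast[OF l(1)]]
            chain_last_butlast[OF l(1) ln]]])
qed

lemma last_finite: "\<lbrakk>finite b; chain b l; l \<noteq> []\<rbrakk> \<Longrightarrow> finite (last l)"
  using last_chain_finite[of b l] by simp

lemma diff_value_hom:
  assumes b: "finite b" and l: "chain b l" "length l = Suc n"
  shows "(\<lambda>w. diff_value n b w l) \<in> mod_hom R (level_at F n b) (ob F (last l))"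
proof -
  have ln: "l \<noteq> []" using l(2) by auto
  note fin = last_finite[OF b l(1) ln]
  show ?thesis unfolding diff_value_def
    by (rule mod_hom_sum[OF inner_diff_chain_value_hom[OF b fin] restriction_evaluate_hom[OF b l] ob_module[OF fin]])
qed

lemma diff_Cobar_hom:
  assumes b: "finite b"
  shows "diff Cobar n b \<in> mod_hom R (ob (coch Cobar n) b) (ob (coch Cobar (Suc n)) b)"
proof (rule mod_homI, unfold normalized_cobar_carrier normalized_cobar_simps)
  interpret B: Module.module R "ob (coch Cobar n) b" by (rule normalized_cobar_module[OF b])
  interpret D: Module.module R "ob (coch Cobar (Suc n)) b" by (rule normalized_cobar_module[OF b])
  note Bclosed = B.M.a_closed B.smult_closed
  note Bc = Bclosed[unfolded normalized_cobar_carrier normalized_cobar_simps]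
  note Dclosed = D.M.a_closed D.smult_closed
  note Dc = Dclosed[unfolded normalized_cobar_carrier normalized_cobar_simps]
  have lv: "v \<in> carrier (level_at F n b)" if "normal F n b v" for v using that by (simp add: normal_def)
  note dn = diff_normal[OF b]
  fix v assume v: "normal F n b v"
  show "normal F (Suc n) b (diff Cobar n b v)" by (rule dn[OF v])
  {
    fix w assume w: "normal F n b w"
    show "diff Cobar n b (v \<oplus>\<^bsub>level_at F n b\<^esub> w) = diff Cobar n b v \<oplus>\<^bsub>level_at F (Suc n) b\<^esub> diff Cobar n b w"
    proof (rule normalized_cobar_eqI[OF dn[OF Bc(1)[OF v w]] Dc(1)[OF dn[OF v] dn[OF w]]])
      fix l assume l: "strict_chain b l" "length l = Suc n"
      note c = strict_chain_chain[OF l(1)]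
      have "last (b # l) = last l" using l(2) by auto
      thus "evaluate (diff Cobar n b (v \<oplus>\<^bsub>level_at F n b\<^esub> w)) l
          = evaluate (diff Cobar n b v \<oplus>\<^bsub>level_at F (Suc n) b\<^esub> diff Cobar n b w) l"
        unfolding evaluate_add[OF c l(2)] evaluate_diff_strict[OF b v l] evaluate_diff_strict[OF b w l]
          evaluate_diff_strict[OF b Bc(1)[OF v w] l]
        using mod_hom_add[OF diff_value_hom[OF b c l(2)] lv[OF v] lv[OF w]] by simp
    qed
  }
  fix r assume r: "r \<in> carrier R"
  show "diff Cobar n b (r \<odot>\<^bsub>level_at F n b\<^esub> v) = r \<odot>\<^bsub>level_at F (Suc n) b\<^esub> diff Cobar n b v"
  proof (rule normalized_cobar_eqI[OF dn[OF Bc(2)[OF r v]] Dc(2)[OF r dn[OF v]]])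
    fix l assume l: "strict_chain b l" "length l = Suc n"
    note c = strict_chain_chain[OF l(1)]
    have "last (b # l) = last l" using l(2) by auto
    thus "evaluate (diff Cobar n b (r \<odot>\<^bsub>level_at F n b\<^esub> v)) l
        = evaluate (r \<odot>\<^bsub>level_at F (Suc n) b\<^esub> diff Cobar n b v) l"
      unfolding evaluate_smult[OF c l(2)] evaluate_diff_strict[OF b v l]
        evaluate_diff_strict[OF b Bc(2)[OF r v] l]
      using mod_hom_smult[OF diff_value_hom[OF b c l(2)] r lv[OF v]] by simp
  qed
qed

lemma strict_chain_butlast: "strict_chain b l \<Longrightarrow> strict_chain b (butlast l)"
  using strict_chain_append[of b "butlast l" "[last l]"] by (cases "l = []") auto

lemma diff_Cobar_natural:
  assumes a: "finite a" and f: "f \<in> Sigma_maps a b" and v: "normal F n b v"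
  shows "diff Cobar n a (mor ((perp ^^ n) (based F)) a b f v) =
    mor ((perp ^^ Suc n) (based F)) a b f (diff Cobar n b v)"
proof (rule normalized_cobar_eqI)
  let ?m = "mor ((perp ^^ n) (based F)) a b f v"
  have fa: "f ` a = b" using f by (auto simp: Sigma_maps_def bij_betw_def)
  have b: "finite b" using a fa by blast
  have vc: "v \<in> carrier (level_at F n b)" using v by (simp add: normal_def)
  note m = normal_mor[OF a f v]
  show "normal F (Suc n) a (diff Cobar n a ?m)" by (rule diff_normal[OF a m])
  show "normal F (Suc n) a (mor ((perp ^^ Suc n) (based F)) a b f (diff Cobar n b v))"
    by (rule normal_mor[OF a f diff_normal[OF b v]])
  fix l assume l: "strict_chain a l" "length l = Suc n"
  note ch = strict_chain_chain[OF l(1)]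
  have ln: "l \<noteq> []" using l(2) by auto
  define c where "c = last l"
  define e where "e = last (a # butlast l)"
  have c: "last (a # l) = c" using ln by (simp add: c_def)
  have ca: "c \<subseteq> a" using chain_last_subset[OF ch] c by simp
  have ea: "e \<subseteq> a" unfolding e_def by (rule chain_last_subset[OF chain_butlast[OF ch]])
  have ce: "c \<subseteq> e" unfolding c_def e_def by (rule chain_last_butlast[OF ch ln])
  have fin: "finite c" "finite e" "finite (f ` c)" "finite (f ` e)"
    using finite_subset[OF ca a] finite_subset[OF ea a] by simp_all
  interpret A: abelian_group "ob F c" by (rule ob_abelian_group[OF fin(1)])
  note fl = chain_map_image[OF f ch] last_map_image[OF f ch]
  have fstrict: "strict_chain b (map (image f) l)" using strict_chain_map_image[OF f ch] l(1) by simp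
  have lastf: "last (map (image f) l) = f ` c" using ln by (simp add: last_map c_def)
  have butf: "butlast (map (image f) l) = map (image f) (butlast l)" by (simp add: map_butlast)
  have lastbf: "last (b # butlast (map (image f) l)) = f ` e"
    unfolding butf e_def by (rule last_map_image[OF f chain_butlast[OF ch]])
  note mc = Sigma_mor_hom[OF fin(1,3) Sigma_maps_restrict[OF f ca]]
  have Q: "inner_diff (ob F c) (chain_value n a c ?m) l =
      mor F c (f ` c) (restrict f c) (inner_diff (ob F (f ` c)) (chain_value n b (f ` c) v) (map (image f) l))"
  proof -
    have "inner_diff (ob F c) (chain_value n a c ?m) l =
        inner_diff (ob F c) (\<lambda>s. mor F c (f ` c) (restrict f c) (chain_value n b (f ` c) v (map (image f) s))) l"
    proof (rule A.inner_diff_cong_chain[OF ch])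
      fix s assume s: "chain a s" "s \<noteq> []" "Suc (length s) = length l" "last s = last l"
      have sc: "last (a # s) = c" using s by (simp add: c_def)
      have sn: "length s = n" using s(3) l(2) by simp
      have "chain_value n a c ?m s = evaluate ?m s" by (rule chain_value_eq[OF s(1) sn sc])
      also have "\<dots> = mor F c (f ` c) (restrict f c) (evaluate v (map (image f) s))"
        unfolding evaluate_mor[OF f s(1) sn] sc ..
      also have "evaluate v (map (image f) s) = chain_value n b (f ` c) v (map (image f) s)"
        using chain_map_image[OF f s(1)] last_map_image[OF f s(1)] sn sc by (intro chain_value_eq[symmetric]) simp_all
      finally show "chain_value n a c ?m s =
        mor F c (f ` c) (restrict f c) (chain_value n b (f ` c) v (map (image f) s))" .
    qed
    also have "\<dots> = mor F c (f ` c) (restrict f c)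
        (inner_diff (ob F (f ` c)) (\<lambda>s. chain_value n b (f ` c) v (map (image f) s)) l)"
      by (rule inner_diff_hom[OF mc ob_module[OF fin(3)] ob_module[OF fin(1)] chain_value_closed[OF vc fin(3)], symmetric])
    finally show ?thesis unfolding inner_diff_map .
  qed
  have ev: "evaluate v (map (image f) (butlast l)) \<in> carrier (ob F (f ` e))"
    using level_evaluate_closed[OF vc chain_map_image[OF f chain_butlast[OF ch]]]
      last_map_image[OF f chain_butlast[OF ch]] l(2) by (simp add: e_def)
  have r: "restriction F c e (evaluate ?m (butlast l)) =
      mor F c (f ` c) (restrict f c) (restriction F (f ` c) (f ` e) (evaluate v (butlast (map (image f) l))))"
  proof -
    have "evaluate ?m (butlast l) = mor F e (f ` e) (restrict f e) (evaluate v (map (image f) (butlast l)))"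
      unfolding e_def by (rule evaluate_mor[OF f chain_butlast[OF ch]]) (simp add: l(2))
    moreover have "restrict f e ` c = f ` c" "restrict (restrict f e) c = restrict f c"
      using ce by (auto simp: Int_absorb1 restrict_restrict)
    ultimately show ?thesis
      using restriction_natural[OF fin(2) Sigma_maps_restrict[OF f ea] ce ev] unfolding butf by simp
  qed
  have rc: "restriction F (f ` c) (f ` e) (evaluate v (butlast (map (image f) l))) \<in> carrier (ob F (f ` c))"
    unfolding butf by (rule mod_hom_closed[OF restriction_hom[OF fin(4) image_mono[OF ce]] ev])
  have Qc: "inner_diff (ob F (f ` c)) (chain_value n b (f ` c) v) (map (image f) l) \<in> carrier (ob F (f ` c))"
    by (rule abelian_group.inner_diff_closed[OF ob_abelian_group[OF fin(3)] chain_value_closed[OF vc fin(3)]])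
  have "evaluate (diff Cobar n a ?m) l = inner_diff (ob F c) (chain_value n a c ?m) l
      \<oplus>\<^bsub>ob F c\<^esub> restriction F c e (evaluate ?m (butlast l))"
    using evaluate_diff_strict[OF a m l] unfolding diff_value_def c_def e_def .
  also have "\<dots> = mor F c (f ` c) (restrict f c) (diff_value n b v (map (image f) l))"
    unfolding Q r diff_value_def lastf lastbf by (rule mod_hom_add[OF mc Qc rc, symmetric])
  also have "diff_value n b v (map (image f) l) = evaluate (diff Cobar n b v) (map (image f) l)"
    by (rule evaluate_diff_strict[OF b v fstrict, symmetric]) (simp add: l(2))
  finally show "evaluate (diff Cobar n a ?m) l = evaluate (mor ((perp ^^ Suc n) (based F)) a b f (diff Cobar n b v)) l"
    unfolding evaluate_mor[OF f ch l(2)] c .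
qed

text \<open>For a chain that ends in \<open>e, c\<close>, the square of the inner differential vanishes. The inner differential
of the restriction term consists of the restriction to \<open>c\<close> of the inner differential at \<open>e\<close>, and of a
composite of two restrictions, both with sign \<open>-1\<close>; these are cancelled by the restriction of the
differential at \<open>e\<close>.\<close>

lemma diff_diff_Cobar:
  assumes b: "finite b" and w: "normal F n b w"
  shows "diff Cobar (Suc n) b (diff Cobar n b w) = \<zero>\<^bsub>level_at F (Suc (Suc n)) b\<^esub>"
proof (rule normalized_cobar_eqI)
  let ?d = "diff Cobar n b w"
  have wc: "w \<in> carrier (level_at F n b)" using w by (simp add: normal_def)
  note d = diff_normal[OF b w]
  show "normal F (Suc (Suc n)) b (diff Cobar (Suc n) b ?d)" by (rule diff_normal[OF b d])
  show "normal F (Suc (Suc n)) b \<zero>\<^bsub>level_at F (Suc (Suc n)) b\<^esub>"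
    using submodule_zero[OF normal_submodule[OF b]] by (simp only: mem_Collect_eq)
  fix l assume l: "strict_chain b l" "length l = Suc (Suc n)"
  note ch = strict_chain_chain[OF l(1)]
  have ln: "l \<noteq> []" "butlast l \<noteq> []" using l(2) by (cases l; auto)+
  define c where "c = last l"
  define e where "e = last (butlast l)"
  define t where "t = butlast (butlast l)"
  define p where "p = last (b # t)"
  have but: "butlast l = t @ [e]" using ln(2) by (simp add: t_def e_def)
  have lt: "l = t @ [e, c]"
  proof -
    have "l = butlast l @ [c]" using ln(1) by (simp add: c_def)
    thus ?thesis unfolding but by simp
  qed
  have chb: "chain b (t @ [e])" using chain_butlast[OF ch] unfolding but .
  have strictb: "strict_chain b (t @ [e])" using strict_chain_butlast[OF l(1)] unfolding but .
  have cht: "chain b t" by (rule chain_appendD[OF chb])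
  have len: "length t = n" using l(2) lt by simp
  have fin: "finite c" "finite e" "finite p"
    using last_finite[OF b ch ln(1)] last_finite[OF b chb] last_chain_finite[OF b cht] by (simp_all add: c_def p_def)
  have ce: "c \<subseteq> e" and ep: "e \<subseteq> p"
    using chain_last_butlast[OF ch ln(1)] chain_last_butlast[OF chb] unfolding but by (simp_all add: c_def p_def)
  interpret A: abelian_group "ob F c" by (rule ob_abelian_group[OF fin(1)])
  note rce = restriction_hom[OF fin(2) ce] and rep = restriction_hom[OF fin(3) ep]
  let ?q = "chain_value n b c w"
  note q = chain_value_closed[OF wc fin(1)]
  define g where "g s = (if chain b s \<and> length s = Suc n \<and> last s = c
      then restriction F c (last (b # butlast s)) (evaluate w (butlast s)) else \<zero>\<^bsub>ob F c\<^esub>)" for s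
  have g: "g s \<in> carrier (ob F c)" for s
    using mod_hom_closed[OF restriction_evaluate_hom[OF b] wc, of s] by (auto simp: g_def)
  have ew: "evaluate w t \<in> carrier (ob F p)"
    using level_evaluate_closed[OF wc cht len] by (simp add: p_def)
  have gtc: "g (t @ [c]) = restriction F c p (evaluate w t)"
    using cht len order_trans[OF ce ep] by (simp add: g_def chain_append p_def)
  have Q1: "inner_diff (ob F c) (chain_value (Suc n) b c ?d) l
      = inner_diff (ob F c) (\<lambda>s. inner_diff (ob F c) ?q s \<oplus>\<^bsub>ob F c\<^esub> g s) l"
  proof (rule A.inner_diff_cong_strict[OF l(1)])
    fix s assume s: "strict_chain b s" "s \<noteq> []" "Suc (length s) = length l" "last s = last l"
    have sn: "length s = Suc n" and sc: "last s = c" using s l(2) by (simp_all add: c_def)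
    have "chain_value (Suc n) b c ?d s = diff_value n b w s"
      using evaluate_diff_strict[OF b w s(1) sn] strict_chain_chain[OF s(1)] s(2) sn sc
      by (simp add: chain_value_def)
    thus "chain_value (Suc n) b c ?d s = inner_diff (ob F c) ?q s \<oplus>\<^bsub>ob F c\<^esub> g s"
      using strict_chain_chain[OF s(1)] sn by (simp add: diff_value_def sc g_def)
  qed
  also have "\<dots> = inner_diff (ob F c) g l"
  proof -
    have "inner_diff (ob F c) (inner_diff (ob F c) ?q) l = \<zero>\<^bsub>ob F c\<^esub>" by (rule A.inner_diff_inner_diff[OF q])
    moreover have "inner_diff (ob F c) g l \<in> carrier (ob F c)" by (rule A.inner_diff_closed[OF g])
    ultimately show ?thesis
      using A.inner_diff_add[of "inner_diff (ob F c) ?q" g l, OF A.inner_diff_closed[OF q] g] by simp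
  qed
  also have "\<dots> = \<ominus>\<^bsub>ob F c\<^esub> inner_diff (ob F c) (\<lambda>s. g (s @ [c])) (t @ [e]) \<oplus>\<^bsub>ob F c\<^esub> \<ominus>\<^bsub>ob F c\<^esub> g (t @ [c])"
    unfolding lt by (rule A.inner_diff_snoc[OF g])
  also have "inner_diff (ob F c) (\<lambda>s. g (s @ [c])) (t @ [e])
      = inner_diff (ob F c) (\<lambda>s. restriction F c e (chain_value n b e w s)) (t @ [e])"
  proof (rule A.inner_diff_cong_chain[OF chb])
    fix s assume s: "chain b s" "s \<noteq> []" "Suc (length s) = length (t @ [e])" "last s = last (t @ [e])"
    show "g (s @ [c]) = restriction F c e (chain_value n b e w s)"
      using s len ce by (simp add: g_def chain_append chain_value_def)
  qed
  also have "\<dots> = restriction F c e (inner_diff (ob F e) (chain_value n b e w) (t @ [e]))"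
    by (rule inner_diff_hom[OF rce ob_module[OF fin(2)] ob_module[OF fin(1)] chain_value_closed[OF wc fin(2)], symmetric])
  finally have Q: "inner_diff (ob F c) (chain_value (Suc n) b c ?d) l =
      \<ominus>\<^bsub>ob F c\<^esub> restriction F c e (inner_diff (ob F e) (chain_value n b e w) (t @ [e]))
      \<oplus>\<^bsub>ob F c\<^esub> \<ominus>\<^bsub>ob F c\<^esub> restriction F c p (evaluate w t)" unfolding gtc .
  have Qe: "inner_diff (ob F e) (chain_value n b e w) (t @ [e]) \<in> carrier (ob F e)"
    by (rule abelian_group.inner_diff_closed[OF ob_abelian_group[OF fin(2)] chain_value_closed[OF wc fin(2)]])
  have re: "restriction F e p (evaluate w t) \<in> carrier (ob F e)" by (rule mod_hom_closed[OF rep ew])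
  have de: "evaluate ?d (t @ [e]) = inner_diff (ob F e) (chain_value n b e w) (t @ [e])
      \<oplus>\<^bsub>ob F e\<^esub> restriction F e p (evaluate w t)"
    using evaluate_diff_strict[OF b w strictb] len by (simp add: diff_value_def p_def)
  have R: "restriction F c e (evaluate ?d (t @ [e])) =
      restriction F c e (inner_diff (ob F e) (chain_value n b e w) (t @ [e]))
      \<oplus>\<^bsub>ob F c\<^esub> restriction F c p (evaluate w t)"
    unfolding de mod_hom_add[OF rce Qe re] restriction_comp[OF fin(3) ep ce ew] ..
  have laste: "last (b # t @ [e]) = e" by simp
  define X where "X = restriction F c e (inner_diff (ob F e) (chain_value n b e w) (t @ [e]))"
  define Y where "Y = restriction F c p (evaluate w t)"
  have XY: "X \<in> carrier (ob F c)" "Y \<in> carrier (ob F c)"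
    unfolding X_def Y_def
    using mod_hom_closed[OF rce Qe] mod_hom_closed[OF restriction_hom[OF fin(3) order_trans[OF ce ep]] ew] by simp_all
  have "evaluate (diff Cobar (Suc n) b ?d) l = (\<ominus>\<^bsub>ob F c\<^esub> X \<oplus>\<^bsub>ob F c\<^esub> \<ominus>\<^bsub>ob F c\<^esub> Y) \<oplus>\<^bsub>ob F c\<^esub> (X \<oplus>\<^bsub>ob F c\<^esub> Y)"
    unfolding evaluate_diff_strict[OF b d l] diff_value_def c_def[symmetric] Q but laste R X_def Y_def ..
  also have "\<dots> = \<zero>\<^bsub>ob F c\<^esub>" using XY by (simp add: A.minus_add[symmetric] A.l_neg)
  also have "\<dots> = evaluate \<zero>\<^bsub>level_at F (Suc (Suc n)) b\<^esub> l"
    unfolding evaluate_zero[OF ch l(2)] using ln(1) by (simp add: c_def)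
  finally show "evaluate (diff Cobar (Suc n) b ?d) l = evaluate \<zero>\<^bsub>level_at F (Suc (Suc n)) b\<^esub> l" .
qed

lemma cochain_complex_Cobar: "cochain_complex R Cobar"
proof (rule cochain_complex.intro)
  show "Sigma_op_module_hom R (coch Cobar n) (coch Cobar (Suc n)) (diff Cobar n)" for n
  proof (intro op_module_hom.intro op_module_hom_axioms.intro normalized_cobar_op_module diff_Cobar_hom)
    fix a b f v
    assume "finite a" "f \<in> Sigma_maps a b" "v \<in> carrier (ob (coch Cobar n) b)"
    thus "diff Cobar n a (mor (coch Cobar n) a b f v) = mor (coch Cobar (Suc n)) a b f (diff Cobar n b v)"
      unfolding normalized_cobar_carrier normalized_cobar_simps by (rule diff_Cobar_natural)
  qed
  show "diff Cobar (Suc n) b (diff Cobar n b v) = \<zero>\<^bsub>ob (coch Cobar (Suc (Suc n))) b\<^esub>"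
    if "finite b" "v \<in> carrier (ob (coch Cobar n) b)" for n b v
    using that unfolding normalized_cobar_carrier normalized_cobar_simps by (rule diff_diff_Cobar)
qed

end

section \<open>The comparison map\<close>

lemma mod_hom_finsum_fun:
  assumes "finite A" "\<And>x. x \<in> A \<Longrightarrow> h x \<in> mod_hom R M N" "Module.module R N"
  shows "(\<lambda>m. \<Oplus>\<^bsub>N\<^esub>x\<in>A. h x m) \<in> mod_hom R M N"
proof (rule mod_homI)
  interpret N: Module.module R N by fact
  note h = mod_homD[OF assms(2)]
  fix m assume m: "m \<in> carrier M"
  show "(\<Oplus>\<^bsub>N\<^esub>x\<in>A. h x m) \<in> carrier N" by (rule N.M.finsum_closedI) (rule h(1)[OF _ m])
  {
    fix m' assume m': "m' \<in> carrier M"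
    have "(\<Oplus>\<^bsub>N\<^esub>x\<in>A. h x (m \<oplus>\<^bsub>M\<^esub> m')) = (\<Oplus>\<^bsub>N\<^esub>x\<in>A. h x m \<oplus>\<^bsub>N\<^esub> h x m')"
      by (rule N.M.finsum_congI) (simp_all add: h m m')
    also have "\<dots> = (\<Oplus>\<^bsub>N\<^esub>x\<in>A. h x m) \<oplus>\<^bsub>N\<^esub> (\<Oplus>\<^bsub>N\<^esub>x\<in>A. h x m')"
      by (rule N.M.finsum_addI) (simp_all add: h m m')
    finally show "(\<Oplus>\<^bsub>N\<^esub>x\<in>A. h x (m \<oplus>\<^bsub>M\<^esub> m')) = (\<Oplus>\<^bsub>N\<^esub>x\<in>A. h x m) \<oplus>\<^bsub>N\<^esub> (\<Oplus>\<^bsub>N\<^esub>x\<in>A. h x m')" .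
  }
  fix r assume r: "r \<in> carrier R"
  have "(\<Oplus>\<^bsub>N\<^esub>x\<in>A. h x (r \<odot>\<^bsub>M\<^esub> m)) = (\<Oplus>\<^bsub>N\<^esub>x\<in>A. r \<odot>\<^bsub>N\<^esub> h x m)"
    by (rule N.M.finsum_congI) (simp_all add: h m r)
  also have "\<dots> = r \<odot>\<^bsub>N\<^esub> (\<Oplus>\<^bsub>N\<^esub>x\<in>A. h x m)"
    by (rule N.finsum_smult_ldistr[OF assms(1) r, symmetric]) (rule Pi_I, rule h(1)[OF _ m])
  finally show "(\<Oplus>\<^bsub>N\<^esub>x\<in>A. h x (r \<odot>\<^bsub>M\<^esub> m)) = r \<odot>\<^bsub>N\<^esub> (\<Oplus>\<^bsub>N\<^esub>x\<in>A. h x m)" .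
qed

lemma mod_hom_direct_sum:
  assumes "\<And>i. i \<in> I \<Longrightarrow> h i \<in> mod_hom R M (N i)"
  shows "(\<lambda>m. \<lambda>i\<in>I. h i m) \<in> mod_hom R M (direct_sum I N)"
proof -
  note h = mod_homD[OF assms]
  show ?thesis by (rule mod_homI) (simp_all add: h fun_eq_iff)
qed

lemma removal_chain_inj:
  "\<lbrakk>removal_chain b xs = removal_chain b ys; set xs \<subseteq> b; set ys \<subseteq> b; distinct xs; distinct ys\<rbrakk> \<Longrightarrow> xs = ys"
proof (induction xs arbitrary: b ys)
  case Nil
  hence "removal_chain b ys = []" by simp
  thus ?case by simp
next
  case (Cons x xs)
  have "ys \<noteq> []" using Cons.prems(1) by (metis list.distinct(1) removal_chain.simps)
  then obtain y zs where ys: "ys = y # zs" by (cases ys) simp_all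
  have eqs: "b - {x} = b - {y} \<and> removal_chain (b - {x}) xs = removal_chain (b - {y}) zs"
    using Cons.prems(1) unfolding ys removal_chain.simps list.inject .
  note eq = eqs[THEN conjunct1] eqs[THEN conjunct2]
  have "x \<in> b" "y \<in> b" using Cons.prems(2,3) by (simp_all add: ys)
  hence xy: "x = y" using eq(1) by blast
  have "xs = zs"
  proof (rule Cons.IH)
    show "removal_chain (b - {x}) xs = removal_chain (b - {x}) zs" using eq(2) xy by simp
    show "set xs \<subseteq> b - {x}" "set zs \<subseteq> b - {x}" "distinct xs" "distinct zs"
      using Cons.prems(2-5) xy by (auto simp: ys)
  qed
  thus ?case by (simp add: ys xy)
qed

lemma map_image_removal_chain:
  assumes f: "inj_on f a"
  shows "\<lbrakk>d \<subseteq> a; set xs \<subseteq> a\<rbrakk> \<Longrightarrow> map (image f) (removal_chain d xs) = removal_chain (f ` d) (map f xs)"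
proof (induction xs arbitrary: d)
  case (Cons y ys)
  have im: "f ` (d - {y}) = f ` d - {f y}"
    using inj_on_image_set_diff[OF f, of d "{y}"] Cons.prems by auto
  have "map (image f) (removal_chain (d - {y}) ys) = removal_chain (f ` (d - {y})) (map f ys)"
    by (rule Cons.IH) (use Cons.prems in auto)
  thus ?case unfolding im by (simp add: im)
qed simp

text \<open>The wedge is taken in the order opposite to that in which points are removed: the restriction term of
the differential removes one more point \<open>x\<close> at the end, and the Koszul differential puts \<open>x\<close> in front.\<close>

definition comparison :: "('r, 'q) ring_scheme \<Rightarrow> ('x, 'r, 'm) presheaf \<Rightarrow> nat \<Rightarrow> 'x set \<Rightarrow>
    ('x, 'm) iter \<Rightarrow> ('x, 'r, 'm) koszul_elt" where
  "comparison R F n b w = (\<lambda>c\<in>koszul_index n b.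
     \<Oplus>\<^bsub>tensor R (ob F c) (orientation R (b - c))\<^esub>xs\<in>perms (b - c).
       word_tensor R (ob F c) (b - c) (evaluate w (removal_chain b xs)) (rev xs))"

lemma koszul_indexD:
  assumes "finite b" "c \<in> koszul_index n b"
  shows "c \<subseteq> b" "finite c" "card (b - c) = n"
proof -
  show 1: "c \<subseteq> b" using assms(2) by (simp add: koszul_index_def)
  show 2: "finite c" by (rule finite_subset[OF 1 assms(1)])
  have "card c + n = card b" using assms(2) by (simp add: koszul_index_def)
  thus "card (b - c) = n" unfolding card_Diff_subset[OF 2 1] by simp
qed

lemma removal_chain_perms:
  assumes "finite b" "c \<in> koszul_index n b" "xs \<in> perms (b - c)"
  shows "strict_chain b (removal_chain b xs)" "length (removal_chain b xs) = n"
    "last (b # removal_chain b xs) = c"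
proof -
  have xs: "distinct xs" "set xs = b - c" using assms(3) by (simp_all add: perms_def)
  show "strict_chain b (removal_chain b xs)" by (rule removal_chain_strict) (simp_all add: xs Diff_subset)
  show "length (removal_chain b xs) = n"
    using perms_length[OF assms(3)] koszul_indexD(3)[OF assms(1,2)] by simp
  show "last (b # removal_chain b xs) = c"
    using koszul_indexD(1)[OF assms(1,2)] unfolding last_removal_chain xs(2) by (rule double_diff) simp
qed

context FI_functor
begin

abbreviation K where "K b c \<equiv> tensor R (ob F c) (orientation R (b - c))"

lemma K_module: "finite c \<Longrightarrow> Module.module R (K b c)"
  by (rule module_pair.tensor_module) (simp add: module_pair_def ob_module orientation_module)

lemma koszul_ob: "ob (coch (koszul R F) n) b = direct_sum (koszul_index n b) (K b)"
  by (simp add: koszul_def koszul_term_def)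

lemma koszul_mor: "mor (coch (koszul R F) n) a b g w = (\<lambda>c\<in>koszul_index n a.
    tensor_map R (ob F c) (orientation R (a - c)) (mor F c (g ` c) (restrict g c))
      (orientation_map R (a - c) (restrict g (a - c))) (w (g ` c)))"
  by (simp add: koszul_def koszul_term_def)

lemma koszul_diff: "diff (koszul R F) n b w = (\<lambda>c\<in>koszul_index (Suc n) b.
    \<Oplus>\<^bsub>K b c\<^esub>x\<in>b - c. tensor_map R (ob F c) (orientation R (b - c))
      (restriction F c (insert x c)) (wedge_point R (b - c) x) (w (insert x c)))"
  by (simp add: koszul_def)

lemma koszul_ob_module: "finite b \<Longrightarrow> Module.module R (ob (coch (koszul R F) n) b)"
  unfolding koszul_ob by (rule direct_sum_module[OF is_cring], rule K_module, rule koszul_indexD(2))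

lemma word_hom:
  assumes b: "finite b" and c: "c \<in> koszul_index n b" and xs: "xs \<in> perms (b - c)"
  shows "(\<lambda>m. word_tensor R (ob F c) (b - c) m (rev xs)) \<in> mod_hom R (ob F c) (K b c)"
  by (rule word_tensor_hom[OF ob_module[OF koszul_indexD(2)[OF b c]]]) (simp add: perms_rev xs)

lemma evaluate_removal_chain_hom:
  assumes b: "finite b" and c: "c \<in> koszul_index n b" and xs: "xs \<in> perms (b - c)"
  shows "(\<lambda>w. evaluate w (removal_chain b xs)) \<in> mod_hom R (level_at F n b) (ob F c)"
  using evaluate_hom[OF strict_chain_chain[OF removal_chain_perms(1)[OF b c xs]] removal_chain_perms(2)[OF b c xs], of R F]
  unfolding removal_chain_perms(3)[OF b c xs] .

lemma comparison_component_hom: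
  assumes b: "finite b" and c: "c \<in> koszul_index n b"
  shows "(\<lambda>w. \<Oplus>\<^bsub>K b c\<^esub>xs\<in>perms (b - c).
      word_tensor R (ob F c) (b - c) (evaluate w (removal_chain b xs)) (rev xs))
    \<in> mod_hom R (level_at F n b) (K b c)"
  by (rule mod_hom_finsum_fun[OF finite_perms[OF finite_Diff[OF b]] _ K_module[OF koszul_indexD(2)[OF b c]]])
     (rule mod_hom_comp[OF evaluate_removal_chain_hom[OF b c] word_hom[OF b c]])

lemma comparison_level_hom:
  assumes b: "finite b"
  shows "comparison R F n b \<in> mod_hom R (level_at F n b) (ob (coch (koszul R F) n) b)"
proof -
  have "comparison R F n b = (\<lambda>w. \<lambda>c\<in>koszul_index n b. \<Oplus>\<^bsub>K b c\<^esub>xs\<in>perms (b - c).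
      word_tensor R (ob F c) (b - c) (evaluate w (removal_chain b xs)) (rev xs))"
    by (rule ext) (simp only: comparison_def)
  thus ?thesis unfolding koszul_ob
    using mod_hom_direct_sum[OF comparison_component_hom[OF b]] by simp
qed

lemma comparison_hom:
  assumes b: "finite b"
  shows "comparison R F n b \<in> mod_hom R (ob (coch Cobar n) b) (ob (coch (koszul R F) n) b)"
  using mod_homD[OF comparison_level_hom[OF b]]
  by (intro mod_homI) (simp_all only: normalized_cobar_carrier normalized_cobar_simps normal_def)

text \<open>The values on chains can be prescribed freely, and by \<open>word_tensor_surj\<close> one flag for each \<open>c\<close> is enough
to reach all elements of the summand at \<open>c\<close>.\<close>

lemma comparison_surj:
  assumes b: "finite b" and y: "y \<in> carrier (ob (coch (koszul R F) n) b)"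
  shows "\<exists>w. normal F n b w \<and> comparison R F n b w = y"
proof -
  have "\<exists>xs m. xs \<in> perms (b - c) \<and> m \<in> carrier (ob F c) \<and> y c = word_tensor R (ob F c) (b - c) m (rev xs)"
    if c: "c \<in> koszul_index n b" for c
  proof -
    have fin: "finite (b - c)" using b by simp
    obtain xs where xs: "xs \<in> perms (b - c)" using perms_nonempty[OF fin] by blast
    have "y c \<in> carrier (K b c)" using y c unfolding koszul_ob by (simp add: PiE_iff)
    thus ?thesis
      using word_tensor_surj[OF fin ob_module[OF koszul_indexD(2)[OF b c]], of "rev xs"] xs perms_rev by blast
  qed
  then obtain xs m where xm: "\<And>c. c \<in> koszul_index n b \<Longrightarrow> xs c \<in> perms (b - c)"
    "\<And>c. c \<in> koszul_index n b \<Longrightarrow> m c \<in> carrier (ob F c)"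
    "\<And>c. c \<in> koszul_index n b \<Longrightarrow> y c = word_tensor R (ob F c) (b - c) (m c) (rev (xs c))"
    by metis
  define f where "f l = (if last (b # l) \<in> koszul_index n b \<and> l = removal_chain b (xs (last (b # l)))
    then m (last (b # l)) else \<zero>\<^bsub>ob F (last (b # l))\<^esub>)" for l
  define w where "w = assemble n b f"
  have fc: "f l \<in> carrier (ob F (last (b # l)))" if "chain b l" for l
  proof (cases "last (b # l) \<in> koszul_index n b \<and> l = removal_chain b (xs (last (b # l)))")
    case True
    show ?thesis unfolding f_def if_P[OF True] by (rule xm(2)[OF True[THEN conjunct1]])
  next
    case False
    show ?thesis unfolding f_def if_not_P[OF False]
      by (rule abelian_groupE(2)[OF ob_abelian_group[OF last_chain_finite[OF b that]]])
  qed
  have wc: "w \<in> carrier (level_at F n b)" unfolding w_def by (rule assemble_carrier[OF fc])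
  have ev: "evaluate w l = f l" if "chain b l" "length l = n" for l
    unfolding w_def by (rule evaluate_assemble[OF that])
  have "normal F n b w"
    unfolding normal_def
  proof (intro conjI wc allI impI)
    fix l assume l: "chain b l \<and> length l = n \<and> \<not> strict_chain b l"
    have "l \<noteq> removal_chain b (xs c)" if "c \<in> koszul_index n b" for c
      using removal_chain_perms(1)[OF b that xm(1)[OF that]] l by metis
    thus "evaluate w l = \<zero>\<^bsub>ob F (last (b # l))\<^esub>" using ev l unfolding f_def by metis
  qed
  moreover have "comparison R F n b w = y"
  proof
    fix c
    show "comparison R F n b w c = y c"
    proof (cases "c \<in> koszul_index n b")
      case False
      thus ?thesis using y unfolding koszul_ob comparison_def by (simp add: PiE_iff extensional_def)
    next
      case c: True
      note fin = koszul_indexD(2)[OF b c]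
      interpret Kc: Module.module R "K b c" by (rule K_module[OF fin])
      let ?t = "\<lambda>zs. word_tensor R (ob F c) (b - c) (evaluate w (removal_chain b zs)) (rev zs)"
      have tc: "?t zs \<in> carrier (K b c)" if "zs \<in> perms (b - c)" for zs
        by (rule mod_hom_closed[OF word_hom[OF b c that] mod_hom_closed[OF evaluate_removal_chain_hom[OF b c that] wc]])
      have ez: "evaluate w (removal_chain b zs) = (if zs = xs c then m c else \<zero>\<^bsub>ob F c\<^esub>)"
        if zs: "zs \<in> perms (b - c)" for zs
      proof -
        note r = removal_chain_perms[OF b c zs]
        have "removal_chain b zs = removal_chain b (xs c) \<longleftrightarrow> zs = xs c"
          using removal_chain_inj[of b zs "xs c"] zs xm(1)[OF c] by (auto simp: perms_def)
        thus ?thesis unfolding ev[OF strict_chain_chain[OF r(1)] r(2)] f_def r(3) using c by simp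
      qed
      have "comparison R F n b w c = (\<Oplus>\<^bsub>K b c\<^esub>zs\<in>perms (b - c). ?t zs)"
        using c by (simp add: comparison_def)
      also have "\<dots> = (\<Oplus>\<^bsub>K b c\<^esub>zs\<in>insert (xs c) (perms (b - c) - {xs c}). ?t zs)"
        using xm(1)[OF c] by (simp add: insert_absorb)
      also have "\<dots> = ?t (xs c) \<oplus>\<^bsub>K b c\<^esub> (\<Oplus>\<^bsub>K b c\<^esub>zs\<in>perms (b - c) - {xs c}. ?t zs)"
      proof (rule Kc.M.finsum_insertI)
        show "finite (perms (b - c) - {xs c})" using b by (simp add: finite_perms)
        show "?t zs \<in> carrier (K b c)" if "zs \<in> perms (b - c) - {xs c}" for zs using tc that by simp
      qed (use tc xm(1)[OF c] in simp_all)
      also have "(\<Oplus>\<^bsub>K b c\<^esub>zs\<in>perms (b - c) - {xs c}. ?t zs) = (\<Oplus>\<^bsub>K b c\<^esub>zs\<in>perms (b - c) - {xs c}. \<zero>\<^bsub>K b c\<^esub>)"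
      proof (rule Kc.M.finsum_congI)
        fix zs assume zs: "zs \<in> perms (b - c) - {xs c}"
        thus "?t zs = \<zero>\<^bsub>K b c\<^esub>"
          using ez[of zs] mod_hom_zero[OF word_hom[OF b c, of zs] ob_module[OF fin] Kc.module_axioms] by simp
      qed simp
      finally show ?thesis using tc[OF xm(1)[OF c]] ez[OF xm(1)[OF c]] xm(3)[OF c] by simp
    qed
  qed
  ultimately show ?thesis by blast
qed

lemma koszul_mor_component_hom:
  assumes a: "finite a" and f: "f \<in> Sigma_maps a b" and c: "c \<in> koszul_index n a"
  shows "tensor_map R (ob F c) (orientation R (a - c)) (mor F c (f ` c) (restrict f c))
      (orientation_map R (a - c) (restrict f (a - c))) \<in> mod_hom R (K b (f ` c)) (K a c)"
    and "\<lbrakk>m \<in> carrier (ob F (f ` c)); xs \<in> perms (a - c)\<rbrakk> \<Longrightarrow>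
      tensor_map R (ob F c) (orientation R (a - c)) (mor F c (f ` c) (restrict f c))
        (orientation_map R (a - c) (restrict f (a - c)))
        (word_tensor R (ob F (f ` c)) (b - f ` c) m (map f xs))
      = word_tensor R (ob F c) (a - c) (mor F c (f ` c) (restrict f c) m) xs"
    and "f ` c \<in> koszul_index n b" and "perms (b - f ` c) = map f ` perms (a - c)"
proof -
  note ca = koszul_indexD(1)[OF a c] and fin = koszul_indexD(2)[OF a c]
  have fa: "f ` a = b" and inj: "inj_on f a" using f by (auto simp: Sigma_maps_def bij_betw_def)
  have im: "f ` (a - c) = b - f ` c" using inj_on_image_set_diff[OF inj _ ca, of a] fa by simp
  have bij: "bij_betw (restrict f (a - c)) (a - c) (b - f ` c)"
    using im inj_on_subset[OF inj Diff_subset[of a c]] by (simp add: bij_betw_def)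
  have hom: "mor F c (f ` c) (restrict f c) \<in> mod_hom R (ob F (f ` c)) (ob F c)"
    by (rule Sigma_mor_hom[OF fin finite_imageI[OF fin] Sigma_maps_restrict[OF f ca]])
  note props = word_tensor_orientation_map[OF ob_module[OF fin] ob_module[OF finite_imageI[OF fin]] hom bij]
  show "tensor_map R (ob F c) (orientation R (a - c)) (mor F c (f ` c) (restrict f c))
      (orientation_map R (a - c) (restrict f (a - c))) \<in> mod_hom R (K b (f ` c)) (K a c)" by (rule props(1))
  show "tensor_map R (ob F c) (orientation R (a - c)) (mor F c (f ` c) (restrict f c))
        (orientation_map R (a - c) (restrict f (a - c)))
        (word_tensor R (ob F (f ` c)) (b - f ` c) m (map f xs))
      = word_tensor R (ob F c) (a - c) (mor F c (f ` c) (restrict f c) m) xs"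
    if m: "m \<in> carrier (ob F (f ` c))" and xs: "xs \<in> perms (a - c)"
  proof -
    have eq: "map (restrict f (a - c)) xs = map f xs" using xs by (auto simp: perms_def)
    show ?thesis using props(2)[OF m xs] unfolding eq .
  qed
  have "card (f ` c) = card c" "card b = card a"
    using card_image[OF inj_on_subset[OF inj ca]] card_image[OF inj] fa by simp_all
  thus "f ` c \<in> koszul_index n b" using c image_mono[OF ca, of f] fa by (simp add: koszul_index_def)
  show "perms (b - f ` c) = map f ` perms (a - c)"
  proof (intro equalityI subsetI)
    fix ys assume ys: "ys \<in> perms (b - f ` c)"
    let ?g = "inv_into (a - c) f"
    have inj': "inj_on f (a - c)" by (rule inj_on_subset[OF inj Diff_subset])
    have "map f (map ?g ys) = ys"
      using ys im by (auto simp: perms_def f_inv_into_f intro!: map_idI)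
    moreover have "map ?g ys \<in> perms (a - c)"
    proof -
      have "set (map ?g ys) = a - c"
        using ys im inv_into_image_cancel[OF inj' subset_refl] by (simp add: perms_def)
      moreover have "distinct (map ?g ys)"
        using ys im inj_on_inv_into[of "b - f ` c" f "a - c"] by (simp add: perms_def distinct_map)
      ultimately show ?thesis by (simp add: perms_def)
    qed
    ultimately show "ys \<in> map f ` perms (a - c)" by (metis imageI)
  next
    fix ys assume "ys \<in> map f ` perms (a - c)"
    then obtain xs where "xs \<in> perms (a - c)" "ys = map f xs" by (rule imageE)
    thus "ys \<in> perms (b - f ` c)"
      using im inj_on_subset[OF inj Diff_subset[of a c]] by (simp add: perms_def distinct_map)
  qed
qed

text \<open>A bijection \<open>f\<close> carries the flag of a word to the flag of its image under \<open>f\<close>, and it permutes the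
orderings over which the sums range.\<close>

lemma comparison_natural:
  assumes a: "finite a" and f: "f \<in> Sigma_maps a b" and w: "normal F n b w"
  shows "comparison R F n a (mor ((perp ^^ n) (based F)) a b f w) =
    mor (coch (koszul R F) n) a b f (comparison R F n b w)"
  unfolding koszul_mor comparison_def[of R F n a]
proof (rule restrict_cong')
  fix c assume c: "c \<in> koszul_index n a"
  note props = koszul_mor_component_hom[OF a f c]
  note ca = koszul_indexD(1)[OF a c] and fin = koszul_indexD(2)[OF a c]
  have fa: "f ` a = b" and inj: "inj_on f a" using f by (auto simp: Sigma_maps_def bij_betw_def)
  have b: "finite b" using a fa by blast
  have wc: "w \<in> carrier (level_at F n b)" using w by (simp add: normal_def)
  interpret Ka: Module.module R "K a c" by (rule K_module[OF fin])
  interpret Kb: Module.module R "K b (f ` c)" by (rule K_module[OF finite_imageI[OF fin]])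
  let ?\<mu> = "mor F c (f ` c) (restrict f c)"
  let ?t = "tensor_map R (ob F c) (orientation R (a - c)) ?\<mu> (orientation_map R (a - c) (restrict f (a - c)))"
  let ?s = "\<lambda>ys. word_tensor R (ob F (f ` c)) (b - f ` c) (evaluate w (removal_chain b ys)) (rev ys)"
  have sc: "?s ys \<in> carrier (K b (f ` c))" if "ys \<in> perms (b - f ` c)" for ys
    by (rule mod_hom_closed[OF word_hom[OF b props(3) that] mod_hom_closed[OF evaluate_removal_chain_hom[OF b props(3) that] wc]])
  have mp: "map f xs \<in> perms (b - f ` c)" if "xs \<in> perms (a - c)" for xs
    unfolding props(4) by (rule imageI[OF that])
  have ts: "?t (?s (map f xs)) = word_tensor R (ob F c) (a - c)
      (evaluate (mor ((perp ^^ n) (based F)) a b f w) (removal_chain a xs)) (rev xs)" if xs: "xs \<in> perms (a - c)" for xs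
  proof -
    note r = removal_chain_perms[OF a c xs]
    have "set xs \<subseteq> a" using xs by (auto simp: perms_def)
    hence mi: "map (image f) (removal_chain a xs) = removal_chain b (map f xs)"
      using map_image_removal_chain[OF inj subset_refl, of xs] fa by simp
    have "evaluate (mor ((perp ^^ n) (based F)) a b f w) (removal_chain a xs)
        = ?\<mu> (evaluate w (removal_chain b (map f xs)))"
      unfolding evaluate_mor[OF f strict_chain_chain[OF r(1)] r(2)] r(3) mi ..
    moreover have "?t (?s (map f xs)) = word_tensor R (ob F c) (a - c) (?\<mu> (evaluate w (removal_chain b (map f xs)))) (rev xs)"
      unfolding rev_map
      by (rule props(2)[OF mod_hom_closed[OF evaluate_removal_chain_hom[OF b props(3) mp[OF xs]] wc]])
         (simp add: perms_rev xs)
    ultimately show ?thesis by simp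
  qed
  have "?t (comparison R F n b w (f ` c)) = ?t (\<Oplus>\<^bsub>K b (f ` c)\<^esub>ys\<in>perms (b - f ` c). ?s ys)"
    using props(3) by (simp add: comparison_def)
  also have "(\<Oplus>\<^bsub>K b (f ` c)\<^esub>ys\<in>perms (b - f ` c). ?s ys) = (\<Oplus>\<^bsub>K b (f ` c)\<^esub>xs\<in>perms (a - c). ?s (map f xs))"
    unfolding props(4)
  proof (rule Kb.M.finsum_reindex)
    show "?s \<in> map f ` perms (a - c) \<rightarrow> carrier (K b (f ` c))"
      unfolding props(4)[symmetric] by (rule Pi_I) (rule sc)
    show "inj_on (map f) (perms (a - c))"
    proof (rule inj_onI)
      fix xs ys assume xy: "xs \<in> perms (a - c)" "ys \<in> perms (a - c)" "map f xs = map f ys"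
      have "inj_on f (set xs \<union> set ys)" by (rule inj_on_subset[OF inj]) (use xy in \<open>auto simp: perms_def\<close>)
      thus "xs = ys" using xy(3) by (simp add: inj_on_map_eq_map)
    qed
  qed
  also have "?t \<dots> = (\<Oplus>\<^bsub>K a c\<^esub>xs\<in>perms (a - c). ?t (?s (map f xs)))"
    by (rule mod_hom_finsum[OF props(1) Kb.module_axioms Ka.module_axioms]) (rule Pi_I, rule sc[OF mp])
  also have "\<dots> = (\<Oplus>\<^bsub>K a c\<^esub>xs\<in>perms (a - c). word_tensor R (ob F c) (a - c)
      (evaluate (mor ((perp ^^ n) (based F)) a b f w) (removal_chain a xs)) (rev xs))"
  proof (rule Ka.M.finsum_congI[OF ts])
    fix xs assume xs: "xs \<in> perms (a - c)"
    show "word_tensor R (ob F c) (a - c)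
      (evaluate (mor ((perp ^^ n) (based F)) a b f w) (removal_chain a xs)) (rev xs) \<in> carrier (K a c)"
      unfolding ts[OF xs, symmetric] by (rule mod_hom_closed[OF props(1) sc[OF mp[OF xs]]])
  qed
  finally show "(\<Oplus>\<^bsub>K a c\<^esub>xs\<in>perms (a - c). word_tensor R (ob F c) (a - c)
      (evaluate (mor ((perp ^^ n) (based F)) a b f w) (removal_chain a xs)) (rev xs))
    = ?t (comparison R F n b w (f ` c))" by (rule sym)
qed

lemma koszul_diff_component_hom:
  assumes b: "finite b" and c: "c \<in> koszul_index (Suc n) b" and x: "x \<in> b - c"
  shows "tensor_map R (ob F c) (orientation R (b - c)) (restriction F c (insert x c)) (wedge_point R (b - c) x)
      \<in> mod_hom R (K b (insert x c)) (K b c)"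
    and "\<lbrakk>m \<in> carrier (ob F (insert x c)); xs \<in> perms (b - c - {x})\<rbrakk> \<Longrightarrow>
      tensor_map R (ob F c) (orientation R (b - c)) (restriction F c (insert x c)) (wedge_point R (b - c) x)
        (word_tensor R (ob F (insert x c)) (b - insert x c) m xs)
      = word_tensor R (ob F c) (b - c) (restriction F c (insert x c) m) (x # xs)"
    and "insert x c \<in> koszul_index n b" and "b - insert x c = b - c - {x}"
proof -
  note cb = koszul_indexD(1)[OF b c] and fin = koszul_indexD(2)[OF b c]
  show eq: "b - insert x c = b - c - {x}" by blast
  have fin': "finite (insert x c)" "finite (b - c)" using fin b by simp_all
  note props = word_tensor_wedge_point[OF ob_module[OF fin] ob_module[OF fin'(1)]
      restriction_hom[OF fin'(1) subset_insertI] fin'(2) x]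
  show "tensor_map R (ob F c) (orientation R (b - c)) (restriction F c (insert x c)) (wedge_point R (b - c) x)
      \<in> mod_hom R (K b (insert x c)) (K b c)" unfolding eq by (rule props(1))
  show "tensor_map R (ob F c) (orientation R (b - c)) (restriction F c (insert x c)) (wedge_point R (b - c) x)
        (word_tensor R (ob F (insert x c)) (b - insert x c) m xs)
      = word_tensor R (ob F c) (b - c) (restriction F c (insert x c) m) (x # xs)"
    if "m \<in> carrier (ob F (insert x c))" "xs \<in> perms (b - c - {x})"
    unfolding eq by (rule props(2)[OF that])
  show "insert x c \<in> koszul_index n b"
    using c x cb fin by (simp add: koszul_index_def)
qed

text \<open>The sum of the inner differentials over all flags to \<open>c\<close> vanishes by \<open>alternating_sum_inner_diff\<close>. In the
restriction terms the flags are grouped by the point \<open>x\<close> that is removed last; removing that point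
leaves a flag from \<open>b\<close> to \<open>c \<union> {x}\<close>, and the group adds up to the summand for \<open>x\<close> of the Koszul differential.\<close>

lemma comparison_commutes:
  assumes b: "finite b" and w: "normal F n b w"
  shows "comparison R F (Suc n) b (diff Cobar n b w) = diff (koszul R F) n b (comparison R F n b w)"
  unfolding koszul_diff comparison_def[of R F "Suc n"]
proof (rule restrict_cong')
  fix c assume c: "c \<in> koszul_index (Suc n) b"
  note cb = koszul_indexD(1)[OF b c] and fin = koszul_indexD(2)[OF b c] and card = koszul_indexD(3)[OF b c]
  have wc: "w \<in> carrier (level_at F n b)" using w by (simp add: normal_def)
  have finbc: "finite (b - c)" using b by simp
  have ne: "b - c \<noteq> {}" using card by (metis card.empty nat.distinct(1))
  interpret Kc: Module.module R "K b c" by (rule K_module[OF fin])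
  interpret A: abelian_group "ob F c" by (rule ob_abelian_group[OF fin])
  define T where "T xs m = word_tensor R (ob F c) (b - c) m (rev xs)" for xs m
  have T: "T xs \<in> mod_hom R (ob F c) (K b c)" if "xs \<in> perms (b - c)" for xs
    using word_hom[OF b c that] unfolding T_def .
  let ?Q = "\<lambda>xs. inner_diff (ob F c) (chain_value n b c w) (removal_chain b xs)"
  define r where "r xs = restriction F c (last (b # butlast (removal_chain b xs))) (evaluate w (butlast (removal_chain b xs)))" for xs
  have Qc: "?Q xs \<in> carrier (ob F c)" for xs by (rule A.inner_diff_closed[OF chain_value_closed[OF wc fin]])
  have rc: "r xs \<in> carrier (ob F c)" if xs: "xs \<in> perms (b - c)" for xs
  proof -
    note p = removal_chain_perms[OF b c xs]
    have "last (removal_chain b xs) = c"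
      using p(2,3) unfolding last.simps by (metis length_0_conv nat.distinct(1))
    thus ?thesis
      using mod_hom_closed[OF restriction_evaluate_hom[OF b strict_chain_chain[OF p(1)] p(2)] wc] by (simp add: r_def)
  qed
  have ev: "evaluate (diff Cobar n b w) (removal_chain b xs) = ?Q xs \<oplus>\<^bsub>ob F c\<^esub> r xs" if xs: "xs \<in> perms (b - c)" for xs
  proof -
    note p = removal_chain_perms[OF b c xs]
    have "last (removal_chain b xs) = c"
      using p(2,3) unfolding last.simps by (metis length_0_conv nat.distinct(1))
    thus ?thesis using evaluate_diff_strict[OF b w p(1,2)] by (simp add: diff_value_def r_def)
  qed
  have "(\<Oplus>\<^bsub>K b c\<^esub>xs\<in>perms (b - c). word_tensor R (ob F c) (b - c) (evaluate (diff Cobar n b w) (removal_chain b xs)) (rev xs))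
      = (\<Oplus>\<^bsub>K b c\<^esub>xs\<in>perms (b - c). T xs (?Q xs) \<oplus>\<^bsub>K b c\<^esub> T xs (r xs))"
  proof (rule Kc.M.finsum_congI)
    fix xs assume xs: "xs \<in> perms (b - c)"
    show "word_tensor R (ob F c) (b - c) (evaluate (diff Cobar n b w) (removal_chain b xs)) (rev xs)
        = T xs (?Q xs) \<oplus>\<^bsub>K b c\<^esub> T xs (r xs)"
      unfolding ev[OF xs] T_def[symmetric] by (rule mod_hom_add[OF T[OF xs] Qc rc[OF xs]])
    show "T xs (?Q xs) \<oplus>\<^bsub>K b c\<^esub> T xs (r xs) \<in> carrier (K b c)"
      by (intro Kc.M.a_closed mod_hom_closed[OF T[OF xs]] Qc rc[OF xs])
  qed
  also have "\<dots> = (\<Oplus>\<^bsub>K b c\<^esub>xs\<in>perms (b - c). T xs (?Q xs)) \<oplus>\<^bsub>K b c\<^esub> (\<Oplus>\<^bsub>K b c\<^esub>xs\<in>perms (b - c). T xs (r xs))"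
    by (rule Kc.M.finsum_addI) (rule mod_hom_closed[OF T], assumption, (rule Qc rc, assumption?))+
  also have "(\<Oplus>\<^bsub>K b c\<^esub>xs\<in>perms (b - c). T xs (?Q xs)) = \<zero>\<^bsub>K b c\<^esub>"
  proof (rule alternating_sum_inner_diff[OF ob_abelian_group[OF fin] Kc.M.abelian_group_axioms finbc chain_value_closed[OF wc fin]])
    fix zs x y ws m assume xs: "zs @ x # y # ws \<in> perms (b - c)" and m: "m \<in> carrier (ob F c)"
    have "rev ws @ y # x # rev zs \<in> perms (b - c)" using xs perms_rev[of "zs @ x # y # ws"] by simp
    thus "T (zs @ y # x # ws) m = \<ominus>\<^bsub>K b c\<^esub> T (zs @ x # y # ws) m"
      using word_tensor_swap[OF ob_module[OF fin] _ m, of "rev ws" y x "rev zs" "b - c"] by (simp add: T_def)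
  qed (simp_all add: mod_homD[OF T] mod_hom_zero[OF T ob_module[OF fin] Kc.module_axioms])
  also have "(\<Oplus>\<^bsub>K b c\<^esub>xs\<in>perms (b - c). T xs (r xs)) = (\<Oplus>\<^bsub>K b c\<^esub>x\<in>b - c. \<Oplus>\<^bsub>K b c\<^esub>ys\<in>perms (b - c - {x}). T (ys @ [x]) (r (ys @ [x])))"
    by (rule Kc.M.finsum_perms_snoc[OF finbc ne]) (rule mod_hom_closed[OF T rc])
  also have "\<zero>\<^bsub>K b c\<^esub> \<oplus>\<^bsub>K b c\<^esub> \<dots> = (\<Oplus>\<^bsub>K b c\<^esub>x\<in>b - c. tensor_map R (ob F c) (orientation R (b - c))
      (restriction F c (insert x c)) (wedge_point R (b - c) x) (comparison R F n b w (insert x c)))"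
  proof -
    have step: "(\<Oplus>\<^bsub>K b c\<^esub>ys\<in>perms (b - c - {x}). T (ys @ [x]) (r (ys @ [x])))
        = tensor_map R (ob F c) (orientation R (b - c)) (restriction F c (insert x c)) (wedge_point R (b - c) x)
            (comparison R F n b w (insert x c))"
      and closed: "(\<Oplus>\<^bsub>K b c\<^esub>ys\<in>perms (b - c - {x}). T (ys @ [x]) (r (ys @ [x]))) \<in> carrier (K b c)"
      if x: "x \<in> b - c" for x
    proof -
      note props = koszul_diff_component_hom[OF b c x]
      let ?t = "tensor_map R (ob F c) (orientation R (b - c)) (restriction F c (insert x c)) (wedge_point R (b - c) x)"
      interpret Kx: Module.module R "K b (insert x c)" by (rule K_module) (simp add: fin)
      let ?s = "\<lambda>ys. word_tensor R (ob F (insert x c)) (b - insert x c) (evaluate w (removal_chain b ys)) (rev ys)"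
      have yp: "ys \<in> perms (b - insert x c)" if "ys \<in> perms (b - c - {x})" for ys using that by (simp only: props(4))
      have sc: "?s ys \<in> carrier (K b (insert x c))" if "ys \<in> perms (b - c - {x})" for ys
        by (rule mod_hom_closed[OF word_hom[OF b props(3) yp[OF that]]
              mod_hom_closed[OF evaluate_removal_chain_hom[OF b props(3) yp[OF that]] wc]])
      have ts: "T (ys @ [x]) (r (ys @ [x])) = ?t (?s ys)" if ys: "ys \<in> perms (b - c - {x})" for ys
      proof -
        have "set ys = b - c - {x}" using ys by (simp add: perms_def)
        have lastb: "last (b # removal_chain b ys) = insert x c" by (rule removal_chain_perms(3)[OF b props(3) yp[OF ys]])
        have "r (ys @ [x]) = restriction F c (insert x c) (evaluate w (removal_chain b ys))"
          unfolding r_def removal_chain_append removal_chain.simps butlast_snoc lastb ..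
        moreover have "?t (?s ys) = word_tensor R (ob F c) (b - c)
            (restriction F c (insert x c) (evaluate w (removal_chain b ys))) (x # rev ys)"
          by (rule props(2)[OF mod_hom_closed[OF evaluate_removal_chain_hom[OF b props(3) yp[OF ys]] wc]])
             (simp add: perms_rev ys)
        ultimately show ?thesis by (simp add: T_def)
      qed
      have tc: "?t (?s ys) \<in> carrier (K b c)" if "ys \<in> perms (b - c - {x})" for ys
        by (rule mod_hom_closed[OF props(1) sc[OF that]])
      have "?t (comparison R F n b w (insert x c)) = ?t (\<Oplus>\<^bsub>K b (insert x c)\<^esub>ys\<in>perms (b - c - {x}). ?s ys)"
        using props(3) by (simp add: comparison_def props(4))
      also have "\<dots> = (\<Oplus>\<^bsub>K b c\<^esub>ys\<in>perms (b - c - {x}). ?t (?s ys))"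
        by (rule mod_hom_finsum[OF props(1) Kx.module_axioms Kc.module_axioms]) (rule Pi_I, rule sc)
      also have "\<dots> = (\<Oplus>\<^bsub>K b c\<^esub>ys\<in>perms (b - c - {x}). T (ys @ [x]) (r (ys @ [x])))"
        by (rule Kc.M.finsum_congI) (simp_all only: ts tc)
      finally show "(\<Oplus>\<^bsub>K b c\<^esub>ys\<in>perms (b - c - {x}). T (ys @ [x]) (r (ys @ [x])))
        = ?t (comparison R F n b w (insert x c))" by (rule sym)
      show "(\<Oplus>\<^bsub>K b c\<^esub>ys\<in>perms (b - c - {x}). T (ys @ [x]) (r (ys @ [x]))) \<in> carrier (K b c)"
        by (rule Kc.M.finsum_closedI) (simp only: ts tc)
    qed
    have "\<zero>\<^bsub>K b c\<^esub> \<oplus>\<^bsub>K b c\<^esub> (\<Oplus>\<^bsub>K b c\<^esub>x\<in>b - c. \<Oplus>\<^bsub>K b c\<^esub>ys\<in>perms (b - c - {x}). T (ys @ [x]) (r (ys @ [x])))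
        = (\<Oplus>\<^bsub>K b c\<^esub>x\<in>b - c. \<Oplus>\<^bsub>K b c\<^esub>ys\<in>perms (b - c - {x}). T (ys @ [x]) (r (ys @ [x])))"
      by (rule Kc.M.l_zero[OF Kc.M.finsum_closedI[OF closed]])
    also have "\<dots> = (\<Oplus>\<^bsub>K b c\<^esub>x\<in>b - c. tensor_map R (ob F c) (orientation R (b - c))
      (restriction F c (insert x c)) (wedge_point R (b - c) x) (comparison R F n b w (insert x c)))"
    proof (rule Kc.M.finsum_congI[OF step])
      fix x assume x: "x \<in> b - c"
      show "tensor_map R (ob F c) (orientation R (b - c)) (restriction F c (insert x c)) (wedge_point R (b - c) x)
          (comparison R F n b w (insert x c)) \<in> carrier (K b c)"
        unfolding step[OF x, symmetric] by (rule closed[OF x])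
    qed
    finally show ?thesis .
  qed
  finally show "(\<Oplus>\<^bsub>K b c\<^esub>xs\<in>perms (b - c). word_tensor R (ob F c) (b - c) (evaluate (diff Cobar n b w) (removal_chain b xs)) (rev xs))
    = (\<Oplus>\<^bsub>K b c\<^esub>x\<in>b - c. tensor_map R (ob F c) (orientation R (b - c))
      (restriction F c (insert x c)) (wedge_point R (b - c) x) (comparison R F n b w (insert x c)))" .
qed

end

subsection \<open>The Koszul complex as a quotient\<close>

context FI_functor
begin

lemma koszul_mor_hom:
  assumes a: "finite a" and f: "f \<in> Sigma_maps a b"
  shows "mor (coch (koszul R F) n) a b f \<in>
    mod_hom R (ob (coch (koszul R F) n) b) (ob (coch (koszul R F) n) a)"
proof -
  let ?t = "\<lambda>c. tensor_map R (ob F c) (orientation R (a - c)) (mor F c (f ` c) (restrict f c))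
      (orientation_map R (a - c) (restrict f (a - c)))"
  have eq: "mor (coch (koszul R F) n) a b f = (\<lambda>w. \<lambda>c\<in>koszul_index n a. ?t c (w (f ` c)))"
    by (rule ext) (rule koszul_mor)
  have comp: "(\<lambda>w. ?t c (w (f ` c))) \<in> mod_hom R (direct_sum (koszul_index n b) (K b)) (K a c)"
    if c: "c \<in> koszul_index n a" for c
  proof -
    have "(\<lambda>w. w (f ` c)) \<in> mod_hom R (direct_sum (koszul_index n b) (K b)) (K b (f ` c))"
      by (rule direct_sum_proj_hom[OF koszul_mor_component_hom(3)[OF a f c]])
    thus ?thesis by (rule mod_hom_comp[OF _ koszul_mor_component_hom(1)[OF a f c]])
  qed
  show ?thesis unfolding koszul_ob eq by (rule mod_hom_direct_sum[OF comp])
qed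

lemma koszul_diff_hom:
  assumes b: "finite b"
  shows "diff (koszul R F) n b \<in> mod_hom R (ob (coch (koszul R F) n) b) (ob (coch (koszul R F) (Suc n)) b)"
proof -
  let ?t = "\<lambda>c x. tensor_map R (ob F c) (orientation R (b - c)) (restriction F c (insert x c)) (wedge_point R (b - c) x)"
  have eq: "diff (koszul R F) n b = (\<lambda>w. \<lambda>c\<in>koszul_index (Suc n) b. \<Oplus>\<^bsub>K b c\<^esub>x\<in>b - c. ?t c x (w (insert x c)))"
    by (rule ext) (rule koszul_diff)
  have comp: "(\<lambda>w. \<Oplus>\<^bsub>K b c\<^esub>x\<in>b - c. ?t c x (w (insert x c)))
      \<in> mod_hom R (direct_sum (koszul_index n b) (K b)) (K b c)" if c: "c \<in> koszul_index (Suc n) b" for c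
  proof (rule mod_hom_finsum_fun[OF finite_Diff[OF b] _ K_module[OF koszul_indexD(2)[OF b c]]])
    fix x assume x: "x \<in> b - c"
    show "(\<lambda>w. ?t c x (w (insert x c))) \<in> mod_hom R (direct_sum (koszul_index n b) (K b)) (K b c)"
    proof -
      have "(\<lambda>w. w (insert x c)) \<in> mod_hom R (direct_sum (koszul_index n b) (K b)) (K b (insert x c))"
        by (rule direct_sum_proj_hom[OF koszul_diff_component_hom(3)[OF b c x]])
      thus ?thesis by (rule mod_hom_comp[OF _ koszul_diff_component_hom(1)[OF b c x]])
    qed
  qed
  show ?thesis unfolding koszul_ob eq by (rule mod_hom_direct_sum[OF comp])
qed

text \<open>Every element of the Koszul complex comes from the normalized complex. Since the comparison map is
compatible with the structure maps and differentials, the identities that hold in the normalized complex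
follow for the Koszul complex.\<close>

lemma koszul_lift:
  assumes "finite b" "y \<in> carrier (ob (coch (koszul R F) n) b)"
  obtains w where "normal F n b w" "y = comparison R F n b w"
  using comparison_surj[OF assms] by blast

lemma koszul_op_module: "Sigma_op_module R (coch (koszul R F) n)"
proof (intro op_module.intro op_module_axioms.intro is_cring)
  interpret N: op_module Sigma_maps R "coch Cobar n" by (rule normalized_cobar_op_module)
  note mor_eq = normalized_cobar_simps(4)
  fix a :: "'x set" assume a: "finite a"
  show "Module.module R (ob (coch (koszul R F) n) a)" by (rule koszul_ob_module[OF a])
  {
    fix v assume "v \<in> carrier (ob (coch (koszul R F) n) a)"
    then obtain w where w: "normal F n a w" "v = comparison R F n a w" using koszul_lift[OF a] by blast
    have f: "(\<lambda>x\<in>a. x) \<in> Sigma_maps a a" by (auto simp: Sigma_maps_def bij_betw_def inj_on_def)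
    have "mor ((perp ^^ n) (based F)) a a (\<lambda>x\<in>a. x) w = w"
      using N.mor_id[OF a, of w] w(1) unfolding normalized_cobar_carrier mor_eq by simp
    thus "mor (coch (koszul R F) n) a a (\<lambda>x\<in>a. x) v = v"
      using comparison_natural[OF a f w(1)] unfolding w(2) by simp
  }
  fix b :: "'x set" and f assume b: "finite b" and f: "f \<in> Sigma_maps a b"
  show "mor (coch (koszul R F) n) a b f \<in> mod_hom R (ob (coch (koszul R F) n) b) (ob (coch (koszul R F) n) a)"
    by (rule koszul_mor_hom[OF a f])
  fix c :: "'x set" and g v assume c: "finite c" and g: "g \<in> Sigma_maps b c"
    and v: "v \<in> carrier (ob (coch (koszul R F) n) c)"
  obtain w where w: "normal F n c w" "v = comparison R F n c w" using koszul_lift[OF c v] by blast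
  have "compose a g f \<in> a \<rightarrow>\<^sub>E c"
    using f g by (auto simp: Sigma_maps_def PiE_iff compose_def)
  moreover have "bij_betw (compose a g f) a c"
    using f g unfolding Sigma_maps_def by (blast intro: bij_betw_compose)
  ultimately have gf: "compose a g f \<in> Sigma_maps a c" by (simp add: Sigma_maps_def)
  have "mor ((perp ^^ n) (based F)) a c (compose a g f) w
      = mor ((perp ^^ n) (based F)) a b f (mor ((perp ^^ n) (based F)) b c g w)"
    using N.mor_comp[OF a b c f g, of w] w(1) unfolding normalized_cobar_carrier mor_eq by simp
  thus "mor (coch (koszul R F) n) a c (compose a g f) v
      = mor (coch (koszul R F) n) a b f (mor (coch (koszul R F) n) b c g v)"
    unfolding w(2) comparison_natural[OF a gf w(1), symmetric] comparison_natural[OF b g w(1), symmetric]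
      comparison_natural[OF a f normal_mor[OF b g w(1)], symmetric] by simp
qed

lemma comparison_zero:
  "finite b \<Longrightarrow> comparison R F n b \<zero>\<^bsub>level_at F n b\<^esub> = \<zero>\<^bsub>ob (coch (koszul R F) n) b\<^esub>"
  by (rule mod_hom_zero[OF comparison_level_hom level_at_module koszul_ob_module])

lemma cochain_complex_koszul: "cochain_complex R (koszul R F)"
proof (rule cochain_complex.intro)
  show "Sigma_op_module_hom R (coch (koszul R F) n) (coch (koszul R F) (Suc n)) (diff (koszul R F) n)" for n
  proof (intro op_module_hom.intro op_module_hom_axioms.intro koszul_op_module koszul_diff_hom)
    fix a b f v
    assume a: "finite a" and b: "finite b" and f: "f \<in> Sigma_maps a b"
      and v: "v \<in> carrier (ob (coch (koszul R F) n) b)"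
    obtain w where w: "normal F n b w" "v = comparison R F n b w" using koszul_lift[OF b v] by blast
    show "diff (koszul R F) n a (mor (coch (koszul R F) n) a b f v)
        = mor (coch (koszul R F) (Suc n)) a b f (diff (koszul R F) n b v)"
      unfolding w(2) comparison_natural[OF a f w(1), symmetric]
        comparison_commutes[OF a normal_mor[OF a f w(1)], symmetric] comparison_commutes[OF b w(1), symmetric]
        comparison_natural[OF a f diff_normal[OF b w(1)], symmetric] diff_Cobar_natural[OF a f w(1)] ..
  qed
  fix n b v assume b: "finite b" and v: "v \<in> carrier (ob (coch (koszul R F) n) b)"
  obtain w where w: "normal F n b w" "v = comparison R F n b w" using koszul_lift[OF b v] by blast
  show "diff (koszul R F) (Suc n) b (diff (koszul R F) n b v) = \<zero>\<^bsub>ob (coch (koszul R F) (Suc (Suc n))) b\<^esub>"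
    unfolding w(2) comparison_commutes[OF b w(1), symmetric]
      comparison_commutes[OF b diff_normal[OF b w(1)], symmetric] diff_diff_Cobar[OF b w(1)]
    by (rule comparison_zero[OF b])
qed

lemma comparison_cochain_map: "cochain_map R Cobar (koszul R F) (comparison R F)"
proof (intro cochain_map.intro cochain_map_axioms.intro cochain_complex_Cobar cochain_complex_koszul)
  show "Sigma_op_module_hom R (coch Cobar n) (coch (koszul R F) n) (comparison R F n)" for n
  proof (intro op_module_hom.intro op_module_hom_axioms.intro normalized_cobar_op_module koszul_op_module comparison_hom)
    fix a b f v
    assume "finite a" "f \<in> Sigma_maps a b" "v \<in> carrier (ob (coch Cobar n) b)"
    thus "comparison R F n a (mor (coch Cobar n) a b f v) = mor (coch (koszul R F) n) a b f (comparison R F n b v)"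
      unfolding normalized_cobar_carrier normalized_cobar_simps by (rule comparison_natural)
  qed
  show "comparison R F (Suc n) b (diff Cobar n b v) = diff (koszul R F) n b (comparison R F n b v)"
    if "finite b" "v \<in> carrier (ob (coch Cobar n) b)" for n b v
    using that unfolding normalized_cobar_carrier by (rule comparison_commutes)
qed

lemma comparison_surjective: "surjective_map Cobar (koszul R F) (comparison R F)"
  unfolding surjective_map_def
proof (intro allI impI equalityI subsetI)
  fix n and b :: "'x set" and y assume b: "finite b"
  {
    assume "y \<in> comparison R F n b ` carrier (ob (coch Cobar n) b)"
    then obtain w where "w \<in> carrier (ob (coch Cobar n) b)" "y = comparison R F n b w" by blast
    thus "y \<in> carrier (ob (coch (koszul R F) n) b)" using mod_hom_closed[OF comparison_hom[OF b]] by simp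
  }
  assume "y \<in> carrier (ob (coch (koszul R F) n) b)"
  then obtain w where "normal F n b w" "y = comparison R F n b w" using koszul_lift[OF b] by blast
  thus "y \<in> comparison R F n b ` carrier (ob (coch Cobar n) b)"
    unfolding normalized_cobar_carrier[symmetric] by (simp only: imageI)
qed

subsection \<open>The kernel of the comparison map is acyclic\<close>

text \<open>Off one complete flag from \<open>b\<close> to \<open>c\<close>, the function is an inner coboundary by \<open>inner_diff_exact\<close>. The
comparison map kills inner coboundaries, so if it kills the function as well, then it kills the
difference, which is supported on that flag; by \<open>word_tensor_inj\<close> the difference is zero.\<close>

lemma chain_value_exact:
  assumes b: "finite b" and v: "normal F n b v" and c: "c \<subseteq> b"
    and cocycle: "\<And>l. \<lbrakk>strict_chain b l; length l = Suc n; last (b # l) = c\<rbrakk> \<Longrightarrow>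
      inner_diff (ob F c) (chain_value n b c v) l = \<zero>\<^bsub>ob F c\<^esub>"
    and kernel: "c \<in> koszul_index n b \<Longrightarrow> comparison R F n b v c = \<zero>\<^bsub>K b c\<^esub>"
  shows "\<exists>w. (\<forall>l. w l \<in> carrier (ob F c)) \<and> (\<forall>l. strict_chain b l \<and> length l = n \<and> last (b # l) = c \<longrightarrow>
    evaluate v l = inner_diff (ob F c) w l)"
proof -
  have fin: "finite c" by (rule finite_subset[OF c b])
  have finbc: "finite (b - c)" using b by simp
  have vc: "v \<in> carrier (level_at F n b)" using v by (simp add: normal_def)
  interpret A: abelian_group "ob F c" by (rule ob_abelian_group[OF fin])
  interpret Kc: Module.module R "K b c" by (rule K_module[OF fin])
  let ?q = "chain_value n b c v"
  note q = chain_value_closed[OF vc fin]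
  obtain xs where xs: "xs \<in> perms (b - c)" using perms_nonempty[OF finbc] by blast
  have dist: "distinct xs" "set xs = b - c" using xs by (simp_all add: perms_def)
  have bc: "b = c \<union> set xs" "c \<inter> set xs = {}" using c unfolding dist(2) by blast+
  obtain w where w: "\<And>l. w l \<in> carrier (ob F c)"
    "\<And>l. \<lbrakk>strict_chain b l; length l = n; last (b # l) = c; l \<noteq> removal_chain b xs\<rbrakk> \<Longrightarrow>
      ?q l = inner_diff (ob F c) w l"
    using A.inner_diff_exact[OF dist(1) bc q cocycle] by metis
  have full: "?q (removal_chain b xs) = inner_diff (ob F c) w (removal_chain b xs)"
    if "length (removal_chain b xs) = n"
  proof -
    have "card (b - c) = n" using that perms_length[OF xs] by simp
    hence ci: "c \<in> koszul_index n b"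
      using card_Diff_subset[OF fin c] card_mono[OF b c] c by (simp add: koszul_index_def)
    define T where "T zs m = word_tensor R (ob F c) (b - c) m (rev zs)" for zs m
    have T: "T zs \<in> mod_hom R (ob F c) (K b c)" if "zs \<in> perms (b - c)" for zs
      using word_hom[OF b ci that] unfolding T_def .
    \<comment> \<open>The difference of the two functions on flags; it can be nonzero only at \<open>xs\<close>.\<close>
    define h where "h zs = ?q (removal_chain b zs) \<ominus>\<^bsub>ob F c\<^esub> inner_diff (ob F c) w (removal_chain b zs)" for zs
    have Qc: "inner_diff (ob F c) w l \<in> carrier (ob F c)" for l by (rule A.inner_diff_closed[OF w(1)])
    have h: "h zs \<in> carrier (ob F c)" for zs unfolding h_def by (rule A.minus_closed[OF q Qc])
    have q_eq: "?q (removal_chain b zs) = h zs \<oplus>\<^bsub>ob F c\<^esub> inner_diff (ob F c) w (removal_chain b zs)" for zs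
      unfolding h_def a_minus_def using q[of "removal_chain b zs"] Qc[of "removal_chain b zs"] by (simp add: A.a_assoc A.l_neg)
    have "\<zero>\<^bsub>K b c\<^esub> = (\<Oplus>\<^bsub>K b c\<^esub>zs\<in>perms (b - c). T zs (evaluate v (removal_chain b zs)))"
      using kernel[OF ci] ci by (simp add: comparison_def T_def)
    also have "\<dots> = (\<Oplus>\<^bsub>K b c\<^esub>zs\<in>perms (b - c). T zs (h zs) \<oplus>\<^bsub>K b c\<^esub> T zs (inner_diff (ob F c) w (removal_chain b zs)))"
    proof (rule Kc.M.finsum_congI)
      fix zs assume zs: "zs \<in> perms (b - c)"
      note p = removal_chain_perms[OF b ci zs]
      have "evaluate v (removal_chain b zs) = ?q (removal_chain b zs)"
        by (rule chain_value_eq[OF strict_chain_chain[OF p(1)] p(2,3), symmetric])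
      thus "T zs (evaluate v (removal_chain b zs)) = T zs (h zs) \<oplus>\<^bsub>K b c\<^esub> T zs (inner_diff (ob F c) w (removal_chain b zs))"
        unfolding q_eq using mod_hom_add[OF T[OF zs] h Qc] by simp
      show "T zs (h zs) \<oplus>\<^bsub>K b c\<^esub> T zs (inner_diff (ob F c) w (removal_chain b zs)) \<in> carrier (K b c)"
        by (intro Kc.M.a_closed mod_hom_closed[OF T[OF zs]] h Qc)
    qed
    also have "\<dots> = (\<Oplus>\<^bsub>K b c\<^esub>zs\<in>perms (b - c). T zs (h zs))
        \<oplus>\<^bsub>K b c\<^esub> (\<Oplus>\<^bsub>K b c\<^esub>zs\<in>perms (b - c). T zs (inner_diff (ob F c) w (removal_chain b zs)))"
      by (rule Kc.M.finsum_addI) (rule mod_hom_closed[OF T], assumption, (rule Qc h))+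
    also have "(\<Oplus>\<^bsub>K b c\<^esub>zs\<in>perms (b - c). T zs (inner_diff (ob F c) w (removal_chain b zs))) = \<zero>\<^bsub>K b c\<^esub>"
    proof (rule alternating_sum_inner_diff[OF ob_abelian_group[OF fin] Kc.M.abelian_group_axioms finbc w(1)])
      fix zs x y ws m assume xs: "zs @ x # y # ws \<in> perms (b - c)" and m: "m \<in> carrier (ob F c)"
      have "rev ws @ y # x # rev zs \<in> perms (b - c)" using xs perms_rev[of "zs @ x # y # ws"] by simp
      thus "T (zs @ y # x # ws) m = \<ominus>\<^bsub>K b c\<^esub> T (zs @ x # y # ws) m"
        using word_tensor_swap[OF ob_module[OF fin] _ m, of "rev ws" y x "rev zs" "b - c"] by (simp add: T_def)
    qed (simp_all add: mod_homD[OF T] mod_hom_zero[OF T ob_module[OF fin] Kc.module_axioms])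
    also have "(\<Oplus>\<^bsub>K b c\<^esub>zs\<in>perms (b - c). T zs (h zs)) = (\<Oplus>\<^bsub>K b c\<^esub>zs\<in>insert xs (perms (b - c) - {xs}). T zs (h zs))"
      using xs by (simp add: insert_absorb)
    also have "\<dots> = T xs (h xs) \<oplus>\<^bsub>K b c\<^esub> (\<Oplus>\<^bsub>K b c\<^esub>zs\<in>perms (b - c) - {xs}. T zs (h zs))"
    proof (rule Kc.M.finsum_insertI)
      show "finite (perms (b - c) - {xs})" using finite_perms[OF finbc] by simp
      show "T zs (h zs) \<in> carrier (K b c)" if "zs \<in> perms (b - c) - {xs}" for zs
        by (rule mod_hom_closed[OF T h]) (use that in simp)
    qed (use mod_hom_closed[OF T[OF xs] h] in simp_all)
    also have "(\<Oplus>\<^bsub>K b c\<^esub>zs\<in>perms (b - c) - {xs}. T zs (h zs)) = (\<Oplus>\<^bsub>K b c\<^esub>zs\<in>perms (b - c) - {xs}. \<zero>\<^bsub>K b c\<^esub>)"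
    proof (rule Kc.M.finsum_congI)
      fix zs assume "zs \<in> perms (b - c) - {xs}"
      hence zs: "zs \<in> perms (b - c)" "zs \<noteq> xs" by simp_all
      note p = removal_chain_perms[OF b ci zs(1)]
      have "removal_chain b zs \<noteq> removal_chain b xs"
        using removal_chain_inj[of b zs xs] zs xs by (auto simp: perms_def)
      hence "?q (removal_chain b zs) = inner_diff (ob F c) w (removal_chain b zs)" by (rule w(2)[OF p])
      hence "h zs = \<zero>\<^bsub>ob F c\<^esub>"
        unfolding h_def using Qc[of "removal_chain b zs"] by (simp add: a_minus_def A.r_neg)
      thus "T zs (h zs) = \<zero>\<^bsub>K b c\<^esub>"
        using mod_hom_zero[OF T[OF zs(1)] ob_module[OF fin] Kc.module_axioms] by simp
    qed simp
    finally have "T xs (h xs) = \<zero>\<^bsub>K b c\<^esub>" using mod_hom_closed[OF T[OF xs] h] by simp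
    hence "h xs = \<zero>\<^bsub>ob F c\<^esub>"
      unfolding T_def by (intro word_tensor_inj[OF ob_module[OF fin] _ h, of "rev xs"]) (simp_all add: perms_rev xs)
    thus ?thesis unfolding q_eq using Qc by simp
  qed
  have "evaluate v l = inner_diff (ob F c) w l" if l: "strict_chain b l" "length l = n" "last (b # l) = c" for l
    using chain_value_eq[OF strict_chain_chain[OF l(1)] l(2,3), of v] w(2)[OF l] full l(2) by metis
  thus ?thesis using w(1) by blast
qed

lemma card_Diff_psubset:
  assumes "finite b" "c \<subset> e" "e \<subseteq> b" shows "card (b - e) < card (b - c)"
  by (rule psubset_card_mono) (use assms in auto)

lemma strict_chain_last_butlast:
  assumes "strict_chain b l" "l \<noteq> []" shows "last (b # l) \<subset> last (b # butlast l)"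
proof -
  have "strict_chain (last (b # butlast l)) [last l]"
    using assms strict_chain_append[of b "butlast l" "[last l]"] by simp
  thus ?thesis using assms(2) by simp
qed

text \<open>The step of the filtration by the codimension of the last subset of a chain. If \<open>v\<close> vanishes in
codimension less than \<open>p\<close>, its restriction terms vanish up to codimension \<open>p\<close>, so in codimension \<open>p\<close> it is a
cocycle for the inner differential and hence an inner coboundary. The primitives for the subsets of
codimension \<open>p\<close> are assembled to \<open>u\<close>, whose restriction terms live in codimension greater than \<open>p\<close>. The
comparison map kills \<open>u\<close>: it involves only chains of length \<open>m\<close> to subsets of codimension \<open>m\<close>, and
\<open>m < p\<close>.\<close>

lemma kernel_filtration_step:
  assumes b: "finite b" and v: "normal F (Suc m) b v"
    and dv: "diff Cobar (Suc m) b v = \<zero>\<^bsub>level_at F (Suc (Suc m)) b\<^esub>"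
    and kernel: "comparison R F (Suc m) b v = \<zero>\<^bsub>ob (coch (koszul R F) (Suc m)) b\<^esub>"
    and p: "Suc m \<le> p"
    and vanish: "\<And>l. \<lbrakk>strict_chain b l; length l = Suc m; card (b - last (b # l)) < p\<rbrakk> \<Longrightarrow>
      evaluate v l = \<zero>\<^bsub>ob F (last (b # l))\<^esub>"
  shows "\<exists>u. normal F m b u \<and> comparison R F m b u = \<zero>\<^bsub>ob (coch (koszul R F) m) b\<^esub> \<and>
    (\<forall>l. strict_chain b l \<and> length l = Suc m \<and> card (b - last (b # l)) < Suc p \<longrightarrow>
      evaluate (diff Cobar m b u) l = evaluate v l)"
proof -
  have vc: "v \<in> carrier (level_at F (Suc m) b)" using v by (simp add: normal_def)
  have "\<exists>w. (\<forall>l. w l \<in> carrier (ob F c)) \<and> (\<forall>l. strict_chain b l \<and> length l = Suc m \<and> last (b # l) = c \<longrightarrow>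
      evaluate v l = inner_diff (ob F c) w l)" if c: "c \<subseteq> b" and cp: "card (b - c) = p" for c
  proof (rule chain_value_exact[OF b v c])
    have fin: "finite c" by (rule finite_subset[OF c b])
    interpret A: abelian_group "ob F c" by (rule ob_abelian_group[OF fin])
    show "comparison R F (Suc m) b v c = \<zero>\<^bsub>K b c\<^esub>" if "c \<in> koszul_index (Suc m) b"
      unfolding kernel koszul_ob using that by simp
    fix l assume l: "strict_chain b l" "length l = Suc (Suc m)" "last (b # l) = c"
    note ch = strict_chain_chain[OF l(1)]
    have ln: "l \<noteq> []" using l(2) by auto
    have lc: "last l = c" using l(3) ln by simp
    define e where "e = last (b # butlast l)"
    have e: "e \<subseteq> b" unfolding e_def by (rule chain_last_subset[OF chain_butlast[OF ch]])
    have fine: "finite e" by (rule finite_subset[OF e b])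
    have ce: "c \<subset> e" unfolding e_def l(3)[symmetric] by (rule strict_chain_last_butlast[OF l(1) ln])
    have "evaluate v (butlast l) = \<zero>\<^bsub>ob F e\<^esub>"
      using vanish[OF strict_chain_butlast[OF l(1)]] l(2) card_Diff_psubset[OF b ce e] unfolding e_def[symmetric] cp by simp
    hence r: "restriction F c e (evaluate v (butlast l)) = \<zero>\<^bsub>ob F c\<^esub>"
      using mod_hom_zero[OF restriction_hom[OF fine psubset_imp_subset[OF ce]] ob_module[OF fine] ob_module[OF fin]] by simp
    have "\<zero>\<^bsub>ob F c\<^esub> = evaluate (diff Cobar (Suc m) b v) l"
      unfolding dv evaluate_zero[OF ch l(2)] l(3) ..
    also have "\<dots> = inner_diff (ob F c) (chain_value (Suc m) b c v) l \<oplus>\<^bsub>ob F c\<^esub> \<zero>\<^bsub>ob F c\<^esub>"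
      unfolding evaluate_diff_strict[OF b v l(1,2)] diff_value_def lc e_def[symmetric] r ..
    also have "\<dots> = inner_diff (ob F c) (chain_value (Suc m) b c v) l"
      by (rule A.r_zero[OF A.inner_diff_closed[OF chain_value_closed[OF vc fin]]])
    finally show "inner_diff (ob F c) (chain_value (Suc m) b c v) l = \<zero>\<^bsub>ob F c\<^esub>" by (rule sym)
  qed
  then obtain w where w: "\<And>c l. \<lbrakk>c \<subseteq> b; card (b - c) = p\<rbrakk> \<Longrightarrow> w c l \<in> carrier (ob F c)"
    "\<And>c l. \<lbrakk>c \<subseteq> b; card (b - c) = p; strict_chain b l; length l = Suc m; last (b # l) = c\<rbrakk> \<Longrightarrow>
      evaluate v l = inner_diff (ob F c) (w c) l"
    by metis
  \<comment> \<open>The primitives of all subsets of codimension \<open>p\<close> are combined into one function on chains.\<close>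
  define f where "f l = (if strict_chain b l \<and> card (b - last (b # l)) = p then w (last (b # l)) l
    else \<zero>\<^bsub>ob F (last (b # l))\<^esub>)" for l
  define u where "u = assemble m b f"
  have fc: "f l \<in> carrier (ob F (last (b # l)))" if l: "chain b l" for l
  proof (cases "strict_chain b l \<and> card (b - last (b # l)) = p")
    case True
    show ?thesis unfolding f_def if_P[OF True] by (rule w(1)[OF chain_last_subset[OF l] True[THEN conjunct2]])
  next
    case False
    show ?thesis unfolding f_def if_not_P[OF False]
      by (rule abelian_groupE(2)[OF ob_abelian_group[OF last_chain_finite[OF b l]]])
  qed
  have uc: "u \<in> carrier (level_at F m b)" unfolding u_def by (rule assemble_carrier[OF fc])
  have ev: "evaluate u l = f l" if "chain b l" "length l = m" for l
    unfolding u_def by (rule evaluate_assemble[OF that])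
  have u: "normal F m b u"
    unfolding normal_def by (intro conjI uc allI impI) (simp only: ev f_def simp_thms if_False)
  have u0: "evaluate u l = \<zero>\<^bsub>ob F (last (b # l))\<^esub>"
    if "chain b l" "length l = m" "card (b - last (b # l)) \<noteq> p" for l
    unfolding ev[OF that(1,2)] f_def using that(3) by (simp only: simp_thms if_False)
  have "comparison R F m b u = comparison R F m b \<zero>\<^bsub>level_at F m b\<^esub>"
    unfolding comparison_def
  proof (rule restrict_cong')
    fix c assume c: "c \<in> koszul_index m b"
    interpret Kc: Module.module R "K b c" by (rule K_module[OF koszul_indexD(2)[OF b c]])
    show "(\<Oplus>\<^bsub>K b c\<^esub>xs\<in>perms (b - c). word_tensor R (ob F c) (b - c) (evaluate u (removal_chain b xs)) (rev xs))
      = (\<Oplus>\<^bsub>K b c\<^esub>xs\<in>perms (b - c). word_tensor R (ob F c) (b - c)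
          (evaluate \<zero>\<^bsub>level_at F m b\<^esub> (removal_chain b xs)) (rev xs))"
    proof (rule Kc.M.finsum_congI)
      fix xs assume xs: "xs \<in> perms (b - c)"
      note r = removal_chain_perms[OF b c xs]
      note ch = strict_chain_chain[OF r(1)]
      have "evaluate u (removal_chain b xs) = evaluate \<zero>\<^bsub>level_at F m b\<^esub> (removal_chain b xs)"
        unfolding evaluate_zero[OF ch r(2)]
      proof (rule u0[OF ch r(2)])
        show "card (b - last (b # removal_chain b xs)) \<noteq> p"
          unfolding r(3) using koszul_indexD(3)[OF b c] p by simp
      qed
      thus "word_tensor R (ob F c) (b - c) (evaluate u (removal_chain b xs)) (rev xs)
        = word_tensor R (ob F c) (b - c) (evaluate \<zero>\<^bsub>level_at F m b\<^esub> (removal_chain b xs)) (rev xs)" by (simp only:)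
      show "word_tensor R (ob F c) (b - c) (evaluate \<zero>\<^bsub>level_at F m b\<^esub> (removal_chain b xs)) (rev xs) \<in> carrier (K b c)"
        by (rule mod_hom_closed[OF word_hom[OF b c xs] mod_hom_closed[OF evaluate_removal_chain_hom[OF b c xs]
              abelian_groupE(2)]]) (use level_at_module[OF b] in \<open>simp add: module_def\<close>)
    qed
  qed
  hence comp: "comparison R F m b u = \<zero>\<^bsub>ob (coch (koszul R F) m) b\<^esub>" by (simp only: comparison_zero[OF b])
  have "evaluate (diff Cobar m b u) l = evaluate v l"
    if l: "strict_chain b l" "length l = Suc m" and codim: "card (b - last (b # l)) < Suc p" for l
  proof -
    note ch = strict_chain_chain[OF l(1)]
    have ln: "l \<noteq> []" using l(2) by auto
    define c where "c = last (b # l)"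
    have lc: "last l = c" unfolding c_def using ln by simp
    have cb: "c \<subseteq> b" unfolding c_def by (rule chain_last_subset[OF ch])
    have fin: "finite c" by (rule finite_subset[OF cb b])
    interpret A: abelian_group "ob F c" by (rule ob_abelian_group[OF fin])
    define e where "e = last (b # butlast l)"
    have e: "e \<subseteq> b" unfolding e_def by (rule chain_last_subset[OF chain_butlast[OF ch]])
    have fine: "finite e" by (rule finite_subset[OF e b])
    have ce: "c \<subset> e" unfolding e_def c_def by (rule strict_chain_last_butlast[OF l(1) ln])
    have cp: "card (b - c) < Suc p" using codim by (simp only: c_def)
    have "evaluate u (butlast l) = \<zero>\<^bsub>ob F e\<^esub>"
      unfolding e_def
    proof (rule u0[OF chain_butlast[OF ch]])
      show "card (b - last (b # butlast l)) \<noteq> p" unfolding e_def[symmetric]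
        using card_Diff_psubset[OF b ce e] cp by linarith
    qed (simp add: l(2))
    hence r: "restriction F c e (evaluate u (butlast l)) = \<zero>\<^bsub>ob F c\<^esub>"
      using mod_hom_zero[OF restriction_hom[OF fine psubset_imp_subset[OF ce]] ob_module[OF fine] ob_module[OF fin]] by simp
    have "evaluate (diff Cobar m b u) l = inner_diff (ob F c) (chain_value m b c u) l \<oplus>\<^bsub>ob F c\<^esub> \<zero>\<^bsub>ob F c\<^esub>"
      unfolding evaluate_diff_strict[OF b u l] diff_value_def lc e_def[symmetric] r ..
    also have "\<dots> = inner_diff (ob F c) (chain_value m b c u) l"
      by (rule A.r_zero[OF A.inner_diff_closed[OF chain_value_closed[OF uc fin]]])
    also have "\<dots> = evaluate v l"
    proof (cases "card (b - c) = p")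
      case True
      have "inner_diff (ob F c) (chain_value m b c u) l = inner_diff (ob F c) (w c) l"
      proof (rule A.inner_diff_cong_strict[OF l(1)])
        fix s assume s: "strict_chain b s" "s \<noteq> []" "Suc (length s) = length l" "last s = last l"
        have sc: "last (b # s) = c" "length s = m" using s lc l(2) by simp_all
        note chs = strict_chain_chain[OF s(1)]
        show "chain_value m b c u s = w c s"
          unfolding chain_value_eq[OF chs sc(2,1)] ev[OF chs sc(2)] f_def sc(1) using s(1) True by simp
      qed
      thus ?thesis using w(2)[OF cb True l c_def[symmetric]] by simp
    next
      case False
      have "inner_diff (ob F c) (chain_value m b c u) l = inner_diff (ob F c) (\<lambda>_. \<zero>\<^bsub>ob F c\<^esub>) l"
      proof (rule A.inner_diff_cong_strict[OF l(1)])
        fix s assume s: "strict_chain b s" "s \<noteq> []" "Suc (length s) = length l" "last s = last l"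
        have sc: "last (b # s) = c" "length s = m" using s lc l(2) by simp_all
        note chs = strict_chain_chain[OF s(1)]
        show "chain_value m b c u s = \<zero>\<^bsub>ob F c\<^esub>"
          unfolding chain_value_eq[OF chs sc(2,1)] ev[OF chs sc(2)] f_def sc(1) using False by simp
      qed
      moreover have "evaluate v l = \<zero>\<^bsub>ob F c\<^esub>"
        unfolding c_def
      proof (rule vanish[OF l])
        show "card (b - last (b # l)) < p" using cp False unfolding c_def by linarith
      qed
      ultimately show ?thesis by simp
    qed
    finally show ?thesis .
  qed
  thus ?thesis using u comp by blast
qed

text \<open>The filtration starts in codimension equal to the degree.\<close>

lemma strict_chain_codim: "\<lbrakk>finite b; strict_chain b l\<rbrakk> \<Longrightarrow> length l \<le> card (b - last (b # l))"
proof (induction l arbitrary: b)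
  case (Cons c cs)
  have cb: "c \<subset> b" and cs: "strict_chain c cs" using Cons.prems(2) by simp_all
  have fin: "finite c" by (rule finite_subset[OF psubset_imp_subset[OF cb] Cons.prems(1)])
  have sub: "last (c # cs) \<subseteq> c" by (rule chain_last_subset[OF strict_chain_chain[OF cs]])
  have "card (c - last (c # cs)) < card (b - last (c # cs))"
  proof (rule psubset_card_mono)
    show "finite (b - last (c # cs))" using Cons.prems(1) by (rule finite_Diff)
    show "c - last (c # cs) \<subset> b - last (c # cs)" using cb sub by blast
  qed
  thus ?case using Cons.IH[OF fin cs] by simp
qed simp

lemma kernel_exact_filtered:
  assumes b: "finite b" and "normal F (Suc m) b v"
    and "diff Cobar (Suc m) b v = \<zero>\<^bsub>level_at F (Suc (Suc m)) b\<^esub>"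
    and "comparison R F (Suc m) b v = \<zero>\<^bsub>ob (coch (koszul R F) (Suc m)) b\<^esub>"
    and "Suc m \<le> p"
    and "\<And>l. \<lbrakk>strict_chain b l; length l = Suc m; card (b - last (b # l)) < p\<rbrakk> \<Longrightarrow>
      evaluate v l = \<zero>\<^bsub>ob F (last (b # l))\<^esub>"
  shows "\<exists>u. normal F m b u \<and> comparison R F m b u = \<zero>\<^bsub>ob (coch (koszul R F) m) b\<^esub> \<and> diff Cobar m b u = v"
  using assms(2-)
proof (induction "Suc (card b) - p" arbitrary: p v)
  interpret Lm: Module.module R "ob (coch Cobar m) b" by (rule normalized_cobar_module[OF b])
  interpret Ln: Module.module R "ob (coch Cobar (Suc m)) b" by (rule normalized_cobar_module[OF b])
  interpret Lk: Module.module R "ob (coch Cobar (Suc (Suc m))) b" by (rule normalized_cobar_module[OF b])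
  interpret Km: Module.module R "ob (coch (koszul R F) m) b" by (rule koszul_ob_module[OF b])
  interpret Kn: Module.module R "ob (coch (koszul R F) (Suc m)) b" by (rule koszul_ob_module[OF b])
  note dm = diff_Cobar_hom[OF b, of m] and dn = diff_Cobar_hom[OF b, of "Suc m"]
  note cm = comparison_hom[OF b, of m] and cn = comparison_hom[OF b, of "Suc m"]
  {
    case 0
    have zero: "normal F m b \<zero>\<^bsub>level_at F m b\<^esub>"
      using Lm.M.zero_closed unfolding normalized_cobar_carrier normalized_cobar_simps .
    have d0: "diff Cobar m b \<zero>\<^bsub>level_at F m b\<^esub> = \<zero>\<^bsub>level_at F (Suc m) b\<^esub>"
      using mod_hom_zero[OF dm Lm.module_axioms Ln.module_axioms] unfolding normalized_cobar_simps .
    have zero': "normal F (Suc m) b \<zero>\<^bsub>level_at F (Suc m) b\<^esub>"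
      using Ln.M.zero_closed unfolding normalized_cobar_carrier normalized_cobar_simps .
    have "\<zero>\<^bsub>level_at F (Suc m) b\<^esub> = v"
    proof (rule normalized_cobar_eqI[OF zero' 0(2)])
      fix l assume l: "strict_chain b l" "length l = Suc m"
      have "card (b - last (b # l)) \<le> card b" by (rule card_mono[OF b Diff_subset])
      hence "card (b - last (b # l)) < p" using 0(1) by linarith
      thus "evaluate \<zero>\<^bsub>level_at F (Suc m) b\<^esub> l = evaluate v l"
        unfolding evaluate_zero[OF strict_chain_chain[OF l(1)] l(2)] using 0(6)[OF l] by simp
    qed
    thus ?case using zero d0 comparison_zero[OF b, of m] by blast
  next
    case (Suc k)
    obtain u where u: "normal F m b u" "comparison R F m b u = \<zero>\<^bsub>ob (coch (koszul R F) m) b\<^esub>"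
      "\<And>l. \<lbrakk>strict_chain b l; length l = Suc m; card (b - last (b # l)) < Suc p\<rbrakk> \<Longrightarrow>
        evaluate (diff Cobar m b u) l = evaluate v l"
      using kernel_filtration_step[OF b Suc.prems] by metis
    let ?N = "ob (coch Cobar (Suc m)) b"
    note du = diff_normal[OF b u(1)]
    have vN: "v \<in> carrier ?N" and uM: "u \<in> carrier (ob (coch Cobar m) b)" and duN: "diff Cobar m b u \<in> carrier ?N"
      unfolding normalized_cobar_carrier by (rule Suc.prems(1), rule u(1), rule du)
    define v' where "v' = v \<ominus>\<^bsub>?N\<^esub> diff Cobar m b u"
    have v'N: "v' \<in> carrier ?N" unfolding v'_def by (rule Ln.M.minus_closed[OF vN duN])
    have v': "normal F (Suc m) b v'" using v'N unfolding normalized_cobar_carrier .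
    have v_eq: "v = v' \<oplus>\<^bsub>?N\<^esub> diff Cobar m b u"
      unfolding v'_def a_minus_def using vN duN by (simp add: Ln.M.a_assoc Ln.M.l_neg)
    have ddu: "diff Cobar (Suc m) b (diff Cobar m b u) = \<zero>\<^bsub>ob (coch Cobar (Suc (Suc m))) b\<^esub>"
      unfolding normalized_cobar_simps by (rule diff_diff_Cobar[OF b u(1)])
    have "diff Cobar (Suc m) b v' = \<zero>\<^bsub>ob (coch Cobar (Suc (Suc m))) b\<^esub>"
      unfolding v'_def mod_hom_diff[OF dn Ln.module_axioms Lk.module_axioms vN duN] ddu
        Suc.prems(2)[folded normalized_cobar_simps(1)]
      by (simp add: a_minus_def)
    hence dv': "diff Cobar (Suc m) b v' = \<zero>\<^bsub>level_at F (Suc (Suc m)) b\<^esub>" unfolding normalized_cobar_simps .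
    have cdu: "comparison R F (Suc m) b (diff Cobar m b u) = \<zero>\<^bsub>ob (coch (koszul R F) (Suc m)) b\<^esub>"
      unfolding comparison_commutes[OF b u(1)] u(2)
      by (rule mod_hom_zero[OF koszul_diff_hom[OF b] Km.module_axioms Kn.module_axioms])
    have cv': "comparison R F (Suc m) b v' = \<zero>\<^bsub>ob (coch (koszul R F) (Suc m)) b\<^esub>"
      unfolding v'_def mod_hom_diff[OF cn Ln.module_axioms Kn.module_axioms vN duN] cdu Suc.prems(3)
      by (simp add: a_minus_def)
    have van: "evaluate v' l = \<zero>\<^bsub>ob F (last (b # l))\<^esub>"
      if l: "strict_chain b l" "length l = Suc m" "card (b - last (b # l)) < Suc p" for l
    proof -
      note ch = strict_chain_chain[OF l(1)]
      interpret A: abelian_group "ob F (last (b # l))" by (rule ob_abelian_group[OF last_chain_finite[OF b ch]])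
      have lv: "x \<in> carrier (level_at F (Suc m) b)" if "x \<in> carrier ?N" for x
        using that unfolding normalized_cobar_carrier by (simp add: normal_def)
      have vc: "evaluate v l \<in> carrier (ob F (last (b # l)))" by (rule level_evaluate_closed[OF lv[OF vN] ch l(2)])
      have v'c: "evaluate v' l \<in> carrier (ob F (last (b # l)))" by (rule level_evaluate_closed[OF lv[OF v'N] ch l(2)])
      have "evaluate v' l \<oplus>\<^bsub>ob F (last (b # l))\<^esub> evaluate v l = evaluate (v' \<oplus>\<^bsub>?N\<^esub> diff Cobar m b u) l"
        unfolding normalized_cobar_simps u(3)[OF l, symmetric] by (rule evaluate_add[OF ch l(2), symmetric])
      also have "\<dots> = evaluate v l" by (rule arg_cong[OF v_eq[symmetric]])
      also have "\<dots> = \<zero>\<^bsub>ob F (last (b # l))\<^esub> \<oplus>\<^bsub>ob F (last (b # l))\<^esub> evaluate v l" by (rule A.l_zero[OF vc, symmetric])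
      finally show ?thesis by (rule A.add.right_cancel[OF vc v'c A.zero_closed, THEN iffD1])
    qed
    have "k = Suc (card b) - Suc p" using Suc.hyps(2) by linarith
    from Suc.hyps(1)[OF this v' dv' cv' le_SucI[OF Suc.prems(4)] van]
    obtain u' where u': "normal F m b u'" "comparison R F m b u' = \<zero>\<^bsub>ob (coch (koszul R F) m) b\<^esub>"
      "diff Cobar m b u' = v'" by blast
    have u'M: "u' \<in> carrier (ob (coch Cobar m) b)" unfolding normalized_cobar_carrier by (rule u'(1))
    show ?case
    proof (intro exI[of _ "u' \<oplus>\<^bsub>ob (coch Cobar m) b\<^esub> u"] conjI)
      show "normal F m b (u' \<oplus>\<^bsub>ob (coch Cobar m) b\<^esub> u)"
        using Lm.M.a_closed[OF u'M uM] unfolding normalized_cobar_carrier .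
      show "comparison R F m b (u' \<oplus>\<^bsub>ob (coch Cobar m) b\<^esub> u) = \<zero>\<^bsub>ob (coch (koszul R F) m) b\<^esub>"
        unfolding mod_hom_add[OF cm u'M uM] u(2) u'(2) by simp
      show "diff Cobar m b (u' \<oplus>\<^bsub>ob (coch Cobar m) b\<^esub> u) = v"
        unfolding mod_hom_add[OF dm u'M uM] u'(3) by (rule v_eq[symmetric])
    qed
  }
qed

lemma kernel_exact_Suc:
  assumes b: "finite b" and v: "normal F (Suc m) b v"
    and "diff Cobar (Suc m) b v = \<zero>\<^bsub>level_at F (Suc (Suc m)) b\<^esub>"
    and "comparison R F (Suc m) b v = \<zero>\<^bsub>ob (coch (koszul R F) (Suc m)) b\<^esub>"
  shows "\<exists>u. normal F m b u \<and> comparison R F m b u = \<zero>\<^bsub>ob (coch (koszul R F) m) b\<^esub> \<and> diff Cobar m b u = v"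
proof (rule kernel_exact_filtered[OF assms order_refl])
  fix l assume l: "strict_chain b l" "length l = Suc m" "card (b - last (b # l)) < Suc m"
  thus "evaluate v l = \<zero>\<^bsub>ob F (last (b # l))\<^esub>" using strict_chain_codim[OF b l(1)] by simp
qed

lemma kernel_exact_0:
  assumes b: "finite b" and v: "normal F 0 b v"
    and kernel: "comparison R F 0 b v = \<zero>\<^bsub>ob (coch (koszul R F) 0) b\<^esub>"
  shows "v = \<zero>\<^bsub>level_at F 0 b\<^esub>"
proof (rule normalized_cobar_eqI[OF v])
  show "normal F 0 b \<zero>\<^bsub>level_at F 0 b\<^esub>"
    using submodule_zero[OF normal_submodule[OF b]] by (simp only: mem_Collect_eq)
  fix l :: "'x set list" assume l: "strict_chain b l" "length l = 0"
  interpret Kb: Module.module R "K b b" by (rule K_module[OF b])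
  have vc: "v \<in> carrier (level_at F 0 b)" using v by (simp only: normal_def)
  have bi: "b \<in> koszul_index 0 b" by (simp add: koszul_index_def)
  have perms: "perms (b - b) = {[]}" by (auto simp: perms_def)
  have ev: "evaluate v [] \<in> carrier (ob F b)" using level_evaluate_closed[OF vc, of "[]"] by simp
  have "[] \<in> perms (b - b)" using perms by simp
  note wc = mod_hom_closed[OF word_tensor_hom[OF ob_module[OF b] this] ev]
  have "\<zero>\<^bsub>K b b\<^esub> = comparison R F 0 b v b" unfolding kernel koszul_ob using bi by simp
  also have "\<dots> = (\<Oplus>\<^bsub>K b b\<^esub>xs\<in>{[]}. word_tensor R (ob F b) (b - b) (evaluate v (removal_chain b xs)) (rev xs))"
    using bi by (simp only: comparison_def restrict_apply if_True perms)
  also have "\<dots> = word_tensor R (ob F b) (b - b) (evaluate v []) []" using wc by (simp del: Diff_cancel evaluate.simps)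
  finally have "evaluate v [] = \<zero>\<^bsub>ob F b\<^esub>"
    by (intro word_tensor_inj[OF ob_module[OF b] \<open>[] \<in> perms (b - b)\<close> ev]) (rule sym)
  thus "evaluate v l = evaluate \<zero>\<^bsub>level_at F 0 b\<^esub> l"
    unfolding evaluate_zero[OF strict_chain_chain[OF l(1)] l(2)] using l(2) by simp
qed

end

section \<open>Detecting quasi-isomorphisms\<close>

lemma cocycles_simps:
  "x \<in> carrier (cocycles C n b) \<longleftrightarrow>
     x \<in> carrier (ob (coch C n) b) \<and> diff C n b x = \<zero>\<^bsub>ob (coch C (Suc n)) b\<^esub>"
  "\<zero>\<^bsub>cocycles C n b\<^esub> = \<zero>\<^bsub>ob (coch C n) b\<^esub>"
  "x \<oplus>\<^bsub>cocycles C n b\<^esub> y = x \<oplus>\<^bsub>ob (coch C n) b\<^esub> y"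
  "r \<odot>\<^bsub>cocycles C n b\<^esub> x = r \<odot>\<^bsub>ob (coch C n) b\<^esub> x"
  by (simp_all add: cocycles_def)

context cochain_complex
begin

lemma term_module: "finite b \<Longrightarrow> Module.module R (ob (coch C n) b)"
  by (rule op_module.ob_module[OF op_module_hom.axioms(1)[OF diff_hom]])

lemma diff_mod_hom: "finite b \<Longrightarrow> diff C n b \<in> mod_hom R (ob (coch C n) b) (ob (coch C (Suc n)) b)"
  by (rule op_module_hom.component_hom[OF diff_hom])

lemma cocycles_module: "finite b \<Longrightarrow> Module.module R (cocycles C n b)"
  unfolding cocycles_def
  by (rule submodule.submodule_is_module[OF mod_hom_kernel_submodule]) (assumption | rule diff_mod_hom term_module)+

lemma coboundaries_submodule:
  assumes b: "finite b" shows "submodule (coboundaries C n b) R (cocycles C n b)"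
proof (cases n)
  case 0
  interpret Z: Module.module R "cocycles C 0 b" by (rule cocycles_module[OF b])
  have "(\<lambda>x. x) \<in> mod_hom R (cocycles C 0 b) (cocycles C 0 b)" by (rule mod_homI) simp_all
  from mod_hom_kernel_submodule[OF this Z.module_axioms Z.module_axioms]
  have "submodule {x \<in> carrier (cocycles C 0 b). x = \<zero>\<^bsub>cocycles C 0 b\<^esub>} R (cocycles C 0 b)" .
  moreover have "{x \<in> carrier (cocycles C 0 b). x = \<zero>\<^bsub>cocycles C 0 b\<^esub>} = coboundaries C n b"
    using Z.M.zero_closed unfolding 0 by (auto simp: cocycles_simps(2))
  ultimately show ?thesis unfolding 0 by simp
next
  case (Suc m)
  have "diff C m b \<in> mod_hom R (ob (coch C m) b) (cocycles C (Suc m) b)"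
    using mod_homD[OF diff_mod_hom[OF b]] diff_diff[OF b] by (intro mod_homI) (simp_all add: cocycles_simps)
  thus ?thesis unfolding Suc
    using mod_hom_image_submodule[OF _ term_module[OF b] cocycles_module[OF b]] by simp
qed

end

text \<open>The part of the long exact cohomology sequence that is needed for a surjection with acyclic kernel. A
cocycle of the target is lifted to some \<open>w\<close>; the coboundary of \<open>w\<close> is a cocycle of the kernel, hence
the coboundary of an element of the kernel, by which \<open>w\<close> is corrected to a cocycle. A cocycle that
becomes a coboundary is likewise corrected by the coboundary of a lift.\<close>

lemma quasi_isomorphism_if_kernel_exact:
  fixes C :: "('x, 'r, 'm) cochain"
  assumes map: "cochain_map R C D \<phi>" and surj: "surjective_map C D \<phi>"
    and exact_0: "\<And>b v. \<lbrakk>finite b; v \<in> carrier (ob (coch C 0) b); \<phi> 0 b v = \<zero>\<^bsub>ob (coch D 0) b\<^esub>\<rbrakk>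
      \<Longrightarrow> v = \<zero>\<^bsub>ob (coch C 0) b\<^esub>"
    and exact_Suc: "\<And>n b v. \<lbrakk>finite b; v \<in> carrier (ob (coch C (Suc n)) b);
        diff C (Suc n) b v = \<zero>\<^bsub>ob (coch C (Suc (Suc n))) b\<^esub>; \<phi> (Suc n) b v = \<zero>\<^bsub>ob (coch D (Suc n)) b\<^esub>\<rbrakk>
      \<Longrightarrow> \<exists>u\<in>carrier (ob (coch C n) b). \<phi> n b u = \<zero>\<^bsub>ob (coch D n) b\<^esub> \<and> diff C n b u = v"
  shows "quasi_isomorphism R C D \<phi>"
  unfolding quasi_isomorphism_def
proof (intro allI impI)
  fix n and b :: "'x set" assume b: "finite b"
  interpret cochain_map R C D \<phi> by fact
  let ?C = "\<lambda>n. ob (coch C n) b" and ?D = "\<lambda>n. ob (coch D n) b"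
  let ?Z = "\<lambda>n. cocycles C n b" and ?Y = "\<lambda>n. cocycles D n b"
  note modC = C.term_module[OF b] and modD = D.term_module[OF b]
  note dC = C.diff_mod_hom[OF b] and dD = D.diff_mod_hom[OF b]
  have p: "\<phi> n b \<in> mod_hom R (?C n) (?D n)" for n
    by (rule op_module_hom.component_hom[OF degree_hom b])
  note comm = commutes[OF b]
  have lift: "\<exists>v\<in>carrier (?C n). \<phi> n b v = y" if "y \<in> carrier (?D n)" for n y
  proof -
    have "y \<in> \<phi> n b ` carrier (?C n)" using that surj[unfolded surjective_map_def, rule_format, OF b, of n] by simp
    thus ?thesis by blast
  qed
  have lift_cocycle: "\<exists>v\<in>carrier (?Z n). \<phi> n b v = y" if y: "y \<in> carrier (?Y n)" for y
  proof -
    interpret Cn: Module.module R "?C n" by (rule modC)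
    interpret Cs: Module.module R "?C (Suc n)" by (rule modC)
    interpret Dn: Module.module R "?D n" by (rule modD)
    have yD: "y \<in> carrier (?D n)" and dy: "diff D n b y = \<zero>\<^bsub>?D (Suc n)\<^esub>" using y by (simp_all add: cocycles_simps)
    obtain w where w: "w \<in> carrier (?C n)" "\<phi> n b w = y" using lift[OF yD] by blast
    have dw: "diff C n b w \<in> carrier (?C (Suc n))" by (rule mod_hom_closed[OF dC w(1)])
    have "\<phi> (Suc n) b (diff C n b w) = \<zero>\<^bsub>?D (Suc n)\<^esub>" unfolding comm[OF w(1)] w(2) by (rule dy)
    from exact_Suc[OF b dw C.diff_diff[OF b w(1)] this]
    obtain u where u: "u \<in> carrier (?C n)" "\<phi> n b u = \<zero>\<^bsub>?D n\<^esub>" "diff C n b u = diff C n b w" by blast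
    have "diff C n b (w \<ominus>\<^bsub>?C n\<^esub> u) = \<zero>\<^bsub>?C (Suc n)\<^esub>"
      unfolding mod_hom_diff[OF dC modC modC w(1) u(1)] u(3) unfolding a_minus_def by (rule Cs.M.r_neg[OF dw])
    hence "w \<ominus>\<^bsub>?C n\<^esub> u \<in> carrier (?Z n)" using Cn.M.minus_closed[OF w(1) u(1)] by (simp add: cocycles_simps)
    moreover have "\<phi> n b (w \<ominus>\<^bsub>?C n\<^esub> u) = y"
      unfolding mod_hom_diff[OF p modC modD w(1) u(1)] w(2) u(2) using yD by (simp add: a_minus_def)
    ultimately show ?thesis by blast
  qed
  have coboundary: "v \<in> coboundaries C n b"
    if v: "v \<in> carrier (?Z n)" and pv: "\<phi> n b v \<in> coboundaries D n b" for v
  proof (cases n)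
    case 0
    thus ?thesis using exact_0[OF b, of v] v pv by (simp add: cocycles_simps)
  next
    case (Suc m)
    interpret Cm: Module.module R "?C m" by (rule modC)
    interpret Cn: Module.module R "?C n" by (rule modC)
    interpret Cs: Module.module R "?C (Suc n)" by (rule modC)
    interpret Dn: Module.module R "?D n" by (rule modD)
    have vC: "v \<in> carrier (?C n)" and dv: "diff C n b v = \<zero>\<^bsub>?C (Suc n)\<^esub>" using v by (simp_all add: cocycles_simps)
    obtain y where y: "y \<in> carrier (?D m)" "\<phi> n b v = diff D m b y" using pv unfolding Suc by auto
    obtain w where w: "w \<in> carrier (?C m)" "\<phi> m b w = y" using lift[OF y(1)] by blast
    have dw: "diff C m b w \<in> carrier (?C n)" unfolding Suc by (rule mod_hom_closed[OF dC w(1)])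
    have pw: "\<phi> n b (diff C m b w) = \<phi> n b v" unfolding y(2) w(2)[symmetric] unfolding Suc by (rule comm[OF w(1)])
    define x where "x = v \<ominus>\<^bsub>?C n\<^esub> diff C m b w"
    have x: "x \<in> carrier (?C n)" unfolding x_def by (rule Cn.M.minus_closed[OF vC dw])
    have "\<phi> n b x = \<zero>\<^bsub>?D n\<^esub>"
      unfolding x_def mod_hom_diff[OF p modC modD vC dw] pw unfolding a_minus_def by (rule Dn.M.r_neg[OF mod_hom_closed[OF p vC]])
    moreover have "diff C n b (diff C m b w) = \<zero>\<^bsub>?C (Suc n)\<^esub>" unfolding Suc by (rule C.diff_diff[OF b w(1)])
    hence "diff C n b x = \<zero>\<^bsub>?C (Suc n)\<^esub>"
      unfolding x_def mod_hom_diff[OF dC modC modC vC dw] dv by (simp add: a_minus_def)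
    ultimately obtain u where u: "u \<in> carrier (?C m)" "diff C m b u = x"
      using exact_Suc[OF b, of x m] x unfolding Suc by blast
    have du: "diff C m b u \<in> carrier (?C n)" unfolding u(2) by (rule x)
    have "v = diff C m b u \<oplus>\<^bsub>?C n\<^esub> diff C m b w"
      unfolding u(2) x_def a_minus_def using vC dw by (simp add: Cn.M.a_assoc Cn.M.l_neg)
    also have "\<dots> = diff C m b (u \<oplus>\<^bsub>?C m\<^esub> w)" unfolding Suc by (rule mod_hom_add[OF dC u(1) w(1), symmetric])
    finally show ?thesis unfolding Suc using Cm.M.a_closed[OF u(1) w(1)] by simp
  qed
  have pZ: "\<phi> n b \<in> mod_hom R (?Z n) (?Y n)"
  proof (rule mod_homI)
    fix x assume "x \<in> carrier (?Z n)"
    hence x: "x \<in> carrier (?C n)" "diff C n b x = \<zero>\<^bsub>?C (Suc n)\<^esub>" by (simp_all add: cocycles_simps)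
    have "diff D n b (\<phi> n b x) = \<zero>\<^bsub>?D (Suc n)\<^esub>"
      unfolding comm[OF x(1), symmetric] x(2) by (rule mod_hom_zero[OF p modC modD])
    thus "\<phi> n b x \<in> carrier (?Y n)" using mod_hom_closed[OF p x(1)] by (simp add: cocycles_simps)
  qed (simp_all add: cocycles_simps mod_hom_add[OF p] mod_hom_smult[OF p])
  have pB: "\<phi> n b ` coboundaries C n b \<subseteq> coboundaries D n b"
  proof (cases n)
    case 0
    thus ?thesis using mod_hom_zero[OF p[of 0] modC modD] by simp
  next
    case (Suc m)
    thus ?thesis using comm[of _ m] mod_hom_closed[OF p[of m]] by auto
  qed
  note ZC = C.cocycles_module[OF b, of n] and ZD = D.cocycles_module[OF b, of n]
  note BC = C.coboundaries_submodule[OF b, of n] and BD = D.coboundaries_submodule[OF b, of n]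
  note H = quotient_carrier[OF ZC BC] quotient_carrier[OF ZD BD]
  note hom = coset_map_hom[OF pZ ZC ZD BC BD pB] and coset = coset_map_coset[OF pZ ZC ZD BC BD pB]
  interpret Z: Module.module R "?Z n" by (rule ZC)
  have "bij_betw (coset_map (?Y n) (coboundaries D n b) (\<phi> n b))
      (carrier (quotient_module (?Z n) (coboundaries C n b))) (carrier (quotient_module (?Y n) (coboundaries D n b)))"
    unfolding bij_betw_def
  proof
    show "inj_on (coset_map (?Y n) (coboundaries D n b) (\<phi> n b)) (carrier (quotient_module (?Z n) (coboundaries C n b)))"
    proof (rule inj_onI, unfold H, elim imageE)
      fix A B x y assume x: "x \<in> carrier (?Z n)" and y: "y \<in> carrier (?Z n)"
        and A: "A = coboundaries C n b +>\<^bsub>?Z n\<^esub> x" and B: "B = coboundaries C n b +>\<^bsub>?Z n\<^esub> y"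
        and "coset_map (?Y n) (coboundaries D n b) (\<phi> n b) A = coset_map (?Y n) (coboundaries D n b) (\<phi> n b) B"
      hence "\<phi> n b x \<ominus>\<^bsub>?Y n\<^esub> \<phi> n b y \<in> coboundaries D n b"
        using quotient_eq_iff[OF ZD BD mod_hom_closed[OF pZ x] mod_hom_closed[OF pZ y]] unfolding A B coset[OF x] coset[OF y] by simp
      hence "\<phi> n b (x \<ominus>\<^bsub>?Z n\<^esub> y) \<in> coboundaries D n b" unfolding mod_hom_diff[OF pZ ZC ZD x y] .
      hence "x \<ominus>\<^bsub>?Z n\<^esub> y \<in> coboundaries C n b" by (rule coboundary[OF Z.M.minus_closed[OF x y]])
      thus "A = B" unfolding A B quotient_eq_iff[OF ZC BC x y] .
    qed
    have "coset_map (?Y n) (coboundaries D n b) (\<phi> n b) ` carrier (quotient_module (?Z n) (coboundaries C n b))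
        = (\<lambda>y. coboundaries D n b +>\<^bsub>?Y n\<^esub> y) ` \<phi> n b ` carrier (?Z n)"
      unfolding H image_image by (rule image_cong[OF refl coset])
    also have "\<phi> n b ` carrier (?Z n) = carrier (?Y n)"
    proof (intro equalityI subsetI)
      show "y \<in> \<phi> n b ` carrier (?Z n)" if "y \<in> carrier (?Y n)" for y using lift_cocycle[OF that] by blast
      show "y \<in> carrier (?Y n)" if "y \<in> \<phi> n b ` carrier (?Z n)" for y using that mod_hom_closed[OF pZ] by blast
    qed
    finally show "coset_map (?Y n) (coboundaries D n b) (\<phi> n b) ` carrier (quotient_module (?Z n) (coboundaries C n b))
        = carrier (quotient_module (?Y n) (coboundaries D n b))" unfolding H .
  qed
  with hom show "cohomology_map D \<phi> n b \<in> mod_hom R (cohomology C n b) (cohomology D n b) \<and>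
     bij_betw (cohomology_map D \<phi> n b) (carrier (cohomology C n b)) (carrier (cohomology D n b))"
    unfolding cohomology_map_def cohomology_def by blast
qed

lemma (in FI_functor) comparison_quasi_isomorphism: "quasi_isomorphism R Cobar (koszul R F) (comparison R F)"
proof (rule quasi_isomorphism_if_kernel_exact[OF comparison_cochain_map comparison_surjective])
  fix b :: "'x set" and v n assume b: "finite b"
  {
    assume "v \<in> carrier (ob (coch Cobar 0) b)" "comparison R F 0 b v = \<zero>\<^bsub>ob (coch (koszul R F) 0) b\<^esub>"
    thus "v = \<zero>\<^bsub>ob (coch Cobar 0) b\<^esub>"
      unfolding normalized_cobar_carrier normalized_cobar_simps(1) by (rule kernel_exact_0[OF b])
  }
  assume "v \<in> carrier (ob (coch Cobar (Suc n)) b)"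
    "diff Cobar (Suc n) b v = \<zero>\<^bsub>ob (coch Cobar (Suc (Suc n))) b\<^esub>"
    "comparison R F (Suc n) b v = \<zero>\<^bsub>ob (coch (koszul R F) (Suc n)) b\<^esub>"
  from kernel_exact_Suc[OF b this[unfolded normalized_cobar_carrier normalized_cobar_simps(1)]]
  show "\<exists>u\<in>carrier (ob (coch Cobar n) b). comparison R F n b u = \<zero>\<^bsub>ob (coch (koszul R F) n) b\<^esub> \<and> diff Cobar n b u = v"
    unfolding Bex_def normalized_cobar_carrier .
qed

section \<open>Naturality\<close>

lemma cobar_map_assemble:
  "cobar_map \<tau> n b (assemble n b f) = assemble n b (\<lambda>l. \<tau> (last (b # l)) (f l))"
proof (induction n arbitrary: b f)
  case 0
  show ?case by (simp add: cobar_map_def based_map_def)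
next
  case (Suc n)
  show ?case using Suc.IH unfolding cobar_map_def perp_map_Suc perp_map_assemble by simp
qed

lemma comparison_map:
  assumes \<tau>: "FI_op_module_hom R F G \<tau>" and b: "finite b"
    and v: "v \<in> carrier (ob (coch (normalized_cobar F) n) b)"
  shows "comparison R G n b (cobar_map \<tau> n b v) = koszul_map R G \<tau> n b (comparison R F n b v)"
proof -
  interpret \<tau>: op_module_hom FI_maps R F G \<tau> by fact
  interpret F: FI_functor R F by (simp add: FI_functor_def \<tau>.F.op_module_axioms)
  interpret G: FI_functor R G by (simp add: FI_functor_def \<tau>.G.op_module_axioms)
  have vl: "v \<in> carrier (level_at F n b)" using v unfolding normalized_cobar_carrier by (simp add: normal_def)
  have eq: "cobar_map \<tau> n b v = assemble n b (\<lambda>l. \<tau> (last (b # l)) (evaluate v l))"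
    using vl cobar_map_assemble[of \<tau> n b "evaluate v"] level_carrier_iff[of v n F b] by simp
  have ev: "evaluate (cobar_map \<tau> n b v) l = \<tau> (last (b # l)) (evaluate v l)" if "chain b l" "length l = n" for l
    unfolding eq by (rule evaluate_assemble[OF that])
  show ?thesis
    unfolding comparison_def koszul_map_def
  proof (rule restrict_cong')
    fix c assume c: "c \<in> koszul_index n b"
    note fin = koszul_indexD(2)[OF b c]
    interpret Kc: Module.module R "G.K b c" by (rule G.K_module[OF fin])
    let ?t = "tensor_map R (ob G c) (orientation R (b - c)) (\<tau> c) id"
    have t: "?t \<in> mod_hom R (F.K b c) (G.K b c)"
      by (rule \<tau>.F.tensor_id_hom[OF \<tau>.G.ob_module[OF fin] \<tau>.F.ob_module[OF fin] \<tau>.component_hom[OF fin]])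
    have m: "evaluate v (removal_chain b xs) \<in> carrier (ob F c)" if "xs \<in> perms (b - c)" for xs
      by (rule mod_hom_closed[OF F.evaluate_removal_chain_hom[OF b c that] vl])
    let ?s = "\<lambda>xs. word_tensor R (ob F c) (b - c) (evaluate v (removal_chain b xs)) (rev xs)"
    have s: "?s xs \<in> carrier (F.K b c)" if "xs \<in> perms (b - c)" for xs
      by (rule mod_hom_closed[OF F.word_hom[OF b c that] m[OF that]])
    have "?t (\<Oplus>\<^bsub>F.K b c\<^esub>xs\<in>perms (b - c). ?s xs) = (\<Oplus>\<^bsub>G.K b c\<^esub>xs\<in>perms (b - c). ?t (?s xs))"
      by (rule mod_hom_finsum[OF t F.K_module[OF fin] G.K_module[OF fin]]) (rule funcsetI, rule s)
    also have "\<dots> = (\<Oplus>\<^bsub>G.K b c\<^esub>xs\<in>perms (b - c).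
        word_tensor R (ob G c) (b - c) (evaluate (cobar_map \<tau> n b v) (removal_chain b xs)) (rev xs))"
    proof (rule Kc.M.finsum_congI[symmetric])
      fix xs assume xs: "xs \<in> perms (b - c)"
      note r = removal_chain_perms[OF b c xs]
      show "word_tensor R (ob G c) (b - c) (evaluate (cobar_map \<tau> n b v) (removal_chain b xs)) (rev xs) = ?t (?s xs)"
        unfolding ev[OF strict_chain_chain[OF r(1)] r(2)] r(3)
        by (rule \<tau>.F.tensor_id_word[OF \<tau>.G.ob_module[OF fin] \<tau>.F.ob_module[OF fin] \<tau>.component_hom[OF fin] m[OF xs], symmetric])
          (simp add: perms_rev xs)
      show "?t (?s xs) \<in> carrier (G.K b c)" by (rule mod_hom_closed[OF t s[OF xs]])
    qed
    finally show "(\<Oplus>\<^bsub>G.K b c\<^esub>xs\<in>perms (b - c).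
        word_tensor R (ob G c) (b - c) (evaluate (cobar_map \<tau> n b v) (removal_chain b xs)) (rev xs))
      = ?t ((\<lambda>c\<in>koszul_index n b. \<Oplus>\<^bsub>F.K b c\<^esub>xs\<in>perms (b - c).
          word_tensor R (ob F c) (b - c) (evaluate v (removal_chain b xs)) (rev xs)) c)"
      using c by simp
  qed
qed

theorem theorem4p1:
  fixes R :: "('r, 'q) ring_scheme"
  assumes "cring R"
  shows "\<exists>\<phi> :: ('x, 'r, 'm) presheaf \<Rightarrow> nat \<Rightarrow> 'x set \<Rightarrow> ('x, 'm) iter \<Rightarrow> ('x, 'r, 'm) koszul_elt.
    (\<forall>F. FI_op_module R F \<longrightarrow>
       cochain_map R (normalized (opposite (cobar F))) (koszul R F) (\<phi> F) \<and>
       surjective_map (normalized (opposite (cobar F))) (koszul R F) (\<phi> F) \<and>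
       quasi_isomorphism R (normalized (opposite (cobar F))) (koszul R F) (\<phi> F)) \<and>
    (\<forall>F G \<tau>. FI_op_module_hom R F G \<tau> \<longrightarrow>
       (\<forall>n b. finite b \<longrightarrow>
          (\<forall>v \<in> carrier (ob (coch (normalized (opposite (cobar F))) n) b).
             \<phi> G n b (cobar_map \<tau> n b v) = koszul_map R G \<tau> n b (\<phi> F n b v))))"
proof (intro exI[of _ "comparison R"] conjI allI impI ballI)
  fix F :: "('x, 'r, 'm) presheaf" assume "FI_op_module R F"
  then interpret FI_functor R F by (simp add: FI_functor_def)
  show "cochain_map R Cobar (koszul R F) (comparison R F)" by (rule comparison_cochain_map)
  show "surjective_map Cobar (koszul R F) (comparison R F)" by (rule comparison_surjective)
  show "quasi_isomorphism R Cobar (koszul R F) (comparison R F)" by (rule comparison_quasi_isomorphism)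
qed (rule comparison_map)

end
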